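(* Let $N\ge 1$, let $\phi\in C^1((0,+\infty);(0,+\infty))$ satisfy $(\phi(s)s)'>0$ and $l-1\le \frac{(\phi(s)s)'}{\phi(s)}\le m-1$ for all $s>0$, where $1<l\le m$ are real constants, and let $V\in C^1(\mathbb R^N;\mathbb R)$. Let $c\in\mathbb R$ be such that $\mathcal V_c=\{x\in\mathbb R^N: V(x)\le c\}$ is the union of two nonempty sets $\mathcal V_c^-,\mathcal V_c^+$ with $\operatorname{dist}(\mathcal V_c^-,\mathcal V_c^+)>0$, and suppose that there exists $R>0$ such that $\inf_{\Gamma_c}J_c=\inf\{J_c(q): q\in\Gamma_c,\ \|q\|_{L^\infty(\mathbb R;\mathbb R^N)}\le R\}$. Then there exists a $c$-connection between $\mathcal V_c^-$ and $\mathcal V_c^+$, whose canonical extension $q_c$ is an entire weak solution of $(\phi(|\dot q|)\dot q)'=\nabla V(q)$ with constant energy $-c$. Moreover, the canonical extension $q_c$ of a $c$-connection can be of heteroclinic type or of homoclinic type only if $c$ is a critical value of $V$ (that is, there is $\xi\in\mathbb R^N$ with $V(\xi)=c$ and $\nabla V(\xi)=0$); if $c$ is a regular value of $V$ (that is, not a critical value), then $q_c$ is necessarily of brake type.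
   Context: Set $\Phi(s)=\int_0^{|s|}\phi(r)r\,dr$ and $G(s)=\phi(s)s^2-\Phi(s)$ for $s>0$, $G(0)=0$; $\phi(|v|)v$ is read as $0$ when $v=0$. $\operatorname{dist}$ is Euclidean distance. The energy is $E_q(t)=G(|\dot q(t)|)-V(q(t))$. For an interval $I$, $L^\Phi(I;\mathbb R^N)$ is the set of $q\in L^1_{loc}(I;\mathbb R^N)$ with $\int_I\Phi(|q|/\lambda)\,dt<\infty$ for some $\lambda>0$; $W^{1,\Phi}(I;\mathbb R^N)$ is the set of $q\in L^\Phi$ with weak derivative in $L^\Phi$; $W^{1,\Phi}_{loc}(\mathbb R;\mathbb R^N)$ consists of functions whose restriction to every compact interval $I$ lies in $W^{1,\Phi}(I;\mathbb R^N)$ (identified with continuous representatives). $J_c(q)=\int_{\mathbb R}(\Phi(|\dot q|)+V(q)-c)\,dt$; $\Gamma_c$ is the set of $q\in W^{1,\Phi}_{loc}(\mathbb R;\mathbb R^N)$ with $V(q(t))\ge c$ for all $t$ and $\liminf_{t\to-\infty}\operatorname{dist}(q(t),\mathcal V_c^-)=\liminf_{t\to+\infty}\operatorname{dist}(q(t),\mathcal V_c^+)=0$. Let $I=(\alpha,\omega)$, $-\infty\le\alpha<\omega\le+\infty$, with closure $\bar I$ in $\mathbb R$. A function $q:\bar I\to\mathbb R^N$ is a $c$-connection between $\mathcal V_c^-$ and $\mathcal V_c^+$ with contact times $\alpha,\omega$ if $q\in L^\infty(I;\mathbb R^N)$ and: (i) $q\in C^1(\bar I;\mathbb R^N)\cap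 C^2(I;\mathbb R^N)$ and $(\phi(|\dot q|)\dot q)'=\nabla V(q)$ on $I$; (ii) $V(q(t))>c$ and $E_q(t)=-c$ for all $t\in I$; (iii) $\lim_{t\to\alpha^+}\operatorname{dist}(q(t),\mathcal V_c^-)=\lim_{t\to\omega^-}\operatorname{dist}(q(t),\mathcal V_c^+)=0$. The canonical extension $q_c:\mathbb R\to\mathbb R^N$ of a $c$-connection $q$ is: $q_c=q$ if $\alpha=-\infty,\omega=+\infty$ (heteroclinic type); if exactly one contact time is finite (homoclinic type), the extension of $q$ to $\mathbb R$ by reflection in time about it, i.e. $q_c(t)=q(2\alpha-t)$ for $t<\alpha$ if $\alpha\in\mathbb R$, respectively $q_c(t)=q(2\omega-t)$ for $t>\omega$ if $\omega\in\mathbb R$; if both are finite (brake type), the $2(\omega-\alpha)$-periodic extension of the function equal to $q$ on $[\alpha,\omega]$ and to $q(2\omega-t)$ for $t\in(\omega,2\omega-\alpha]$. A weak solution on $\mathbb R$ is a function $q$ with $\int_{\mathbb R}\big(\phi(|\dot q|)\dot q\cdot\dot\psi+\nabla V(q)\cdot\psi\big)\,dt=0$ for all $\psi\in C_0^\infty(\mathbb R;\mathbb R^N)$. *)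

theory Defs
  imports "HOL-Analysis.Analysis" "HOL-Probability.Essential_Supremum"
begin

section \<open>Differentiability classes\<close>

definition grad :: "('a::real_inner \<Rightarrow> real) \<Rightarrow> 'a \<Rightarrow> 'a" where
  "grad V x = (THE D. GDERIV V x :> D)"

lemma grad_eqI:
  assumes "GDERIV V x :> D"
  shows "grad V x = D"
proof -
  have "D' = D" if D': "GDERIV V x :> D'" for D'
  proof -
    have "(\<lambda>h. h \<bullet> D') = (\<lambda>h. h \<bullet> D)"
      using has_derivative_unique[OF D'[unfolded gderiv_def] assms[unfolded gderiv_def]] .
    then have "(D' - D) \<bullet> D' = (D' - D) \<bullet> D"
      by (rule fun_cong)
    then have "(D' - D) \<bullet> (D' - D) = 0"
      by (simp only: inner_diff_right)
    then show ?thesis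
      by simp
  qed
  then show ?thesis
    unfolding grad_def using assms by (intro the_equality)
qed

definition C1_potential :: "('a::real_inner \<Rightarrow> real) \<Rightarrow> bool" where
  "C1_potential V \<longleftrightarrow> (\<forall>x. GDERIV V x :> grad V x) \<and> continuous_on UNIV (grad V)"

text \<open>Derivatives are taken within the set, so they are one-sided at an endpoint of an interval
  belonging to it; the sets used below are nondegenerate intervals, where they are unique.\<close>

definition C1_on :: "real set \<Rightarrow> (real \<Rightarrow> 'a::real_normed_vector) \<Rightarrow> bool" where
  "C1_on S f \<longleftrightarrow> (\<exists>D. (\<forall>t\<in>S. (f has_vector_derivative D t) (at t within S)) \<and> continuous_on S D)"

definition C2_on :: "real set \<Rightarrow> (real \<Rightarrow> 'a::real_normed_vector) \<Rightarrow> bool" where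
  "C2_on S f \<longleftrightarrow> (\<exists>D. (\<forall>t\<in>S. (f has_vector_derivative D t) (at t within S)) \<and> C1_on S D)"

abbreviation vderiv :: "(real \<Rightarrow> 'a::real_normed_vector) \<Rightarrow> real \<Rightarrow> 'a" where
  "vderiv f \<equiv> (\<lambda>t. vector_derivative f (at t))"

definition test_function :: "real set \<Rightarrow> (real \<Rightarrow> 'a::real_normed_vector) \<Rightarrow> bool" where
  "test_function U \<psi> \<longleftrightarrow> (\<forall>n. (vderiv ^^ n) \<psi> differentiable_on UNIV)
     \<and> compact (closure {t. \<psi> t \<noteq> 0}) \<and> closure {t. \<psi> t \<noteq> 0} \<subseteq> U"

section \<open>Orlicz and Orlicz--Sobolev spaces\<close>

text \<open>The integrand vanishes at \<open>r = 0\<close> whatever the junk value \<open>\<phi> 0\<close> is; likewise the vector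
  \<open>\<phi> (norm v) *\<^sub>R v\<close> used below is \<open>0\<close> for \<open>v = 0\<close>.\<close>

definition Phi :: "(real \<Rightarrow> real) \<Rightarrow> real \<Rightarrow> real" where
  "Phi \<phi> s = (LINT r:{0..\<bar>s\<bar>}|lborel. \<phi> r * r)"

definition G_fun :: "(real \<Rightarrow> real) \<Rightarrow> real \<Rightarrow> real" where
  "G_fun \<phi> s = (if s = 0 then 0 else \<phi> s * s\<^sup>2 - Phi \<phi> s)"

definition L1_loc :: "real set \<Rightarrow> (real \<Rightarrow> 'a::euclidean_space) set" where
  "L1_loc I = {q. \<forall>K. compact K \<and> K \<subseteq> I \<longrightarrow> set_integrable lebesgue K q}"

definition L_Phi :: "(real \<Rightarrow> real) \<Rightarrow> real set \<Rightarrow> (real \<Rightarrow> 'a::euclidean_space) set" where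
  "L_Phi \<phi> I = {q \<in> L1_loc I.
     \<exists>\<kappa>>0. (\<integral>\<^sup>+t\<in>I. ennreal (Phi \<phi> (norm (q t) / \<kappa>)) \<partial>lebesgue) < \<infinity>}"

definition has_weak_deriv ::
  "real set \<Rightarrow> (real \<Rightarrow> 'a::euclidean_space) \<Rightarrow> (real \<Rightarrow> 'a) \<Rightarrow> bool" where
  "has_weak_deriv I q g \<longleftrightarrow> q \<in> L1_loc I \<and> g \<in> L1_loc I \<and>
     (\<forall>\<psi>::real \<Rightarrow> real. test_function (interior I) \<psi> \<longrightarrow>
        (LINT t:I|lebesgue. vderiv \<psi> t *\<^sub>R q t) = - (LINT t:I|lebesgue. \<psi> t *\<^sub>R g t))"

definition W1_Phi :: "(real \<Rightarrow> real) \<Rightarrow> real set \<Rightarrow> (real \<Rightarrow> 'a::euclidean_space) set" where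
  "W1_Phi \<phi> I = {q \<in> L_Phi \<phi> I. \<exists>g \<in> L_Phi \<phi> I. has_weak_deriv I q g}"

text \<open>Elements are represented by their continuous representatives.\<close>

definition W1_Phi_loc :: "(real \<Rightarrow> real) \<Rightarrow> (real \<Rightarrow> 'a::euclidean_space) set" where
  "W1_Phi_loc \<phi> = {q. continuous_on UNIV q \<and> (\<forall>a b. a < b \<longrightarrow> q \<in> W1_Phi \<phi> {a..b})}"

text \<open>The weak derivative on the real line is unique only almost everywhere; all uses below are
  under an integral.\<close>

definition weak_deriv :: "(real \<Rightarrow> 'a::euclidean_space) \<Rightarrow> real \<Rightarrow> 'a" where
  "weak_deriv q = (SOME g. has_weak_deriv UNIV q g)"

definition Linf_norm :: "real set \<Rightarrow> (real \<Rightarrow> 'a::euclidean_space) \<Rightarrow> ereal" where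
  "Linf_norm I q = esssup (restrict_space lebesgue I) (\<lambda>t. ereal (norm (q t)))"

section \<open>The variational problem\<close>

text \<open>\<open>J_fun\<close> is only ever evaluated at paths with \<open>V (q t) \<ge> c\<close>, whose integrand is nonnegative, so
  the truncation in \<^const>\<open>ennreal\<close> is immaterial and the value \<open>\<infinity>\<close> is allowed.\<close>

definition J_fun ::
  "(real \<Rightarrow> real) \<Rightarrow> ('a::euclidean_space \<Rightarrow> real) \<Rightarrow> real \<Rightarrow> (real \<Rightarrow> 'a) \<Rightarrow> ennreal" where
  "J_fun \<phi> V c q =
     (\<integral>\<^sup>+t. ennreal (Phi \<phi> (norm (weak_deriv q t)) + V (q t) - c) \<partial>lebesgue)"

definition Gamma_set ::
  "(real \<Rightarrow> real) \<Rightarrow> ('a::euclidean_space \<Rightarrow> real) \<Rightarrow> real \<Rightarrow> 'a set \<Rightarrow> 'a set \<Rightarrow> (real \<Rightarrow> 'a) set" where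
  "Gamma_set \<phi> V c Vm Vp = {q \<in> W1_Phi_loc \<phi>. (\<forall>t. V (q t) \<ge> c)
     \<and> Liminf at_bot (\<lambda>t. ereal (infdist (q t) Vm)) = 0
     \<and> Liminf at_top (\<lambda>t. ereal (infdist (q t) Vp)) = 0}"

section \<open>Connections and their canonical extensions\<close>

definition energy ::
  "(real \<Rightarrow> real) \<Rightarrow> ('a::euclidean_space \<Rightarrow> real) \<Rightarrow> (real \<Rightarrow> 'a) \<Rightarrow> real \<Rightarrow> real" where
  "energy \<phi> V q t = G_fun \<phi> (norm (vderiv q t)) - V (q t)"

text \<open>Contact times are extended reals; the values of \<open>q\<close> outside the closure of the interval are
  irrelevant. The limits are taken along the filters \<open>at_right \<alpha>\<close>, \<open>at_left \<omega>\<close> of extended reals,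
  as for improper integrals in the library, to cover finite and infinite contact times at once.\<close>

definition c_connection ::
  "(real \<Rightarrow> real) \<Rightarrow> ('a::euclidean_space \<Rightarrow> real) \<Rightarrow> real \<Rightarrow> 'a set \<Rightarrow> 'a set
     \<Rightarrow> ereal \<Rightarrow> ereal \<Rightarrow> (real \<Rightarrow> 'a) \<Rightarrow> bool" where
  "c_connection \<phi> V c Vm Vp \<alpha> \<omega> q \<longleftrightarrow>
     \<alpha> < \<omega> \<and> Linf_norm (einterval \<alpha> \<omega>) q < \<infinity> \<and>
     C1_on (closure (einterval \<alpha> \<omega>)) q \<and> C2_on (einterval \<alpha> \<omega>) q \<and>
     (\<forall>t\<in>einterval \<alpha> \<omega>.
        ((\<lambda>s. \<phi> (norm (vderiv q s)) *\<^sub>R vderiv q s) has_vector_derivative grad V (q t)) (at t)) \<and>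
     (\<forall>t\<in>einterval \<alpha> \<omega>. V (q t) > c \<and> energy \<phi> V q t = - c) \<and>
     ((\<lambda>t. infdist (q (real_of_ereal t)) Vm) \<longlongrightarrow> 0) (at_right \<alpha>) \<and>
     ((\<lambda>t. infdist (q (real_of_ereal t)) Vp) \<longlongrightarrow> 0) (at_left \<omega>)"

definition heteroclinic_type :: "ereal \<Rightarrow> ereal \<Rightarrow> bool" where
  "heteroclinic_type \<alpha> \<omega> \<longleftrightarrow> \<alpha> = -\<infinity> \<and> \<omega> = \<infinity>"

definition homoclinic_type :: "ereal \<Rightarrow> ereal \<Rightarrow> bool" where
  "homoclinic_type \<alpha> \<omega> \<longleftrightarrow> (\<bar>\<alpha>\<bar> \<noteq> \<infinity> \<and> \<omega> = \<infinity>) \<or> (\<alpha> = -\<infinity> \<and> \<bar>\<omega>\<bar> \<noteq> \<infinity>)"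

definition brake_type :: "ereal \<Rightarrow> ereal \<Rightarrow> bool" where
  "brake_type \<alpha> \<omega> \<longleftrightarrow> \<bar>\<alpha>\<bar> \<noteq> \<infinity> \<and> \<bar>\<omega>\<bar> \<noteq> \<infinity>"

text \<open>In the last case \<open>s\<close> is the representative of \<open>t\<close> modulo the period \<open>T = 2 (\<omega> - \<alpha>)\<close> in
  \<open>[\<alpha>, \<alpha> + T) = [\<alpha>, 2 \<omega> - \<alpha>)\<close>.\<close>

definition canonical_ext :: "ereal \<Rightarrow> ereal \<Rightarrow> (real \<Rightarrow> 'a) \<Rightarrow> real \<Rightarrow> 'a" where
  "canonical_ext \<alpha> \<omega> q t =
     (let a = real_of_ereal \<alpha>; w = real_of_ereal \<omega> in
      if \<alpha> = -\<infinity> \<and> \<omega> = \<infinity> then q t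
      else if \<omega> = \<infinity> then (if t < a then q (2 * a - t) else q t)
      else if \<alpha> = -\<infinity> then (if t > w then q (2 * w - t) else q t)
      else (let T = 2 * (w - a); s = t - T * of_int \<lfloor>(t - a) / T\<rfloor>
            in if s \<le> w then q s else q (2 * w - s)))"

text \<open>\<^const>\<open>has_bochner_integral\<close> makes integrability part of the claim: the total function
  \<^const>\<open>lebesgue_integral\<close> is \<open>0\<close> at non-integrable functions.\<close>

definition weak_solution ::
  "(real \<Rightarrow> real) \<Rightarrow> ('a::euclidean_space \<Rightarrow> real) \<Rightarrow> (real \<Rightarrow> 'a) \<Rightarrow> bool" where
  "weak_solution \<phi> V q \<longleftrightarrow> q \<in> W1_Phi_loc \<phi> \<and>
     (\<forall>\<psi>::real \<Rightarrow> 'a. test_function UNIV \<psi> \<longrightarrow>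
        has_bochner_integral lebesgue
          (\<lambda>t. (\<phi> (norm (weak_deriv q t)) *\<^sub>R weak_deriv q t) \<bullet> vderiv \<psi> t + grad V (q t) \<bullet> \<psi> t) 0)"

definition critical_value :: "('a::real_inner \<Rightarrow> real) \<Rightarrow> real \<Rightarrow> bool" where
  "critical_value V c \<longleftrightarrow> (\<exists>\<xi>. V \<xi> = c \<and> grad V \<xi> = 0)"

end

(* A minimizing sequence with norms at most R is shifted in time so that at time 0 the paths are at half
   the distance of the wells from Vm. Superlinearity of Phi makes it equicontinuous, so a subsequence
   converges pointwise to some q. Lower semicontinuity is never used for q itself: comparing the members of
   the sequence with modified competitors shows that the discretized action of q on a short interval is at
   most that of any competitor with the same end points. Where V(q) > c this gives a local Lipschitz bound
   (competitor: a segment), the Euler-Lagrange equation (competitors: variations of polygonal interpolations)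
   and the energy identity (competitor: a segment run at another speed). If q came back close to Vm after
   time 0, the past could be cut off at a gain, so q ends at Vp, in finite or infinite time; reversing time
   treats the other end. At a finite contact time the speed vanishes by the energy identity, so reflection
   preserves the equation. At an infinite one, the speed tends to 0 and so do the integrals of
   grad V(q) over unit intervals, so that limit points of q are critical points at level c. *)
theory Submission
  imports Defs "HOL-Complex_Analysis.Great_Picard"
begin

text \<open>Every variational statement about q is therefore made for difference quotients on a
  grid, where pointwise convergence suffices. \<open>\<phi>\<close> may blow up or vanish at speed
  0. For this reason the equation is kept as a first-order system in position and momentum
  \<open>mom v\<close>, with the homeomorphism \<open>vel\<close> as inverse; second derivatives are
  formed only where the momentum is nonzero, which the energy identity ensures wherever V(q) > c.
  Admissible paths obey V \<ge> c, so q can be varied only near times with V(q) > c, and contact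
  times are reached by limits. The problem is autonomous and posed on the whole line: a competitor
  may take any time for its journey, the tail of the path being shifted. This freedom fixes the
  energy at exactly -c, and it makes cutting off the past legitimate. The normalisation at time 0
  prevents the limit from degenerating to a point of a well.\<close>

section \<open>The Orlicz function, its derivative and the momentum map\<close>

locale orlicz =
  fixes \<phi> :: "real \<Rightarrow> real" and l :: real
  assumes C1: "\<phi> C1_differentiable_on {0<..}"
    and pos: "s > 0 \<Longrightarrow> \<phi> s > 0"
    and l_gt_1: "1 < l"
    and deriv_pos: "s > 0 \<Longrightarrow> deriv (\<lambda>r. \<phi> r * r) s > 0"
    and deriv_ge: "s > 0 \<Longrightarrow> l - 1 \<le> deriv (\<lambda>r. \<phi> r * r) s / \<phi> s"
begin

text \<open>The derivative of \<open>\<Phi>\<close> on the half line, with the correct value 0 at 0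
  whatever \<open>\<phi> 0\<close> is; also the norm of the momentum at speed s.\<close>

definition \<alpha> :: "real \<Rightarrow> real" where "\<alpha> s = \<phi> s * s"

definition \<alpha>' :: "real \<Rightarrow> real" where "\<alpha>' = deriv \<alpha>"

lemma \<alpha>_0 [simp]: "\<alpha> 0 = 0"
  by (simp add: \<alpha>_def)

lemma \<alpha>_pos: "s > 0 \<Longrightarrow> \<alpha> s > 0"
  by (simp add: \<alpha>_def pos)

lemma \<alpha>_C1: "\<exists>D. (\<forall>s>0. (\<alpha> has_real_derivative D s) (at s)) \<and> continuous_on {0<..} D"
proof -
  obtain D where D: "\<And>s. s > 0 \<Longrightarrow> (\<phi> has_real_derivative D s) (at s)"
      and cD: "continuous_on {0<..} D"
    using C1 unfolding C1_differentiable_on_def has_real_derivative_iff_has_vector_derivative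
    by (metis greaterThan_iff)
  have "continuous_on {0<..} \<phi>"
    using D by (meson DERIV_isCont continuous_at_imp_continuous_on greaterThan_iff)
  then have "continuous_on {0<..} (\<lambda>s. D s * s + \<phi> s)"
    using cD by (intro continuous_intros)
  moreover have "(\<alpha> has_real_derivative D s * s + \<phi> s) (at s)" if "s > 0" for s
    using DERIV_mult[OF D[OF that] DERIV_ident] by (simp add: \<alpha>_def[abs_def])
  ultimately show ?thesis
    by (intro exI[of _ "\<lambda>s. D s * s + \<phi> s"]) auto
qed

lemma \<alpha>_deriv: "s > 0 \<Longrightarrow> (\<alpha> has_real_derivative \<alpha>' s) (at s)"
  using \<alpha>_C1 DERIV_imp_deriv unfolding \<alpha>'_def by metis

lemma \<alpha>'_cont: "continuous_on {0<..} \<alpha>'"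
proof -
  obtain D where D: "\<And>s. s > 0 \<Longrightarrow> (\<alpha> has_real_derivative D s) (at s)"
      and cD: "continuous_on {0<..} D"
    using \<alpha>_C1 by blast
  have "\<alpha>' s = D s" if "s > 0" for s
    using DERIV_imp_deriv[OF D[OF that]] unfolding \<alpha>'_def .
  then show ?thesis
    using cD continuous_on_cong[of "{0<..}" "{0<..}" \<alpha>' D] by simp
qed

lemma \<alpha>'_eq: "\<alpha>' s = deriv (\<lambda>r. \<phi> r * r) s"
proof -
  have "\<alpha> = (\<lambda>r. \<phi> r * r)" by (auto simp: \<alpha>_def)
  then show ?thesis by (simp add: \<alpha>'_def)
qed

lemma \<alpha>'_pos: "s > 0 \<Longrightarrow> \<alpha>' s > 0"
  using deriv_pos by (simp add: \<alpha>'_eq)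

lemma \<alpha>'_ge: "s > 0 \<Longrightarrow> \<alpha>' s * s \<ge> (l - 1) * \<alpha> s"
  using mult_right_mono[OF deriv_ge[of s], of "\<phi> s * s"] pos[of s] by (simp add: \<alpha>'_eq \<alpha>_def)

lemma \<alpha>_strict_mono_pos: "0 < s \<Longrightarrow> s < t \<Longrightarrow> \<alpha> s < \<alpha> t"
  by (rule DERIV_pos_imp_increasing[where f = \<alpha>]) (meson \<alpha>_deriv \<alpha>'_pos less_le_trans)+

lemma \<alpha>_strict_mono: "0 \<le> s \<Longrightarrow> s < t \<Longrightarrow> \<alpha> s < \<alpha> t"
  using \<alpha>_strict_mono_pos[of s t] \<alpha>_pos[of t] by (cases "s = 0") auto

lemma \<alpha>_mono: "0 \<le> s \<Longrightarrow> s \<le> t \<Longrightarrow> \<alpha> s \<le> \<alpha> t"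
  using \<alpha>_strict_mono[of s t] by (cases "s = t") auto

lemma \<alpha>_nonneg: "0 \<le> s \<Longrightarrow> 0 \<le> \<alpha> s"
  using \<alpha>_mono[of 0 s] by simp

lemma \<alpha>_inj: "0 \<le> s \<Longrightarrow> 0 \<le> t \<Longrightarrow> \<alpha> s = \<alpha> t \<Longrightarrow> s = t"
  using \<alpha>_strict_mono[of s t] \<alpha>_strict_mono[of t s] by force

text \<open>The lower index bound says that the logarithmic derivative of \<alpha> is at least (l -
  1) / s, so \<alpha> grows at least like the power l - 1. Comparison with s = 1 yields both the
  decay at 0 and the superlinearity of \<open>\<Phi>\<close> at infinity.\<close>

lemma \<alpha>_quotient_mono:
  assumes "0 < s" "s \<le> t"
  shows "\<alpha> s * s powr (1 - l) \<le> \<alpha> t * t powr (1 - l)"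
proof (rule DERIV_nonneg_imp_nondecreasing[OF assms(2)])
  fix x assume "s \<le> x" "x \<le> t"
  then have x: "x > 0" using assms by simp
  have "((\<lambda>x. \<alpha> x * x powr (1 - l)) has_real_derivative
      \<alpha>' x * x powr (1 - l) + \<alpha> x * ((1 - l) * x powr (1 - l - 1))) (at x)"
    using x by (auto intro!: derivative_eq_intros \<alpha>_deriv has_real_derivative_powr)
  moreover have "\<alpha>' x * x powr (1 - l) + \<alpha> x * ((1 - l) * x powr (1 - l - 1))
      = (\<alpha>' x * x - (l - 1) * \<alpha> x) * x powr (1 - l - 1)"
  proof -
    have "x powr (1 - l) = x powr (1 - l - 1) * x" using powr_add[of x "1 - l - 1" 1] x by simp
    then show ?thesis by (simp only: left_diff_distrib) (simp add: algebra_simps)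
  qed
  moreover have "\<dots> \<ge> 0"
    using \<alpha>'_ge[OF x] by simp
  ultimately show "\<exists>y. ((\<lambda>x. \<alpha> x * x powr (1 - l)) has_real_derivative y) (at x) \<and> 0 \<le> y"
    by metis
qed

lemma \<alpha>_le_powr: "0 < s \<Longrightarrow> s \<le> 1 \<Longrightarrow> \<alpha> s \<le> \<alpha> 1 * s powr (l - 1)"
  using \<alpha>_quotient_mono[of s 1] by (simp add: powr_diff field_simps)

lemma \<alpha>_ge_powr: "1 \<le> s \<Longrightarrow> \<alpha> 1 * s powr (l - 1) \<le> \<alpha> s"
  using \<alpha>_quotient_mono[of 1 s] by (simp add: powr_diff field_simps)

lemma \<alpha>_cont: "continuous_on {0..} \<alpha>"
proof (rule continuous_on_eq_continuous_within[THEN iffD2], rule ballI)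
  fix s :: real assume "s \<in> {0..}"
  then consider "s > 0" | "s = 0" by force
  then show "continuous (at s within {0..}) \<alpha>"
  proof cases
    case 1
    then show ?thesis using \<alpha>_deriv DERIV_isCont continuous_at_imp_continuous_at_within by blast
  next
    case 2
    \<comment> \<open>Nothing is assumed on \<open>\<phi>\<close> near 0; the positive exponent l -
      1 alone forces \<alpha> to 0 there.\<close>
    have "((\<lambda>s. \<alpha> 1 * s powr (l - 1)) \<longlongrightarrow> 0) (at_right 0)"
    proof -
      have "((\<lambda>s::real. s powr (l - 1)) \<longlongrightarrow> 0 powr (l - 1)) (at_right 0)"
        using l_gt_1 by (intro tendsto_powr' tendsto_intros)
          (auto simp: eventually_at_filter)
      from tendsto_mult_left[OF this, of "\<alpha> 1"] show ?thesis using l_gt_1 by simp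
    qed
    then have "(\<alpha> \<longlongrightarrow> 0) (at_right 0)"
    proof (rule tendsto_sandwich[rotated 2, OF tendsto_const])
      show "\<forall>\<^sub>F n in at_right 0. 0 \<le> \<alpha> n"
        by (rule eventually_at_rightI[of 0 1]) (auto intro: \<alpha>_nonneg)
      show "\<forall>\<^sub>F n in at_right 0. \<alpha> n \<le> \<alpha> 1 * n powr (l - 1)"
        by (rule eventually_at_rightI[of 0 1]) (auto intro: \<alpha>_le_powr)
    qed
    then show ?thesis using 2
      by (simp add: continuous_within at_within_Ici_at_right)
  qed
qed

lemma \<alpha>_unbounded: "\<exists>s>0. \<alpha> s \<ge> y"
proof -
  have "filterlim (\<lambda>s. \<alpha> 1 * s powr (l - 1)) at_top at_top"
    using \<alpha>_pos[of 1] l_gt_1 by (intro filterlim_tendsto_pos_mult_at_top[OF tendsto_const] real_powr_at_top) auto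
  then have "\<forall>\<^sub>F s in at_top. y \<le> \<alpha> 1 * s powr (l - 1) \<and> (1::real) \<le> s"
    using eventually_ge_at_top[of 1] unfolding filterlim_at_top by (simp add: eventually_conj_iff)
  then obtain s where "y \<le> \<alpha> 1 * s powr (l - 1)" "1 \<le> s"
    using eventually_happens'[of at_top] by (metis (no_types, lifting) trivial_limit_at_top_linorder)
  then show ?thesis using \<alpha>_ge_powr[of s] by (intro exI[of _ s]) auto
qed

lemma \<alpha>_surj: assumes "0 \<le> y" shows "\<exists>s\<ge>0. \<alpha> s = y"
proof -
  obtain s where s: "s > 0" "\<alpha> s \<ge> y" using \<alpha>_unbounded by blast
  have "\<exists>x\<ge>0. x \<le> s \<and> \<alpha> x = y"
    using s assms by (intro IVT') (auto intro: continuous_on_subset[OF \<alpha>_cont])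
  then show ?thesis by blast
qed

text \<open>The inverse of \<alpha> on the half line, that is, the derivative of the convex
  conjugate of \<open>\<Phi>\<close>: speed as a function of the norm of the momentum.\<close>

definition \<beta> :: "real \<Rightarrow> real" where "\<beta> y = (THE s. s \<ge> 0 \<and> \<alpha> s = y)"

lemma \<beta>_\<alpha>: "0 \<le> s \<Longrightarrow> \<beta> (\<alpha> s) = s"
  unfolding \<beta>_def by (rule the_equality) (auto intro: \<alpha>_inj)

lemma \<beta>_nonneg: "0 \<le> y \<Longrightarrow> 0 \<le> \<beta> y"
  using \<alpha>_surj \<beta>_\<alpha> by fastforce

lemma \<alpha>_\<beta>: "0 \<le> y \<Longrightarrow> \<alpha> (\<beta> y) = y"
  using \<alpha>_surj \<beta>_\<alpha> by fastforce

lemma \<beta>_0 [simp]: "\<beta> 0 = 0"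
  using \<beta>_\<alpha>[of 0] by simp

lemma \<beta>_pos: "0 < y \<Longrightarrow> 0 < \<beta> y"
  using \<beta>_nonneg[of y] \<alpha>_\<beta>[of y] by (cases "\<beta> y = 0") auto

lemma \<beta>_less: assumes "0 \<le> y" "0 \<le> s" "y < \<alpha> s" shows "\<beta> y < s"
  using assms \<alpha>_mono[of s "\<beta> y"] \<alpha>_\<beta>[of y] by force

lemma \<beta>_greater: assumes "0 \<le> s" "\<alpha> s < y" shows "s < \<beta> y"
  using assms \<alpha>_nonneg[of s] \<alpha>_mono[of "\<beta> y" s] \<alpha>_\<beta>[of y] \<beta>_nonneg[of y] by force

lemma \<beta>_cont: "continuous_on {0..} \<beta>"
proof (rule continuous_on_iff[THEN iffD2], intro ballI allI impI)
  fix y e :: real assume "y \<in> {0..}" "e > 0"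
  then have y: "y \<ge> 0" by simp
  define s where "s = \<beta> y"
  have s: "s \<ge> 0" "\<alpha> s = y" using y \<beta>_nonneg \<alpha>_\<beta> by (auto simp: s_def)
  \<comment> \<open>If s < e, then s - e is negative, outside the range where \<alpha> is monotone;
    the lower bound then comes from \<open>\<beta>_nonneg\<close>, and only the gap above s
    restricts d.\<close>
  define d where "d = (if s < e then \<alpha> (s + e) - y else min (\<alpha> (s + e) - y) (y - \<alpha> (s - e)))"
  have "d > 0"
    using \<alpha>_strict_mono[of s "s + e"] \<alpha>_strict_mono[of "s - e" s] s \<open>e > 0\<close> by (auto simp: d_def)
  moreover have "dist (\<beta> z) (\<beta> y) < e" if "z \<ge> 0" "dist z y < d" for z
  proof -
    have "\<beta> z < s + e"
      using that s \<open>e > 0\<close> by (intro \<beta>_less) (auto simp: d_def dist_real_def split: if_splits)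
    moreover have "\<beta> z > s - e"
    proof (cases "s < e")
      case True
      then show ?thesis using \<beta>_nonneg[OF that(1)] by simp
    next
      case False
      then show ?thesis using that s \<open>e > 0\<close>
        by (intro \<beta>_greater) (auto simp: d_def dist_real_def split: if_splits)
    qed
    ultimately show ?thesis by (auto simp: dist_real_def s_def)
  qed
  ultimately show "\<exists>d>0. \<forall>x'\<in>{0..}. dist x' y < d \<longrightarrow> dist (\<beta> x') (\<beta> y) < e"
    by auto
qed

lemma \<beta>_deriv: assumes "y > 0" shows "(\<beta> has_real_derivative inverse (\<alpha>' (\<beta> y))) (at y)"
proof (rule DERIV_inverse_function[where f = \<alpha> and a = 0 and b = "y + 1"])
  show "(\<alpha> has_real_derivative \<alpha>' (\<beta> y)) (at (\<beta> y))"
    by (rule \<alpha>_deriv[OF \<beta>_pos[OF assms]])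
  show "\<alpha>' (\<beta> y) \<noteq> 0" using \<alpha>'_pos[OF \<beta>_pos[OF assms]] by simp
  have "continuous_on {0<..} \<beta>" using \<beta>_cont by (rule continuous_on_subset) auto
  then show "isCont \<beta> y" using assms continuous_on_eq_continuous_at[of "{0<..}" \<beta>] by auto
qed (use assms \<alpha>_\<beta> in auto)

lemma \<beta>_deriv_cont: "continuous_on {0<..} (\<lambda>y. inverse (\<alpha>' (\<beta> y)))"
proof (intro continuous_on_inverse continuous_on_compose2[OF \<alpha>'_cont])
  show "continuous_on {0<..} \<beta>" using \<beta>_cont by (rule continuous_on_subset) auto
  show "\<forall>x\<in>{0<..}. \<alpha>' (\<beta> x) \<noteq> 0" using \<alpha>'_pos \<beta>_pos by (metis greaterThan_iff less_irrefl)
qed (auto intro: \<beta>_pos)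

abbreviation \<Phi> :: "real \<Rightarrow> real" where "\<Phi> \<equiv> Phi \<phi>"

lemma Phi_eq: "\<Phi> s = integral {0..\<bar>s\<bar>} \<alpha>"
proof -
  have "continuous_on {0..\<bar>s\<bar>} \<alpha>" by (rule continuous_on_subset[OF \<alpha>_cont]) auto
  then have "set_integrable lborel {0..\<bar>s\<bar>} \<alpha>"
    unfolding set_integrable_def by (rule borel_integrable_compact[rotated]) auto
  from set_borel_integral_eq_integral(2)[OF this] show ?thesis
    unfolding Phi_def \<alpha>_def .
qed

lemma Phi_0 [simp]: "\<Phi> 0 = 0"
  by (simp add: Phi_eq)

lemma \<alpha>_integrable: "0 \<le> s \<Longrightarrow> \<alpha> integrable_on {s..t}"
  by (rule integrable_continuous_real, rule continuous_on_subset[OF \<alpha>_cont]) auto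

lemma Phi_diff: assumes "0 \<le> s" "s \<le> t" shows "\<Phi> t - \<Phi> s = integral {s..t} \<alpha>"
  using Henstock_Kurzweil_Integration.integral_combine[of 0 s t \<alpha>] assms \<alpha>_integrable[of 0 t] by (simp add: Phi_eq)

text \<open>Convexity in tangent form, read off from the monotonicity of \<alpha> under the
  integral; this way it also covers s = 0.\<close>

lemma Phi_support: assumes "0 \<le> r" "0 \<le> s" shows "\<Phi> r \<ge> \<Phi> s + \<alpha> s * (r - s)"
proof (cases "s \<le> r")
  case True
  have "integral {s..r} (\<lambda>_. \<alpha> s) \<le> integral {s..r} \<alpha>"
    using assms by (intro integral_le \<alpha>_integrable) (auto intro: \<alpha>_mono)
  then show ?thesis using Phi_diff[of s r] True assms by (simp add: mult.commute)
next
  case False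
  have "integral {r..s} \<alpha> \<le> integral {r..s} (\<lambda>_. \<alpha> s)"
    using assms by (intro integral_le \<alpha>_integrable) (auto intro: \<alpha>_mono)
  then show ?thesis using Phi_diff[of r s] False assms by (simp add: algebra_simps)
qed

lemma Phi_nonneg: "\<Phi> s \<ge> 0"
  unfolding Phi_eq by (rule Henstock_Kurzweil_Integration.integral_nonneg[OF \<alpha>_integrable]) (auto intro: \<alpha>_nonneg)

lemma Phi_mono: "0 \<le> s \<Longrightarrow> s \<le> t \<Longrightarrow> \<Phi> s \<le> \<Phi> t"
  using Phi_support[of t s] mult_nonneg_nonneg[OF \<alpha>_nonneg[of s], of "t - s"] by linarith

lemma Phi_abs [simp]: "\<Phi> \<bar>s\<bar> = \<Phi> s"
  by (simp add: Phi_eq)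

lemma Phi_deriv: assumes "s > 0" shows "(\<Phi> has_real_derivative \<alpha> s) (at s)"
proof -
  have "((\<lambda>u. integral {0..u} \<alpha>) has_real_derivative \<alpha> s) (at s within {0..s+1})"
    using assms by (intro integral_has_real_derivative) (auto intro: continuous_on_subset[OF \<alpha>_cont])
  then have "((\<lambda>u. integral {0..u} \<alpha>) has_real_derivative \<alpha> s) (at s)"
    using assms at_within_Icc_at[of 0 s "s + 1"] by simp
  then show ?thesis
  proof (rule has_field_derivative_transform_within_open[of _ _ _ "{0<..}"])
    fix u :: real assume "u \<in> {0<..}"
    then show "integral {0..u} \<alpha> = \<Phi> u" by (simp add: Phi_eq)
  qed (use assms in auto)
qed

lemma Phi_cont: "continuous_on UNIV \<Phi>"
proof -
  have "continuous_on {0..} \<Phi>"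
  proof (rule continuous_on_iff[THEN iffD2], intro ballI allI impI)
    fix s e :: real assume "s \<in> {0..}" "e > 0"
    then have s: "s \<ge> 0" by simp
    define C where "C = \<alpha> (s + 1) + 1"
    have C: "C > 0" using \<alpha>_nonneg[of "s + 1"] s by (simp add: C_def)
    have *: "\<bar>\<Phi> u - \<Phi> v\<bar> \<le> C * \<bar>u - v\<bar>" if "0 \<le> u" "u \<le> v" "v \<le> s + 1" for u v
    proof -
      have "\<Phi> v - \<Phi> u \<le> \<alpha> v * (v - u)"
        using Phi_support[of u v] that by (simp add: algebra_simps)
      also have "\<dots> \<le> C * (v - u)"
        using \<alpha>_mono[of v "s + 1"] that by (intro mult_right_mono) (auto simp: C_def)
      finally show ?thesis using Phi_mono[of u v] that by simp
    qed
    have "dist (\<Phi> x) (\<Phi> s) < e" if x: "x \<ge> 0" "dist x s < min 1 (e / C)" for x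
    proof -
      have "\<bar>\<Phi> x - \<Phi> s\<bar> \<le> C * \<bar>x - s\<bar>"
        using *[of x s] *[of s x] x s by (cases "x \<le> s") (auto simp: dist_real_def abs_minus_commute)
      also have "\<dots> < e" using x C by (simp add: dist_real_def field_simps)
      finally show ?thesis by (simp add: dist_real_def)
    qed
    then show "\<exists>d>0. \<forall>x'\<in>{0..}. dist x' s < d \<longrightarrow> dist (\<Phi> x') (\<Phi> s) < e"
      using C \<open>e > 0\<close> by (intro exI[of _ "min 1 (e / C)"]) auto
  qed
  then have "continuous_on UNIV (\<lambda>s. \<Phi> \<bar>s\<bar>)"
    by (rule continuous_on_compose2) (auto intro!: continuous_intros)
  then show ?thesis by simp
qed

lemma Phi_measurable [measurable]: "\<Phi> \<in> borel_measurable borel"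
  using Phi_cont by (rule borel_measurable_continuous_onI)

text \<open>The tangent of \<open>\<Phi>\<close> at a point s0 where its slope is at least 1 / e.
  This is the form of superlinearity behind all equicontinuity and speed bounds.\<close>

lemma le_eps_Phi: assumes "e > 0" shows "\<exists>K>0. \<forall>s\<ge>0. s \<le> e * \<Phi> s + K"
proof -
  obtain s0 where s0: "s0 > 0" "\<alpha> s0 \<ge> 1 / e" using \<alpha>_unbounded by blast
  have "s \<le> e * \<Phi> s + s0" if "s \<ge> 0" for s
  proof (cases "s \<le> s0")
    case True
    then show ?thesis using Phi_nonneg[of s] assms by (simp add: add_increasing)
  next
    case False
    have "1 / e * (s - s0) \<le> \<alpha> s0 * (s - s0)" using s0 False by (intro mult_right_mono) auto
    also have "\<dots> \<le> \<Phi> s" using Phi_support[of s s0] Phi_nonneg[of s0] that s0 by simp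
    finally show ?thesis using assms by (simp add: field_simps)
  qed
  then show ?thesis using s0 by blast
qed

abbreviation G :: "real \<Rightarrow> real" where "G \<equiv> G_fun \<phi>"

lemma G_eq: "G s = \<alpha> s * s - \<Phi> s"
  by (simp add: G_fun_def \<alpha>_def power2_eq_square)

text \<open>G t - G s is (\<alpha> t - \<alpha> s) s plus the defect of the tangent inequality at t.
  The first term is positive for s > 0; for s = 0 it vanishes, and strictness comes from the tangent
  inequalities linking 0, t/2 and t.\<close>

lemma G_strict_mono: assumes "0 \<le> s" "s < t" shows "G s < G t"
proof -
  have "0 < (\<alpha> t - \<alpha> s) * s + (\<Phi> s - \<Phi> t - \<alpha> t * (s - t))" if "s > 0"
  proof -
    have "0 < (\<alpha> t - \<alpha> s) * s" using \<alpha>_strict_mono[OF assms] that by simp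
    then show ?thesis using Phi_support[of s t] assms by linarith
  qed
  moreover have "0 < G t" if "s = 0"
  proof -
    have "\<Phi> (t/2) \<ge> 0" "\<Phi> (t/2) \<ge> \<Phi> t + \<alpha> t * (t/2 - t)" "\<Phi> 0 \<ge> \<Phi> (t/2) + \<alpha> (t/2) * (0 - t/2)"
      using Phi_support[of "t/2" t] Phi_support[of 0 "t/2"] assms that Phi_nonneg[of "t/2"] by auto
    moreover have "\<alpha> (t/2) * (t/2) < \<alpha> t * (t/2)"
      using \<alpha>_strict_mono[of "t/2" t] assms that by simp
    ultimately show ?thesis by (simp add: G_eq algebra_simps)
  qed
  ultimately show ?thesis using assms by (cases "s = 0") (auto simp: G_eq algebra_simps)
qed

lemma G_0 [simp]: "G 0 = 0"
  by (simp add: G_fun_def)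

text \<open>The gradient of v |-> Phi(|v|): the momentum belonging to the velocity v.\<close>

definition mom :: "'a::euclidean_space \<Rightarrow> 'a" where "mom v = \<phi> (norm v) *\<^sub>R v"

text \<open>Inverse of \<open>mom\<close>; at p = 0 the quotient is junk, but it multiplies the zero
  vector.\<close>

definition vel :: "'a::euclidean_space \<Rightarrow> 'a" where "vel p = (\<beta> (norm p) / norm p) *\<^sub>R p"

lemma mom_0 [simp]: "mom 0 = 0" by (simp add: mom_def)

lemma vel_0 [simp]: "vel 0 = 0" by (simp add: vel_def)

lemma mom_minus: "mom (- v) = - mom v" by (simp add: mom_def)

lemma norm_mom: "norm (mom v) = \<alpha> (norm v)"
  using pos[of "norm v"] by (cases "v = 0") (auto simp: mom_def \<alpha>_def abs_of_pos)

lemma norm_vel: "norm (vel p) = \<beta> (norm p)"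
  using \<beta>_nonneg[of "norm p"] by (cases "p = 0") (auto simp: vel_def)

lemma vel_mom [simp]: "vel (mom v) = v"
proof (cases "v = 0")
  case False
  then have "\<beta> (norm (mom v)) = norm v" by (simp add: norm_mom \<beta>_\<alpha>)
  then have "vel (mom v) = (norm v / (\<phi> (norm v) * norm v) * \<phi> (norm v)) *\<^sub>R v"
    unfolding vel_def norm_mom by (simp add: mom_def \<alpha>_def)
  then show ?thesis using False pos[of "norm v"] by simp
qed simp

lemma mom_vel [simp]: "mom (vel p) = p"
proof (cases "p = 0")
  case False
  have "mom (vel p) = (\<phi> (\<beta> (norm p)) * \<beta> (norm p) / norm p) *\<^sub>R p"
    unfolding mom_def norm_vel by (simp add: vel_def)
  also have "\<dots> = p" using False \<alpha>_\<beta>[of "norm p"] by (simp add: \<alpha>_def)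
  finally show ?thesis .
qed simp

lemma mom_eq_0_iff [simp]: "mom v = 0 \<longleftrightarrow> v = 0"
  by (metis mom_0 vel_mom)

text \<open>Common to \<open>mom\<close> and \<open>vel\<close>. The critical point is 0, where the
  direction is undefined but the norm, k(|v|), tends to 0.\<close>

lemma radial_cont:
  fixes f :: "'a::euclidean_space \<Rightarrow> 'a" and k :: "real \<Rightarrow> real"
  assumes k: "continuous_on {0..} k" and [simp]: "k 0 = 0" and f0: "f 0 = 0"
    and f: "\<And>v. v \<noteq> 0 \<Longrightarrow> f v = (k (norm v) / norm v) *\<^sub>R v" and k_nonneg: "\<And>s. s \<ge> 0 \<Longrightarrow> k s \<ge> 0"
  shows "continuous_on UNIV f"
proof (rule continuous_at_imp_continuous_on, rule ballI)
  fix v :: 'a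
  have ck: "continuous_on UNIV (\<lambda>v::'a. k (norm v))"
    by (rule continuous_on_compose2[OF k]) (auto intro!: continuous_intros)
  show "isCont f v"
  proof (cases "v = 0")
    case True
    have "norm (f u) = k (norm u)" for u
      using f[of u] f0 k_nonneg[of "norm u"] by (cases "u = 0") auto
    moreover have "((\<lambda>u::'a. k (norm u)) \<longlongrightarrow> k (norm (0::'a))) (at 0)"
      using ck[unfolded continuous_on_def, rule_format, of 0] by simp
    ultimately have "(f \<longlongrightarrow> 0) (at 0)" by (simp add: tendsto_norm_zero_cancel)
    then show ?thesis using True f0 by (simp add: isCont_def)
  next
    case False
    have "continuous_on (- {0}) (\<lambda>v::'a. (k (norm v) / norm v) *\<^sub>R v)"
      by (intro continuous_intros continuous_on_subset[OF ck]) auto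
    then have "continuous_on (- {0}) f" by (rule continuous_on_eq) (simp add: f)
    then show ?thesis using False continuous_on_eq_continuous_at[of "- {0}" f] by auto
  qed
qed

lemma mom_cont: "continuous_on UNIV mom"
  by (rule radial_cont[OF \<alpha>_cont]) (auto simp: mom_def \<alpha>_def intro: \<alpha>_nonneg[unfolded \<alpha>_def])

lemma vel_cont: "continuous_on UNIV vel"
  by (rule radial_cont[OF \<beta>_cont]) (auto simp: vel_def intro: \<beta>_nonneg)

text \<open>\<open>Phi_support\<close> along the norms, with Cauchy-Schwarz for
  \<open>mom v \<bullet> u\<close>: \<open>mom v\<close> is a subgradient of the kinetic term at v.
  Jensen's inequality and the first variation both rest on it.\<close>

lemma Phi_norm_support: "\<Phi> (norm u) \<ge> \<Phi> (norm v) + mom v \<bullet> (u - v)"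
proof -
  have "mom v \<bullet> u \<le> \<alpha> (norm v) * norm u"
    using norm_cauchy_schwarz[of "mom v" u] by (simp add: norm_mom)
  moreover have "mom v \<bullet> v = \<alpha> (norm v) * norm v"
    by (simp add: mom_def \<alpha>_def power2_norm_eq_inner[symmetric] power2_eq_square)
  ultimately show ?thesis
    using Phi_support[of "norm u" "norm v"] by (simp add: inner_diff_right algebra_simps)
qed

text \<open>Applied to the momentum, this turns the first-order system into second-order regularity.
  At zero momentum \<open>vel\<close> need not be differentiable, hence the assumption on p.\<close>

lemma vel_C1:
  assumes p: "\<And>t. t \<in> S \<Longrightarrow> (p has_vector_derivative p' t) (at t)" and S: "open S"
    and p': "continuous_on S p'" and nz: "\<And>t. t \<in> S \<Longrightarrow> p t \<noteq> (0::'a::euclidean_space)"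
  shows "C1_on S (\<lambda>t. vel (p t))"
proof -
  define n' where "n' t = (p t \<bullet> p' t) / norm (p t)" for t
  define k' where "k' s = (inverse (\<alpha>' (\<beta> s)) * s - \<beta> s) / s\<^sup>2" for s
  have cp: "continuous_on S p"
    using p by (meson continuous_at_imp_continuous_on has_vector_derivative_continuous)
  have n: "((\<lambda>t. norm (p t)) has_real_derivative n' t) (at t)" if "t \<in> S" for t
  proof -
    have "((\<lambda>t. norm (p t)) has_derivative (\<lambda>h. (h *\<^sub>R p' t) \<bullet> sgn (p t))) (at t)"
      by (rule has_derivative_compose[OF p[OF that, unfolded has_vector_derivative_def]
            has_derivative_norm[OF nz[OF that]]])
    moreover have "(\<lambda>h. (h *\<^sub>R p' t) \<bullet> sgn (p t)) = (\<lambda>h. n' t * h)"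
      by (auto simp: n'_def sgn_div_norm inner_commute divide_inverse)
    ultimately show ?thesis unfolding has_field_derivative_def by simp
  qed
  have k: "((\<lambda>s. \<beta> s / s) has_real_derivative k' s) (at s)" if "s > 0" for s
    unfolding k'_def using that by (auto intro!: derivative_eq_intros \<beta>_deriv simp: power2_eq_square)
  have ck': "continuous_on {0<..} k'"
    unfolding k'_def by (intro continuous_intros \<beta>_deriv_cont continuous_on_subset[OF \<beta>_cont]) auto
  have kn: "((\<lambda>t. \<beta> (norm (p t)) / norm (p t)) has_real_derivative k' (norm (p t)) * n' t) (at t)"
    if "t \<in> S" for t
    using DERIV_chain2[OF k n, of t] that nz[OF that] by simp
  define D where "D t = (\<beta> (norm (p t)) / norm (p t)) *\<^sub>R p' t + (k' (norm (p t)) * n' t) *\<^sub>R p t" for t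
  have "((\<lambda>t. vel (p t)) has_vector_derivative D t) (at t within S)" if "t \<in> S" for t
    unfolding vel_def D_def
    by (rule has_vector_derivative_at_within[OF has_vector_derivative_scaleR[OF kn[OF that] p[OF that]]])
  moreover have "continuous_on S D"
    unfolding D_def n'_def using nz
    by (intro continuous_intros cp p' continuous_on_compose2[OF ck'] continuous_on_compose2[OF \<beta>_cont]) auto
  ultimately show ?thesis
    unfolding C1_on_def by (intro exI[of _ D] conjI ballI)
qed

end

subsection \<open>Integration preliminaries\<close>

lemma bounded_borel_absolutely_integrable:
  fixes f :: "real \<Rightarrow> 'a::euclidean_space"
  assumes "f \<in> borel_measurable borel" "\<And>t. t \<in> {a..b} \<Longrightarrow> norm (f t) \<le> B"
  shows "f absolutely_integrable_on {a..b}"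
proof (rule measurable_bounded_by_integrable_imp_absolutely_integrable[where g = "\<lambda>_. B"])
  show "f \<in> borel_measurable (lebesgue_on {a..b})"
    using assms(1) by (simp add: measurable_completion measurable_restrict_space1)
qed (use assms in auto)

lemma set_lebesgue_integral_superset:
  fixes f :: "real \<Rightarrow> 'a::euclidean_space"
  assumes "f absolutely_integrable_on J" "J \<subseteq> I" "\<And>x. x \<in> I - J \<Longrightarrow> f x = 0"
  shows "(LINT x:I|lebesgue. f x) = integral J f"
proof -
  have "(\<lambda>x. indicator I x *\<^sub>R f x) = (\<lambda>x. indicator J x *\<^sub>R f x)"
    using assms(2,3) by (auto simp: indicator_def fun_eq_iff)
  then have "(LINT x:I|lebesgue. f x) = (LINT x:J|lebesgue. f x)"
    by (simp add: set_lebesgue_integral_def)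
  then show ?thesis using set_lebesgue_integral_eq_integral(2)[OF assms(1)] by simp
qed

lemma continuous_times_absolutely_integrable:
  fixes h :: "'a::euclidean_space \<Rightarrow> 'b::euclidean_space \<Rightarrow> 'c::euclidean_space"
  assumes "bounded_bilinear h" "continuous_on {a..b::real} u" "g absolutely_integrable_on {a..b}"
  shows "(\<lambda>x. h (u x) (g x)) absolutely_integrable_on {a..b}"
proof (rule absolutely_integrable_bounded_measurable_product[where h = h and f = u and g = g])
  show "bilinear h" using assms(1) by (simp add: bilinear_conv_bounded_bilinear)
  show "u \<in> borel_measurable (lebesgue_on {a..b})"
    using assms(2) by (intro continuous_imp_measurable_on_sets_lebesgue) auto
  show "bounded (u ` {a..b})"
    using assms(2) by (intro compact_imp_bounded compact_continuous_image) auto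
qed (use assms in auto)

text \<open>The product rule holds since the increment of the product over \<open>[s,t]\<close> differs from the
  claimed integral by at most the oscillation of the factors times an additive interval function.\<close>

lemma integral_by_parts_indefinite:
  fixes h :: "'a::euclidean_space \<Rightarrow> 'b::euclidean_space \<Rightarrow> 'c::euclidean_space"
  assumes h: "bounded_bilinear h" and ab: "a \<le> b"
    and f: "f absolutely_integrable_on {a..b::real}" and g: "g absolutely_integrable_on {a..b}"
    and u: "\<And>t. t \<in> {a..b} \<Longrightarrow> u t = u a + integral {a..t} f"
    and v: "\<And>t. t \<in> {a..b} \<Longrightarrow> v t = v a + integral {a..t} g"
  shows "((\<lambda>t. h (u t) (g t) + h (f t) (v t)) has_integral h (u b) (v b) - h (u a) (v a)) {a..b}"
proof -
  interpret bounded_bilinear h by fact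
  obtain K where K: "K > 0" "\<And>x y. norm (h x y) \<le> norm x * norm y * K" using pos_bounded by blast
  have fi: "f integrable_on {a..b}" and gi: "g integrable_on {a..b}"
    using f g by (auto simp: set_lebesgue_integral_eq_integral)
  have "continuous_on {a..b} (\<lambda>t. u a + integral {a..t} f)"
    by (intro continuous_intros indefinite_integral_continuous_1 fi)
  then have cu: "continuous_on {a..b} u"
    by (rule continuous_on_eq) (rule u[symmetric])
  have "continuous_on {a..b} (\<lambda>t. v a + integral {a..t} g)"
    by (intro continuous_intros indefinite_integral_continuous_1 gi)
  then have cv: "continuous_on {a..b} v"
    by (rule continuous_on_eq) (rule v[symmetric])
  define H where "H = (\<lambda>t. h (u t) (g t) + h (f t) (v t))"
  define M where "M = (\<lambda>t. norm (f t) + norm (g t))"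
  have "(\<lambda>t. h (u t) (g t)) absolutely_integrable_on {a..b}"
    by (rule continuous_times_absolutely_integrable[OF h cu g])
  moreover have "(\<lambda>t. h (f t) (v t)) absolutely_integrable_on {a..b}"
    using continuous_times_absolutely_integrable[OF flip cv f] by simp
  ultimately have H: "H absolutely_integrable_on {a..b}"
    unfolding H_def by (rule set_integral_add)
  have M: "M absolutely_integrable_on {a..b}"
    unfolding M_def using absolutely_integrable_norm[OF f] absolutely_integrable_norm[OF g]
    by (auto simp: o_def intro: set_integral_add)
  have sub: "k integrable_on {s..t}" if "k absolutely_integrable_on {a..b}" "a \<le> s" "t \<le> b"
    for k :: "real \<Rightarrow> 'z::euclidean_space" and s t
    using that absolutely_integrable_on_subinterval[OF that(1), of s t] by (auto simp: set_lebesgue_integral_eq_integral)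
  have Hi: "H integrable_on {s..t}" and Mi: "M integrable_on {s..t}"
    and fi': "f integrable_on {s..t}" and gi': "g integrable_on {s..t}" if "a \<le> s" "t \<le> b" for s t
    using sub that H M f g by blast+
  have du: "u t - u s = integral {s..t} f" if "a \<le> s" "s \<le> t" "t \<le> b" for s t
    using u[of t] u[of s] that Henstock_Kurzweil_Integration.integral_combine[of a s t f] fi'[of a t] by (simp add: algebra_simps)
  have dv: "v t - v s = integral {s..t} g" if "a \<le> s" "s \<le> t" "t \<le> b" for s t
    using v[of t] v[of s] that Henstock_Kurzweil_Integration.integral_combine[of a s t g] gi'[of a t] by (simp add: algebra_simps)
  define Z where "Z s t = h (u t) (v t) - h (u s) (v s) - integral {s..t} H" for s t
  have Zadd: "Z s t = Z s r + Z r t" if "a \<le> s" "s \<le> r" "r \<le> t" "t \<le> b" for s r t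
    using Henstock_Kurzweil_Integration.integral_combine[of s r t H] Hi[of s t] that by (simp add: Z_def algebra_simps)
  have small: "norm (Z a b) \<le> K * e * integral {a..b} M" if e: "e > 0" for e
  proof -
    have "uniformly_continuous_on {a..b} u" "uniformly_continuous_on {a..b} v"
      using cu cv by (auto intro: compact_uniformly_continuous)
    then obtain d1 d2 where d: "d1 > 0" "d2 > 0"
      "\<And>s t. s \<in> {a..b} \<Longrightarrow> t \<in> {a..b} \<Longrightarrow> dist t s < d1 \<Longrightarrow> dist (u t) (u s) < e"
      "\<And>s t. s \<in> {a..b} \<Longrightarrow> t \<in> {a..b} \<Longrightarrow> dist t s < d2 \<Longrightarrow> dist (v t) (v s) < e"
      unfolding uniformly_continuous_on_def using e by metis
    \<comment> \<open>Bisection: the estimate is additive in the interval, so it passes from short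
      intervals, where u and v oscillate by less than e, to [a,b].\<close>
    define P where "P s t \<longleftrightarrow> (a \<le> s \<and> s \<le> t \<and> t \<le> b \<longrightarrow> norm (Z s t) \<le> K * e * integral {s..t} M)" for s t
    have "P a b"
    proof (rule Bolzano[OF ab])
      fix s r t assume "P s r" "P r t" and le: "s \<le> r" "r \<le> t"
      then show "P s t"
        unfolding P_def
      proof (intro impI, elim conjE)
        assume st: "a \<le> s" "s \<le> t" "t \<le> b"
          and 1: "a \<le> s \<and> s \<le> r \<and> r \<le> b \<longrightarrow> norm (Z s r) \<le> K * e * integral {s..r} M"
          and 2: "a \<le> r \<and> r \<le> t \<and> t \<le> b \<longrightarrow> norm (Z r t) \<le> K * e * integral {r..t} M"
        have "norm (Z s t) \<le> norm (Z s r) + norm (Z r t)"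
          using Zadd[of s r t] st le norm_triangle_ineq by metis
        also have "\<dots> \<le> K * e * (integral {s..r} M + integral {r..t} M)"
          using 1 2 st le by (simp add: distrib_left)
        also have "integral {s..r} M + integral {r..t} M = integral {s..t} M"
          using Henstock_Kurzweil_Integration.integral_combine[of s r t M] Mi[of s t] st le by simp
        finally show "norm (Z s t) \<le> K * e * integral {s..t} M" .
      qed
    next
      fix x assume "a \<le> x" "x \<le> b"
      show "\<exists>d>0. \<forall>s t. s \<le> x \<and> x \<le> t \<and> t - s < d \<longrightarrow> P s t"
      proof (intro exI[of _ "min d1 d2"] conjI allI impI)
        fix s t assume st: "s \<le> x \<and> x \<le> t \<and> t - s < min d1 d2"
        show "P s t" unfolding P_def
        proof (intro impI, elim conjE)
          assume ab': "a \<le> s" "s \<le> t" "t \<le> b"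
          have I1: "(\<lambda>r. h (u t) (g r)) integrable_on {s..t}" "integral {s..t} (\<lambda>r. h (u t) (g r)) = h (u t) (v t - v s)"
            using integrable_linear[OF gi' bounded_linear_right, of s t] integral_linear[OF gi' bounded_linear_right, of s t] dv ab'
            by (auto simp: o_def)
          have I2: "(\<lambda>r. h (f r) (v s)) integrable_on {s..t}" "integral {s..t} (\<lambda>r. h (f r) (v s)) = h (u t - u s) (v s)"
            using integrable_linear[OF fi' bounded_linear_left, of s t] integral_linear[OF fi' bounded_linear_left, of s t] du ab'
            by (auto simp: o_def)
          have "Z s t = integral {s..t} (\<lambda>r. h (u t) (g r)) + integral {s..t} (\<lambda>r. h (f r) (v s)) - integral {s..t} H"
            by (simp add: Z_def I1 I2 diff_left diff_right)
          also have "\<dots> = integral {s..t} (\<lambda>r. h (u t) (g r) + h (f r) (v s) - H r)"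
            using I1(1) I2(1) Hi[of s t] ab' by (simp add: integral_add integral_diff integrable_add)
          finally have Z: "Z s t = integral {s..t} (\<lambda>r. h (u t) (g r) + h (f r) (v s) - H r)" .
          have "norm (Z s t) \<le> integral {s..t} (\<lambda>r. K * e * M r)"
            unfolding Z
          proof (rule integral_norm_bound_integral)
            show "(\<lambda>r. h (u t) (g r) + h (f r) (v s) - H r) integrable_on {s..t}"
              using I1(1) I2(1) Hi[of s t] ab' by (intro integrable_diff integrable_add)
            show "(\<lambda>r. K * e * M r) integrable_on {s..t}"
              using integrable_cmul[OF Mi[of s t], of "K * e"] ab' by simp
            fix r assume r: "r \<in> {s..t}"
            have "h (u t) (g r) + h (f r) (v s) - H r = h (u t - u r) (g r) + h (f r) (v s - v r)"
              by (simp add: H_def diff_left diff_right)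
            also have "norm \<dots> \<le> norm (u t - u r) * norm (g r) * K + norm (f r) * norm (v s - v r) * K"
              using K(2) by (meson add_mono norm_triangle_le)
            also have "\<dots> \<le> e * norm (g r) * K + norm (f r) * e * K"
              using d(3)[of r t] d(4)[of r s] r ab' st K(1)
              by (intro add_mono mult_right_mono mult_left_mono) (auto simp: dist_norm)
            also have "\<dots> = K * e * M r" by (simp add: M_def algebra_simps)
            finally show "norm (h (u t) (g r) + h (f r) (v s) - H r) \<le> K * e * M r" .
          qed
          then show "norm (Z s t) \<le> K * e * integral {s..t} M" by simp
        qed
      qed (use d in auto)
    qed
    then show ?thesis using ab by (simp add: P_def)
  qed
  have "integral {a..b} M \<ge> 0"
    using Mi[of a b] by (intro Henstock_Kurzweil_Integration.integral_nonneg) (auto simp: M_def)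
  have "norm (Z a b) \<le> 0 + e" if "e > 0" for e
  proof -
    define e' where "e' = e / (K * (integral {a..b} M + 1))"
    have "e' > 0" using that K \<open>integral {a..b} M \<ge> 0\<close> by (simp add: e'_def)
    have "norm (Z a b) \<le> K * e' * integral {a..b} M" by (rule small[OF \<open>e' > 0\<close>])
    also have "\<dots> \<le> K * e' * (integral {a..b} M + 1)" using \<open>e' > 0\<close> K by (intro mult_left_mono) auto
    also have "\<dots> = e" using K \<open>integral {a..b} M \<ge> 0\<close> by (simp add: e'_def)
    finally show ?thesis by simp
  qed
  then have "Z a b = 0" using field_le_epsilon[of "norm (Z a b)" 0] by simp
  then show ?thesis
    using Hi[of a b] by (simp add: Z_def H_def[symmetric] has_integral_iff)
qed

text \<open>Half lines are an intersection-stable generator of the Borel sets, so the integral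
  vanishes over every Borel set by Dynkin induction.\<close>

lemma zero_integrals_imp_AE_zero:
  fixes f :: "real \<Rightarrow> 'a::euclidean_space"
  assumes f: "integrable lborel f" and z: "\<And>x. (LINT t:{..x}|lborel. f t) = 0"
  shows "AE t in lborel. f t = 0"
proof (rule sigma_finite_measure.density_zero[OF sigma_finite_lborel f])
  fix A :: "real set" assume "A \<in> sets lborel"
  then have A: "A \<in> sigma_sets UNIV (range (\<lambda>x::real. {..x}))"
    by (simp add: borel_eq_atMost)
  have sm: "B \<in> sets lborel" if "B \<in> sigma_sets UNIV (range (\<lambda>x::real. {..x}))" for B
    using that by (simp add: borel_eq_atMost)
  have si: "set_integrable lborel B f" if "B \<in> sets lborel" for B
    unfolding set_integrable_def using f that by (intro integrable_mult_indicator) auto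
  \<comment> \<open>Complements in the induction require the total integral, obtained as the limit
    over the half lines up to n.\<close>
  have tot: "(LINT t|lborel. f t) = 0"
  proof -
    have "(\<lambda>n. LINT t:{..real n}|lborel. f t) \<longlonglongrightarrow> (LINT t:(\<Union>n. {..real n})|lborel. f t)"
      by (rule set_integral_cont_up) (auto simp: incseq_def intro!: si)
    moreover have "(\<Union>n. {..real n}) = UNIV" by (auto intro: real_arch_simple)
    ultimately show ?thesis using z
      by (simp add: set_lebesgue_integral_def LIMSEQ_const_iff)
  qed
  have "Int_stable (range (\<lambda>x::real. {..x}))" "range (\<lambda>x::real. {..x}) \<subseteq> Pow UNIV"
    by (auto simp: Int_stable_def)
  from this A show "(LINT t:A|lborel. f t) = 0"
  proof (induction rule: sigma_sets_induct_disjoint)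
    case (basic B)
    then show ?case using z by auto
  next
    case empty
    then show ?case by (simp add: set_lebesgue_integral_def)
  next
    case (compl B)
    have "(LINT t|lborel. f t) = (LINT t:B \<union> (UNIV - B)|lborel. f t)"
      by (simp add: set_lebesgue_integral_def)
    also have "\<dots> = (LINT t:B|lborel. f t) + (LINT t:UNIV - B|lborel. f t)"
      using sm[OF compl(1)] by (intro set_integral_Un si) auto
    finally show ?case using compl tot by simp
  next
    case (union B)
    have "(LINT t:(\<Union>i. B i)|lborel. f t) = (\<Sum>i. (LINT t:B i|lborel. f t))"
    proof (rule lebesgue_integral_countable_add)
      show "B i \<in> sets lborel" for i using union(2) by (intro sm) auto
      then show "set_integrable lborel (\<Union>i. B i) f" by (intro si) auto
      show "B i \<inter> B j = {}" if "i \<noteq> j" for i j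
        using union(1) that by (auto simp: disjoint_family_on_def)
    qed
    then show ?case using union by simp
  qed
qed

subsection \<open>Smooth cut-off functions\<close>

text \<open>k-fold differentiability with explicit derivatives. For all k together this is
  smoothness, and the recursion lets closure properties be proved by induction without computing
  iterates of \<open>vderiv\<close>.\<close>

primrec Ck :: "nat \<Rightarrow> (real \<Rightarrow> 'a::real_normed_vector) \<Rightarrow> bool" where
  "Ck 0 f = True"
| "Ck (Suc k) f = (\<exists>f'. (\<forall>x. (f has_vector_derivative f' x) (at x)) \<and> Ck k f')"

lemma Ck_SucD: "Ck (Suc k) f \<Longrightarrow> Ck k f"
  by (induction k arbitrary: f) auto

lemma Ck_vderiv:
  assumes "Ck (Suc k) f"
  shows "Ck k (vderiv f)" "f differentiable_on UNIV"
proof -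
  obtain f' where f': "\<forall>x. (f has_vector_derivative f' x) (at x)" "Ck k f'" using assms by auto
  then have "vderiv f = f'" using vector_derivative_at by blast
  then show "Ck k (vderiv f)" using f' by simp
  show "f differentiable_on UNIV"
    using f'(1) unfolding differentiable_on_def
    by (meson differentiableI_vector has_vector_derivative_at_within)
qed

lemma Ck_vderiv_funpow: "(\<And>k. Ck k f) \<Longrightarrow> Ck k ((vderiv ^^ n) f)"
  by (induction n arbitrary: k) (auto intro: Ck_vderiv)

lemma test_functionI:
  assumes "\<And>k. Ck k f" "\<And>x. x \<notin> {a..b} \<Longrightarrow> f x = 0" "{a..b} \<subseteq> U"
  shows "test_function U f"
proof -
  have sub: "closure {t. f t \<noteq> 0} \<subseteq> {a..b}"
    using assms(2) by (intro closure_minimal) (auto, force+)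
  have "compact (closure {t. f t \<noteq> 0})"
    using sub by (metis bounded_closed_interval bounded_subset closed_closure compact_eq_bounded_closed)
  then show ?thesis
    unfolding test_function_def using sub assms(3) Ck_vderiv(2)[OF Ck_vderiv_funpow[OF assms(1)]] by auto
qed

lemma Ck_add: "Ck k f \<Longrightarrow> Ck k g \<Longrightarrow> Ck k (\<lambda>x. f x + g x)"
proof (induction k arbitrary: f g)
  case (Suc k)
  obtain f' where f': "\<forall>x. (f has_vector_derivative f' x) (at x)" "Ck k f'" using Suc.prems by auto
  obtain g' where g': "\<forall>x. (g has_vector_derivative g' x) (at x)" "Ck k g'" using Suc.prems by auto
  show ?case unfolding Ck.simps
    using f' g' Suc.IH by (intro exI[of _ "\<lambda>x. f' x + g' x"]) (auto intro: has_vector_derivative_add)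
qed simp

lemma Ck_diff: "Ck k f \<Longrightarrow> Ck k g \<Longrightarrow> Ck k (\<lambda>x. f x - g x)"
proof (induction k arbitrary: f g)
  case (Suc k)
  obtain f' where f': "\<forall>x. (f has_vector_derivative f' x) (at x)" "Ck k f'" using Suc.prems by auto
  obtain g' where g': "\<forall>x. (g has_vector_derivative g' x) (at x)" "Ck k g'" using Suc.prems by auto
  show ?case unfolding Ck.simps
    using f' g' Suc.IH by (intro exI[of _ "\<lambda>x. f' x - g' x"]) (auto intro: has_vector_derivative_diff)
qed simp

lemma Ck_cmult: "Ck k f \<Longrightarrow> Ck k (\<lambda>x. c * f x :: real)"
proof (induction k arbitrary: f)
  case (Suc k)
  then obtain f' where f': "\<forall>x. (f has_vector_derivative f' x) (at x)" "Ck k f'" by auto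
  show ?case unfolding Ck.simps using f' Suc.IH[OF f'(2)]
    by (intro exI[of _ "\<lambda>x. c * f' x"]) (auto intro: has_vector_derivative_mult_right)
qed simp

lemma Ck_mult: "Ck k f \<Longrightarrow> Ck k g \<Longrightarrow> Ck k (\<lambda>x. f x * g x :: real)"
proof (induction k arbitrary: f g)
  case (Suc k)
  obtain f' where f': "\<forall>x. (f has_vector_derivative f' x) (at x)" "Ck k f'" using Suc.prems by auto
  obtain g' where g': "\<forall>x. (g has_vector_derivative g' x) (at x)" "Ck k g'" using Suc.prems by auto
  have "((\<lambda>x. f x * g x) has_vector_derivative f x * g' x + f' x * g x) (at x)" for x
    using has_vector_derivative_mult[OF f'(1)[rule_format] g'(1)[rule_format]] .
  moreover have "Ck k (\<lambda>x. f x * g' x + f' x * g x)"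
    by (rule Ck_add[OF Suc.IH[OF Ck_SucD[OF Suc.prems(1)] g'(2)] Suc.IH[OF f'(2) Ck_SucD[OF Suc.prems(2)]]])
  ultimately show ?case unfolding Ck.simps by (intro exI[of _ "\<lambda>x. f x * g' x + f' x * g x"]) auto
qed simp

lemma Ck_affine: "Ck k f \<Longrightarrow> Ck k (\<lambda>x. f (c * x + d) :: real)"
proof (induction k arbitrary: f)
  case (Suc k)
  obtain f' where f': "\<And>x. (f has_vector_derivative f' x) (at x)" "Ck k f'" using Suc.prems by auto
  have "((\<lambda>x. f (c * x + d)) has_vector_derivative c * f' (c * x + d)) (at x)" for x
  proof -
    have "((\<lambda>x. c * x + d) has_real_derivative c) (at x)" by (auto intro!: derivative_eq_intros)
    from DERIV_chain2[OF f'(1)[unfolded has_real_derivative_iff_has_vector_derivative[symmetric]] this]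
    show ?thesis by (simp add: has_real_derivative_iff_has_vector_derivative[symmetric] mult.commute)
  qed
  moreover have "Ck k (\<lambda>x. c * f' (c * x + d))" using Suc.IH[OF f'(2)] by (rule Ck_cmult)
  ultimately show ?case unfolding Ck.simps by (intro exI[of _ "\<lambda>x. c * f' (c * x + d)"]) auto
qed simp

text \<open>The functions P(1/x) exp(-1/x), continued by 0: a class closed under differentiation, so
  that the smoothness of exp(-1/x) becomes an induction over all P.\<close>

definition flat :: "real poly \<Rightarrow> real \<Rightarrow> real" where
  "flat P x = (if x > 0 then poly P (1 / x) * exp (- (1 / x)) else 0)"

lemma flat_tendsto_0: "(flat P \<longlongrightarrow> 0) (at 0)"
proof (rule filterlim_split_at)
  show "(flat P \<longlongrightarrow> 0) (at_left 0)"
    by (rule tendsto_eventually) (auto simp: flat_def eventually_at_filter)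
  \<comment> \<open>In the variable y = 1/x: the exponential beats each monomial.\<close>
  have "((\<lambda>y. \<Sum>i\<le>degree P. coeff P i * (y ^ i / exp y)) \<longlongrightarrow> (\<Sum>i\<le>degree P. coeff P i * 0)) at_top"
    by (intro tendsto_intros tendsto_power_div_exp_0)
  then have "((\<lambda>y. poly P y * exp (- y)) \<longlongrightarrow> 0) at_top"
    by (simp add: poly_altdef exp_minus divide_inverse sum_distrib_right mult.assoc)
  from filterlim_compose[OF this filterlim_inverse_at_top_right]
  have "((\<lambda>x. poly P (1 / x) * exp (- (1 / x))) \<longlongrightarrow> 0) (at_right 0)"
    by (simp add: divide_inverse)
  then show "(flat P \<longlongrightarrow> 0) (at_right 0)"
    by (rule Lim_transform_eventually) (auto simp: flat_def eventually_at_filter)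
qed

lemma flat_deriv:
  "(flat P has_real_derivative flat ([:0, 0, 1:] * (P - pderiv P)) x) (at x)"
proof (rule linorder_cases[of x 0])
  assume "x > 0"
  have "((\<lambda>x. poly P (1 / x) * exp (- (1 / x))) has_real_derivative
      flat ([:0, 0, 1:] * (P - pderiv P)) x) (at x)"
    using \<open>x > 0\<close>
    by (auto intro!: derivative_eq_intros poly_DERIV[THEN DERIV_chain2] simp: flat_def field_simps power2_eq_square)
  then show ?thesis
    by (rule has_field_derivative_transform_within_open[of _ _ _ "{0<..}"]) (use \<open>x > 0\<close> in \<open>auto simp: flat_def\<close>)
next
  assume "x < 0"
  have "((\<lambda>x. 0) has_real_derivative flat ([:0, 0, 1:] * (P - pderiv P)) x) (at x)"
    using \<open>x < 0\<close> by (auto simp: flat_def)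
  then show ?thesis
    by (rule has_field_derivative_transform_within_open[of _ _ _ "{..<0}"]) (use \<open>x < 0\<close> in \<open>auto simp: flat_def\<close>)
next
  assume "x = 0"
  \<comment> \<open>Dividing by h multiplies P by the variable, so the difference quotient at 0
    belongs to the same class and tends to 0.\<close>
  have "(\<lambda>h. (flat P (0 + h) - flat P 0) / h) = flat (pCons 0 P)"
    by (auto simp: flat_def field_simps)
  moreover have "flat Q 0 = 0" for Q by (simp add: flat_def)
  ultimately show ?thesis
    using flat_tendsto_0[of "pCons 0 P"] unfolding DERIV_def \<open>x = 0\<close> by simp
qed

lemma Ck_flat: "Ck k (flat P)"
  by (induction k arbitrary: P)
    (auto intro!: exI flat_deriv[unfolded has_real_derivative_iff_has_vector_derivative])

definition bump :: "real \<Rightarrow> real" where "bump x = flat 1 x * flat 1 (1 - x)"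

lemma Ck_bump: "Ck k bump"
  using Ck_mult[OF Ck_flat Ck_affine[OF Ck_flat, where c = "-1" and d = 1], of k 1 1]
  by (simp add: bump_def[abs_def])

lemma bump_nonneg: "bump x \<ge> 0" by (simp add: bump_def flat_def)

lemma bump_zero: "x \<le> 0 \<or> x \<ge> 1 \<Longrightarrow> bump x = 0" by (auto simp: bump_def flat_def)

lemma bump_cont: "continuous_on A bump"
proof -
  obtain b' where "\<forall>x. (bump has_vector_derivative b' x) (at x)" using Ck_bump[of 1] by auto
  then show ?thesis by (intro continuous_at_imp_continuous_on ballI has_vector_derivative_continuous) auto
qed

lemma bump_integral_pos: "integral {0..1} bump > 0"
proof -
  have "integral {0..1} bump \<noteq> 0"
  proof
    assume "integral {0..1} bump = 0"
    then have "(bump has_integral 0) (cbox 0 1)"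
      using integrable_integral[OF integrable_continuous_real[OF bump_cont], of 0 1] by simp
    then have "bump (1/2) = 0"
      by (intro has_integral_0_cbox_imp_0[of 0 1 bump]) (auto intro: bump_cont bump_nonneg)
    then show False by (simp add: bump_def flat_def)
  qed
  moreover have "integral {0..1} bump \<ge> 0"
    by (intro Henstock_Kurzweil_Integration.integral_nonneg integrable_continuous_real bump_cont bump_nonneg)
  ultimately show ?thesis by simp
qed

text \<open>For negative x the interval is empty and the integral 0, which is the intended value
  since \<open>bump\<close> lives on [0,1].\<close>

definition smooth_step :: "real \<Rightarrow> real" where
  "smooth_step x = integral {0..x} bump / integral {0..1} bump"

lemma smooth_step_deriv: "(smooth_step has_real_derivative bump x / integral {0..1} bump) (at x)"
proof -
  \<comment> \<open>A base point left of both x and 0, so that one indefinite integral describes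
    \<open>smooth_step\<close> near x, on whichever side of 0 x lies.\<close>
  define a where "a = min x 0 - 1"
  have xa: "a < x" by (simp add: a_def)
  have bi: "bump integrable_on {s..t}" for s t by (intro integrable_continuous_real bump_cont)
  have eq[simp]: "integral {a..y} bump = integral {0..y} bump" if "y > a" for y
  proof (cases "y \<ge> 0")
    case True
    have "integral {a..0} bump = integral {a..0} (\<lambda>_. 0)" by (rule integral_cong) (simp add: bump_zero)
    then show ?thesis
      using Henstock_Kurzweil_Integration.integral_combine[of a 0 y bump] True bi[of a y] by (simp add: a_def)
  next
    case False
    have "integral {a..y} bump = integral {a..y} (\<lambda>_. 0)" using False by (intro integral_cong) (simp add: bump_zero)
    then show ?thesis using False by simp
  qed
  have "((\<lambda>y. integral {a..y} bump) has_real_derivative bump x) (at x within {a..x + 1})"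
    by (intro integral_has_real_derivative bump_cont) (auto simp: a_def)
  then have "((\<lambda>y. integral {a..y} bump) has_real_derivative bump x) (at x)"
    using at_within_Icc_at[of a x "x + 1"] by (simp add: a_def)
  then have "((\<lambda>y. integral {0..y} bump) has_real_derivative bump x) (at x)"
    by (rule has_field_derivative_transform_within_open[of _ _ _ "{a<..}"]) (simp_all add: xa)
  then show ?thesis unfolding smooth_step_def by (rule DERIV_cdivide)
qed

lemma Ck_smooth_step: "Ck k smooth_step"
proof (cases k)
  case (Suc j)
  have "Ck j (\<lambda>x. bump x / integral {0..1} bump)"
    using Ck_cmult[OF Ck_bump, of j "inverse (integral {0..1} bump)"] by (simp add: divide_inverse mult.commute)
  then show ?thesis
    unfolding Suc Ck.simps using smooth_step_deriv[unfolded has_real_derivative_iff_has_vector_derivative]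
    by (intro exI[of _ "\<lambda>x. bump x / integral {0..1} bump"]) auto
qed simp

lemma smooth_step_mono: "x \<le> y \<Longrightarrow> smooth_step x \<le> smooth_step y"
  by (rule DERIV_nonneg_imp_nondecreasing)
    (use smooth_step_deriv bump_nonneg bump_integral_pos in \<open>auto intro!: exI divide_nonneg_pos\<close>)

lemma smooth_step_0: "x \<le> 0 \<Longrightarrow> smooth_step x = 0"
  by (cases "x = 0") (auto simp: smooth_step_def)

lemma smooth_step_1: assumes "x \<ge> 1" shows "smooth_step x = 1"
proof -
  have "integral {1..x} bump = integral {1..x} (\<lambda>_. 0)" by (rule integral_cong) (simp add: bump_zero)
  moreover have "bump integrable_on {0..x}" by (intro integrable_continuous_real bump_cont)
  ultimately show ?thesis
    using Henstock_Kurzweil_Integration.integral_combine[of 0 1 x bump] assms bump_integral_pos by (simp add: smooth_step_def)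
qed

lemma smooth_step_bounds: "0 \<le> smooth_step x" "smooth_step x \<le> 1"
  using smooth_step_mono[of "min x 0" x] smooth_step_mono[of x "max x 1"] by (auto simp: smooth_step_0 smooth_step_1)

subsection \<open>Weak derivatives of continuous functions\<close>

text \<open>The working notion of weak derivative: q is an indefinite integral of g. Fixing a Borel
  g instead of a class modulo null sets keeps gluing, shifting and reflecting within plain
  functions.\<close>

definition primitive :: "(real \<Rightarrow> 'a::euclidean_space) \<Rightarrow> (real \<Rightarrow> 'a) \<Rightarrow> bool" where
  "primitive q g \<longleftrightarrow> g \<in> borel_measurable borel \<and>
     (\<forall>s t. s \<le> t \<longrightarrow> g absolutely_integrable_on {s..t} \<and> integral {s..t} g = q t - q s)"

lemma primitiveD:
  assumes "primitive q g"
  shows "g \<in> borel_measurable borel" "g absolutely_integrable_on {s..t}" "g integrable_on {s..t}"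
    "s \<le> t \<Longrightarrow> integral {s..t} g = q t - q s"
proof -
  show "g \<in> borel_measurable borel" "s \<le> t \<Longrightarrow> integral {s..t} g = q t - q s"
    using assms by (auto simp: primitive_def)
  show "g absolutely_integrable_on {s..t}"
    using assms by (cases "s \<le> t") (auto simp: primitive_def)
  then show "g integrable_on {s..t}" by (rule set_lebesgue_integral_eq_integral)
qed

lemma primitive_cont:
  assumes "primitive q g" shows "continuous_on UNIV q"
proof (rule continuous_at_imp_continuous_on, rule ballI)
  fix x :: real
  have "continuous_on {x - 1..x + 1} (\<lambda>t. q (x - 1) + integral {x - 1..t} g)"
    by (intro continuous_intros indefinite_integral_continuous_1 primitiveD(3)[OF assms])
  then have "continuous_on {x - 1..x + 1} q"
    by (rule continuous_on_eq) (use primitiveD(4)[OF assms] in auto)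
  then show "isCont q x"
    by (rule continuous_on_interior) simp
qed

lemma L1_locI:
  fixes g :: "real \<Rightarrow> 'a::euclidean_space"
  assumes "\<And>s t. g absolutely_integrable_on {s..t}"
  shows "g \<in> L1_loc I"
  unfolding L1_loc_def
proof (intro CollectI allI impI, elim conjE)
  fix K :: "real set" assume K: "compact K"
  then obtain a where "K \<subseteq> {-a..a}"
    by (metis bounded_subset_cbox_symmetric cbox_interval compact_imp_bounded)
  moreover have "K \<in> sets lebesgue"
    using K by (simp add: borel_compact)
  ultimately show "set_integrable lebesgue K g"
    using set_integrable_subset[OF assms] by blast
qed

lemma AE_lebesgue_negligible:
  assumes "AE x in lebesgue. P (x::'a::euclidean_space)"
  obtains N where "negligible N" "\<And>x. x \<notin> N \<Longrightarrow> P x"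
  using AE_E3[OF assms] negligible_iff_null_sets by (metis DiffI UNIV_I space_completion space_lborel space_borel)

text \<open>A mollifier of mass 1 supported to the right of r, in [r, r + e]; it is the derivative
  of \<open>ramp\<close>.\<close>

definition kern :: "real \<Rightarrow> real \<Rightarrow> real \<Rightarrow> real" where
  "kern e r x = bump ((x - r) / e) / (integral {0..1} bump * e)"

definition ramp :: "real \<Rightarrow> real \<Rightarrow> real \<Rightarrow> real" where
  "ramp e r x = smooth_step ((x - r) / e)"

lemma ramp_deriv: assumes "e > 0" shows "(ramp e r has_vector_derivative kern e r x) (at x)"
proof -
  have "((\<lambda>x. (x - r) / e) has_real_derivative 1 / e) (at x)"
    using assms by (auto intro!: derivative_eq_intros)
  from DERIV_chain2[OF smooth_step_deriv this] show ?thesis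
    unfolding ramp_def[abs_def] kern_def has_real_derivative_iff_has_vector_derivative[symmetric] by simp
qed

lemma Ck_ramp: "Ck k (ramp e r)"
  using Ck_affine[OF Ck_smooth_step, of k "1 / e" "- r / e"]
  by (simp add: ramp_def[abs_def] diff_divide_distrib)

lemma kern_cont: "e > 0 \<Longrightarrow> continuous_on A (kern e r)"
  unfolding kern_def[abs_def] using bump_integral_pos
  by (intro continuous_intros continuous_on_compose2[OF bump_cont[of UNIV]]) auto

lemma kern_nonneg: "e > 0 \<Longrightarrow> kern e r x \<ge> 0"
  unfolding kern_def using bump_integral_pos bump_nonneg by (intro divide_nonneg_nonneg) auto

lemma kern_zero: "e > 0 \<Longrightarrow> x \<notin> {r..r + e} \<Longrightarrow> kern e r x = 0"
  unfolding kern_def by (subst bump_zero) (auto simp: field_simps)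

lemma ramp_0: "e > 0 \<Longrightarrow> x \<le> r \<Longrightarrow> ramp e r x = 0"
  unfolding ramp_def by (rule smooth_step_0) (auto simp: field_simps)

lemma ramp_1: "e > 0 \<Longrightarrow> r + e \<le> x \<Longrightarrow> ramp e r x = 1"
  unfolding ramp_def by (rule smooth_step_1) (auto simp: field_simps)

lemma kern_has_integral: assumes "e > 0" shows "(kern e r has_integral 1) {r..r + e}"
proof -
  have "(kern e r has_integral (ramp e r (r + e) - ramp e r r)) {r..r + e}"
    using assms by (intro fundamental_theorem_of_calculus)
      (auto intro: has_vector_derivative_at_within[OF ramp_deriv])
  then show ?thesis using assms by (simp add: ramp_0 ramp_1)
qed

lemma kern_average:
  fixes q :: "real \<Rightarrow> 'a::euclidean_space"
  assumes q: "continuous_on UNIV q" and d: "d > 0"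
  shows "(\<lambda>n. integral {r..r + d / Suc n} (\<lambda>x. kern (d / Suc n) r x *\<^sub>R q x)) \<longlonglongrightarrow> q r"
proof (rule metric_LIMSEQ_I)
  fix \<epsilon> :: real assume "\<epsilon> > 0"
  have "isCont q r" using q continuous_on_eq_continuous_at[of UNIV q] by auto
  then obtain \<delta> where \<delta>: "\<delta> > 0" "\<And>x. dist x r < \<delta> \<Longrightarrow> dist (q x) (q r) < \<epsilon> / 2"
    unfolding continuous_at_eps_delta using \<open>\<epsilon> > 0\<close> by (metis half_gt_zero)
  have "(\<lambda>n. d / real (Suc n)) \<longlonglongrightarrow> 0" by (rule LIMSEQ_Suc[OF lim_const_over_n])
  then have "\<forall>\<^sub>F n in sequentially. d / real (Suc n) < \<delta>"
    using \<delta>(1) by (rule order_tendstoD)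
  then obtain n0 where n0: "\<And>n. n \<ge> n0 \<Longrightarrow> d / real (Suc n) < \<delta>"
    by (auto simp: eventually_sequentially)
  show "\<exists>n0. \<forall>n\<ge>n0. dist (integral {r..r + d / Suc n} (\<lambda>x. kern (d / Suc n) r x *\<^sub>R q x)) (q r) < \<epsilon>"
  proof (intro exI allI impI)
    fix n assume "n \<ge> n0"
    define e where "e = d / real (Suc n)"
    have e: "e > 0" "e < \<delta>" using n0[OF \<open>n \<ge> n0\<close>] d by (auto simp: e_def)
    have i1: "(\<lambda>x. kern e r x *\<^sub>R q x) integrable_on {r..r + e}"
      using e by (intro integrable_continuous_real continuous_intros kern_cont continuous_on_subset[OF q]) auto
    have i2: "((\<lambda>x. kern e r x *\<^sub>R q r) has_integral 1 *\<^sub>R q r) {r..r + e}"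
      by (rule has_integral_scaleR_left[OF kern_has_integral[OF e(1)]])
    have "norm (integral {r..r + e} (\<lambda>x. kern e r x *\<^sub>R q x) - q r)
        = norm (integral {r..r + e} (\<lambda>x. kern e r x *\<^sub>R q x - kern e r x *\<^sub>R q r))"
      using i1 i2 by (simp add: integral_diff has_integral_iff)
    also have "\<dots> \<le> integral {r..r + e} (\<lambda>x. kern e r x * (\<epsilon> / 2))"
    proof (rule integral_norm_bound_integral)
      show "(\<lambda>x. kern e r x *\<^sub>R q x - kern e r x *\<^sub>R q r) integrable_on {r..r + e}"
        using i1 i2 by (auto intro!: integrable_diff simp: has_integral_iff)
      show "(\<lambda>x. kern e r x * (\<epsilon> / 2)) integrable_on {r..r + e}"
        using has_integral_mult_left[OF kern_has_integral[OF e(1), of r]] by blast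
      fix x assume x: "x \<in> {r..r + e}"
      have "norm (kern e r x *\<^sub>R q x - kern e r x *\<^sub>R q r) = kern e r x * dist (q x) (q r)"
        using kern_nonneg[OF e(1), of r x] by (simp add: dist_norm scaleR_diff_right[symmetric])
      also have "\<dots> \<le> kern e r x * (\<epsilon> / 2)"
        using \<delta>(2)[of x] x e kern_nonneg[OF e(1), of r x] by (intro mult_left_mono) (auto simp: dist_real_def)
      finally show "norm (kern e r x *\<^sub>R q x - kern e r x *\<^sub>R q r) \<le> kern e r x * (\<epsilon> / 2)" .
    qed
    also have "\<dots> = \<epsilon> / 2"
      using has_integral_mult_left[OF kern_has_integral[OF e(1), of r], of "\<epsilon> / 2"] by (simp add: has_integral_iff)
    also have "\<dots> < \<epsilon>" using \<open>\<epsilon> > 0\<close> by simp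
    finally show "dist (integral {r..r + d / Suc n} (\<lambda>x. kern (d / Suc n) r x *\<^sub>R q x)) (q r) < \<epsilon>"
      by (simp add: dist_norm e_def)
  qed
qed

lemma ramp_tendsto:
  assumes "d > 0"
  shows "(\<lambda>n. ramp (d / Suc n) r x) \<longlonglongrightarrow> (if x \<le> r then 0 else 1)"
proof (cases "x \<le> r")
  case True
  then show ?thesis using assms by (simp add: ramp_0)
next
  case False
  have "(\<lambda>n. d / real (Suc n)) \<longlonglongrightarrow> 0" by (rule LIMSEQ_Suc[OF lim_const_over_n])
  then have "\<forall>\<^sub>F n in sequentially. d / real (Suc n) < x - r"
    using False by (intro order_tendstoD) auto
  then have "\<forall>\<^sub>F n in sequentially. ramp (d / Suc n) r x = 1"
    by eventually_elim (use assms in \<open>auto intro: ramp_1\<close>)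
  then show ?thesis using False by (simp add: tendsto_eventually)
qed

text \<open>The ramp at s minus the ramp at t tends to the indicator of (s,t], while its derivative
  is a difference of mollifiers that average q at s and at t. So the weak formulation becomes the
  fundamental theorem. As ramps rise to the right of their base point, a margin d beyond t is
  required.\<close>

lemma weak_deriv_imp_integral:
  fixes q :: "real \<Rightarrow> 'a::euclidean_space"
  assumes w: "has_weak_deriv I q g" and q: "continuous_on UNIV q"
    and st: "s < t" and d: "d > 0" and I: "{s..t + d} \<subseteq> interior I"
  shows "g absolutely_integrable_on {s..t}" "integral {s..t} g = q t - q s"
proof -
  have II: "{s..t + d} \<subseteq> I" using I interior_subset by blast
  have g: "g absolutely_integrable_on {s..t + d}"
    using w II by (auto simp: has_weak_deriv_def L1_loc_def)
  then show "g absolutely_integrable_on {s..t}"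
    using d by (intro absolutely_integrable_on_subinterval[OF g]) auto
  define e where "e n = d / real (Suc n)" for n
  have e: "e n > 0" "e n \<le> d" for n
    using d by (auto simp: e_def field_simps)
  define \<psi> where "\<psi> n x = ramp (e n) s x - ramp (e n) t x" for n x
  have \<psi>0: "\<psi> n x = 0" if "x \<notin> {s..t + d}" for n x
    using that st e[of n] by (cases "x < s") (auto simp: \<psi>_def ramp_0 ramp_1)
  have tf: "test_function (interior I) (\<psi> n)" for n
    unfolding \<psi>_def[abs_def]
    by (rule test_functionI[OF Ck_diff[OF Ck_ramp Ck_ramp] _ I]) (use \<psi>0 in \<open>auto simp: \<psi>_def\<close>)
  have dpsi: "(\<psi> n has_vector_derivative kern (e n) s x - kern (e n) t x) (at x)" for n x
    unfolding \<psi>_def[abs_def] using e by (intro has_vector_derivative_diff ramp_deriv)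
  have vd: "vderiv (\<psi> n) x = kern (e n) s x - kern (e n) t x" for n x
    by (rule vector_derivative_at[OF dpsi])
  have \<psi>c: "continuous_on A (\<psi> n)" for n A
    using dpsi by (meson continuous_at_imp_continuous_on has_vector_derivative_continuous)
  have \<psi>b: "\<bar>\<psi> n x\<bar> \<le> 1" for n x
    using smooth_step_bounds[of "(x - s) / e n"] smooth_step_bounds[of "(x - t) / e n"]
    by (auto simp: \<psi>_def ramp_def)
  have R: "(LINT x:I|lebesgue. \<psi> n x *\<^sub>R g x) = integral {s..t + d} (\<lambda>x. \<psi> n x *\<^sub>R g x)" for n
    using \<psi>0 by (intro set_lebesgue_integral_superset[OF _ II]
        continuous_times_absolutely_integrable[OF bounded_bilinear_scaleR \<psi>c g]) auto
  have L: "(LINT x:I|lebesgue. vderiv (\<psi> n) x *\<^sub>R q x)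
      = integral {s..s + e n} (\<lambda>x. kern (e n) s x *\<^sub>R q x) - integral {t..t + e n} (\<lambda>x. kern (e n) t x *\<^sub>R q x)" for n
  proof -
    have kc: "continuous_on A (\<lambda>x. kern (e n) r x *\<^sub>R q x)" for A r
      by (intro continuous_intros kern_cont e continuous_on_subset[OF q]) auto
    have *: "integral {s..t + d} (\<lambda>x. kern (e n) r x *\<^sub>R q x) = integral {r..r + e n} (\<lambda>x. kern (e n) r x *\<^sub>R q x)"
      if "r = s \<or> r = t" for r
    proof (rule integral_unique, rule has_integral_on_superset[where S = "{r..r + e n}"])
      show "((\<lambda>x. kern (e n) r x *\<^sub>R q x) has_integral integral {r..r + e n} (\<lambda>x. kern (e n) r x *\<^sub>R q x)) {r..r + e n}"
        by (intro integrable_integral integrable_continuous_real kc)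
    qed (use that e[of n] st kern_zero in auto)
    have "(LINT x:I|lebesgue. vderiv (\<psi> n) x *\<^sub>R q x)
        = integral {s..t + d} (\<lambda>x. kern (e n) s x *\<^sub>R q x - kern (e n) t x *\<^sub>R q x)"
      unfolding vd scaleR_diff_left
    proof (rule set_lebesgue_integral_superset[OF _ II])
      show "(\<lambda>x. kern (e n) s x *\<^sub>R q x - kern (e n) t x *\<^sub>R q x) absolutely_integrable_on {s..t + d}"
        by (intro absolutely_integrable_continuous_real continuous_intros kc)
    qed (use e[of n] st kern_zero in auto)
    also have "\<dots> = integral {s..t + d} (\<lambda>x. kern (e n) s x *\<^sub>R q x) - integral {s..t + d} (\<lambda>x. kern (e n) t x *\<^sub>R q x)"
      by (intro integral_diff integrable_continuous_real kc)
    finally show ?thesis using *[of s] *[of t] by simp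
  qed
  have eq: "integral {s..s + e n} (\<lambda>x. kern (e n) s x *\<^sub>R q x) - integral {t..t + e n} (\<lambda>x. kern (e n) t x *\<^sub>R q x)
      = - integral {s..t + d} (\<lambda>x. \<psi> n x *\<^sub>R g x)" for n
    using w tf[of n] unfolding has_weak_deriv_def L[symmetric] R[symmetric] by blast
  have "(\<lambda>n. integral {s..s + e n} (\<lambda>x. kern (e n) s x *\<^sub>R q x) - integral {t..t + e n} (\<lambda>x. kern (e n) t x *\<^sub>R q x))
      \<longlonglongrightarrow> q s - q t"
    unfolding e_def by (intro tendsto_diff kern_average q d)
  moreover have "(\<lambda>n. integral {s..t + d} (\<lambda>x. \<psi> n x *\<^sub>R g x))
      \<longlonglongrightarrow> integral {s..t + d} (\<lambda>x. if x \<in> {s<..t} then g x else 0)"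
  proof (rule dominated_convergence(2)[where h = "\<lambda>x. norm (g x)"])
    show "(\<lambda>x. \<psi> k x *\<^sub>R g x) integrable_on {s..t + d}" for k
      by (intro set_lebesgue_integral_eq_integral(1)
          continuous_times_absolutely_integrable[OF bounded_bilinear_scaleR \<psi>c g])
    show "(\<lambda>x. norm (g x)) integrable_on {s..t + d}"
      using g by (simp add: absolutely_integrable_on_def)
    show "norm (\<psi> k x *\<^sub>R g x) \<le> norm (g x)" for k x
      using \<psi>b[of k x] by (simp add: mult_left_le_one_le)
    show "(\<lambda>k. \<psi> k x *\<^sub>R g x) \<longlonglongrightarrow> (if x \<in> {s<..t} then g x else 0)" for x
    proof -
      have "(\<lambda>k. \<psi> k x *\<^sub>R g x) \<longlonglongrightarrow> ((if x \<le> s then 0 else 1) - (if x \<le> t then 0 else 1)) *\<^sub>R g x"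
        unfolding \<psi>_def e_def by (intro tendsto_intros ramp_tendsto d)
      also have "((if x \<le> s then 0 else 1) - (if x \<le> t then 0 else 1)) *\<^sub>R g x = (if x \<in> {s<..t} then g x else 0)"
        using st by auto
      finally show ?thesis .
    qed
  qed
  ultimately have "q s - q t = - integral {s..t + d} (\<lambda>x. if x \<in> {s<..t} then g x else 0)"
    unfolding eq using LIMSEQ_unique tendsto_minus by blast
  also have "integral {s..t + d} (\<lambda>x. if x \<in> {s<..t} then g x else 0) = integral {s<..t} g"
    using d by (subst integral_restrict_Int) (auto intro!: arg_cong2[of _ _ _ _ integral])
  also have "\<dots> = integral {s..t} g"
    by (rule integral_subset_negligible) (auto intro: negligible_subset[of "{s}"])
  finally show "integral {s..t} g = q t - q s" by (simp add: algebra_simps)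
qed

lemma borel_representative:
  fixes f :: "real \<Rightarrow> 'a::euclidean_space"
  assumes "f \<in> borel_measurable lebesgue"
  obtains f' where "f' \<in> borel_measurable borel" "AE x in lebesgue. f x = f' x"
proof -
  have "\<exists>k\<in>borel_measurable lborel. AE x in lborel. f x \<bullet> b = k x" for b
    using assms by (intro completion_ex_borel_measurable_real) simp
  then obtain k where k: "\<And>b. k b \<in> borel_measurable lborel" "\<And>b. AE x in lborel. f x \<bullet> b = k b x"
    by metis
  have "AE x in lborel. \<forall>b\<in>Basis. f x \<bullet> b = k b x"
    using k(2) by (subst AE_ball_countable) (auto intro: countable_finite)
  then have "AE x in lborel. f x = (\<Sum>b\<in>Basis. k b x *\<^sub>R b)"
    by eventually_elim (metis (no_types, lifting) euclidean_representation sum.cong)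
  then show ?thesis
    using k(1) by (intro that[of "\<lambda>x. \<Sum>b\<in>Basis. k b x *\<^sub>R b"] AE_completion) auto
qed

text \<open>Both requirements are additive in the interval, so by bisection only short intervals
  lying on one side of each point x matter. This suits functions that change their formula at
  x.\<close>

lemma primitiveI:
  fixes g :: "real \<Rightarrow> 'a::euclidean_space"
  assumes g: "g \<in> borel_measurable borel"
    and loc: "\<And>x. \<exists>d>0. \<forall>s t. x - d \<le> s \<and> s \<le> t \<and> t \<le> x + d \<and> (t \<le> x \<or> x \<le> s) \<longrightarrow>
       g absolutely_integrable_on {s..t} \<and> integral {s..t} g = q t - q s"
  shows "primitive q g"
  unfolding primitive_def
proof (intro conjI[OF g] allI impI)
  fix a b :: real assume ab: "a \<le> b"
  define P where "P s t \<longleftrightarrow> g absolutely_integrable_on {s..t} \<and> integral {s..t} g = q t - q s" for s t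
  have tr: "P s t" if "P s r" "P r t" "s \<le> r" "r \<le> t" for s r t
  proof -
    have ai: "g absolutely_integrable_on {s..t}"
      using that absolutely_integrable_on_combine unfolding P_def by blast
    have "integral {s..t} g = integral {s..r} g + integral {r..t} g"
      using Henstock_Kurzweil_Integration.integral_combine[of s r t g] that set_lebesgue_integral_eq_integral(1)[OF ai]
      by simp
    also have "\<dots> = (q r - q s) + (q t - q r)" using that by (simp only: P_def)
    finally show ?thesis using ai by (simp add: P_def)
  qed
  have "P a b"
  proof (rule Bolzano[OF ab])
    fix x
    obtain d where d: "d > 0" "\<And>s t. x - d \<le> s \<Longrightarrow> s \<le> t \<Longrightarrow> t \<le> x + d \<Longrightarrow> t \<le> x \<or> x \<le> s \<Longrightarrow> P s t"
      using loc[of x] unfolding P_def by meson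
    show "\<exists>d>0. \<forall>s t. s \<le> x \<and> x \<le> t \<and> t - s < d \<longrightarrow> P s t"
    proof (intro exI[of _ d] conjI allI impI d(1))
      fix s t assume st: "s \<le> x \<and> x \<le> t \<and> t - s < d"
      show "P s t" using st d by (intro tr[of s x t] d(2)) auto
    qed
  qed (use tr in blast)
  then show "g absolutely_integrable_on {a..b} \<and> integral {a..b} g = q b - q a"
    by (simp add: P_def)
qed

text \<open>Each compact interval provides a weak derivative of its own. Borel representatives on
  the unit intervals between integers are glued with the help of the floor function; the larger
  intervals [k-1, k+2] supply the margin of \<open>weak_deriv_imp_integral\<close>.\<close>

lemma W1_Phi_loc_primitive:
  fixes q :: "real \<Rightarrow> 'a::euclidean_space"
  assumes "q \<in> W1_Phi_loc \<phi>"
  obtains g where "primitive q g"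
proof -
  have q: "continuous_on UNIV q" using assms by (simp add: W1_Phi_loc_def)
  have "\<exists>h. has_weak_deriv {of_int k - 1..of_int k + 2} q h" for k :: int
  proof -
    have "\<forall>a b. a < b \<longrightarrow> q \<in> W1_Phi \<phi> {a..b}" using assms by (simp add: W1_Phi_loc_def)
    from this[rule_format, of "of_int k - 1" "of_int k + 2"] show ?thesis by (auto simp: W1_Phi_def)
  qed
  then obtain h where h: "\<And>k::int. has_weak_deriv {of_int k - 1..of_int k + 2} q (h k)" by metis
  have "\<exists>f\<in>borel_measurable borel. AE x in lebesgue. x \<in> {of_int k..of_int k + 1} \<longrightarrow> h k x = f x" for k :: int
  proof -
    have "h k absolutely_integrable_on {of_int k..of_int k + 1}"
      by (rule weak_deriv_imp_integral(1)[OF h q, where d = "1/2"]) auto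
    then have "(\<lambda>x. indicator {real_of_int k..of_int k + 1} x *\<^sub>R h k x) \<in> borel_measurable lebesgue"
      unfolding set_integrable_def by (rule borel_measurable_integrable)
    then obtain f where "f \<in> borel_measurable borel"
      "AE x in lebesgue. indicator {real_of_int k..of_int k + 1} x *\<^sub>R h k x = f x"
      by (rule borel_representative)
    then show ?thesis
      by (intro bexI[of _ f]) (auto elim!: eventually_mono simp: indicator_def split: if_splits)
  qed
  then obtain f where fb: "\<And>k. f k \<in> borel_measurable borel"
    and fh: "\<And>k::int. AE x in lebesgue. x \<in> {of_int k..of_int k + 1} \<longrightarrow> h k x = f k x"
    by metis
  define g where "g t = f \<lfloor>t\<rfloor> t" for t :: real
  have gb: "g \<in> borel_measurable borel"
    unfolding g_def by (rule measurable_compose_countable[OF fb]) simp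
  have piece: "g absolutely_integrable_on {s..t} \<and> integral {s..t} g = q t - q s"
    if "of_int k \<le> s" "s \<le> t" "t \<le> of_int k + 1" for k :: int and s t
  proof (cases "s = t")
    case True
    then show ?thesis using absolutely_integrable_continuous_real[of s s g] by simp
  next
    case False
    obtain N where N: "negligible N" "\<And>x. x \<notin> N \<Longrightarrow> x \<in> {of_int k..of_int k + 1} \<longrightarrow> h k x = f k x"
      using fh[of k] by (rule AE_lebesgue_negligible) blast
    \<comment> \<open>The right end point k + 1 already belongs to the next cell, hence it joins the
      exceptional null set.\<close>
    have gh: "g x = h k x" if "x \<in> {s..t} - (N \<union> {of_int k + 1})" for x
    proof -
      have "\<lfloor>x\<rfloor> = k" using that \<open>of_int k \<le> s\<close> \<open>t \<le> of_int k + 1\<close> by (intro floor_unique) auto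
      then show ?thesis using N(2)[of x] that \<open>of_int k \<le> s\<close> \<open>t \<le> of_int k + 1\<close> by (auto simp: g_def)
    qed
    have neg: "negligible (N \<union> {of_int k + 1})" using N(1) by auto
    have hk: "h k absolutely_integrable_on {s..t}" "integral {s..t} (h k) = q t - q s"
      using that False by (intro weak_deriv_imp_integral[OF h[of k] q, of s t "1/2"]; auto)+
    have "g absolutely_integrable_on {s..t}" by (rule absolutely_integrable_spike[OF hk(1) neg gh])
    moreover have "integral {s..t} (h k) = integral {s..t} g" by (rule integral_spike[OF neg gh])
    ultimately show ?thesis using hk(2) by simp
  qed
  have "primitive q g"
  proof (rule primitiveI[OF gb])
    fix x :: real
    define k where "k = \<lfloor>x\<rfloor>"
    have k: "of_int k \<le> x" "x < of_int k + 1" by (auto simp: k_def)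
    show "\<exists>d>0. \<forall>s t. x - d \<le> s \<and> s \<le> t \<and> t \<le> x + d \<and> (t \<le> x \<or> x \<le> s) \<longrightarrow>
       g absolutely_integrable_on {s..t} \<and> integral {s..t} g = q t - q s"
    proof (cases "x = of_int k")
      case True
      show ?thesis
        by (rule exI[of _ 1]) (use True piece[of k] piece[of "k - 1"] in auto)
    next
      case False
      show ?thesis
        by (rule exI[of _ "min (x - of_int k) (of_int k + 1 - x)"]) (use False k piece[of k] in auto)
    qed
  qed
  then show ?thesis by (rule that)
qed

lemma test_functionD:
  fixes \<psi> :: "real \<Rightarrow> 'a::euclidean_space"
  assumes "test_function U \<psi>"
  shows "(\<psi> has_vector_derivative vderiv \<psi> x) (at x)" "continuous_on A (vderiv \<psi>)"
    "x \<notin> U \<Longrightarrow> \<psi> x = 0" "x \<notin> closure {t. \<psi> t \<noteq> 0} \<Longrightarrow> \<psi> x = 0 \<and> vderiv \<psi> x = 0"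
proof -
  have n: "(vderiv ^^ n) \<psi> differentiable_on UNIV" for n using assms by (simp add: test_function_def)
  have "\<psi> differentiable (at x)" for x
    using n[of 0] by (simp add: differentiable_on_def)
  then show d: "(\<psi> has_vector_derivative vderiv \<psi> x) (at x)" for x
    using vector_derivative_works by blast
  show "continuous_on A (vderiv \<psi>)"
    using differentiable_imp_continuous_on[OF n[of 1]] continuous_on_subset by auto
  show "x \<notin> U \<Longrightarrow> \<psi> x = 0"
    using assms closure_subset[of "{t. \<psi> t \<noteq> 0}"] unfolding test_function_def by auto
  show "\<psi> x = 0 \<and> vderiv \<psi> x = 0" if x: "x \<notin> closure {t. \<psi> t \<noteq> 0}" for x
  proof
    show "\<psi> x = 0" using x closure_subset[of "{t. \<psi> t \<noteq> 0}"] by auto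
    have "(\<psi> has_vector_derivative 0) (at x)"
    proof (rule has_vector_derivative_transform_within_open[of "\<lambda>_. 0" _ _ "- closure {t. \<psi> t \<noteq> 0}"])
      show "0 = \<psi> y" if "y \<in> - closure {t. \<psi> t \<noteq> 0}" for y
        using that closure_subset[of "{t. \<psi> t \<noteq> 0}"] by auto
    qed (use x in auto)
    then show "vderiv \<psi> x = 0" by (rule vector_derivative_at)
  qed
qed

lemma test_function_support:
  fixes \<psi> :: "real \<Rightarrow> 'a::euclidean_space"
  assumes "test_function U \<psi>"
  obtains n where "n > 0" "\<And>x. x \<notin> {-n<..<n} \<Longrightarrow> \<psi> x = 0 \<and> vderiv \<psi> x = 0"
proof -
  have "bounded (closure {t. \<psi> t \<noteq> 0})"
    using assms compact_imp_bounded by (auto simp: test_function_def)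
  then obtain n where "n > 0" "\<And>x. x \<in> closure {t. \<psi> t \<noteq> 0} \<Longrightarrow> norm x < n"
    using bounded_pos_less by blast
  then have "x \<notin> closure {t. \<psi> t \<noteq> 0}" if "x \<notin> {-n<..<n}" for x
    using that by fastforce
  then show ?thesis
    using test_functionD(4)[OF assms] by (intro that[OF \<open>n > 0\<close>]) blast
qed

text \<open>\<psi> has to vanish at a and b to remove the boundary terms, but its derivative only
  off the closed interval. In this form the lemma serves both the whole line and I = [a,b].\<close>

lemma primitive_by_parts:
  fixes q :: "real \<Rightarrow> 'a::euclidean_space" and \<psi> :: "real \<Rightarrow> real"
  assumes p: "primitive q g" and ab: "a \<le> b" "{a..b} \<subseteq> I" and \<psi>: "test_function U \<psi>"
    and z: "\<And>x. x \<in> I \<Longrightarrow> x \<notin> {a<..<b} \<Longrightarrow> \<psi> x = 0" "\<And>x. x \<in> I \<Longrightarrow> x \<notin> {a..b} \<Longrightarrow> vderiv \<psi> x = 0"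
  shows "(LINT t:I|lebesgue. vderiv \<psi> t *\<^sub>R q t) = - (LINT t:I|lebesgue. \<psi> t *\<^sub>R g t)"
proof -
  have q: "continuous_on A q" for A using primitive_cont[OF p] continuous_on_subset by blast
  have d: "(\<psi> has_vector_derivative vderiv \<psi> x) (at x)" and cd: "continuous_on A (vderiv \<psi>)" for x A
    by (rule test_functionD(1)[OF \<psi>], rule test_functionD(2)[OF \<psi>])
  have c\<psi>: "continuous_on A \<psi>" for A
    using d by (meson continuous_at_imp_continuous_on has_vector_derivative_continuous)
  have g: "g absolutely_integrable_on {a..b}" by (rule primitiveD(2)[OF p])
  have ai1: "(\<lambda>t. vderiv \<psi> t *\<^sub>R q t) absolutely_integrable_on {a..b}"
    by (intro absolutely_integrable_continuous_real continuous_intros cd q)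
  have ai2: "(\<lambda>t. \<psi> t *\<^sub>R g t) absolutely_integrable_on {a..b}"
    by (rule continuous_times_absolutely_integrable[OF bounded_bilinear_scaleR c\<psi> g])
  have "((\<lambda>t. \<psi> t *\<^sub>R g t + vderiv \<psi> t *\<^sub>R q t) has_integral \<psi> b *\<^sub>R q b - \<psi> a *\<^sub>R q a) {a..b}"
  proof (rule integral_by_parts_indefinite[OF bounded_bilinear_scaleR ab(1) _ g])
    show "vderiv \<psi> absolutely_integrable_on {a..b}"
      by (intro absolutely_integrable_continuous_real cd)
    show "\<psi> t = \<psi> a + integral {a..t} (vderiv \<psi>)" if "t \<in> {a..b}" for t
    proof -
      have "(vderiv \<psi> has_integral \<psi> t - \<psi> a) {a..t}"
        using that d by (intro fundamental_theorem_of_calculus) (auto intro: has_vector_derivative_at_within)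
      then show ?thesis by (simp add: integral_unique)
    qed
    show "q t = q a + integral {a..t} g" if "t \<in> {a..b}" for t
      using primitiveD(4)[OF p, of a t] that by simp
  qed
  moreover have "\<psi> a = 0" "\<psi> b = 0" using z(1)[of a] z(1)[of b] ab by auto
  ultimately have "integral {a..b} (\<lambda>t. \<psi> t *\<^sub>R g t + vderiv \<psi> t *\<^sub>R q t) = 0"
    by (simp add: integral_unique)
  then have "integral {a..b} (\<lambda>t. vderiv \<psi> t *\<^sub>R q t) = - integral {a..b} (\<lambda>t. \<psi> t *\<^sub>R g t)"
    using ai1 ai2 by (simp add: integral_add set_lebesgue_integral_eq_integral(1) add_eq_0_iff)
  moreover have "(LINT t:I|lebesgue. vderiv \<psi> t *\<^sub>R q t) = integral {a..b} (\<lambda>t. vderiv \<psi> t *\<^sub>R q t)"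
    by (rule set_lebesgue_integral_superset[OF ai1 ab(2)]) (use z(2) in auto)
  moreover have "(LINT t:I|lebesgue. \<psi> t *\<^sub>R g t) = integral {a..b} (\<lambda>t. \<psi> t *\<^sub>R g t)"
    by (rule set_lebesgue_integral_superset[OF ai2 ab(2)]) (use z(1) in auto)
  ultimately show ?thesis by simp
qed

lemma primitive_has_weak_deriv:
  fixes q :: "real \<Rightarrow> 'a::euclidean_space"
  assumes p: "primitive q g"
  shows "has_weak_deriv UNIV q g" "a < b \<Longrightarrow> has_weak_deriv {a..b} q g"
proof -
  have q: "continuous_on A q" for A using primitive_cont[OF p] continuous_on_subset by blast
  have L: "q \<in> L1_loc I" "g \<in> L1_loc I" for I
    by (rule L1_locI, rule absolutely_integrable_continuous_real, rule q)
      (rule L1_locI, rule primitiveD(2)[OF p])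
  show "has_weak_deriv UNIV q g"
    unfolding has_weak_deriv_def
  proof (intro conjI L allI impI)
    fix \<psi> :: "real \<Rightarrow> real" assume "test_function (interior UNIV) \<psi>"
    moreover then obtain n where "n > 0" "\<And>x. x \<notin> {-n<..<n} \<Longrightarrow> \<psi> x = 0 \<and> vderiv \<psi> x = 0"
      by (rule test_function_support) blast
    ultimately show "(LINT t:UNIV|lebesgue. vderiv \<psi> t *\<^sub>R q t) = - (LINT t:UNIV|lebesgue. \<psi> t *\<^sub>R g t)"
      by (intro primitive_by_parts[OF p, of "-n" n]) auto
  qed
  show "has_weak_deriv {a..b} q g" if "a < b"
    unfolding has_weak_deriv_def
  proof (intro conjI L allI impI)
    fix \<psi> :: "real \<Rightarrow> real" assume \<psi>: "test_function (interior {a..b}) \<psi>"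
    then show "(LINT t:{a..b}|lebesgue. vderiv \<psi> t *\<^sub>R q t) = - (LINT t:{a..b}|lebesgue. \<psi> t *\<^sub>R g t)"
      using test_functionD(3)[OF \<psi>] that by (intro primitive_by_parts[OF p, of a b]) auto
  qed
qed

text \<open>\<open>weak_deriv\<close> is an arbitrary choice. Its integrals over intervals are
  increments of q, as are those of g, so the two agree almost everywhere on each [-n,n].\<close>

lemma primitive_weak_deriv:
  fixes q :: "real \<Rightarrow> 'a::euclidean_space"
  assumes p: "primitive q g"
  shows "AE t in lebesgue. weak_deriv q t = g t"
proof -
  define w where "w = weak_deriv q"
  have "has_weak_deriv UNIV q w"
    unfolding w_def weak_deriv_def by (rule someI[of _ g]) (rule primitive_has_weak_deriv(1)[OF p])
  note w = weak_deriv_imp_integral[OF this primitive_cont[OF p], of _ _ 1]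
  have *: "AE t in lebesgue. t \<in> {- real n..real n} \<longrightarrow> w t - g t = 0" for n
  \<comment> \<open>For n = 0 the interval is a single point and hence null; the argument for n > 0
    needs a nondegenerate interval.\<close>
  proof (cases "n = 0")
    case True
    have "AE t in lborel. t \<noteq> (0::real)" by (rule AE_lborel_singleton)
    then have "AE t in lebesgue. t \<noteq> (0::real)" by (rule AE_completion)
    then show ?thesis by eventually_elim (use True in auto)
  next
    case False
    define N where "N = real n"
    have N: "N > 0" using False by (simp add: N_def)
    define f where "f t = w t - g t" for t
    have f: "f absolutely_integrable_on {-N..N}"
      unfolding f_def using N by (intro set_integral_diff(1) primitiveD(2)[OF p] w(1)) auto
    have z: "integral {-N..x} f = 0" if "-N < x" "x \<le> N" for x
      unfolding f_def using w[of "-N" x] primitiveD(3,4)[OF p] that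
      by (subst integral_diff) (auto simp: set_lebesgue_integral_eq_integral(1))
    define F where "F x = indicator {-N..N} x *\<^sub>R f x" for x
    have F: "integrable lebesgue F" using f by (simp add: F_def[abs_def] set_integrable_def)
    then obtain F' where F': "F' \<in> borel_measurable borel" "AE x in lebesgue. F x = F' x"
      using borel_representative[of F] borel_measurable_integrable by blast
    have "AE x in lborel. F' x = 0"
    proof (rule zero_integrals_imp_AE_zero)
      have iF': "integrable lebesgue F'"
        using F F' by (subst integrable_cong_AE[of _ _ F]) (auto simp: measurable_completion borel_measurable_integrable)
      then show "integrable lborel F'"
        using F'(1) by (simp add: integrable_completion)
      fix x
      have "(LINT t:{..x}|lborel. F' t) = (LINT t:{..x}|lebesgue. F' t)"
        unfolding set_lebesgue_integral_def using F'(1) by (intro integral_completion[symmetric]) simp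
      also have "\<dots> = (LINT t:{..x}|lebesgue. F t)"
      proof (unfold set_lebesgue_integral_def, rule integral_cong_AE)
        show "(\<lambda>t. indicator {..x} t *\<^sub>R F' t) \<in> borel_measurable lebesgue"
          using F'(1) by (intro measurable_completion) simp
        show "(\<lambda>t. indicator {..x} t *\<^sub>R F t) \<in> borel_measurable lebesgue"
          by (intro borel_measurable_scaleR borel_measurable_integrable[OF F] borel_measurable_indicator) simp
        show "AE t in lebesgue. indicator {..x} t *\<^sub>R F' t = indicator {..x} t *\<^sub>R F t"
          using F'(2) by eventually_elim simp
      qed
      also have "\<dots> = 0"
      proof (cases "x \<le> -N")
        case True
        have "(LINT t:{..x}|lebesgue. F t) = (LINT t|lebesgue. indicator {..x} t *\<^sub>R F t)"
          by (simp add: set_lebesgue_integral_def)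
        also have "\<dots> = 0"
        proof (rule integral_eq_zero_AE)
          have "AE t in lborel. t \<noteq> -N" by (rule AE_lborel_singleton)
          then have "AE t in lebesgue. t \<noteq> -N" by (rule AE_completion)
          then show "AE t in lebesgue. indicator {..x} t *\<^sub>R F t = 0"
            by eventually_elim (use True in \<open>auto simp: F_def indicator_def\<close>)
        qed
        finally show ?thesis .
      next
        case False
        have "(\<lambda>t. indicator {..x} t *\<^sub>R F t) = (\<lambda>t. indicator {-N..min x N} t *\<^sub>R f t)"
          by (auto simp: F_def indicator_def fun_eq_iff)
        then have "(LINT t:{..x}|lebesgue. F t) = (LINT t:{-N..min x N}|lebesgue. f t)"
          by (simp add: set_lebesgue_integral_def)
        also have "\<dots> = integral {-N..min x N} f"
          by (intro set_lebesgue_integral_eq_integral(2) absolutely_integrable_on_subinterval[OF f]) auto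
        finally show ?thesis using z[of "min x N"] False N by simp
      qed
      finally show "(LINT t:{..x}|lborel. F' t) = 0" .
    qed
    then have "AE x in lebesgue. F' x = 0" by (rule AE_completion)
    with F'(2) show ?thesis
      by eventually_elim (auto simp: F_def f_def N_def indicator_def split: if_splits)
  qed
  have "AE t in lebesgue. \<forall>n. t \<in> {- real n..real n} \<longrightarrow> w t - g t = 0"
    by (subst AE_all_countable) (intro allI *)
  then show ?thesis
  proof eventually_elim
    case (elim t)
    obtain n where "\<bar>t\<bar> \<le> real n" using real_arch_simple by blast
    then have "t \<in> {- real n..real n}" by (simp add: abs_le_iff)
    then show ?case using elim by (auto simp: w_def)
  qed
qed

context orlicz
begin

lemma W1_Phi_loc_I:
  fixes q :: "real \<Rightarrow> 'a::euclidean_space"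
  assumes p: "primitive q g"
    and fin: "\<And>a b. (\<integral>\<^sup>+t\<in>{a..b}. ennreal (\<Phi> (norm (g t))) \<partial>lebesgue) < \<infinity>"
  shows "q \<in> W1_Phi_loc \<phi>"
proof -
  have q: "continuous_on A q" for A using primitive_cont[OF p] continuous_on_subset by blast
  have L: "q \<in> L1_loc I" "g \<in> L1_loc I" for I
    by (rule L1_locI, rule absolutely_integrable_continuous_real, rule q)
      (rule L1_locI, rule primitiveD(2)[OF p])
  have "q \<in> W1_Phi \<phi> {a..b}" if "a < b" for a b
  proof -
    have "g \<in> L_Phi \<phi> {a..b}"
      unfolding L_Phi_def using L fin[of a b] by (auto intro!: exI[of _ "1::real"])
    moreover have "q \<in> L_Phi \<phi> {a..b}"
    proof -
      have "continuous_on {a..b} (\<lambda>t. \<Phi> (norm (q t)))"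
        by (intro continuous_on_compose2[OF Phi_cont] continuous_intros q) auto
      then have "(\<lambda>t. \<Phi> (norm (q t))) absolutely_integrable_on {a..b}"
        by (rule absolutely_integrable_continuous_real)
      then have "integrable lebesgue (\<lambda>t. indicator {a..b} t *\<^sub>R \<Phi> (norm (q t)))"
        by (simp add: set_integrable_def)
      then have "(\<integral>\<^sup>+t. ennreal (norm (indicator {a..b} t *\<^sub>R \<Phi> (norm (q t)))) \<partial>lebesgue) < \<infinity>"
        by (simp add: integrable_iff_bounded)
      also have "(\<integral>\<^sup>+t. ennreal (norm (indicator {a..b} t *\<^sub>R \<Phi> (norm (q t)))) \<partial>lebesgue)
          = (\<integral>\<^sup>+t\<in>{a..b}. ennreal (\<Phi> (norm (q t))) \<partial>lebesgue)"
        by (intro nn_integral_cong) (auto simp: indicator_def Phi_nonneg)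
      finally show ?thesis unfolding L_Phi_def using L by (auto intro!: exI[of _ "1::real"])
    qed
    ultimately show ?thesis
      unfolding W1_Phi_def using primitive_has_weak_deriv(2)[OF p that] by blast
  qed
  then show ?thesis by (simp add: W1_Phi_loc_def q)
qed

end

subsection \<open>Paths and their action\<close>

lemma primitiveI':
  fixes g :: "real \<Rightarrow> 'a::euclidean_space"
  assumes "g \<in> borel_measurable borel"
    and "\<And>s t. s \<le> t \<Longrightarrow> (g has_integral q t - q s) {s..t}"
    and "\<And>s t. s \<le> t \<Longrightarrow> (\<lambda>x. norm (g x)) integrable_on {s..t}"
  shows "primitive q g"
  unfolding primitive_def absolutely_integrable_on_def
  using assms by (auto simp: has_integral_iff)

lemma primitive_has_integral:
  assumes "primitive q g" "s \<le> t" shows "(g has_integral q t - q s) {s..t}"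
  using primitiveD(3,4)[OF assms(1)] assms(2) by (auto simp: has_integral_iff)

lemma primitive_norm_integrable:
  assumes "primitive q g" shows "(\<lambda>x. norm (g x)) integrable_on {s..t}"
  using primitiveD(2)[OF assms, of s t] by (simp add: absolutely_integrable_on_def)

lemma primitive_shift:
  assumes p: "primitive q g" shows "primitive (\<lambda>t. q (t + d)) (\<lambda>t. g (t + d))"
proof (rule primitiveI')
  show "(\<lambda>t. g (t + d)) \<in> borel_measurable borel"
    using primitiveD(1)[OF p] by measurable
  fix s t :: real assume st: "s \<le> t"
  show "((\<lambda>t. g (t + d)) has_integral q (t + d) - q (s + d)) {s..t}"
    using has_integral_shift_real_ivl[OF primitive_has_integral[OF p, of "s + d" "t + d"], of d] st by simp
  show "(\<lambda>x. norm (g (x + d))) integrable_on {s..t}"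
    using has_integral_shift_real_ivl[OF integrable_integral[OF primitive_norm_integrable[OF p, of "s + d" "t + d"]], of d]
    by (auto simp: integrable_on_def)
qed

lemma primitive_reflect:
  assumes p: "primitive q g" shows "primitive (\<lambda>t. q (- t)) (\<lambda>t. - g (- t))"
proof (rule primitiveI')
  show "(\<lambda>t. - g (- t)) \<in> borel_measurable borel"
    using primitiveD(1)[OF p] by measurable
  fix s t :: real assume st: "s \<le> t"
  have "((\<lambda>x. g (- x)) has_integral q (- s) - q (- t)) {s..t}"
    using has_integral_reflect_real[of g "q (- s) - q (- t)" "- s" "- t"] primitive_has_integral[OF p, of "-t" "-s"] st by simp
  from has_integral_neg[OF this]
  show "((\<lambda>t. - g (- t)) has_integral q (- t) - q (- s)) {s..t}" by simp
  show "(\<lambda>x. norm (- g (- x))) integrable_on {s..t}"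
    using has_integral_reflect_real[of "\<lambda>x. norm (g x)" _ "- s" "- t"]
      integrable_integral[OF primitive_norm_integrable[OF p, of "-t" "-s"]]
    by (auto simp: integrable_on_def)
qed

definition glue :: "real \<Rightarrow> (real \<Rightarrow> 'a) \<Rightarrow> (real \<Rightarrow> 'a) \<Rightarrow> real \<Rightarrow> 'a" where
  "glue a f1 f2 t = (if t \<le> a then f1 t else f2 t)"

lemma primitive_glue:
  assumes p1: "primitive q1 g1" and p2: "primitive q2 g2" and eq: "q1 a = q2 a"
  shows "primitive (glue a q1 q2) (glue a g1 g2)"
proof (rule primitiveI)
  have [measurable]: "g1 \<in> borel_measurable borel" "g2 \<in> borel_measurable borel"
    using p1 p2 primitiveD(1) by auto
  show "glue a g1 g2 \<in> borel_measurable borel"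
    unfolding glue_def[abs_def] by measurable
  have left: "glue a g1 g2 absolutely_integrable_on {s..t} \<and> integral {s..t} (glue a g1 g2) = glue a q1 q2 t - glue a q1 q2 s"
    if "s \<le> t" "t \<le> a" for s t
  proof -
    have eqs: "glue a g1 g2 x = g1 x" if "x \<in> {s..t} - {}" for x using that \<open>t \<le> a\<close> by (simp add: glue_def)
    have "glue a g1 g2 absolutely_integrable_on {s..t}"
      by (rule absolutely_integrable_spike[OF primitiveD(2)[OF p1] negligible_empty eqs])
    moreover have "integral {s..t} g1 = integral {s..t} (glue a g1 g2)"
      by (rule integral_spike[OF negligible_empty eqs])
    ultimately show ?thesis using primitiveD(4)[OF p1 that(1)] that by (simp add: glue_def)
  qed
  have right: "glue a g1 g2 absolutely_integrable_on {s..t} \<and> integral {s..t} (glue a g1 g2) = glue a q1 q2 t - glue a q1 q2 s"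
    if "s \<le> t" "a \<le> s" for s t
  proof -
    have eqs: "glue a g1 g2 x = g2 x" if "x \<in> {s..t} - {a}" for x using that \<open>a \<le> s\<close> by (auto simp: glue_def)
    have "glue a g1 g2 absolutely_integrable_on {s..t}"
      by (rule absolutely_integrable_spike[OF primitiveD(2)[OF p2] negligible_sing eqs])
    moreover have "integral {s..t} g2 = integral {s..t} (glue a g1 g2)"
      by (rule integral_spike[OF negligible_sing eqs])
    moreover have "glue a q1 q2 r = q2 r" if "a \<le> r" for r using eq that by (cases "r = a") (auto simp: glue_def)
    ultimately show ?thesis using primitiveD(4)[OF p2 that(1)] that by simp
  qed
  fix x :: real
  show "\<exists>d>0. \<forall>s t. x - d \<le> s \<and> s \<le> t \<and> t \<le> x + d \<and> (t \<le> x \<or> x \<le> s) \<longrightarrow>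
      glue a g1 g2 absolutely_integrable_on {s..t} \<and> integral {s..t} (glue a g1 g2) = glue a q1 q2 t - glue a q1 q2 s"
  proof -
    \<comment> \<open>Away from a the interval must not cross a; at x = a any length will do,
      because only intervals on one side of x are considered.\<close>
    define d where "d = (if x = a then 1 else \<bar>x - a\<bar>)"
    have "d > 0" by (simp add: d_def)
    moreover have "s \<le> t \<and> (t \<le> a \<or> a \<le> s)" if "x - d \<le> s \<and> s \<le> t \<and> t \<le> x + d \<and> (t \<le> x \<or> x \<le> s)" for s t
      using that by (auto simp: d_def split: if_splits)
    ultimately show ?thesis using left right by (intro exI[of _ d] conjI allI impI) blast+
  qed
qed

text \<open>The integral over an interval with reversed end points is 0, not negative, hence the two
  cases in the primitive based at a.\<close>

lemma primitive_bounded: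
  fixes w :: "real \<Rightarrow> 'a::euclidean_space"
  assumes w: "w \<in> borel_measurable borel" and B: "\<And>t. norm (w t) \<le> B"
  shows "primitive (\<lambda>t. x + (if a \<le> t then integral {a..t} w else - integral {t..a} w)) w"
  unfolding primitive_def
proof (intro conjI w allI impI)
  show ai: "w absolutely_integrable_on {s..t}" for s t
    using bounded_borel_absolutely_integrable[OF w] B by blast
  have i: "w integrable_on {s..t}" for s t using set_lebesgue_integral_eq_integral(1)[OF ai] .
  fix s t :: real assume "s \<le> t"
  have comb: "s \<le> r \<Longrightarrow> r \<le> t \<Longrightarrow> integral {s..r} w + integral {r..t} w = integral {s..t} w" for s r t
    by (rule Henstock_Kurzweil_Integration.integral_combine[OF _ _ i])
  show "integral {s..t} w = x + (if a \<le> t then integral {a..t} w else - integral {t..a} w)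
      - (x + (if a \<le> s then integral {a..s} w else - integral {s..a} w))"
    using comb[of a s t] comb[of s a t] comb[of s t a] \<open>s \<le> t\<close>
    by (auto simp: algebra_simps split: if_splits)
qed

lemma nn_integral_Icc:
  fixes f :: "real \<Rightarrow> real"
  assumes f: "f absolutely_integrable_on {a..b}" and nn: "\<And>t. t \<in> {a..b} \<Longrightarrow> f t \<ge> 0"
  shows "(\<integral>\<^sup>+t\<in>{a..b}. ennreal (f t) \<partial>lborel) = ennreal (integral {a..b} f)"
proof -
  have "(\<integral>\<^sup>+t\<in>{a..b}. ennreal (f t) \<partial>lborel) = (\<integral>\<^sup>+t. ennreal (indicator {a..b} t *\<^sub>R f t) \<partial>lebesgue)"
    unfolding nn_integral_completion by (intro nn_integral_cong) (auto simp: indicator_def)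
  also have "\<dots> = ennreal (LINT t|lebesgue. indicator {a..b} t *\<^sub>R f t)"
    using f nn by (intro nn_integral_eq_integral) (auto simp: set_integrable_def indicator_def)
  also have "(LINT t|lebesgue. indicator {a..b} t *\<^sub>R f t) = integral {a..b} f"
    using set_lebesgue_integral_eq_integral(2)[OF f] by (simp add: set_lebesgue_integral_def)
  finally show ?thesis .
qed

lemma finite_nn_integral_Icc:
  fixes f :: "real \<Rightarrow> real"
  assumes f: "f \<in> borel_measurable borel" and nn: "\<And>t. f t \<ge> 0"
    and fin: "(\<integral>\<^sup>+t\<in>{a..b}. ennreal (f t) \<partial>lborel) < \<infinity>"
  shows "f absolutely_integrable_on {a..b}"
proof -
  have "integrable lborel (\<lambda>t. indicator {a..b} t *\<^sub>R f t)"
  proof (rule integrableI_nonneg)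
    have "(\<integral>\<^sup>+t. ennreal (indicator {a..b} t *\<^sub>R f t) \<partial>lborel) = (\<integral>\<^sup>+t\<in>{a..b}. ennreal (f t) \<partial>lborel)"
      by (intro nn_integral_cong) (auto simp: indicator_def)
    then show "(\<integral>\<^sup>+t. ennreal (indicator {a..b} t *\<^sub>R f t) \<partial>lborel) < \<infinity>" using fin by simp
  qed (use f nn in auto)
  then show ?thesis
    unfolding set_integrable_def using f by (simp add: integrable_completion)
qed

lemma Liminf_eq_0_iff:
  fixes f :: "real \<Rightarrow> real"
  assumes F: "F \<noteq> bot" and nn: "\<And>t. f t \<ge> 0"
  shows "Liminf F (\<lambda>t. ereal (f t)) = 0 \<longleftrightarrow> (\<forall>e>0. \<exists>\<^sub>F t in F. f t < e)"
proof
  assume L: "Liminf F (\<lambda>t. ereal (f t)) = 0"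
  show "\<forall>e>0. \<exists>\<^sub>F t in F. f t < e"
  proof (intro allI impI, rule ccontr)
    fix e :: real assume "e > 0" "\<not> (\<exists>\<^sub>F t in F. f t < e)"
    then have "\<forall>\<^sub>F t in F. ereal e \<le> ereal (f t)" by (simp add: not_frequently not_less)
    then have "ereal e \<le> Liminf F (\<lambda>t. ereal (f t))" by (rule Liminf_bounded)
    then show False using L \<open>e > 0\<close> by simp
  qed
next
  assume *: "\<forall>e>0. \<exists>\<^sub>F t in F. f t < e"
  have "0 \<le> Liminf F (\<lambda>t. ereal (f t))"
    by (rule Liminf_bounded) (use nn in auto)
  moreover have "\<not> 0 < Liminf F (\<lambda>t. ereal (f t))"
  proof
    assume "0 < Liminf F (\<lambda>t. ereal (f t))"
    then obtain y where y: "0 < y" "y < Liminf F (\<lambda>t. ereal (f t))" using dense by blast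
    then obtain e where e: "y = ereal e" by (cases y) auto
    have "\<forall>\<^sub>F t in F. \<not> f t < e"
      using less_LiminfD[OF y(2)] by eventually_elim (simp add: e)
    then show False using * y e by (auto simp: frequently_def)
  qed
  ultimately show "Liminf F (\<lambda>t. ereal (f t)) = 0" by (simp add: antisym_conv2 not_less)
qed

text \<open>Zero lower limit of the distance, spelled out with times: it visibly depends only on
  arbitrarily early values and so survives gluing and shifting.\<close>

definition from_near :: "'a::metric_space set \<Rightarrow> (real \<Rightarrow> 'a) \<Rightarrow> bool" where
  "from_near A q \<longleftrightarrow> (\<forall>e>0. \<forall>T. \<exists>t\<le>T. infdist (q t) A < e)"

definition to_near :: "'a::metric_space set \<Rightarrow> (real \<Rightarrow> 'a) \<Rightarrow> bool" where
  "to_near A q \<longleftrightarrow> (\<forall>e>0. \<forall>T. \<exists>t\<ge>T. infdist (q t) A < e)"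

lemma from_near_iff: "from_near A q \<longleftrightarrow> Liminf at_bot (\<lambda>t. ereal (infdist (q t) A)) = 0"
  by (subst Liminf_eq_0_iff) (auto simp: from_near_def infdist_nonneg frequently_def eventually_at_bot_linorder)

lemma to_near_iff: "to_near A q \<longleftrightarrow> Liminf at_top (\<lambda>t. ereal (infdist (q t) A)) = 0"
  by (subst Liminf_eq_0_iff) (auto simp: to_near_def infdist_nonneg frequently_def eventually_at_top_linorder)

lemma from_near_reflect: "from_near A (\<lambda>t. q (- t)) \<longleftrightarrow> to_near A q"
  unfolding from_near_def to_near_def
proof (intro iffI allI impI)
  fix e T :: real assume *: "\<forall>e>0. \<forall>T. \<exists>t\<le>T. infdist (q (- t)) A < e" and "e > 0"
  then obtain t where "t \<le> - T" "infdist (q (- t)) A < e" by blast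
  then show "\<exists>t\<ge>T. infdist (q t) A < e" by (intro exI[of _ "- t"]) auto
next
  fix e T :: real assume *: "\<forall>e>0. \<forall>T. \<exists>t\<ge>T. infdist (q t) A < e" and "e > 0"
  then obtain t where "t \<ge> - T" "infdist (q t) A < e" by blast
  then show "\<exists>t\<le>T. infdist (q (- t)) A < e" by (intro exI[of _ "- t"]) auto
qed

lemma to_near_reflect: "to_near A (\<lambda>t. q (- t)) \<longleftrightarrow> from_near A q"
  using from_near_reflect[of A "\<lambda>t. q (- t)"] by simp

lemma from_near_glue: assumes "from_near A q1" shows "from_near A (glue a q1 q2)"
  unfolding from_near_def
proof (intro allI impI)
  fix e T :: real assume "e > 0"
  then obtain t where "t \<le> min T a" "infdist (q1 t) A < e" using assms unfolding from_near_def by blast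
  then show "\<exists>t\<le>T. infdist (glue a q1 q2 t) A < e" by (intro exI[of _ t]) (auto simp: glue_def)
qed

lemma to_near_glue: assumes "to_near A q2" shows "to_near A (glue a q1 q2)"
  unfolding to_near_def
proof (intro allI impI)
  fix e T :: real assume "e > 0"
  then obtain t where "t \<ge> max T (a + 1)" "infdist (q2 t) A < e" using assms unfolding to_near_def by blast
  then show "\<exists>t\<ge>T. infdist (glue a q1 q2 t) A < e" by (intro exI[of _ t]) (auto simp: glue_def)
qed

lemma from_near_shift: assumes "from_near A q" shows "from_near A (\<lambda>t. q (t + d))"
  unfolding from_near_def
proof (intro allI impI)
  fix e T :: real assume "e > 0"
  then obtain t where "t \<le> T + d" "infdist (q t) A < e" using assms unfolding from_near_def by blast
  then show "\<exists>t\<le>T. infdist (q (t + d)) A < e" by (intro exI[of _ "t - d"]) auto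
qed

lemma to_near_shift: assumes "to_near A q" shows "to_near A (\<lambda>t. q (t + d))"
  unfolding to_near_def
proof (intro allI impI)
  fix e T :: real assume "e > 0"
  then obtain t where "t \<ge> T + d" "infdist (q t) A < e" using assms unfolding to_near_def by blast
  then show "\<exists>t\<ge>T. infdist (q (t + d)) A < e" by (intro exI[of _ "t - d"]) auto
qed

section \<open>Paths above level c, their action and its invariances\<close>

locale potential = orlicz \<phi> l for \<phi> :: "real \<Rightarrow> real" and l :: real +
  fixes V :: "'a::euclidean_space \<Rightarrow> real" and c :: real
  assumes V: "C1_potential V"
begin

lemma V_deriv: "(V has_derivative (\<lambda>h. h \<bullet> grad V x)) (at x)"
  using V by (simp add: C1_potential_def gderiv_def)

lemma grad_cont: "continuous_on A (grad V)"
  using V continuous_on_subset by (auto simp: C1_potential_def)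

lemma V_cont: "continuous_on A V"
  using V_deriv by (meson continuous_at_imp_continuous_on has_derivative_continuous)

lemma V_measurable [measurable]: "V \<in> borel_measurable borel"
  using V_cont by (rule borel_measurable_continuous_onI)

definition lag :: "(real \<Rightarrow> 'a) \<Rightarrow> (real \<Rightarrow> 'a) \<Rightarrow> real \<Rightarrow> real" where
  "lag q g t = \<Phi> (norm (g t)) + V (q t) - c"

text \<open>\<open>J_fun\<close> with an explicit Borel velocity g in place of the chosen weak
  derivative, and localised to a set of times so that it can be cut and pasted.\<close>

definition act :: "real set \<Rightarrow> (real \<Rightarrow> 'a) \<Rightarrow> (real \<Rightarrow> 'a) \<Rightarrow> ennreal" where
  "act S q g = (\<integral>\<^sup>+t\<in>S. ennreal (lag q g t) \<partial>lborel)"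

definition path :: "(real \<Rightarrow> 'a) \<Rightarrow> (real \<Rightarrow> 'a) \<Rightarrow> bool" where
  "path q g \<longleftrightarrow> primitive q g \<and> (\<forall>t. V (q t) \<ge> c)"

lemma pathD: assumes "path q g" shows "primitive q g" "V (q t) \<ge> c" "continuous_on A q"
  using assms primitive_cont continuous_on_subset unfolding path_def by blast+

lemma lag_nonneg: "path q g \<Longrightarrow> lag q g t \<ge> 0"
  using Phi_nonneg[of "norm (g t)"] by (simp add: lag_def path_def add_nonneg_nonneg le_diff_eq add_increasing)

lemma lag_measurable: assumes "primitive q g" shows "lag q g \<in> borel_measurable borel"
proof -
  have [measurable]: "g \<in> borel_measurable borel" "q \<in> borel_measurable borel"
    using primitiveD(1)[OF assms] borel_measurable_continuous_onI[OF primitive_cont[OF assms]] by auto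
  show ?thesis unfolding lag_def[abs_def] by measurable
qed

lemma act_mono: "S \<subseteq> T \<Longrightarrow> act S q g \<le> act T q g"
  unfolding act_def by (intro nn_integral_mono) (auto simp: indicator_def)

lemma act_Un:
  assumes "primitive q g" "S \<in> sets borel" "T \<in> sets borel" "S \<inter> T = {}"
  shows "act (S \<union> T) q g = act S q g + act T q g"
  unfolding act_def using lag_measurable[OF assms(1)] assms by (intro nn_integral_disjoint_pair) auto

lemma act_cong: "(\<And>t. t \<in> S \<Longrightarrow> q t = q' t \<and> g t = g' t) \<Longrightarrow> act S q g = act S q' g'"
  unfolding act_def by (intro nn_integral_cong) (auto simp: indicator_def lag_def)

lemma act_glue:
  assumes p1: "primitive q1 g1" and p2: "primitive q2 g2" and eq: "q1 a = q2 a" and S: "S \<in> sets borel"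
  shows "act S (glue a q1 q2) (glue a g1 g2) = act (S \<inter> {..a}) q1 g1 + act (S \<inter> {a<..}) q2 g2"
proof -
  have "act S (glue a q1 q2) (glue a g1 g2) = act (S \<inter> {..a} \<union> S \<inter> {a<..}) (glue a q1 q2) (glue a g1 g2)"
    by (rule arg_cong[of _ _ "\<lambda>S. act S _ _"]) auto
  also have "\<dots> = act (S \<inter> {..a}) (glue a q1 q2) (glue a g1 g2) + act (S \<inter> {a<..}) (glue a q1 q2) (glue a g1 g2)"
    using S by (intro act_Un[OF primitive_glue[OF p1 p2 eq]]) auto
  also have "act (S \<inter> {..a}) (glue a q1 q2) (glue a g1 g2) = act (S \<inter> {..a}) q1 g1"
    by (rule act_cong) (auto simp: glue_def)
  also have "act (S \<inter> {a<..}) (glue a q1 q2) (glue a g1 g2) = act (S \<inter> {a<..}) q2 g2"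
    by (rule act_cong) (auto simp: glue_def)
  finally show ?thesis .
qed

lemma act_Ioc: "act {a<..b} q g = act {a..b} q g"
  unfolding act_def
proof (rule nn_integral_cong_AE)
  show "AE t in lborel. ennreal (lag q g t) * indicator {a<..b} t = ennreal (lag q g t) * indicator {a..b} t"
    using AE_lborel_singleton[of a] by eventually_elim (auto simp: indicator_def)
qed

lemma act_shift:
  assumes "primitive q g"
  shows "act {a<..} (\<lambda>t. q (t + d)) (\<lambda>t. g (t + d)) = act {a + d<..} q g"
proof -
  have "act {a + d<..} q g = (\<integral>\<^sup>+t. ennreal (lag q g t) * indicator {a + d<..} t \<partial>lborel)"
    by (simp add: act_def)
  also have "\<dots> = (\<integral>\<^sup>+t. ennreal (lag q g (d + 1 * t)) * indicator {a + d<..} (d + 1 * t) \<partial>lborel)"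
    using lag_measurable[OF assms] by (subst nn_integral_real_affine[where c = 1 and t = d]) auto
  also have "\<dots> = act {a<..} (\<lambda>t. q (t + d)) (\<lambda>t. g (t + d))"
    unfolding act_def by (intro nn_integral_cong) (auto simp: lag_def indicator_def add.commute)
  finally show ?thesis by simp
qed

lemma act_shift_UNIV:
  assumes "primitive q g"
  shows "act UNIV (\<lambda>t. q (t + d)) (\<lambda>t. g (t + d)) = act UNIV q g"
proof -
  have "act UNIV q g = (\<integral>\<^sup>+t. ennreal (lag q g t) \<partial>lborel)" by (simp add: act_def)
  also have "\<dots> = (\<integral>\<^sup>+t. ennreal (lag q g (d + 1 * t)) \<partial>lborel)"
    using lag_measurable[OF assms] by (subst nn_integral_real_affine[where c = 1 and t = d]) auto
  finally show ?thesis by (simp add: act_def lag_def add.commute)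
qed

lemma act_Icc:
  assumes p: "path q g" and fin: "act {a..b} q g < \<infinity>"
  shows "lag q g absolutely_integrable_on {a..b}" "act {a..b} q g = ennreal (integral {a..b} (lag q g))"
proof -
  show i: "lag q g absolutely_integrable_on {a..b}"
    using fin lag_nonneg[OF p] lag_measurable[OF pathD(1)[OF p]] unfolding act_def
    by (intro finite_nn_integral_Icc)
  show "act {a..b} q g = ennreal (integral {a..b} (lag q g))"
    unfolding act_def by (rule nn_integral_Icc[OF i lag_nonneg[OF p]])
qed

lemma lag_bounded_integrable:
  assumes p: "primitive q g" and B: "\<And>t. t \<in> {a..b} \<Longrightarrow> norm (g t) \<le> B"
  shows "lag q g absolutely_integrable_on {a..b}"
proof -
  have "continuous_on {a..b} (\<lambda>t. V (q t))"
    by (intro continuous_on_compose2[OF V_cont[of UNIV]] continuous_on_subset[OF primitive_cont[OF p]]) auto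
  then have "bounded ((\<lambda>t. V (q t)) ` {a..b})"
    by (intro compact_imp_bounded compact_continuous_image) auto
  then obtain M where M: "\<And>t. t \<in> {a..b} \<Longrightarrow> \<bar>V (q t)\<bar> \<le> M"
    unfolding bounded_iff by (metis imageI real_norm_def)
  show ?thesis
  proof (rule bounded_borel_absolutely_integrable[OF lag_measurable[OF p]])
    fix t assume t: "t \<in> {a..b}"
    have "\<Phi> (norm (g t)) \<le> \<Phi> B" using B[OF t] by (intro Phi_mono) auto
    then show "norm (lag q g t) \<le> \<Phi> B + M + \<bar>c\<bar>"
      using M[OF t] Phi_nonneg[of "norm (g t)"] by (auto simp: lag_def)
  qed
qed

text \<open>Stated for a \<open>primitive\<close> instead of a \<open>path\<close>, since the pieces
  of a competitor satisfy V \<ge> c only on the interval on which they are used.\<close>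

lemma act_bounded:
  assumes p: "primitive q g" and B: "\<And>t. t \<in> {a..b} \<Longrightarrow> norm (g t) \<le> B"
    and V: "\<And>t. t \<in> {a..b} \<Longrightarrow> V (q t) \<ge> c"
  shows "act {a..b} q g = ennreal (integral {a..b} (lag q g))"
  unfolding act_def
proof (rule nn_integral_Icc[OF lag_bounded_integrable[OF p B]])
  show "0 \<le> lag q g t" if "t \<in> {a..b}" for t
    using V[OF that] Phi_nonneg[of "norm (g t)"] by (simp add: lag_def)
qed

definition adm :: "'a set \<Rightarrow> 'a set \<Rightarrow> (real \<Rightarrow> 'a) \<Rightarrow> (real \<Rightarrow> 'a) \<Rightarrow> bool" where
  "adm Vm Vp q g \<longleftrightarrow> path q g \<and> from_near Vm q \<and> to_near Vp q"

lemma J_fun_eq_act: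
  assumes "primitive q g" shows "J_fun \<phi> V c q = act UNIV q g"
proof -
  have "J_fun \<phi> V c q = (\<integral>\<^sup>+t. ennreal (lag q g t) \<partial>lebesgue)"
    unfolding J_fun_def lag_def using primitive_weak_deriv[OF assms]
    by (intro nn_integral_cong_AE) (auto elim: eventually_mono)
  then show ?thesis by (simp add: act_def nn_integral_completion)
qed

lemma Gamma_set_adm:
  assumes "q \<in> Gamma_set \<phi> V c Vm Vp"
  obtains g where "adm Vm Vp q g" "J_fun \<phi> V c q = act UNIV q g"
proof -
  have "q \<in> W1_Phi_loc \<phi>" using assms by (simp add: Gamma_set_def)
  then obtain g where g: "primitive q g" by (rule W1_Phi_loc_primitive)
  then have "adm Vm Vp q g"
    using assms by (auto simp: Gamma_set_def adm_def path_def from_near_iff to_near_iff)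
  then show ?thesis using that J_fun_eq_act[OF g] by blast
qed

text \<open>As V \<ge> c along the path, the action dominates the integral of Phi(|g|), and its
  finiteness puts the path into the Orlicz-Sobolev space.\<close>

lemma adm_Gamma_set:
  assumes a: "adm Vm Vp q g" and fin: "act UNIV q g < \<infinity>"
  shows "q \<in> Gamma_set \<phi> V c Vm Vp" "J_fun \<phi> V c q = act UNIV q g"
proof -
  have p: "path q g" and pr: "primitive q g" using a by (auto simp: adm_def path_def)
  show "J_fun \<phi> V c q = act UNIV q g" by (rule J_fun_eq_act[OF pr])
  have "(\<integral>\<^sup>+t\<in>{a..b}. ennreal (\<Phi> (norm (g t))) \<partial>lebesgue) < \<infinity>" for a b
  proof -
    have "(\<integral>\<^sup>+t\<in>{a..b}. ennreal (\<Phi> (norm (g t))) \<partial>lebesgue) \<le> act UNIV q g"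
      unfolding act_def nn_integral_completion
      using pathD(2)[OF p] by (intro nn_integral_mono) (auto simp: indicator_def lag_def intro!: ennreal_leI)
    then show ?thesis using fin by (rule le_less_trans)
  qed
  then have "q \<in> W1_Phi_loc \<phi>" by (rule W1_Phi_loc_I[OF pr])
  then show "q \<in> Gamma_set \<phi> V c Vm Vp"
    using a by (auto simp: Gamma_set_def adm_def path_def from_near_iff to_near_iff)
qed

lemma act_reflect:
  assumes "primitive q g"
  shows "act UNIV (\<lambda>t. q (- t)) (\<lambda>t. - g (- t)) = act UNIV q g"
proof -
  have "act UNIV q g = (\<integral>\<^sup>+t. ennreal (lag q g t) \<partial>lborel)" by (simp add: act_def)
  also have "\<dots> = (\<integral>\<^sup>+t. ennreal (lag q g (0 + (-1) * t)) \<partial>lborel)"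
    using lag_measurable[OF assms] by (subst nn_integral_real_affine[where c = "-1" and t = 0]) auto
  finally show ?thesis by (simp add: act_def lag_def)
qed

text \<open>Time reversal exchanges the wells; this is how results at one end of the line are
  carried over to the other.\<close>

lemma adm_reflect:
  assumes "adm Vm Vp q g" shows "adm Vp Vm (\<lambda>t. q (- t)) (\<lambda>t. - g (- t))"
  using assms primitive_reflect unfolding adm_def path_def
  by (auto simp: from_near_reflect to_near_reflect)

end

lemma primitive_linear: "primitive (\<lambda>t. x + t *\<^sub>R v) (\<lambda>_. v)"
  by (rule primitiveI') (auto simp: scaleR_diff_left[symmetric] has_integral_iff)

lemma primitive_const: "primitive (\<lambda>_. x) (\<lambda>_. 0)"
  using primitive_linear[of x 0] by simp

lemma primitive_add:
  assumes p1: "primitive q1 g1" and p2: "primitive q2 g2"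
  shows "primitive (\<lambda>t. q1 t + q2 t) (\<lambda>t. g1 t + g2 t)"
  unfolding primitive_def
proof (intro conjI allI impI)
  show "(\<lambda>t. g1 t + g2 t) \<in> borel_measurable borel"
    using primitiveD(1)[OF p1] primitiveD(1)[OF p2] by measurable
  fix s t :: real assume "s \<le> t"
  show "(\<lambda>t. g1 t + g2 t) absolutely_integrable_on {s..t}"
    by (intro set_integral_add(1) primitiveD(2)[OF p1] primitiveD(2)[OF p2])
  show "integral {s..t} (\<lambda>t. g1 t + g2 t) = q1 t + q2 t - (q1 s + q2 s)"
    using integral_add[OF primitiveD(3)[OF p1, of s t] primitiveD(3)[OF p2, of s t]]
      primitiveD(4)[OF p1 \<open>s \<le> t\<close>] primitiveD(4)[OF p2 \<open>s \<le> t\<close>] by simp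
qed

section \<open>Discretized action, Jensen's inequality and equicontinuity\<close>

text \<open>With F = \<Phi>, the kinetic energy of the polygon through the values of q at the nodes
  a + i h. It involves finitely many values of q only, so it is continuous under pointwise
  convergence and makes sense for non-differentiable q.\<close>

definition disc :: "(real \<Rightarrow> real) \<Rightarrow> (real \<Rightarrow> 'a::real_normed_vector) \<Rightarrow> real \<Rightarrow> real \<Rightarrow> nat \<Rightarrow> real" where
  "disc F q a h N = (\<Sum>i<N. h * F (norm (q (a + real (Suc i) * h) - q (a + real i * h)) / h))"

context potential
begin

text \<open>X and Z are the actions of the parts kept before and after a surgery, Y and W those of
  the removed and the inserted part. The first hypothesis makes X + Z finite, which permits
  cancelling.\<close>

lemma adm_act_le_cancel:
  fixes X Y Z W :: ennreal
  assumes "X + Y + Z \<le> ennreal m + ennreal e" "ennreal m \<le> X + W + Z"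
  shows "Y \<le> W + ennreal e"
proof -
  have fin: "X + Z \<noteq> \<infinity>"
  proof
    assume "X + Z = \<infinity>"
    moreover have "X + Y + Z < top" by (rule le_less_trans[OF assms(1)]) simp
    ultimately show False by (auto simp: less_top[symmetric])
  qed
  have "X + Z + Y \<le> X + Z + (W + ennreal e)"
    using order_trans[OF assms(1) add_right_mono[OF assms(2), of "ennreal e"]]
    by (simp add: ac_simps)
  then show ?thesis using fin by (simp add: ennreal_add_left_cancel_le)
qed

lemma V_path_integrable: "continuous_on {s..t::real} q \<Longrightarrow> (\<lambda>r. V (q r) - c) integrable_on {s..t}"
  by (intro integrable_continuous_real continuous_intros continuous_on_compose2[OF V_cont[of UNIV]]) auto

text \<open>Jensen's inequality on one interval: in the subgradient inequality at the mean velocity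
  v the linear term integrates to 0.\<close>

lemma lag_integral_ge_segment:
  assumes p: "path q g" and i: "lag q g integrable_on {s..t}" and st: "s < t"
  shows "integral {s..t} (lag q g)
    \<ge> (t - s) * \<Phi> (norm (q t - q s) / (t - s)) + integral {s..t} (\<lambda>r. V (q r) - c)"
proof -
  define v where "v = (q t - q s) /\<^sub>R (t - s)"
  have nv: "norm v = norm (q t - q s) / (t - s)" using st by (simp add: v_def divide_inverse mult.commute)
  have gi: "(g has_integral q t - q s) {s..t}" using primitive_has_integral[OF pathD(1)[OF p]] st by simp
  have Vi: "(\<lambda>r. V (q r) - c) integrable_on {s..t}" by (rule V_path_integrable[OF pathD(3)[OF p]])
  have "((\<lambda>r. mom v \<bullet> (g r - v)) has_integral mom v \<bullet> ((q t - q s) - (t - s) *\<^sub>R v)) {s..t}"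
    using has_integral_linear[OF has_integral_diff[OF gi has_integral_const_real[of v s t]] bounded_linear_inner_right[of "mom v"]] st
    by (simp add: o_def)
  moreover have "(q t - q s) - (t - s) *\<^sub>R v = 0" using st by (simp add: v_def)
  ultimately have "((\<lambda>r. mom v \<bullet> (g r - v)) has_integral 0) {s..t}" by simp
  from has_integral_add[OF has_integral_add[OF has_integral_const_real[of "\<Phi> (norm v)" s t] this] integrable_integral[OF Vi]]
  have *: "((\<lambda>r. \<Phi> (norm v) + mom v \<bullet> (g r - v) + (V (q r) - c)) has_integral
      (t - s) * \<Phi> (norm v) + integral {s..t} (\<lambda>r. V (q r) - c)) {s..t}"
    using st by simp
  have "(t - s) * \<Phi> (norm v) + integral {s..t} (\<lambda>r. V (q r) - c) \<le> integral {s..t} (lag q g)"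
  proof (rule has_integral_le[OF * integrable_integral[OF i]])
    fix r
    show "\<Phi> (norm v) + mom v \<bullet> (g r - v) + (V (q r) - c) \<le> lag q g r"
      using Phi_norm_support[of v "g r"] by (simp add: lag_def)
  qed
  then show ?thesis by (simp add: nv)
qed

lemma lag_integral_ge_disc:
  assumes p: "path q g" and h: "h > 0" and i: "lag q g integrable_on {a..a + real N * h}"
  shows "integral {a..a + real N * h} (lag q g)
    \<ge> disc \<Phi> q a h N + integral {a..a + real N * h} (\<lambda>r. V (q r) - c)"
  using i
proof (induction N)
  case (Suc N)
  define s where "s = a + real N * h"
  define t where "t = a + real (Suc N) * h"
  have t: "t = s + h" "a \<le> s" "s < t" using h by (auto simp: s_def t_def algebra_simps)
  have i: "lag q g integrable_on {a..t}" using Suc.prems by (simp add: t_def)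
  have i1: "lag q g integrable_on {a..s}" and i2: "lag q g integrable_on {s..t}"
    using t by (auto intro: integrable_subinterval_real[OF i])
  have "integral {a..t} (lag q g) = integral {a..s} (lag q g) + integral {s..t} (lag q g)"
    using Henstock_Kurzweil_Integration.integral_combine[of a s t "lag q g"] i t by simp
  moreover have "integral {a..t} (\<lambda>r. V (q r) - c) = integral {a..s} (\<lambda>r. V (q r) - c) + integral {s..t} (\<lambda>r. V (q r) - c)"
    using Henstock_Kurzweil_Integration.integral_combine[of a s t "\<lambda>r. V (q r) - c"] V_path_integrable[OF pathD(3)[OF p]] t by simp
  moreover have "disc \<Phi> q a h (Suc N) = disc \<Phi> q a h N + h * \<Phi> (norm (q t - q s) / h)"
    by (simp add: disc_def s_def t_def)
  moreover have "integral {a..s} (lag q g) \<ge> disc \<Phi> q a h N + integral {a..s} (\<lambda>r. V (q r) - c)"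
    using Suc.IH i1 by (simp add: s_def)
  moreover have "integral {s..t} (lag q g) \<ge> h * \<Phi> (norm (q t - q s) / h) + integral {s..t} (\<lambda>r. V (q r) - c)"
    using lag_integral_ge_segment[OF p i2] t by simp
  ultimately show ?case unfolding t_def[symmetric] by linarith
qed (simp add: disc_def)

text \<open>Integrate |g| \<le> \<epsilon> Phi(|g|) + K and bound Phi(|g|) by the Lagrangian. The
  resulting modulus depends only on the action bound C.\<close>

lemma path_modulus:
  assumes p: "path q g" and fin: "act UNIV q g \<le> ennreal C" "C \<ge> 0"
    and K: "\<forall>s\<ge>0. s \<le> \<epsilon> * \<Phi> s + K" and e: "\<epsilon> > 0" and st: "s \<le> t"
  shows "norm (q t - q s) \<le> \<epsilon> * C + K * (t - s)"
proof -
  have "act {s..t} q g \<le> ennreal C" using act_mono[of "{s..t}" UNIV] fin(1) order_trans by blast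
  then have A: "lag q g absolutely_integrable_on {s..t}" "ennreal (integral {s..t} (lag q g)) \<le> ennreal C"
    using act_Icc[OF p, of s t] by (auto simp: le_less_trans[OF _ ennreal_less_top])
  have i: "lag q g integrable_on {s..t}" by (rule set_lebesgue_integral_eq_integral(1)[OF A(1)])
  have ei: "(\<lambda>r. \<epsilon> * lag q g r) integrable_on {s..t}" using integrable_cmul[OF i, of \<epsilon>] by simp
  have IC: "integral {s..t} (lag q g) \<le> C" using A(2) fin(2) by simp
  have "norm (q t - q s) = norm (integral {s..t} g)" using primitiveD(4)[OF pathD(1)[OF p] st] by simp
  also have "\<dots> \<le> integral {s..t} (\<lambda>r. \<epsilon> * lag q g r + K)"
  proof (rule integral_norm_bound_integral)
    show "g integrable_on {s..t}" by (rule primitiveD(3)[OF pathD(1)[OF p]])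
    show "(\<lambda>r. \<epsilon> * lag q g r + K) integrable_on {s..t}"
      by (intro integrable_add ei integrable_const_ivl)
    fix r
    have "\<epsilon> * \<Phi> (norm (g r)) \<le> \<epsilon> * lag q g r"
      using pathD(2)[OF p, of r] e by (intro mult_left_mono) (auto simp: lag_def)
    then show "norm (g r) \<le> \<epsilon> * lag q g r + K"
      using K[rule_format, of "norm (g r)"] by simp
  qed
  also have "\<dots> = \<epsilon> * integral {s..t} (lag q g) + K * (t - s)"
    using ei st by (subst integral_add) auto
  also have "\<dots> \<le> \<epsilon> * C + K * (t - s)" using IC e by simp
  finally show ?thesis .
qed

end

section \<open>The two wells and a path of finite action between them\<close>

locale wells = potential \<phi> l V c for \<phi> :: "real \<Rightarrow> real" and l :: real
    and V :: "'a::euclidean_space \<Rightarrow> real" and c :: real +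
  fixes Vm Vp :: "'a set"
  assumes sublevel: "{x. V x \<le> c} = Vm \<union> Vp" and Vm_ne: "Vm \<noteq> {}" and Vp_ne: "Vp \<noteq> {}"
    and sep: "setdist Vm Vp > 0"
begin

lemma wells_sym: "wells \<phi> l V c Vp Vm"
  by unfold_locales (use sublevel Vm_ne Vp_ne sep in \<open>auto simp: setdist_sym\<close>)

lemma V_le: "x \<in> Vm \<Longrightarrow> V x \<le> c" "x \<in> Vp \<Longrightarrow> V x \<le> c"
  using sublevel by auto

lemma V_gt: "x \<notin> Vm \<Longrightarrow> x \<notin> Vp \<Longrightarrow> V x > c"
  using sublevel by (metis UnE mem_Collect_eq not_le)

lemma infdist_Vp_ge: assumes "x \<in> Vm" shows "infdist x Vp \<ge> setdist Vm Vp"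
  unfolding infdist_notempty[OF Vp_ne] using assms Vp_ne
  by (intro cINF_greatest) (auto intro: setdist_le_dist)

text \<open>What is closed is the sublevel set; inside it, keeping at least the distance of the
  wells from Vp is a closed condition that singles out Vm.\<close>

lemma closed_Vm: "closed Vm"
proof -
  have "Vm = {x. V x \<le> c} \<inter> {x. setdist Vm Vp \<le> infdist x Vp}"
    using infdist_Vp_ge sublevel sep by (auto dest: in_closure_iff_infdist_zero)
  moreover have "closed {x. V x \<le> c}" by (intro closed_Collect_le continuous_intros V_cont)
  moreover have "closed {x. setdist Vm Vp \<le> infdist x Vp}" by (intro closed_Collect_le continuous_intros)
  ultimately show ?thesis by (metis closed_Int)
qed

lemma closed_Vp: "closed Vp"
  by (rule wells.closed_Vm[OF wells_sym])

lemma infdist_sum: "infdist x Vm + infdist x Vp \<ge> setdist Vm Vp"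
proof -
  obtain y z where y: "y \<in> Vm" "infdist x Vm = dist x y" and z: "z \<in> Vp" "infdist x Vp = dist x z"
    using infdist_attains_inf[OF closed_Vm Vm_ne, of x] infdist_attains_inf[OF closed_Vp Vp_ne, of x] by metis
  have "setdist Vm Vp \<le> dist y z" using y z by (intro setdist_le_dist)
  also have "\<dots> \<le> dist x y + dist x z" by (metis dist_commute dist_triangle)
  finally show ?thesis using y z by simp
qed

lemma mem_Vm_iff: "x \<in> Vm \<longleftrightarrow> infdist x Vm = 0"
  using closed_Vm Vm_ne by (simp add: in_closed_iff_infdist_zero)

lemma mem_Vp_iff: "x \<in> Vp \<longleftrightarrow> infdist x Vp = 0"
  using closed_Vp Vp_ne by (simp add: in_closed_iff_infdist_zero)

text \<open>Take the least time at which V \<le> c. Before it V > c, so V = c there by continuity;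
  if it is a itself, then \<open>start\<close> gives the lower bound.\<close>

lemma first_hit:
  fixes f :: "real \<Rightarrow> 'a"
  assumes f: "continuous_on {a..b} f" and ab: "a \<le> b" and hit: "V (f b) \<le> c" and start: "V (f a) \<ge> c"
  obtains s where "s \<in> {a..b}" "V (f s) = c" "\<And>t. t \<in> {a..s} \<Longrightarrow> V (f t) \<ge> c"
proof -
  have cf: "continuous_on {a..b} (\<lambda>t. V (f t))"
    by (rule continuous_on_compose2[OF V_cont[of UNIV] f]) auto
  define S where "S = {t \<in> {a..b}. V (f t) \<le> c}"
  have "closed S"
    unfolding S_def by (rule continuous_on_closed_Collect_le[OF cf]) (auto intro: continuous_intros)
  moreover have "S \<subseteq> {a..b}" by (auto simp: S_def)
  ultimately have "compact S" by (metis bounded_closed_interval bounded_subset compact_eq_bounded_closed)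
  moreover have "b \<in> S" using hit ab by (simp add: S_def)
  ultimately obtain s where s: "s \<in> S" "\<And>t. t \<in> S \<Longrightarrow> s \<le> t"
    using compact_attains_inf[of S] by auto
  have *: "V (f t) > c" if "t \<in> {a..<s}" for t
    using s(2)[of t] s(1) that by (force simp: S_def)
  have "V (f s) \<ge> c"
  proof (cases "s = a")
    case False
    have "continuous_on (closure {a<..<s}) (\<lambda>t. V (f t))"
      using False s(1) by (intro continuous_on_subset[OF cf]) (auto simp: S_def)
    moreover have "s \<in> closure {a<..<s}" using False s(1) by (auto simp: S_def)
    ultimately show ?thesis
    proof (rule continuous_ge_on_closure)
      fix t assume "t \<in> {a<..<s}"
      then show "c \<le> V (f t)" using *[of t] by simp
    qed
  qed (use start in simp)
  moreover have "s \<in> {a..b}" "V (f s) \<le> c" using s(1) by (auto simp: S_def)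
  moreover have "V (f t) \<ge> c" if "t \<in> {a..s}" for t
    using *[of t] \<open>c \<le> V (f s)\<close> that by (cases "t = s") auto
  ultimately show ?thesis by (intro that[of s]) auto
qed

lemma closed_preimage_segment:
  fixes f :: "real \<Rightarrow> 'a"
  assumes "continuous_on UNIV f" "closed A"
  shows "compact ({a..b} \<inter> f -` A)"
proof -
  have "closed (f -` A)" using assms by (simp add: continuous_on_closed_vimage)
  then show ?thesis by (rule compact_Int_closed[OF compact_Icc])
qed

text \<open>On a straight segment from Vm to Vp, take the last time t1 in Vm and then the first time
  t2 in Vp after it. In between V > c; waiting at the two end points, where V = c, costs nothing. So
  the infimum is finite.\<close>

lemma finite_adm: "\<exists>q g. adm Vm Vp q g \<and> act UNIV q g < \<infinity>"
proof -
  obtain x y where x: "x \<in> Vm" and y: "y \<in> Vp" using Vm_ne Vp_ne by blast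
  define f where "f t = x + t *\<^sub>R (y - x)" for t
  have cf: "continuous_on A f" for A unfolding f_def[abs_def] by (intro continuous_intros)
  have disj: "Vm \<inter> Vp = {}" using infdist_Vp_ge sep by (force simp: mem_Vp_iff)
  have "0 \<in> {0..1} \<inter> f -` Vm" using x by (simp add: f_def)
  then obtain t1 where "t1 \<in> {0..1} \<inter> f -` Vm" "\<forall>t \<in> {0..1} \<inter> f -` Vm. t \<le> t1"
    using compact_attains_sup[OF closed_preimage_segment[OF cf closed_Vm, of 0 1]] by blast
  then have t1: "t1 \<in> {0..1}" "f t1 \<in> Vm" "\<And>t. t \<in> {0..1} \<Longrightarrow> f t \<in> Vm \<Longrightarrow> t \<le> t1" by auto
  have "1 \<in> {t1..1} \<inter> f -` Vp" using y t1 by (simp add: f_def)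
  then obtain t2 where "t2 \<in> {t1..1} \<inter> f -` Vp" "\<forall>t \<in> {t1..1} \<inter> f -` Vp. t2 \<le> t"
    using compact_attains_inf[OF closed_preimage_segment[OF cf closed_Vp, of t1 1]] by blast
  then have t2: "t2 \<in> {t1..1}" "f t2 \<in> Vp" "\<And>t. t \<in> {t1..1} \<Longrightarrow> f t \<in> Vp \<Longrightarrow> t2 \<le> t" by auto
  have lt: "t1 < t2" using t1(2) t2(1,2) disj by (cases "t1 = t2") auto
  have gt: "V (f t) > c" if "t \<in> {t1<..<t2}" for t
    using t1(1) t1(3)[of t] t2(1) t2(3)[of t] that by (intro V_gt) force+
  have ge: "V (f t) \<ge> c" if "t \<in> {t1..t2}" for t
  proof (rule continuous_ge_on_closure[of "{t1<..<t2}" "\<lambda>t. V (f t)"])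
    show "continuous_on (closure {t1<..<t2}) (\<lambda>t. V (f t))"
      by (rule continuous_on_compose2[OF V_cont[of UNIV] cf]) auto
    show "t \<in> closure {t1<..<t2}" using that lt by simp
    show "c \<le> V (f s)" if "s \<in> {t1<..<t2}" for s using gt[OF that] by simp
  qed
  have eq: "V (f t1) = c" "V (f t2) = c"
    using ge[of t1] ge[of t2] V_le(1)[OF t1(2)] V_le(2)[OF t2(2)] lt by auto
  define g1 where "g1 = (\<lambda>_::real. 0::'a)"
  define p1 where "p1 = (\<lambda>_::real. f t1)"
  define p2 where "p2 = (\<lambda>_::real. f t2)"
  define w where "w = (\<lambda>_::real. y - x)"
  have pr: "primitive p1 g1" "primitive p2 g1" "primitive f w"
    unfolding p1_def p2_def g1_def f_def[abs_def] w_def by (auto intro: primitive_const primitive_linear)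
  define q where "q = glue t1 p1 (glue t2 f p2)"
  define g where "g = glue t1 g1 (glue t2 w g1)"
  have pr2: "primitive (glue t2 f p2) (glue t2 w g1)"
    by (rule primitive_glue) (use pr in \<open>auto simp: p2_def\<close>)
  have e1: "p1 t1 = glue t2 f p2 t1" using lt by (simp add: glue_def p1_def)
  have prq: "primitive q g"
    unfolding q_def g_def by (rule primitive_glue[OF pr(1) pr2 e1])
  have zero: "act S p1 g1 = 0" "act S p2 g1 = 0" for S
    by (auto simp: act_def lag_def p1_def p2_def g1_def eq)
  have "act UNIV q g = act {..t1} p1 g1 + act {t1<..} (glue t2 f p2) (glue t2 w g1)"
    unfolding q_def g_def by (subst act_glue[OF pr(1) pr2 e1]) auto
  also have "\<dots> = act ({t1<..} \<inter> {..t2}) f w + act ({t1<..} \<inter> {t2<..}) p2 g1"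
    by (subst act_glue[OF pr(3) pr(2)]) (auto simp: p2_def zero)
  also have "\<dots> \<le> act {t1..t2} f w"
    unfolding zero by (simp, rule act_mono) auto
  also have "\<dots> = ennreal (integral {t1..t2} (lag f w))"
    by (rule act_bounded[OF pr(3), where B = "norm (y - x)"]) (use ge in \<open>auto simp: w_def\<close>)
  finally have "act UNIV q g < \<infinity>" by (simp add: le_less_trans[OF _ ennreal_less_top])
  moreover have "path q g"
    using prq ge eq by (auto simp: path_def q_def glue_def p1_def p2_def)
  moreover have "from_near Vm q"
    unfolding q_def by (rule from_near_glue) (use t1(2) in \<open>auto simp: from_near_def p1_def mem_Vm_iff\<close>)
  moreover have "to_near Vp q"
    unfolding q_def by (intro to_near_glue) (use t2(2) in \<open>auto simp: to_near_def p2_def mem_Vp_iff\<close>)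
  ultimately show ?thesis unfolding adm_def by blast
qed

end

section \<open>A minimizing sequence and its pointwise limit\<close>

text \<open>Here m0 is the infimum, e n the excess of the n-th action over it, and V(q 0) > c
  records that the time normalisation keeps the limit out of both wells. Velocities of the limit are
  deliberately absent.\<close>

locale min_seq = wells \<phi> l V c Vm Vp for \<phi> :: "real \<Rightarrow> real" and l :: real
    and V :: "'a::euclidean_space \<Rightarrow> real" and c :: real and Vm Vp :: "'a set" +
  fixes qs gs :: "nat \<Rightarrow> real \<Rightarrow> 'a" and q :: "real \<Rightarrow> 'a" and m0 R :: real and e :: "nat \<Rightarrow> real"
  assumes adm_seq: "adm Vm Vp (qs n) (gs n)"
    and bnd: "norm (qs n t) \<le> R"
    and act_seq: "act UNIV (qs n) (gs n) \<le> ennreal m0 + ennreal (e n)"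
    and e_nonneg: "e n \<ge> 0" and e_lim: "e \<longlonglongrightarrow> 0" and m0_nonneg: "m0 \<ge> 0"
    and minimal: "adm Vm Vp p w \<Longrightarrow> ennreal m0 \<le> act UNIV p w"
    and conv: "(\<lambda>n. qs n t) \<longlonglongrightarrow> q t"
    and q0: "V (q 0) > c"
begin

text \<open>All assumptions are symmetric under time reversal with the wells exchanged, so only the
  behaviour for positive times has to be studied.\<close>

lemma rev: "min_seq \<phi> l V c Vp Vm (\<lambda>n t. qs n (- t)) (\<lambda>n t. - gs n (- t)) (\<lambda>t. q (- t)) m0 R e"
proof -
  interpret r: wells \<phi> l V c Vp Vm by (rule wells_sym)
  show ?thesis
  proof
    fix n
    have pr: "primitive (qs n) (gs n)" using adm_seq by (simp add: adm_def path_def)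
    show "adm Vp Vm (\<lambda>t. qs n (- t)) (\<lambda>t. - gs n (- t))" by (rule adm_reflect[OF adm_seq])
    show "act UNIV (\<lambda>t. qs n (- t)) (\<lambda>t. - gs n (- t)) \<le> ennreal m0 + ennreal (e n)"
      using act_seq act_reflect[OF pr] by simp
  next
    fix p w assume a: "adm Vp Vm p w"
    have "ennreal m0 \<le> act UNIV (\<lambda>t. p (- t)) (\<lambda>t. - w (- t))" by (rule minimal[OF adm_reflect[OF a]])
    also have "\<dots> = act UNIV p w" using a by (intro act_reflect) (simp add: adm_def path_def)
    finally show "ennreal m0 \<le> act UNIV p w" .
  qed (use bnd e_nonneg e_lim m0_nonneg conv q0 in auto)
qed

lemma path_seq: "path (qs n) (gs n)"
  using adm_seq by (simp add: adm_def)

lemma prim_seq: "primitive (qs n) (gs n)"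
  using path_seq pathD(1) by blast

lemma norm_q: "norm (q t) \<le> R"
  by (rule LIMSEQ_le_const2[OF tendsto_norm[OF conv]]) (use bnd in auto)

lemma V_conv: "(\<lambda>n. V (qs n t)) \<longlonglongrightarrow> V (q t)"
  using V_cont[of UNIV] conv by (metis UNIV_I continuous_on_eq_continuous_at isCont_tendsto_compose open_UNIV)

lemma V_q_ge: "V (q t) \<ge> c"
  by (rule LIMSEQ_le_const[OF V_conv]) (use pathD(2)[OF path_seq] in auto)

lemma act_bound: "\<exists>C\<ge>0. \<forall>n. act UNIV (qs n) (gs n) \<le> ennreal C"
proof -
  obtain B where B: "\<And>n. norm (e n) \<le> B" using convergent_imp_Bseq[OF convergentI[OF e_lim]] by (auto simp: Bseq_def)
  have "act UNIV (qs n) (gs n) \<le> ennreal (m0 + B)" for n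
    using act_seq[of n] B[of n] m0_nonneg e_nonneg[of n]
    by (auto simp: ennreal_plus[symmetric] simp del: ennreal_plus intro: order_trans ennreal_leI)
  moreover have "m0 + B \<ge> 0" using B[of 0] m0_nonneg norm_ge_zero[of "e 0"] by linarith
  ultimately show ?thesis by blast
qed

lemma act_seq_finite: "act S (qs n) (gs n) < \<infinity>"
proof -
  obtain C where "act UNIV (qs n) (gs n) \<le> ennreal C" using act_bound by blast
  then have "act S (qs n) (gs n) \<le> ennreal C" by (rule order_trans[OF act_mono[OF subset_UNIV]])
  then show ?thesis by (simp add: le_less_trans[OF _ ennreal_less_top])
qed

lemma q_unif_cont: "uniformly_continuous_on UNIV q"
proof -
  obtain C where C: "C \<ge> 0" "\<And>n. act UNIV (qs n) (gs n) \<le> ennreal C" using act_bound by blast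
  show ?thesis
    unfolding uniformly_continuous_on_def
  proof (intro allI impI)
    fix \<epsilon> :: real assume "\<epsilon> > 0"
    define \<eta> where "\<eta> = \<epsilon> / (4 * (C + 1))"
    have \<eta>: "\<eta> > 0" "\<eta> * C \<le> \<epsilon> / 4" using \<open>\<epsilon> > 0\<close> C by (auto simp: \<eta>_def field_simps)
    obtain K where K: "K > 0" "\<forall>s\<ge>0. s \<le> \<eta> * \<Phi> s + K" using le_eps_Phi[OF \<eta>(1)] by blast
    have *: "norm (q t - q s) \<le> \<epsilon> / 4 + K * (t - s)" if "s \<le> t" for s t
    proof (rule LIMSEQ_le_const2[OF tendsto_norm[OF tendsto_diff[OF conv conv]]], intro exI allI impI)
      fix n
      show "norm (qs n t - qs n s) \<le> \<epsilon> / 4 + K * (t - s)"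
        using path_modulus[OF path_seq C(2) C(1) K(2) \<eta>(1) that, of n] \<eta>(2) by simp
    qed
    have "dist (q t) (q s) < \<epsilon>" if "dist t s < \<epsilon> / (4 * K)" for s t
    proof -
      have "norm (q t - q s) \<le> \<epsilon> / 4 + K * \<bar>t - s\<bar>"
        using *[of s t] *[of t s] by (cases "s \<le> t") (auto simp: norm_minus_commute abs_minus_commute)
      moreover have "K * \<bar>t - s\<bar> < \<epsilon> / 4" using that K(1) by (simp add: dist_real_def field_simps)
      ultimately show ?thesis using \<open>\<epsilon> > 0\<close> by (simp add: dist_norm)
    qed
    then show "\<exists>d>0. \<forall>s\<in>UNIV. \<forall>t\<in>UNIV. dist t s < d \<longrightarrow> dist (q t) (q s) < \<epsilon>"
      using \<open>\<epsilon> > 0\<close> K(1) by (intro exI[of _ "\<epsilon> / (4 * K)"]) auto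
  qed
qed

lemma q_cont: "continuous_on A q"
  using uniformly_continuous_imp_continuous[OF q_unif_cont] continuous_on_subset by blast

lemma Vq_cont: "continuous_on A (\<lambda>t. V (q t))"
  by (rule continuous_on_compose2[OF V_cont[of UNIV] q_cont]) auto

lemma V_bound: "\<exists>M\<ge>0. \<forall>x\<in>cball 0 r. \<bar>V x - c\<bar> \<le> M"
proof -
  have "bounded ((\<lambda>x. V x - c) ` cball 0 r)"
    by (intro compact_imp_bounded compact_continuous_image continuous_intros V_cont) auto
  then obtain M where M: "\<forall>x\<in>cball 0 r. \<bar>V x - c\<bar> \<le> M"
    unfolding bounded_iff by (metis imageI real_norm_def)
  show ?thesis by (rule exI[of _ "max M 0"]) (use M in \<open>auto simp: le_max_iff_disj\<close>)
qed

lemma integral_V_tendsto: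
  "(\<lambda>n. integral {a..b} (\<lambda>r. V (qs n r) - c)) \<longlonglongrightarrow> integral {a..b} (\<lambda>r. V (q r) - c)"
proof -
  obtain M where M: "\<forall>x\<in>cball 0 R. \<bar>V x - c\<bar> \<le> M" using V_bound by blast
  show ?thesis
  proof (rule dominated_convergence(2)[where h = "\<lambda>_. M"])
    show "(\<lambda>r. V (qs n r) - c) integrable_on {a..b}" for n
      by (rule V_path_integrable[OF pathD(3)[OF path_seq]])
    show "norm (V (qs n r) - c) \<le> M" for n r using M bnd[of n r] by simp
    show "(\<lambda>n. V (qs n r) - c) \<longlonglongrightarrow> V (q r) - c" for r by (intro tendsto_intros V_conv)
  qed auto
qed

lemma lag_seq:
  assumes "a \<le> b"
  shows "lag (qs n) (gs n) integrable_on {a..b}"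
    "act {a..b} (qs n) (gs n) = ennreal (integral {a..b} (lag (qs n) (gs n)))"
    "integral {a..b} (lag (qs n) (gs n)) \<ge> integral {a..b} (\<lambda>r. V (qs n r) - c)"
proof -
  show i: "lag (qs n) (gs n) integrable_on {a..b}"
    by (rule set_lebesgue_integral_eq_integral(1)[OF act_Icc(1)[OF path_seq act_seq_finite]])
  show "act {a..b} (qs n) (gs n) = ennreal (integral {a..b} (lag (qs n) (gs n)))"
    by (rule act_Icc(2)[OF path_seq act_seq_finite])
  show "integral {a..b} (lag (qs n) (gs n)) \<ge> integral {a..b} (\<lambda>r. V (qs n r) - c)"
    by (rule integral_le[OF V_path_integrable[OF pathD(3)[OF path_seq]] i]) (simp add: lag_def Phi_nonneg)
qed

lemma integral_V_le: assumes "a \<le> b" shows "integral {a..b} (\<lambda>r. V (q r) - c) \<le> m0"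
proof (rule LIMSEQ_le[OF integral_V_tendsto])
  show "(\<lambda>n. m0 + e n) \<longlonglongrightarrow> m0" using tendsto_add[OF tendsto_const e_lim, of m0] by simp
  have "integral {a..b} (\<lambda>r. V (qs n r) - c) \<le> m0 + e n" for n
  proof -
    have "ennreal (integral {a..b} (lag (qs n) (gs n))) \<le> ennreal m0 + ennreal (e n)"
      using order_trans[OF act_mono[OF subset_UNIV] act_seq, of "{a..b}" n] lag_seq(2)[OF assms, of n] by simp
    then have "integral {a..b} (lag (qs n) (gs n)) \<le> m0 + e n"
      using m0_nonneg e_nonneg[of n] by (simp add: ennreal_plus[symmetric] ennreal_le_iff del: ennreal_plus)
    then show ?thesis using lag_seq(3)[OF assms, of n] by simp
  qed
  then show "\<exists>N. \<forall>n\<ge>N. integral {a..b} (\<lambda>r. V (qs n r) - c) \<le> m0 + e n" by blast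
qed

lemma disc_tendsto: "(\<lambda>n. disc \<Phi> (qs n) a h N) \<longlonglongrightarrow> disc \<Phi> q a h N"
proof -
  have "isCont \<Phi> x" for x using Phi_cont continuous_on_eq_continuous_at by blast
  then show ?thesis unfolding disc_def divide_inverse
    by (intro tendsto_intros isCont_tendsto_compose[of _ \<Phi>] conv)
qed

text \<open>Replace \<open>qs n\<close> on \<open>[a,b]\<close> by \<open>\<gamma>\<close>, corrected linearly at the end points, at the price of a
  time shift, and let \<open>n\<close> tend to infinity. The kinetic part of the limit \<open>q\<close>, not yet known to be
  weakly differentiable, is replaced by its discretization \<open>disc\<close>, which Jensen's inequality bounds by the
  kinetic part of \<open>qs n\<close>.\<close>

lemma comparison:
  assumes ab: "a < b" and T: "T > 0" and w: "primitive \<gamma> w" "\<And>t. norm (w t) \<le> B"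
    and ends: "\<gamma> a = q a" "\<gamma> (a + T) = q b" and inside: "\<And>t. t \<in> {a..a + T} \<Longrightarrow> V (\<gamma> t) > c" and N: "N > 0"
  shows "disc \<Phi> q a ((b - a) / real N) N + integral {a..b} (\<lambda>r. V (q r) - c) \<le> integral {a..a + T} (lag \<gamma> w)"
proof -
  define ea where "ea n = qs n a - q a" for n
  define eb where "eb n = qs n b - q b" for n
  \<comment> \<open>Slope of the linear correction that distributes the end point errors ea and eb
    over [a, a + T], so that the corrected curve joins \<open>qs n a\<close> to
    \<open>qs n b\<close>.\<close>
  define v where "v n = (eb n - ea n) /\<^sub>R T" for n
  define \<gamma>n where "\<gamma>n n t = \<gamma> t + ((ea n - a *\<^sub>R v n) + t *\<^sub>R v n)" for n t
  define wn where "wn n t = w t + v n" for n t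
  have ea0: "ea \<longlonglongrightarrow> 0" unfolding ea_def[abs_def] using tendsto_diff[OF conv tendsto_const, of a "q a"] by simp
  have eb0: "eb \<longlonglongrightarrow> 0" unfolding eb_def[abs_def] using tendsto_diff[OF conv tendsto_const, of b "q b"] by simp
  have v0: "v \<longlonglongrightarrow> 0" unfolding v_def[abs_def] using tendsto_scaleR[OF tendsto_const tendsto_diff[OF eb0 ea0], of "inverse T"] by simp
  have pn: "primitive (\<gamma>n n) (wn n)" for n
    unfolding \<gamma>n_def[abs_def] wn_def[abs_def] by (rule primitive_add[OF w(1) primitive_linear])
  have nea: "\<gamma>n n a = qs n a" for n by (simp add: \<gamma>n_def ends ea_def)
  have neb: "\<gamma>n n (a + T) = qs n b" for n
  proof -
    have "T *\<^sub>R v n = eb n - ea n" using T by (simp add: v_def)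
    moreover have "\<gamma>n n (a + T) = q b + (ea n + T *\<^sub>R v n)" by (simp add: \<gamma>n_def ends scaleR_left_distrib)
    ultimately show ?thesis by (simp add: eb_def)
  qed
  have near: "norm (\<gamma>n n t - \<gamma> t) \<le> norm (ea n) + T * norm (v n)" if "t \<in> {a..a + T}" for n t
  proof -
    have "\<gamma>n n t - \<gamma> t = ea n + (t - a) *\<^sub>R v n" by (simp add: \<gamma>n_def scaleR_diff_left)
    also have "norm \<dots> \<le> norm (ea n) + (t - a) * norm (v n)"
      using that norm_triangle_ineq[of "ea n" "(t - a) *\<^sub>R v n"] by simp
    also have "\<dots> \<le> norm (ea n) + T * norm (v n)" using that by (intro add_left_mono mult_right_mono) auto
    finally show ?thesis .
  qed
  have \<eta>0: "(\<lambda>n. norm (ea n) + T * norm (v n)) \<longlonglongrightarrow> 0"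
    using tendsto_add[OF tendsto_norm_zero[OF ea0] tendsto_mult_right_zero[OF tendsto_norm_zero[OF v0], of T]] by simp
  have cg: "continuous_on {a..a + T} \<gamma>" by (rule continuous_on_subset[OF primitive_cont[OF w(1)]]) auto
  have "compact (\<gamma> ` {a..a + T})" using cg by (intro compact_continuous_image) auto
  from compact_imp_bounded[OF this] obtain r where "\<forall>x\<in>\<gamma> ` {a..a + T}. norm x \<le> r"
    unfolding bounded_iff by blast
  then have r: "\<And>t. t \<in> {a..a + T} \<Longrightarrow> norm (\<gamma> t) \<le> r" by blast
  have cVg: "continuous_on {a..a + T} (\<lambda>t. V (\<gamma> t))" by (rule continuous_on_compose2[OF V_cont[of UNIV] cg]) auto
  \<comment> \<open>By compactness V - c has a positive minimum \<delta> along \<gamma>, so a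
    uniformly small correction keeps the competitor above level c, for n \<ge> n0.\<close>
  obtain t0 where t0: "t0 \<in> {a..a + T}" "\<And>t. t \<in> {a..a + T} \<Longrightarrow> V (\<gamma> t0) \<le> V (\<gamma> t)"
    using continuous_attains_inf[OF _ _ cVg] T by auto
  define \<delta> where "\<delta> = V (\<gamma> t0) - c"
  have \<delta>: "\<delta> > 0" using inside[OF t0(1)] by (simp add: \<delta>_def)
  have "uniformly_continuous_on (cball 0 (r + 1)) V" by (intro compact_uniformly_continuous V_cont) auto
  then obtain \<rho> where \<rho>: "\<rho> > 0" "\<And>x y. x \<in> cball 0 (r + 1) \<Longrightarrow> y \<in> cball 0 (r + 1) \<Longrightarrow> dist y x < \<rho> \<Longrightarrow> dist (V y) (V x) < \<delta>"
    unfolding uniformly_continuous_on_def using \<delta> by metis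
  have "\<forall>\<^sub>F n in sequentially. norm (ea n) + T * norm (v n) < min \<rho> 1"
    using \<eta>0 \<rho>(1) by (intro order_tendstoD) auto
  then obtain n0 where n0: "\<And>n. n \<ge> n0 \<Longrightarrow> norm (ea n) + T * norm (v n) < min \<rho> 1"
    by (auto simp: eventually_sequentially)
  have nb: "norm (\<gamma>n n t) \<le> r + 1" if "n \<ge> n0" "t \<in> {a..a + T}" for n t
    using near[OF that(2), of n] n0[OF that(1)] r[OF that(2)] norm_triangle_sub[of "\<gamma>n n t" "\<gamma> t"] by linarith
  have Vn: "V (\<gamma>n n t) \<ge> c" if "n \<ge> n0" "t \<in> {a..a + T}" for n t
  proof -
    have "dist (V (\<gamma>n n t)) (V (\<gamma> t)) < \<delta>"
      using near[OF that(2), of n] n0[OF that(1)] r[OF that(2)] nb[OF that] by (intro \<rho>(2)) (auto simp: dist_norm)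
    then show ?thesis using t0(2)[OF that(2)] by (auto simp: \<delta>_def dist_real_def)
  qed
  have wb: "norm (wn n t) \<le> B + norm (v n)" for n t
    using norm_triangle_ineq[of "w t" "v n"] w(2)[of t] by (simp add: wn_def)
  \<comment> \<open>The tail of \<open>qs n\<close> after time b is moved so as to start at time a +
    T.\<close>
  define d where "d = b - (a + T)"
  have key: "integral {a..b} (lag (qs n) (gs n)) \<le> integral {a..a + T} (lag (\<gamma>n n) (wn n)) + e n" if n: "n \<ge> n0" for n
  proof -
    define p2 where "p2 = (\<lambda>t. qs n (t + d))"
    define g2 where "g2 = (\<lambda>t. gs n (t + d))"
    have pr2: "primitive p2 g2" unfolding p2_def g2_def by (rule primitive_shift[OF prim_seq])
    have e2: "\<gamma>n n (a + T) = p2 (a + T)" by (simp add: neb p2_def d_def)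
    have pr3: "primitive (glue (a + T) (\<gamma>n n) p2) (glue (a + T) (wn n) g2)" by (rule primitive_glue[OF pn pr2 e2])
    have e1: "qs n a = glue (a + T) (\<gamma>n n) p2 a" using T by (simp add: glue_def nea)
    define p where "p = glue a (qs n) (glue (a + T) (\<gamma>n n) p2)"
    define g where "g = glue a (gs n) (glue (a + T) (wn n) g2)"
    have "adm Vm Vp p g"
      unfolding adm_def
    proof (intro conjI)
      have "primitive p g" unfolding p_def g_def by (rule primitive_glue[OF prim_seq pr3 e1])
      moreover have "V (p t) \<ge> c" for t
        using Vn[OF n] pathD(2)[OF path_seq] by (simp add: p_def glue_def p2_def)
      ultimately show "path p g" by (simp add: path_def)
      show "from_near Vm p" unfolding p_def using adm_seq[of n] by (intro from_near_glue) (simp add: adm_def)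
      show "to_near Vp p" unfolding p_def p2_def using adm_seq[of n] by (intro to_near_glue to_near_shift) (simp add: adm_def)
    qed
    then have "ennreal m0 \<le> act UNIV p g" by (rule minimal)
    also have "act UNIV p g = act {..a} (qs n) (gs n) + act {a<..} (glue (a + T) (\<gamma>n n) p2) (glue (a + T) (wn n) g2)"
      unfolding p_def g_def by (subst act_glue[OF prim_seq pr3 e1]) auto
    also have "act {a<..} (glue (a + T) (\<gamma>n n) p2) (glue (a + T) (wn n) g2)
        = act ({a<..} \<inter> {..a + T}) (\<gamma>n n) (wn n) + act ({a<..} \<inter> {a + T<..}) p2 g2"
      by (rule act_glue[OF pn pr2 e2]) auto
    also have "{a<..} \<inter> {..a + T} = {a<..a + T}" by auto
    also have "{a<..} \<inter> {a + T<..} = {a + T<..}" using T by auto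
    also have "act {a + T<..} p2 g2 = act {b<..} (qs n) (gs n)"
      unfolding p2_def g2_def by (subst act_shift[OF prim_seq]) (simp add: d_def)
    finally have 1: "ennreal m0 \<le> act {..a} (qs n) (gs n) + act {a..a + T} (\<gamma>n n) (wn n) + act {b<..} (qs n) (gs n)"
      by (simp add: act_Ioc add.assoc)
    have "act UNIV (qs n) (gs n) = act ({..a} \<union> ({a<..b} \<union> {b<..})) (qs n) (gs n)"
      using ab by (intro arg_cong[of _ _ "\<lambda>S. act S _ _"]) auto
    also have "\<dots> = act {..a} (qs n) (gs n) + act ({a<..b} \<union> {b<..}) (qs n) (gs n)"
      by (rule act_Un[OF prim_seq]) (use ab in auto)
    also have "act ({a<..b} \<union> {b<..}) (qs n) (gs n) = act {a<..b} (qs n) (gs n) + act {b<..} (qs n) (gs n)"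
      by (rule act_Un[OF prim_seq]) auto
    finally have 2: "act {..a} (qs n) (gs n) + act {a..b} (qs n) (gs n) + act {b<..} (qs n) (gs n) \<le> ennreal m0 + ennreal (e n)"
      using act_seq[of n] by (simp add: act_Ioc add.assoc)
    have "act {a..b} (qs n) (gs n) \<le> act {a..a + T} (\<gamma>n n) (wn n) + ennreal (e n)"
      by (rule adm_act_le_cancel[OF 2 1])
    also have "act {a..a + T} (\<gamma>n n) (wn n) = ennreal (integral {a..a + T} (lag (\<gamma>n n) (wn n)))"
      using Vn[OF n] wb by (intro act_bounded[OF pn]) auto
    also have "act {a..b} (qs n) (gs n) = ennreal (integral {a..b} (lag (qs n) (gs n)))"
      using ab by (intro lag_seq) auto
    finally have "ennreal (integral {a..b} (lag (qs n) (gs n))) \<le> ennreal (integral {a..a + T} (lag (\<gamma>n n) (wn n))) + ennreal (e n)" .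
    moreover have "integral {a..a + T} (lag (\<gamma>n n) (wn n)) \<ge> 0"
    proof (rule Henstock_Kurzweil_Integration.integral_nonneg)
      show "lag (\<gamma>n n) (wn n) integrable_on {a..a + T}"
        using wb by (intro set_lebesgue_integral_eq_integral(1) lag_bounded_integrable[OF pn]) auto
      show "0 \<le> lag (\<gamma>n n) (wn n) t" if "t \<in> {a..a + T}" for t
        using Vn[OF n that] Phi_nonneg[of "norm (wn n t)"] by (simp add: lag_def)
    qed
    ultimately show ?thesis using e_nonneg[of n] by (simp add: ennreal_plus[symmetric] ennreal_le_iff del: ennreal_plus)
  qed
  define h where "h = (b - a) / real N"
  have h: "h > 0" "a + real N * h = b" using ab N by (auto simp: h_def)
  have low: "disc \<Phi> (qs n) a h N + integral {a..b} (\<lambda>r. V (qs n r) - c) \<le> integral {a..b} (lag (qs n) (gs n))" for n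
    using lag_integral_ge_disc[OF path_seq h(1), where a = a and N = N and n1 = n] lag_seq(1)[of a b n] ab by (simp add: h(2))
  obtain M where M: "M \<ge> 0" "\<forall>x\<in>cball 0 (r + 1). \<bar>V x - c\<bar> \<le> M" using V_bound by blast
  \<comment> \<open>The index is shifted by n0 because the uniform bounds hold only from there on;
    the velocity bound is B + 1/T because T times the norm of v is then at most 1.\<close>
  have lim: "(\<lambda>n. integral {a..a + T} (lag (\<gamma>n (n + n0)) (wn (n + n0)))) \<longlonglongrightarrow> integral {a..a + T} (lag \<gamma> w)"
  proof (rule dominated_convergence(2)[where h = "\<lambda>_. \<Phi> (B + 1 / T) + M"])
    show "lag (\<gamma>n (n + n0)) (wn (n + n0)) integrable_on {a..a + T}" for n
      using wb by (intro set_lebesgue_integral_eq_integral(1) lag_bounded_integrable[OF pn]) auto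
    show "norm (lag (\<gamma>n (n + n0)) (wn (n + n0)) t) \<le> \<Phi> (B + 1 / T) + M" if t: "t \<in> {a..a + T}" for n t
    proof -
      have "T * norm (v (n + n0)) \<le> 1" using n0[of "n + n0"] norm_ge_zero[of "ea (n + n0)"] by linarith
      then have "norm (v (n + n0)) \<le> 1 / T" using T by (simp add: field_simps)
      then have "\<Phi> (norm (wn (n + n0) t)) \<le> \<Phi> (B + 1 / T)" using wb[of "n + n0" t] by (intro Phi_mono) auto
      moreover have "\<bar>V (\<gamma>n (n + n0) t) - c\<bar> \<le> M" using M(2) nb[of "n + n0" t] t by simp
      ultimately show ?thesis using Phi_nonneg[of "norm (wn (n + n0) t)"] by (simp add: lag_def)
    qed
    show "(\<lambda>n. lag (\<gamma>n (n + n0)) (wn (n + n0)) t) \<longlonglongrightarrow> lag \<gamma> w t" if t: "t \<in> {a..a + T}" for t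
    proof -
      have "(\<lambda>n. \<gamma>n n t - \<gamma> t) \<longlonglongrightarrow> 0"
        by (rule tendsto_norm_zero_cancel, rule real_tendsto_sandwich[OF _ _ tendsto_const \<eta>0]) (use near[OF t] in auto)
      then have 1: "(\<lambda>n. \<gamma>n n t) \<longlonglongrightarrow> \<gamma> t" by (simp add: LIM_zero_iff)
      have 2: "(\<lambda>n. wn n t) \<longlonglongrightarrow> w t" unfolding wn_def using tendsto_add[OF tendsto_const v0, of "w t"] by simp
      have cP: "isCont \<Phi> x" for x using Phi_cont continuous_on_eq_continuous_at by blast
      have cV: "isCont V x" for x using V_cont[of UNIV] continuous_on_eq_continuous_at by blast
      have "(\<lambda>n. lag (\<gamma>n n) (wn n) t) \<longlonglongrightarrow> lag \<gamma> w t"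
        unfolding lag_def by (intro tendsto_intros isCont_tendsto_compose[OF cP] isCont_tendsto_compose[OF cV] 1 2)
      then show ?thesis by (rule LIMSEQ_ignore_initial_segment)
    qed
  qed auto
  have "disc \<Phi> q a h N + integral {a..b} (\<lambda>r. V (q r) - c) \<le> integral {a..a + T} (lag \<gamma> w) + 0"
  proof (rule LIMSEQ_le)
    show "(\<lambda>n. disc \<Phi> (qs (n + n0)) a h N + integral {a..b} (\<lambda>r. V (qs (n + n0) r) - c))
        \<longlonglongrightarrow> disc \<Phi> q a h N + integral {a..b} (\<lambda>r. V (q r) - c)"
      by (rule LIMSEQ_ignore_initial_segment[OF tendsto_add[OF disc_tendsto integral_V_tendsto]])
    show "(\<lambda>n. integral {a..a + T} (lag (\<gamma>n (n + n0)) (wn (n + n0))) + e (n + n0)) \<longlonglongrightarrow> integral {a..a + T} (lag \<gamma> w) + 0"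
      by (rule tendsto_add[OF lim LIMSEQ_ignore_initial_segment[OF e_lim]])
    show "\<exists>K. \<forall>n\<ge>K. disc \<Phi> (qs (n + n0)) a h N + integral {a..b} (\<lambda>r. V (qs (n + n0) r) - c)
        \<le> integral {a..a + T} (lag (\<gamma>n (n + n0)) (wn (n + n0))) + e (n + n0)"
      using low key by (meson le_add2 order_trans)
  qed
  then show ?thesis by (simp add: h_def)
qed

text \<open>If \<open>q\<close> is \<open>\<epsilon>\<close>-close to \<open>Vm\<close> at time \<open>b\<close>, then a competitor may wait in \<open>Vm\<close> and join \<open>q b\<close> by a
  segment of length about \<open>\<epsilon>\<close>, so everything before \<open>b\<close> costs at most a multiple of \<open>\<epsilon>\<close>.\<close>

lemma cut:
  "\<exists>C>0. \<forall>\<xi>\<in>Vm. \<forall>s b \<epsilon>. s \<le> b \<longrightarrow> 0 < \<epsilon> \<longrightarrow> \<epsilon> \<le> min 1 (setdist Vm Vp) \<longrightarrow> dist (q b) \<xi> < \<epsilon> \<longrightarrow>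
     integral {s..b} (\<lambda>r. V (q r) - c) \<le> C * \<epsilon>"
proof -
  obtain M where M: "M \<ge> 0" "\<forall>x\<in>cball 0 (R + 1). \<bar>V x - c\<bar> \<le> M" using V_bound by blast
  \<comment> \<open>Bounds the Lagrangian along a connecting segment run at unit speed: its length
    is below 1, so it stays in the ball of radius R + 1.\<close>
  define C where "C = \<Phi> 1 + M + 1"
  have C: "C > 0" using M(1) Phi_nonneg[of 1] by (simp add: C_def)
  show ?thesis
  proof (intro exI[of _ C] conjI ballI allI impI C)
    fix \<xi> s b \<epsilon> assume \<xi>: "\<xi> \<in> Vm" and sb: "s \<le> b" and \<epsilon>: "0 < \<epsilon>" "\<epsilon> \<le> min 1 (setdist Vm Vp)" and d: "dist (q b) \<xi> < \<epsilon>"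
    have "(\<lambda>n. dist (qs n b) \<xi>) \<longlonglongrightarrow> dist (q b) \<xi>" by (intro tendsto_intros conv)
    then have "\<forall>\<^sub>F n in sequentially. dist (qs n b) \<xi> < \<epsilon>" using d by (rule order_tendstoD)
    then obtain n0 where n0: "\<And>n. n \<ge> n0 \<Longrightarrow> dist (qs n b) \<xi> < \<epsilon>" by (auto simp: eventually_sequentially)
    have key: "integral {s..b} (\<lambda>r. V (qs n r) - c) \<le> C * \<epsilon> + e n" if n: "n \<ge> n0" for n
    proof -
      define x where "x = qs n b"
      \<comment> \<open>If \<xi> = x, then u = 0 and L = 0 and the construction degenerates
        correctly; this is why only norm u \<le> 1 is claimed.\<close>
      define u where "u = sgn (\<xi> - x)"
      define L where "L = norm (\<xi> - x)"
      have L: "0 \<le> L" "L < \<epsilon>" using n0[OF n] by (auto simp: L_def x_def dist_norm norm_minus_commute)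
      have nu: "norm u \<le> 1" by (simp add: u_def norm_sgn)
      have Lu: "x + L *\<^sub>R u = \<xi>" by (cases "\<xi> = x") (auto simp: L_def u_def sgn_div_norm)
      have cf: "continuous_on {0..L} (\<lambda>t. x + t *\<^sub>R u)" by (intro continuous_intros)
      have h: "V (x + L *\<^sub>R u) \<le> c" "c \<le> V (x + 0 *\<^sub>R u)"
        using V_le(1)[OF \<xi>] pathD(2)[OF path_seq, of n b] by (simp_all add: Lu) (simp add: x_def)
      \<comment> \<open>The segment may leave the region V \<ge> c before it reaches \<xi>, so it is
        stopped when it first meets level c.\<close>
      obtain T where T: "T \<in> {0..L}" "V (x + T *\<^sub>R u) = c" "\<And>t. t \<in> {0..T} \<Longrightarrow> V (x + t *\<^sub>R u) \<ge> c"
        using first_hit[OF cf L(1) h] by blast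
      define z where "z = x + T *\<^sub>R u"
      \<comment> \<open>A stopping point in Vp would be closer to \<xi> than the distance of the
        wells, since L < \<epsilon>.\<close>
      have z: "z \<in> Vm"
      proof (rule ccontr)
        assume "z \<notin> Vm"
        moreover have "z \<in> Vm \<union> Vp" using T(2) sublevel unfolding z_def by (metis (mono_tags, lifting) mem_Collect_eq order_refl)
        ultimately have "setdist Vm Vp \<le> dist \<xi> z" using \<xi> by (intro setdist_le_dist) auto
        also have "dist \<xi> z = norm ((L - T) *\<^sub>R u)" by (simp add: z_def Lu[symmetric] dist_norm scaleR_diff_left)
        also have "\<dots> \<le> L" using T(1) mult_left_le[OF nu, of "L - T"] by simp
        finally show False using L \<epsilon> by simp
      qed
      define g0 where "g0 = (\<lambda>_::real. 0::'a)"
      define p0 where "p0 = (\<lambda>_::real. z)"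
      \<comment> \<open>The segment run backwards at unit speed: it leaves z at time b - T and
        arrives at x at time b.\<close>
      define p1 where "p1 = (\<lambda>t. (x + b *\<^sub>R u) + t *\<^sub>R (- u))"
      define g1 where "g1 = (\<lambda>_::real. - u)"
      have pr: "primitive p0 g0" "primitive p1 g1"
        unfolding p0_def g0_def p1_def g1_def by (rule primitive_const primitive_linear)+
      have p1_eq: "p1 t = x + (b - t) *\<^sub>R u" for t by (simp add: p1_def scaleR_diff_left)
      have e0: "p0 (b - T) = p1 (b - T)" by (simp add: p1_eq p0_def z_def)
      have prg: "primitive (glue (b - T) p0 p1) (glue (b - T) g0 g1)" by (rule primitive_glue[OF pr e0])
      have e1: "glue (b - T) p0 p1 b = qs n b" using T(1) e0 by (auto simp: glue_def p1_eq x_def)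
      define p where "p = glue b (glue (b - T) p0 p1) (qs n)"
      define g where "g = glue b (glue (b - T) g0 g1) (gs n)"
      have Vp1: "V (p1 t) \<ge> c" if "t \<in> {b - T..b}" for t using T(3)[of "b - t"] that by (simp add: p1_eq)
      have Vz: "V z = c" using T(2) by (simp add: z_def)
      have "adm Vm Vp p g"
        unfolding adm_def
      proof (intro conjI)
        have "primitive p g" unfolding p_def g_def by (rule primitive_glue[OF prg prim_seq e1])
        moreover have "V (p t) \<ge> c" for t
          using Vp1 pathD(2)[OF path_seq] Vz by (simp add: p_def glue_def p0_def)
        ultimately show "path p g" by (simp add: path_def)
        show "from_near Vm p" unfolding p_def
          by (intro from_near_glue) (use z in \<open>auto simp: from_near_def p0_def mem_Vm_iff\<close>)
        show "to_near Vp p" unfolding p_def using adm_seq[of n] by (intro to_near_glue) (simp add: adm_def)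
      qed
      then have "ennreal m0 \<le> act UNIV p g" by (rule minimal)
      also have "act UNIV p g = act {..b} (glue (b - T) p0 p1) (glue (b - T) g0 g1) + act {b<..} (qs n) (gs n)"
        unfolding p_def g_def by (subst act_glue[OF prg prim_seq e1]) auto
      also have "act {..b} (glue (b - T) p0 p1) (glue (b - T) g0 g1)
          = act ({..b} \<inter> {..b - T}) p0 g0 + act ({..b} \<inter> {b - T<..}) p1 g1"
        by (rule act_glue[OF pr e0]) auto
      also have "act ({..b} \<inter> {..b - T}) p0 g0 = 0" by (simp add: act_def lag_def p0_def g0_def Vz)
      also have "act ({..b} \<inter> {b - T<..}) p1 g1 \<le> act {b - T..b} p1 g1" by (rule act_mono) auto
      also have "act {b - T..b} p1 g1 = ennreal (integral {b - T..b} (lag p1 g1))"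
        using Vp1 nu by (intro act_bounded[OF pr(2), where B = 1]) (auto simp: g1_def)
      also have "\<dots> \<le> ennreal (C * \<epsilon>)"
      proof (rule ennreal_leI)
        have "integral {b - T..b} (lag p1 g1) \<le> integral {b - T..b} (\<lambda>_. C)"
        proof (rule integral_le)
          show "lag p1 g1 integrable_on {b - T..b}"
            using nu by (intro set_lebesgue_integral_eq_integral(1) lag_bounded_integrable[OF pr(2), where B = 1]) (auto simp: g1_def)
          show "lag p1 g1 t \<le> C" if t: "t \<in> {b - T..b}" for t
          proof -
            have "norm ((b - t) *\<^sub>R u) \<le> 1 * 1"
              unfolding norm_scaleR using t T(1) L \<epsilon> nu by (intro mult_mono) auto
            then have "norm (p1 t) \<le> R + 1"
              using norm_triangle_ineq[of x "(b - t) *\<^sub>R u"] bnd[of n b] by (simp add: p1_eq x_def)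
            then have "\<bar>V (p1 t) - c\<bar> \<le> M" using M(2) by simp
            moreover have "\<Phi> (norm (g1 t)) \<le> \<Phi> 1" using nu by (intro Phi_mono) (auto simp: g1_def)
            ultimately show ?thesis by (simp add: lag_def C_def)
          qed
        qed auto
        also have "\<dots> \<le> C * \<epsilon>" using T(1) L C by (simp add: mult.commute)
        finally show "integral {b - T..b} (lag p1 g1) \<le> C * \<epsilon>" .
      qed
      finally have 1: "ennreal m0 \<le> 0 + ennreal (C * \<epsilon>) + act {b<..} (qs n) (gs n)"
        by (simp add: add_right_mono)
      have "act {s..b} (qs n) (gs n) + act {b<..} (qs n) (gs n) = act ({s..b} \<union> {b<..}) (qs n) (gs n)"
        by (subst act_Un[OF prim_seq]) auto
      also have "\<dots> \<le> ennreal m0 + ennreal (e n)" by (rule order_trans[OF act_mono[OF subset_UNIV] act_seq])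
      finally have 2: "0 + act {s..b} (qs n) (gs n) + act {b<..} (qs n) (gs n) \<le> ennreal m0 + ennreal (e n)" by simp
      have "act {s..b} (qs n) (gs n) \<le> ennreal (C * \<epsilon>) + ennreal (e n)" by (rule adm_act_le_cancel[OF 2 1])
      then have "integral {s..b} (lag (qs n) (gs n)) \<le> C * \<epsilon> + e n"
        using lag_seq(2)[OF sb, of n] C \<epsilon>(1) e_nonneg[of n]
        by (simp add: ennreal_plus[symmetric] ennreal_le_iff del: ennreal_plus)
      then show ?thesis using lag_seq(3)[OF sb, of n] by simp
    qed
    have "integral {s..b} (\<lambda>r. V (q r) - c) \<le> C * \<epsilon> + 0"
      by (rule LIMSEQ_le[OF integral_V_tendsto tendsto_add[OF tendsto_const e_lim]]) (use key in blast)
    then show "integral {s..b} (\<lambda>r. V (q r) - c) \<le> C * \<epsilon>" by simp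
  qed
qed

end

section \<open>Polygonal interpolation and the Euler-Lagrange equation\<close>

text \<open>Slope at time t of the polygon through the values of q at a + k h; at a node it is the
  slope of the cell to the right.\<close>

definition stepw :: "(real \<Rightarrow> 'a::real_normed_vector) \<Rightarrow> real \<Rightarrow> real \<Rightarrow> real \<Rightarrow> 'a" where
  "stepw q a h t = (q (a + (of_int \<lfloor>(t - a) / h\<rfloor> + 1) * h) - q (a + of_int \<lfloor>(t - a) / h\<rfloor> * h)) /\<^sub>R h"

lemma stepw_eq:
  assumes "h > 0" "a + real k * h \<le> t" "t < a + real (Suc k) * h"
  shows "stepw q a h t = (q (a + real (Suc k) * h) - q (a + real k * h)) /\<^sub>R h"
proof -
  have "real k \<le> (t - a) / h" "(t - a) / h < real k + 1"
    using assms by (simp_all add: field_simps)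
  then have "\<lfloor>(t - a) / h\<rfloor> = int k" by (intro floor_unique) auto
  then show ?thesis by (simp add: stepw_def add.commute)
qed

text \<open>The function F is left free: the identity recovers q at the nodes, and
  \<open>\<Phi>\<close> of the norm gives \<open>disc\<close>.\<close>

lemma stepw_has_integral:
  fixes F :: "'a::real_normed_vector \<Rightarrow> 'b::banach"
  assumes h: "h > 0"
  shows "((\<lambda>t. F (stepw q a h t)) has_integral
    (\<Sum>i<k. h *\<^sub>R F ((q (a + real (Suc i) * h) - q (a + real i * h)) /\<^sub>R h))) {a..a + real k * h}"
proof (induction k)
  case 0
  show ?case using has_integral_null_real[of a a] by simp
next
  case (Suc k)
  define s where "s = a + real k * h"
  define t where "t = a + real (Suc k) * h"
  have st: "a \<le> s" "s < t" "t - s = h" using h by (auto simp: s_def t_def algebra_simps)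
  define y where "y = F ((q t - q s) /\<^sub>R h)"
  have "((\<lambda>_. y) has_integral h *\<^sub>R y) {s..t}"
    using has_integral_const_real[of y s t] st by simp
  then have "((\<lambda>r. F (stepw q a h r)) has_integral h *\<^sub>R y) {s..t}"
  proof (rule has_integral_spike_finite[of "{t}", rotated 2])
    fix r assume "r \<in> {s..t} - {t}"
    then have "a + real k * h \<le> r" "r < a + real (Suc k) * h" by (auto simp: s_def t_def)
    from stepw_eq[OF h this, of q] show "F (stepw q a h r) = y" by (simp add: y_def s_def t_def)
  qed simp
  from has_integral_combine[OF st(1) less_imp_le[OF st(2)] Suc.IH[folded s_def] this]
  show ?case by (simp add: y_def s_def t_def)
qed

lemma stepw_bound:
  assumes h: "h > 0" and L: "\<And>s t. s \<in> {a..a + real N * h} \<Longrightarrow> t \<in> {a..a + real N * h} \<Longrightarrow> norm (q t - q s) \<le> L * \<bar>t - s\<bar>"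
    and t: "a \<le> t" "t < a + real N * h"
  shows "norm (stepw q a h t) \<le> L"
proof -
  define k where "k = nat \<lfloor>(t - a) / h\<rfloor>"
  have fl: "\<lfloor>(t - a) / h\<rfloor> = int k" using t h by (simp add: k_def)
  have k: "real k \<le> (t - a) / h" "(t - a) / h < real k + 1"
    using fl floor_correct[of "(t - a) / h"] by auto
  have kt: "a + real k * h \<le> t" "t < a + real (Suc k) * h" using k h by (simp_all add: field_simps)
  have "(t - a) / h < real N" using t h by (simp add: field_simps)
  then have "k < N" using k(1) by linarith
  then have "real (Suc k) * h \<le> real N * h" using h by (intro mult_right_mono) auto
  then have "norm (q (a + real (Suc k) * h) - q (a + real k * h)) \<le> L * \<bar>(a + real (Suc k) * h) - (a + real k * h)\<bar>"
    using h \<open>k < N\<close> by (intro L) (auto simp: algebra_simps)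
  also have "\<dots> = L * h" using h by (simp add: algebra_simps)
  finally show ?thesis unfolding stepw_eq[OF h kt] norm_scaleR using h by (simp add: field_simps)
qed

lemma stepw_measurable:
  fixes q :: "real \<Rightarrow> 'a::euclidean_space"
  assumes "continuous_on UNIV q" shows "stepw q a h \<in> borel_measurable borel"
proof -
  have [measurable]: "q \<in> borel_measurable borel" using assms by (rule borel_measurable_continuous_onI)
  show ?thesis unfolding stepw_def[abs_def] by measurable
qed

lemma primitive_cmul:
  assumes p: "primitive q g" shows "primitive (\<lambda>t. k *\<^sub>R q t) (\<lambda>t. k *\<^sub>R g t)"
  unfolding primitive_def
proof (intro conjI allI impI)
  show "(\<lambda>t. k *\<^sub>R g t) \<in> borel_measurable borel" using primitiveD(1)[OF p] by measurable
  fix s t :: real assume st: "s \<le> t"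
  show "(\<lambda>t. k *\<^sub>R g t) absolutely_integrable_on {s..t}"
    using primitiveD(2)[OF p, of s t] by (rule absolutely_integrable_scaleR_left)
  show "integral {s..t} (\<lambda>t. k *\<^sub>R g t) = k *\<^sub>R q t - k *\<^sub>R q s"
    using primitiveD(4)[OF p st] by (simp add: scaleR_diff_right)
qed

context potential
begin

text \<open>With \<open>w\<close> the slope of the polygonal interpolation of \<open>q\<close>, \<open>P\<close> a primitive of \<open>\<nabla>V(q)\<close> and \<open>cs\<close>
  the mean of \<open>mom w - P\<close>, the variation of the interpolation in the direction with derivative
  \<open>-(mom w - P - cs)\<close> shows that \<open>mom w - P - cs\<close> tends to zero in mean square.\<close>

lemma euler_lagrange_step:
  fixes q :: "real \<Rightarrow> 'a"
  assumes q: "continuous_on UNIV q" and ab: "a < b" and L: "L \<ge> 0"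
    and lip: "\<And>s t. s \<in> {a..b} \<Longrightarrow> t \<in> {a..b} \<Longrightarrow> norm (q t - q s) \<le> L * \<bar>t - s\<bar>"
    and r: "r > 0"
    and cmp: "\<And>N \<gamma> w B. N > 0 \<Longrightarrow> primitive \<gamma> w \<Longrightarrow> (\<And>t. norm (w t) \<le> B) \<Longrightarrow> \<gamma> a = q a \<Longrightarrow> \<gamma> b = q b \<Longrightarrow>
      (\<And>t. t \<in> {a..b} \<Longrightarrow> dist (\<gamma> t) (q t) < r) \<Longrightarrow>
      disc \<Phi> q a ((b - a) / real N) N + integral {a..b} (\<lambda>t. V (q t) - c) \<le> integral {a..b} (lag \<gamma> w)"
  obtains P w cs and \<gamma> where
    "\<And>t. t \<in> {a..b} \<Longrightarrow> (P has_vector_derivative grad V (q t)) (at t within {a..b})"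
    "P \<in> borel_measurable borel" "bounded (range P)"
    "\<And>N. w N \<in> borel_measurable borel" "\<And>N t. norm (w N t) \<le> L" "bounded (range cs)"
    "\<And>N::nat. N > 0 \<Longrightarrow> primitive (\<gamma> N) (w N)" "\<And>t. t \<in> {a..b} \<Longrightarrow> (\<lambda>N. \<gamma> N t) \<longlonglongrightarrow> q t"
    "(\<lambda>N. integral {a..b} (\<lambda>t. (norm (mom (w N t) - P t - cs N))\<^sup>2)) \<longlonglongrightarrow> 0"
proof -
  define gq where "gq t = grad V (q t)" for t
  have cgq: "continuous_on A gq" for A
    unfolding gq_def[abs_def] by (rule continuous_on_compose2[OF grad_cont[of UNIV] continuous_on_subset[OF q]]) auto
  define P where "P t = integral {a..t} gq" for t
  have Pd: "(P has_vector_derivative gq t) (at t within {a..b})" if "t \<in> {a..b}" for t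
    unfolding P_def[abs_def] by (rule integral_has_vector_derivative[OF cgq that])
  have cP: "continuous_on {a..b} P" using Pd by (rule continuous_on_vector_derivative)
  obtain B2 where B2: "B2 \<ge> 0" "\<And>t. t \<in> {a..b} \<Longrightarrow> norm (P t) \<le> B2"
  proof -
    have "bounded (P ` {a..b})" by (intro compact_imp_bounded compact_continuous_image cP) auto
    then obtain B where "\<forall>x\<in>P ` {a..b}. norm x \<le> B" unfolding bounded_iff by blast
    then show ?thesis by (intro that[of "max B 0"]) (auto simp: le_max_iff_disj)
  qed
  obtain B3 where B3: "B3 \<ge> 0" "\<And>t. t \<in> {a..b} \<Longrightarrow> norm (gq t) \<le> B3"
  proof -
    have "bounded (gq ` {a..b})" by (intro compact_imp_bounded compact_continuous_image cgq) auto
    then obtain B where "\<forall>x\<in>gq ` {a..b}. norm x \<le> B" unfolding bounded_iff by blast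
    then show ?thesis by (intro that[of "max B 0"]) (auto simp: le_max_iff_disj)
  qed
  \<comment> \<open>P outside [a,b] is of no interest; cutting it off there makes it Borel and
    bounded on the whole line.\<close>
  define PP where "PP t = (if t \<in> {a..b} then P t else 0)" for t
  have PPm: "PP \<in> borel_measurable borel"
    unfolding PP_def using borel_measurable_continuous_on_if[OF _ cP continuous_on_const] by simp
  define h where "h N = (b - a) / real N" for N :: nat
  have h: "h N > 0" "a + real N * h N = b" if "N > 0" for N using ab that by (auto simp: h_def)
  define w where "w N t = (if a \<le> t \<and> t < b \<and> N > 0 then stepw q a (h N) t else 0)" for N t
  have wm: "w N \<in> borel_measurable borel" for N
  proof -
    have [measurable]: "stepw q a (h N) \<in> borel_measurable borel" by (rule stepw_measurable[OF q])
    show ?thesis unfolding w_def[abs_def] by measurable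
  qed
  have wb: "norm (w N t) \<le> L" for N t
    using stepw_bound[OF h(1), of N a N q L t] lip h(2)[of N] L by (auto simp: w_def)
  have wi: "((\<lambda>t. F (w N t)) has_integral (\<Sum>i<k. h N *\<^sub>R F ((q (a + real (Suc i) * h N) - q (a + real i * h N)) /\<^sub>R h N))) {a..a + real k * h N}"
    if N: "N > 0" "k \<le> N" for N k and F :: "'a \<Rightarrow> 'c::banach"
  proof (rule has_integral_spike_finite[of "{b}", OF _ _ stepw_has_integral[OF h(1)[OF N(1)]]])
    fix t assume t: "t \<in> {a..a + real k * h N} - {b}"
    have "real k * h N \<le> real N * h N" using N h(1)[of N] by (intro mult_right_mono) auto
    then show "F (w N t) = F (stepw q a (h N) t)" using t h(2)[OF N(1)] N by (auto simp: w_def)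
  qed simp
  define \<gamma>0 where "\<gamma>0 N t = q a + (if a \<le> t then integral {a..t} (w N) else - integral {t..a} (w N))" for N t
  have p0: "primitive (\<gamma>0 N) (w N)" for N
    unfolding \<gamma>0_def[abs_def] by (rule primitive_bounded[OF wm wb])
  have node: "\<gamma>0 N (a + real k * h N) = q (a + real k * h N)" if N: "N > 0" "k \<le> N" for N k
  proof -
    have "a \<le> a + real k * h N" using h(1)[OF N(1)] by simp
    moreover have "integral {a..a + real k * h N} (w N) = (\<Sum>i<k. q (a + real (Suc i) * h N) - q (a + real i * h N))"
      using wi[OF N, of "\<lambda>x. x"] h(1)[OF N(1)] by (simp add: integral_unique)
    moreover have "\<dots> = q (a + real k * h N) - q a"
      using sum_lessThan_telescope[of "\<lambda>i. q (a + real i * h N)" k] by simp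
    ultimately show ?thesis by (simp add: \<gamma>0_def)
  qed
  have disc_eq: "disc \<Phi> q a (h N) N = integral {a..b} (\<lambda>t. \<Phi> (norm (w N t)))" if N: "N > 0" for N
    using wi[OF N order_refl, of "\<lambda>x. \<Phi> (norm x)"] h[OF N]
    by (simp add: disc_def integral_unique divide_inverse mult.commute)
  have near0: "norm (\<gamma>0 N t - q t) \<le> 2 * L * h N" if N: "N > 0" and t: "t \<in> {a..b}" for N t
  proof -
    define k where "k = nat \<lfloor>(t - a) / h N\<rfloor>"
    have fl: "\<lfloor>(t - a) / h N\<rfloor> = int k" using t h(1)[OF N] by (simp add: k_def)
    have k: "real k \<le> (t - a) / h N" "(t - a) / h N < real k + 1"
      using fl floor_correct[of "(t - a) / h N"] by auto
    define s where "s = a + real k * h N"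
    have s: "a \<le> s" "s \<le> t" "t - s \<le> h N" using k h(1)[OF N] by (simp_all add: field_simps s_def)
    have "(t - a) / h N \<le> real N" using t h[OF N] by (simp add: field_simps)
    then have "k \<le> N" using k(1) by linarith
    then have "\<gamma>0 N s = q s" unfolding s_def by (rule node[OF N])
    then have "\<gamma>0 N t - q t = (\<gamma>0 N t - \<gamma>0 N s) - (q t - q s)" by simp
    also have "norm \<dots> \<le> norm (\<gamma>0 N t - \<gamma>0 N s) + norm (q t - q s)" by (rule norm_triangle_ineq4)
    also have "norm (q t - q s) \<le> L * h N"
      using lip[of s t] s t L mult_left_mono[OF s(3) L] by auto
    also have "norm (\<gamma>0 N t - \<gamma>0 N s) \<le> L * h N"
    proof -
      have "norm (\<gamma>0 N t - \<gamma>0 N s) = norm (integral {s..t} (w N))" using primitiveD(4)[OF p0 s(2)] by simp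
      also have "\<dots> \<le> integral {s..t} (\<lambda>_. L)"
        by (rule integral_norm_bound_integral[OF primitiveD(3)[OF p0]]) (use wb in auto)
      also have "\<dots> \<le> L * h N" using s mult_left_mono[OF s(3) L] by (simp add: mult.commute)
      finally show ?thesis .
    qed
    finally show ?thesis by simp
  qed
  have h0: "h \<longlonglongrightarrow> 0" unfolding h_def by (rule lim_const_over_n)
  define cs where "cs N = integral {a..b} (\<lambda>t. mom (w N t) - PP t) /\<^sub>R (b - a)" for N
  \<comment> \<open>The negative L2 gradient of the action in the velocity variable, with its mean
    removed. Its primitive \<psi> therefore vanishes at both a and b and is an admissible
    variation.\<close>
  define \<zeta> where "\<zeta> N t = (if t \<in> {a..b} then - (mom (w N t) - PP t - cs N) else 0)" for N t
  have momm: "mom \<in> borel_measurable borel" by (rule borel_measurable_continuous_onI[OF mom_cont])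
  have mwm: "(\<lambda>t. mom (w N t)) \<in> borel_measurable borel" for N
    using measurable_compose[OF wm momm] .
  have mwb: "norm (mom (w N t)) \<le> \<alpha> L" for N t
    using wb[of N t] by (simp add: norm_mom \<alpha>_mono)
  have PPb: "norm (PP t) \<le> B2" for t using B2 by (simp add: PP_def)
  have d1: "norm (mom (w N t) - PP t) \<le> \<alpha> L + B2" for N t
    using norm_triangle_ineq4[of "mom (w N t)" "PP t"] mwb[of N t] PPb[of t] by linarith
  have i1: "(\<lambda>t. mom (w N t) - PP t) integrable_on {a..b}" for N
    by (rule set_lebesgue_integral_eq_integral(1)[OF bounded_borel_absolutely_integrable[OF borel_measurable_diff[OF mwm PPm] d1]])
  have csb: "norm (cs N) \<le> \<alpha> L + B2" for N
  proof -
    have "norm (integral {a..b} (\<lambda>t. mom (w N t) - PP t)) \<le> integral {a..b} (\<lambda>_. \<alpha> L + B2)"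
      by (rule integral_norm_bound_integral[OF i1]) (use d1 in auto)
    also have "\<dots> = (b - a) * (\<alpha> L + B2)" using ab by simp
    finally show ?thesis using ab by (simp add: cs_def field_simps)
  qed
  define Z where "Z = 2 * (\<alpha> L + B2)"
  have Z0: "Z \<ge> 0" using \<alpha>_nonneg[OF L] B2(1) by (simp add: Z_def)
  have \<zeta>b: "norm (\<zeta> N t) \<le> Z" for N t
    using norm_triangle_ineq4[of "mom (w N t) - PP t" "cs N"] d1[of N t] csb[of N] Z0
    by (auto simp: \<zeta>_def Z_def norm_minus_commute)
  have \<zeta>m: "\<zeta> N \<in> borel_measurable borel" for N
  proof -
    note [measurable] = mwm PPm
    show ?thesis unfolding \<zeta>_def[abs_def] by measurable
  qed
  define \<psi> where "\<psi> N t = 0 + (if a \<le> t then integral {a..t} (\<zeta> N) else - integral {t..a} (\<zeta> N))" for N t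
  have p\<psi>: "primitive (\<psi> N) (\<zeta> N)" for N
    unfolding \<psi>_def[abs_def] by (rule primitive_bounded[OF \<zeta>m \<zeta>b])
  have \<psi>a: "\<psi> N a = 0" for N by (simp add: \<psi>_def)
  have \<zeta>int: "integral {a..b} (\<zeta> N) = 0" for N
  proof -
    have "integral {a..b} (\<zeta> N) = integral {a..b} (\<lambda>t. cs N - (mom (w N t) - PP t))"
      by (rule integral_cong) (simp add: \<zeta>_def)
    also have "\<dots> = (b - a) *\<^sub>R cs N - integral {a..b} (\<lambda>t. mom (w N t) - PP t)"
      using i1 ab by (subst integral_diff) auto
    also have "\<dots> = 0" using ab by (simp add: cs_def)
    finally show ?thesis .
  qed
  have \<psi>b0: "\<psi> N b = 0" for N using \<zeta>int ab by (simp add: \<psi>_def)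
  have \<psi>bd: "norm (\<psi> N t) \<le> Z * (b - a)" if "t \<in> {a..b}" for N t
  proof -
    have "norm (integral {a..t} (\<zeta> N)) \<le> integral {a..t} (\<lambda>_. Z)"
      by (rule integral_norm_bound_integral[OF primitiveD(3)[OF p\<psi>] integrable_const_ivl]) (rule \<zeta>b)
    then have "norm (\<psi> N t) \<le> integral {a..t} (\<lambda>_. Z)" using that by (simp add: \<psi>_def)
    also have "\<dots> \<le> Z * (b - a)" using that mult_right_mono[OF _ Z0, of "t - a" "b - a"] by (simp add: mult.commute)
    finally show ?thesis .
  qed
  \<comment> \<open>Moves the potential term of the first variation from \<psi> to \<zeta>, so that
    it can be combined with the kinetic term.\<close>
  have parts: "integral {a..b} (\<lambda>t. gq t \<bullet> \<psi> N t) = - integral {a..b} (\<lambda>t. PP t \<bullet> \<zeta> N t)" for N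
  proof -
    have "((\<lambda>t. P t \<bullet> \<zeta> N t + gq t \<bullet> \<psi> N t) has_integral P b \<bullet> \<psi> N b - P a \<bullet> \<psi> N a) {a..b}"
    proof (rule integral_by_parts_indefinite[OF bounded_bilinear_inner less_imp_le[OF ab]])
      show "gq absolutely_integrable_on {a..b}" by (rule absolutely_integrable_continuous_real[OF cgq])
      show "\<zeta> N absolutely_integrable_on {a..b}" by (rule primitiveD(2)[OF p\<psi>])
      show "P t = P a + integral {a..t} gq" for t by (simp add: P_def)
      show "\<psi> N t = \<psi> N a + integral {a..t} (\<zeta> N)" if "t \<in> {a..b}" for t using that by (simp add: \<psi>_def)
    qed
    then have *: "((\<lambda>t. P t \<bullet> \<zeta> N t + gq t \<bullet> \<psi> N t) has_integral 0) {a..b}" by (simp add: \<psi>a \<psi>b0)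
    have "(\<lambda>t. gq t \<bullet> \<psi> N t) integrable_on {a..b}"
      by (intro integrable_continuous_real continuous_intros cgq continuous_on_subset[OF primitive_cont[OF p\<psi>]]) auto
    from has_integral_diff[OF * integrable_integral[OF this]]
    have "((\<lambda>t. P t \<bullet> \<zeta> N t) has_integral - integral {a..b} (\<lambda>t. gq t \<bullet> \<psi> N t)) {a..b}" by simp
    moreover have "integral {a..b} (\<lambda>t. P t \<bullet> \<zeta> N t) = integral {a..b} (\<lambda>t. PP t \<bullet> \<zeta> N t)"
      by (rule integral_cong) (simp add: PP_def)
    ultimately show ?thesis by (simp add: integral_unique)
  qed
  define C1 where "C1 = (b - a) * (Z + 1 + Z * (b - a))"
  have C1: "C1 > 0"
  proof -
    have "Z * (b - a) \<ge> 0" using Z0 ab by simp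
    then show ?thesis unfolding C1_def using ab Z0 by (intro mult_pos_pos) linarith+
  qed
  obtain r1 where r1: "\<And>t. t \<in> {a..b} \<Longrightarrow> norm (q t) \<le> r1"
  proof -
    have "bounded (q ` {a..b})" by (intro compact_imp_bounded compact_continuous_image continuous_on_subset[OF q]) auto
    then obtain B where "\<forall>x\<in>q ` {a..b}. norm x \<le> B" unfolding bounded_iff by blast
    then show ?thesis by (intro that[of B]) auto
  qed
  have main: "\<exists>N0. \<forall>N\<ge>N0. integral {a..b} (\<lambda>t. (norm (\<zeta> N t))\<^sup>2) \<le> \<eta> * C1" if \<eta>: "0 < \<eta>" "\<eta> \<le> 1" for \<eta>
  proof -
    have "uniformly_continuous_on (cball 0 (L + Z)) mom"
      by (intro compact_uniformly_continuous continuous_on_subset[OF mom_cont]) auto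
    then obtain \<rho>1 where \<rho>1: "\<rho>1 > 0" "\<And>x y. x \<in> cball 0 (L + Z) \<Longrightarrow> y \<in> cball 0 (L + Z) \<Longrightarrow> dist y x < \<rho>1 \<Longrightarrow> dist (mom y) (mom x :: 'a) < \<eta>"
      unfolding uniformly_continuous_on_def using \<eta> by metis
    have "uniformly_continuous_on (cball 0 (r1 + 1)) (grad V)"
      by (intro compact_uniformly_continuous grad_cont) auto
    then obtain \<rho>2 where \<rho>2: "\<rho>2 > 0" "\<And>x y. x \<in> cball 0 (r1 + 1) \<Longrightarrow> y \<in> cball 0 (r1 + 1) \<Longrightarrow> dist y x < \<rho>2 \<Longrightarrow> dist (grad V y) (grad V x) < \<eta>"
      unfolding uniformly_continuous_on_def using \<eta> by metis
    define m where "m = min (min \<rho>2 1) r"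
    have m: "m > 0" "m \<le> \<rho>2" "m \<le> 1" "m \<le> r" using \<rho>2 r by (auto simp: m_def)
    \<comment> \<open>The amplitude of the variation, fixed before N: small enough that velocities
      change by less than \<rho>1 and that \<epsilon> \<psi> moves the curve by less than m / 2. The
      other half of m is left for the interpolation error.\<close>
    define \<epsilon> where "\<epsilon> = min 1 (min (\<rho>1 / (2 * (Z + 1))) (m / (4 * (Z * (b - a) + 1))))"
    have Zba: "Z * (b - a) \<ge> 0" using Z0 ab by simp
    have \<epsilon>: "\<epsilon> > 0" "\<epsilon> \<le> 1" using \<rho>1 m Z0 Zba by (auto simp: \<epsilon>_def)
    have \<epsilon>1: "\<epsilon> * Z < \<rho>1"
    proof -
      have "\<epsilon> \<le> \<rho>1 / (2 * (Z + 1))" by (simp add: \<epsilon>_def)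
      then have "\<epsilon> * (2 * (Z + 1)) \<le> \<rho>1" using Z0 by (simp add: pos_le_divide_eq)
      moreover have "\<epsilon> * Z < \<epsilon> * (2 * (Z + 1))" using \<epsilon> Z0 by (intro mult_strict_left_mono) auto
      ultimately show ?thesis by linarith
    qed
    have \<epsilon>2: "\<epsilon> * (Z * (b - a)) < m / 2"
    proof -
      have "\<epsilon> \<le> m / (4 * (Z * (b - a) + 1))" by (simp add: \<epsilon>_def)
      then have "\<epsilon> * (4 * (Z * (b - a) + 1)) \<le> m" using Zba by (simp add: pos_le_divide_eq)
      moreover have "\<epsilon> * (4 * (Z * (b - a) + 1)) = 4 * (\<epsilon> * (Z * (b - a))) + 4 * \<epsilon>" by (simp add: algebra_simps)
      moreover have "\<epsilon> * (Z * (b - a)) \<ge> 0" using \<epsilon> Zba by simp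
      ultimately show ?thesis using \<epsilon> by linarith
    qed
    \<comment> \<open>The polygon differs from q by at most 2 L h. The resulting error in the
      potential must be small against \<epsilon> \<eta> and not just against \<eta>, because the
      inequality will be divided by \<epsilon>.\<close>
    have "(\<lambda>N. 2 * L * h N * (B3 + 1)) \<longlonglongrightarrow> 2 * L * 0 * (B3 + 1)" by (intro tendsto_intros h0)
    then have "(\<lambda>N. 2 * L * h N * (B3 + 1)) \<longlonglongrightarrow> 0" by simp
    then have "\<forall>\<^sub>F N in sequentially. 2 * L * h N * (B3 + 1) < min (\<epsilon> * \<eta>) (m / 2)"
      using \<epsilon> \<eta> m by (intro order_tendstoD) auto
    then obtain N0 where N0: "\<And>N. N \<ge> N0 \<Longrightarrow> 2 * L * h N * (B3 + 1) < min (\<epsilon> * \<eta>) (m / 2)"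
      by (auto simp: eventually_sequentially)
    show ?thesis
    proof (intro exI[of _ "max N0 1"] allI impI)
      fix N assume "max N0 1 \<le> N"
      then have N: "N > 0" "N \<ge> N0" by auto
      have hN: "2 * L * h N * (B3 + 1) < \<epsilon> * \<eta>" "2 * L * h N * (B3 + 1) < m / 2" using N0[OF N(2)] by auto
      have hL: "2 * L * h N \<ge> 0" using L h(1)[OF N(1)] by simp
      have "2 * L * h N * B3 \<ge> 0" by (rule mult_nonneg_nonneg[OF hL B3(1)])
      moreover have "2 * L * h N * (B3 + 1) = 2 * L * h N * B3 + 2 * L * h N" by (simp add: distrib_left)
      ultimately have hN2: "2 * L * h N < m / 2" using hN(2) by linarith
      define \<gamma> where "\<gamma> t = \<gamma>0 N t + \<epsilon> *\<^sub>R \<psi> N t" for t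
      define ww where "ww t = w N t + \<epsilon> *\<^sub>R \<zeta> N t" for t
      have p\<gamma>: "primitive \<gamma> ww"
        unfolding \<gamma>_def[abs_def] ww_def[abs_def] by (rule primitive_add[OF p0 primitive_cmul[OF p\<psi>]])
      have wwb: "norm (ww t) \<le> L + Z" for t
      proof -
        have "norm (\<epsilon> *\<^sub>R \<zeta> N t) \<le> 1 * Z" unfolding norm_scaleR using \<epsilon> \<zeta>b[of N t] by (intro mult_mono) auto
        then show ?thesis using norm_triangle_ineq[of "w N t" "\<epsilon> *\<^sub>R \<zeta> N t"] wb[of N t] by (simp add: ww_def)
      qed
      have close: "norm (\<gamma> t - q t) < m" if t: "t \<in> {a..b}" for t
      proof -
        have "norm (\<gamma> t - q t) \<le> norm (\<gamma>0 N t - q t) + \<epsilon> * norm (\<psi> N t)"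
          using norm_triangle_ineq[of "\<gamma>0 N t - q t" "\<epsilon> *\<^sub>R \<psi> N t"] \<epsilon> by (simp add: \<gamma>_def algebra_simps)
        also have "\<dots> \<le> 2 * L * h N + \<epsilon> * (Z * (b - a))"
          using near0[OF N(1) t] \<psi>bd[OF t, of N] \<epsilon> by (intro add_mono mult_left_mono) auto
        also have "\<dots> < m" using hN2 \<epsilon>2 by linarith
        finally show ?thesis .
      qed
      have "disc \<Phi> q a (h N) N + integral {a..b} (\<lambda>t. V (q t) - c) \<le> integral {a..b} (lag \<gamma> ww)"
        unfolding h_def
      proof (rule cmp[OF N(1) p\<gamma> wwb])
        show "\<gamma> a = q a" by (simp add: \<gamma>_def \<psi>a \<gamma>0_def)
        show "\<gamma> b = q b" using node[OF N(1) order_refl] h(2)[OF N(1)] by (simp add: \<gamma>_def \<psi>b0)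
        show "dist (\<gamma> t) (q t) < r" if "t \<in> {a..b}" for t using close[OF that] m by (simp add: dist_norm)
      qed
      then have c0: "integral {a..b} (\<lambda>t. \<Phi> (norm (w N t))) + integral {a..b} (\<lambda>t. V (q t) - c) \<le> integral {a..b} (lag \<gamma> ww)"
        using disc_eq[OF N(1)] by simp
      have pw: "lag \<gamma> ww t \<le> \<Phi> (norm (w N t)) + (V (q t) - c) + \<epsilon> * (mom (w N t) \<bullet> \<zeta> N t + gq t \<bullet> \<psi> N t + \<eta> * (Z + 1 + Z * (b - a)))"
        if t: "t \<in> {a..b}" for t
      proof -
        \<comment> \<open>The subgradient is taken at the perturbed velocity ww, so the error of
          linearisation is a difference of momenta, controlled by the uniform continuity of
          \<open>mom\<close>.\<close>
        have "\<Phi> (norm (w N t)) \<ge> \<Phi> (norm (ww t)) + mom (ww t) \<bullet> (w N t - ww t)" by (rule Phi_norm_support)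
        then have e1: "\<Phi> (norm (ww t)) \<le> \<Phi> (norm (w N t)) + \<epsilon> * (mom (ww t) \<bullet> \<zeta> N t)" by (simp add: ww_def)
        have "dist (mom (ww t)) (mom (w N t)) < \<eta>"
        proof (rule \<rho>1(2))
          show "w N t \<in> cball 0 (L + Z)" using wb[of N t] Z0 by simp
          show "ww t \<in> cball 0 (L + Z)" using wwb by simp
          have "dist (ww t) (w N t) \<le> \<epsilon> * Z" using \<zeta>b[of N t] \<epsilon> by (simp add: ww_def dist_norm mult_left_mono)
          then show "dist (ww t) (w N t) < \<rho>1" using \<epsilon>1 by simp
        qed
        then have "(mom (ww t) - mom (w N t)) \<bullet> \<zeta> N t \<le> \<eta> * Z"
          using norm_cauchy_schwarz[of "mom (ww t) - mom (w N t)" "\<zeta> N t"] mult_mono[of "norm (mom (ww t) - mom (w N t))" \<eta> "norm (\<zeta> N t)" Z]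
            \<zeta>b[of N t] \<eta> by (simp add: dist_norm)
        then have "mom (ww t) \<bullet> \<zeta> N t \<le> mom (w N t) \<bullet> \<zeta> N t + \<eta> * Z" by (simp add: inner_diff_left)
        then have e2: "\<epsilon> * (mom (ww t) \<bullet> \<zeta> N t) \<le> \<epsilon> * (mom (w N t) \<bullet> \<zeta> N t + \<eta> * Z)" using \<epsilon> by simp
        have e3: "V (\<gamma> t) - V (q t) \<le> gq t \<bullet> (\<gamma> t - q t) + \<eta> * norm (\<gamma> t - q t)"
        proof -
          obtain x where x: "x \<in> closed_segment (q t) (\<gamma> t)" "V (\<gamma> t) - V (q t) = (\<gamma> t - q t) \<bullet> grad V x"
          proof -
            define d where "d = \<gamma> t - q t"
            have "((\<lambda>s. V (q t + s *\<^sub>R d)) has_real_derivative d \<bullet> grad V (q t + s *\<^sub>R d)) (at s)" for s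
            proof -
              have *: "((\<lambda>s. q t + s *\<^sub>R d) has_derivative (\<lambda>s. s *\<^sub>R d)) (at s)"
                by (auto intro!: derivative_eq_intros)
              have **: "(\<lambda>h. d \<bullet> grad V (q t + s *\<^sub>R d) * h) = (\<lambda>k. (k *\<^sub>R d) \<bullet> grad V (q t + s *\<^sub>R d))"
                by (auto simp: mult.commute)
              show ?thesis
                unfolding has_field_derivative_def ** by (rule has_derivative_compose[OF * V_deriv])
            qed
            then obtain z where z: "0 < z" "z < 1" "V (q t + 1 *\<^sub>R d) - V (q t + 0 *\<^sub>R d) = (1 - 0) * (d \<bullet> grad V (q t + z *\<^sub>R d))"
              using MVT2[of 0 1 "\<lambda>s. V (q t + s *\<^sub>R d)" "\<lambda>s. d \<bullet> grad V (q t + s *\<^sub>R d)"] by auto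
            show ?thesis
            proof (rule that[of "q t + z *\<^sub>R d"])
              show "q t + z *\<^sub>R d \<in> closed_segment (q t) (\<gamma> t)"
                using z by (auto simp: in_segment d_def algebra_simps intro!: exI[of _ z])
              show "V (\<gamma> t) - V (q t) = (\<gamma> t - q t) \<bullet> grad V (q t + z *\<^sub>R d)" using z(3) by (simp add: d_def)
            qed
          qed
          have dx: "dist x (q t) \<le> norm (\<gamma> t - q t)" using segment_bound1[OF x(1)] by (simp add: dist_norm)
          have "norm x \<le> r1 + 1" using norm_triangle_sub[of x "q t"] dx close[OF t] m r1[OF t] by (simp add: dist_norm)
          then have "dist (grad V x) (grad V (q t)) < \<eta>" using dx close[OF t] m r1[OF t] by (intro \<rho>2(2)) auto
          then have "(\<gamma> t - q t) \<bullet> (grad V x - gq t) \<le> norm (\<gamma> t - q t) * \<eta>"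
            using norm_cauchy_schwarz[of "\<gamma> t - q t" "grad V x - gq t"]
              mult_left_mono[of "norm (grad V x - gq t)" \<eta> "norm (\<gamma> t - q t)"] by (simp add: dist_norm gq_def)
          then show ?thesis unfolding x(2) by (simp add: inner_diff_right inner_commute algebra_simps)
        qed
        have e4: "gq t \<bullet> (\<gamma> t - q t) \<le> B3 * (2 * L * h N) + \<epsilon> * (gq t \<bullet> \<psi> N t)"
        proof -
          have "gq t \<bullet> (\<gamma> t - q t) = gq t \<bullet> (\<gamma>0 N t - q t) + \<epsilon> * (gq t \<bullet> \<psi> N t)"
            by (simp add: \<gamma>_def inner_diff_right inner_add_right)
          also have "gq t \<bullet> (\<gamma>0 N t - q t) \<le> B3 * (2 * L * h N)"
            using norm_cauchy_schwarz[of "gq t" "\<gamma>0 N t - q t"] mult_mono[OF B3(2)[OF t] near0[OF N(1) t] B3(1)] by simp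
          finally show ?thesis by simp
        qed
        have e5: "\<eta> * norm (\<gamma> t - q t) \<le> 2 * L * h N + \<epsilon> * (\<eta> * (Z * (b - a)))"
        proof -
          have "norm (\<gamma> t - q t) \<le> 2 * L * h N + \<epsilon> * (Z * (b - a))"
          proof -
            have "norm (\<gamma> t - q t) \<le> norm (\<gamma>0 N t - q t) + \<epsilon> * norm (\<psi> N t)"
              using norm_triangle_ineq[of "\<gamma>0 N t - q t" "\<epsilon> *\<^sub>R \<psi> N t"] \<epsilon> by (simp add: \<gamma>_def algebra_simps)
            also have "\<dots> \<le> 2 * L * h N + \<epsilon> * (Z * (b - a))"
              using near0[OF N(1) t] \<psi>bd[OF t, of N] \<epsilon> by (intro add_mono mult_left_mono) auto
            finally show ?thesis .
          qed
          then have "\<eta> * norm (\<gamma> t - q t) \<le> \<eta> * (2 * L * h N) + \<eta> * (\<epsilon> * (Z * (b - a)))"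
            using \<eta> by (metis distrib_left less_imp_le mult_left_mono)
          moreover have "\<eta> * (2 * L * h N) \<le> 2 * L * h N" using mult_right_mono[OF \<eta>(2) hL] by simp
          ultimately show ?thesis by (simp add: algebra_simps)
        qed
        have e6: "B3 * (2 * L * h N) + 2 * L * h N \<le> \<epsilon> * \<eta>" using hN(1) by (simp add: algebra_simps)
        have "lag \<gamma> ww t = \<Phi> (norm (ww t)) + (V (q t) - c) + (V (\<gamma> t) - V (q t))" by (simp add: lag_def)
        also have "\<dots> \<le> \<Phi> (norm (w N t)) + \<epsilon> * (mom (w N t) \<bullet> \<zeta> N t + \<eta> * Z) + (V (q t) - c)
            + (\<epsilon> * \<eta> + \<epsilon> * (gq t \<bullet> \<psi> N t) + \<epsilon> * (\<eta> * (Z * (b - a))))"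
          using e1 e2 e3 e4 e5 e6 by linarith
        finally show ?thesis by (simp add: algebra_simps)
      qed
      define k1 where "k1 t = \<Phi> (norm (w N t))" for t
      define k2 where "k2 t = V (q t) - c" for t
      define k3 where "k3 t = mom (w N t) \<bullet> \<zeta> N t" for t
      define k4 where "k4 t = gq t \<bullet> \<psi> N t" for t
      define k5 where "k5 t = PP t \<bullet> \<zeta> N t" for t
      have bi: "f integrable_on {a..b}" if "f \<in> borel_measurable borel" "\<And>t. norm (f t) \<le> B" for f :: "real \<Rightarrow> 'z::euclidean_space" and B
        by (rule set_lebesgue_integral_eq_integral(1)[OF bounded_borel_absolutely_integrable[OF that]])
      have j1: "k1 integrable_on {a..b}"
      proof (rule bi[of _ "\<Phi> L"])
        show "k1 \<in> borel_measurable borel" unfolding k1_def[abs_def] using wm[of N] by measurable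
        show "norm (k1 t) \<le> \<Phi> L" for t using Phi_mono[OF norm_ge_zero wb[of N t]] Phi_nonneg[of "norm (w N t)"] by (simp add: k1_def)
      qed
      have j2: "k2 integrable_on {a..b}" unfolding k2_def[abs_def] by (rule V_path_integrable[OF continuous_on_subset[OF q]]) simp
      have j3: "k3 integrable_on {a..b}"
      proof (rule bi[of _ "\<alpha> L * Z"])
        show "k3 \<in> borel_measurable borel" unfolding k3_def[abs_def] using mwm[of N] \<zeta>m[of N] by measurable
        show "norm (k3 t) \<le> \<alpha> L * Z" for t
          using Cauchy_Schwarz_ineq2[of "mom (w N t)" "\<zeta> N t"] mult_mono[OF mwb[of N t] \<zeta>b[of N t]] \<alpha>_nonneg[OF L] by (simp add: k3_def)
      qed
      have j4: "k4 integrable_on {a..b}" unfolding k4_def[abs_def]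
        by (intro integrable_continuous_real continuous_intros cgq continuous_on_subset[OF primitive_cont[OF p\<psi>]]) auto
      have j5: "k5 integrable_on {a..b}"
      proof (rule bi[of _ "B2 * Z"])
        show "k5 \<in> borel_measurable borel" unfolding k5_def[abs_def] using PPm \<zeta>m[of N] by measurable
        show "norm (k5 t) \<le> B2 * Z" for t
          using Cauchy_Schwarz_ineq2[of "PP t" "\<zeta> N t"] mult_mono[OF PPb[of t] \<zeta>b[of N t]] B2 by (simp add: k5_def)
      qed
      have jl: "lag \<gamma> ww integrable_on {a..b}"
        by (rule set_lebesgue_integral_eq_integral(1)[OF lag_bounded_integrable[OF p\<gamma> wwb]])
      define X where "X = \<eta> * (Z + 1 + Z * (b - a))"
      have HI: "((\<lambda>t. k1 t + k2 t + \<epsilon> * (k3 t + k4 t + X)) has_integral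
          integral {a..b} k1 + integral {a..b} k2 + \<epsilon> * (integral {a..b} k3 + integral {a..b} k4 + (b - a) * X)) {a..b}"
        using ab has_integral_const_real[of X a b]
        by (intro has_integral_add has_integral_mult_right integrable_integral j1 j2 j3 j4) auto
      have "integral {a..b} (lag \<gamma> ww)
          \<le> integral {a..b} k1 + integral {a..b} k2 + \<epsilon> * (integral {a..b} k3 + integral {a..b} k4 + (b - a) * X)"
        by (rule has_integral_le[OF integrable_integral[OF jl] HI])
          (use pw in \<open>simp add: k1_def k2_def k3_def k4_def X_def\<close>)
      \<comment> \<open>The left side of c0 equals the zeroth-order terms k1 and k2; after
        cancelling them only the first variation and the error X remain.\<close>
      then have "0 \<le> \<epsilon> * (integral {a..b} k3 + integral {a..b} k4 + (b - a) * X)"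
        using c0 by (simp add: k1_def[abs_def] k2_def[abs_def])
      then have "0 \<le> integral {a..b} k3 + integral {a..b} k4 + (b - a) * X" using \<epsilon>(1) by (simp add: zero_le_mult_iff)
      moreover have "integral {a..b} k4 = - integral {a..b} k5"
        using parts[of N] by (simp add: k4_def[abs_def] k5_def[abs_def])
      \<comment> \<open>Because \<zeta> = cs - (mom w - P) has mean zero, the first variation is
        minus the squared norm of \<zeta>; minimality thus bounds that norm by the error.\<close>
      moreover have "integral {a..b} (\<lambda>t. (norm (\<zeta> N t))\<^sup>2) = - (integral {a..b} k3 - integral {a..b} k5)"
      proof -
        have "integral {a..b} (\<lambda>t. (norm (\<zeta> N t))\<^sup>2) = integral {a..b} (\<lambda>t. cs N \<bullet> \<zeta> N t - (k3 t - k5 t))"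
        proof (rule integral_cong)
          fix t assume "t \<in> {a..b}"
          then have "\<zeta> N t = cs N - (mom (w N t) - PP t)" by (simp add: \<zeta>_def)
          then have "\<zeta> N t \<bullet> \<zeta> N t = (cs N - (mom (w N t) - PP t)) \<bullet> \<zeta> N t" by simp
          then show "(norm (\<zeta> N t))\<^sup>2 = cs N \<bullet> \<zeta> N t - (k3 t - k5 t)"
            by (simp add: power2_norm_eq_inner k3_def k5_def inner_diff_left)
        qed
        also have "\<dots> = integral {a..b} (\<lambda>t. cs N \<bullet> \<zeta> N t) - (integral {a..b} k3 - integral {a..b} k5)"
        proof -
          have "(\<lambda>t. cs N \<bullet> \<zeta> N t) integrable_on {a..b}"
            using integrable_linear[OF primitiveD(3)[OF p\<psi>] bounded_linear_inner_right[of "cs N"]] by (simp add: o_def)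
          then show ?thesis using j3 j5 by (simp add: integral_diff integrable_diff)
        qed
        also have "integral {a..b} (\<lambda>t. cs N \<bullet> \<zeta> N t) = 0"
          using integral_linear[OF primitiveD(3)[OF p\<psi>] bounded_linear_inner_right[of "cs N"]] \<zeta>int by (simp add: o_def)
        finally show ?thesis by simp
      qed
      moreover have "(b - a) * X = \<eta> * C1" by (simp add: X_def C1_def)
      ultimately show "integral {a..b} (\<lambda>t. (norm (\<zeta> N t))\<^sup>2) \<le> \<eta> * C1" by linarith
    qed
  qed
  have eqz: "integral {a..b} (\<lambda>t. (norm (mom (w N t) - P t - cs N))\<^sup>2) = integral {a..b} (\<lambda>t. (norm (\<zeta> N t))\<^sup>2)" for N
    by (rule integral_cong) (simp add: \<zeta>_def PP_def norm_minus_commute)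
  have nn: "integral {a..b} (\<lambda>t. (norm (\<zeta> N t))\<^sup>2) \<ge> 0" for N
  proof (rule Henstock_Kurzweil_Integration.integral_nonneg)
    show "(\<lambda>t. (norm (\<zeta> N t))\<^sup>2) integrable_on {a..b}"
    proof (rule set_lebesgue_integral_eq_integral(1)[OF bounded_borel_absolutely_integrable])
      show "(\<lambda>t. (norm (\<zeta> N t))\<^sup>2) \<in> borel_measurable borel" using \<zeta>m[of N] by measurable
      show "norm ((norm (\<zeta> N t))\<^sup>2) \<le> Z\<^sup>2" for t using \<zeta>b[of N t] by (simp add: power_mono)
    qed
  qed auto
  have lim: "(\<lambda>N. integral {a..b} (\<lambda>t. (norm (mom (w N t) - P t - cs N))\<^sup>2)) \<longlonglongrightarrow> 0"
    unfolding eqz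
  proof (rule LIMSEQ_I)
    fix \<delta> :: real assume "\<delta> > 0"
    define \<eta> where "\<eta> = min 1 (\<delta> / (2 * C1))"
    have "0 < \<eta>" "\<eta> \<le> 1" using \<open>\<delta> > 0\<close> C1 by (auto simp: \<eta>_def)
    from main[OF this] obtain N0 where "\<forall>N\<ge>N0. integral {a..b} (\<lambda>t. (norm (\<zeta> N t))\<^sup>2) \<le> \<eta> * C1" by blast
    moreover have "\<eta> * C1 < \<delta>"
    proof -
      have "\<eta> * C1 \<le> \<delta> / (2 * C1) * C1" using C1 by (intro mult_right_mono) (auto simp: \<eta>_def)
      then show ?thesis using C1 \<open>\<delta> > 0\<close> by simp
    qed
    ultimately show "\<exists>N0. \<forall>N\<ge>N0. norm (integral {a..b} (\<lambda>t. (norm (\<zeta> N t))\<^sup>2) - 0) < \<delta>"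
      using nn by (intro exI[of _ N0]) force
  qed
  have conv: "(\<lambda>N. \<gamma>0 N t) \<longlonglongrightarrow> q t" if t: "t \<in> {a..b}" for t
  proof -
    have "(\<lambda>N. 2 * L * h N) \<longlonglongrightarrow> 2 * L * 0" by (intro tendsto_intros h0)
    then have "(\<lambda>N. 2 * L * h N) \<longlonglongrightarrow> 0" by simp
    moreover have "\<forall>\<^sub>F N in sequentially. norm (\<gamma>0 N t - q t) \<le> 2 * L * h N"
      using eventually_gt_at_top[of 0] by eventually_elim (use near0 t in auto)
    ultimately have "(\<lambda>N. \<gamma>0 N t - q t) \<longlonglongrightarrow> 0" by (rule Lim_null_comparison[rotated])
    then show ?thesis by (simp add: LIM_zero_iff)
  qed
  show ?thesis
  proof (rule that[of PP w cs \<gamma>0])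
    show "(PP has_vector_derivative grad V (q t)) (at t within {a..b})" if "t \<in> {a..b}" for t
      using Pd[OF that] unfolding gq_def
      by (rule has_vector_derivative_transform[OF that, rotated]) (simp add: PP_def)
    show "bounded (range PP)" "bounded (range cs)"
      unfolding bounded_iff using PPb csb by auto
    have "integral {a..b} (\<lambda>t. (norm (mom (w N t) - PP t - cs N))\<^sup>2)
        = integral {a..b} (\<lambda>t. (norm (mom (w N t) - P t - cs N))\<^sup>2)" for N
      by (rule integral_cong) (simp add: PP_def)
    then show "(\<lambda>N. integral {a..b} (\<lambda>t. (norm (mom (w N t) - PP t - cs N))\<^sup>2)) \<longlonglongrightarrow> 0"
      using lim by simp
  qed (use PPm wm wb p0 conv in auto)
qed

text \<open>\<open>vel\<close> need not be Lipschitz. Uniform continuity handles close arguments;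
  for the others the difference is bounded and absorbed by a large multiple of the squared distance.
  So mean-square convergence of momenta gives convergence of velocities in mean.\<close>

lemma vel_modulus:
  assumes "\<eta> > 0"
  obtains K where "K \<ge> 0" "\<And>x y::'a. norm x \<le> B \<Longrightarrow> norm y \<le> B \<Longrightarrow> norm (vel x - vel y) \<le> \<eta> + K * (norm (x - y))\<^sup>2"
proof -
  have "uniformly_continuous_on (cball 0 B) (vel :: 'a \<Rightarrow> 'a)"
    by (intro compact_uniformly_continuous continuous_on_subset[OF vel_cont]) auto
  then obtain d where d: "d > 0" "\<And>x y. x \<in> cball 0 B \<Longrightarrow> y \<in> cball 0 B \<Longrightarrow> dist y x < d \<Longrightarrow> dist (vel y) (vel x :: 'a) < \<eta>"
    unfolding uniformly_continuous_on_def using assms by metis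
  have "bounded (vel ` cball (0::'a) B)"
    by (intro compact_imp_bounded compact_continuous_image continuous_on_subset[OF vel_cont]) auto
  then obtain S where S: "\<forall>z\<in>vel ` cball (0::'a) B. norm z \<le> S" unfolding bounded_iff by blast
  define K where "K = 2 * max S 0 / d\<^sup>2"
  show ?thesis
  proof (rule that[of K])
    show "K \<ge> 0" by (simp add: K_def)
    fix x y :: 'a assume xy: "norm x \<le> B" "norm y \<le> B"
    show "norm (vel x - vel y) \<le> \<eta> + K * (norm (x - y))\<^sup>2"
    proof (cases "dist x y < d")
      case True
      then have "norm (vel x - vel y) \<le> \<eta>" using d(2)[of y x] xy by (simp add: dist_norm)
      moreover have "K * (norm (x - y))\<^sup>2 \<ge> 0" by (simp add: K_def)
      ultimately show ?thesis by linarith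
    next
      case False
      then have "d\<^sup>2 \<le> (norm (x - y))\<^sup>2" using d(1) by (intro power_mono) (auto simp: dist_norm)
      then have "K * d\<^sup>2 \<le> K * (norm (x - y))\<^sup>2" by (intro mult_left_mono) (simp_all add: K_def)
      moreover have "K * d\<^sup>2 = 2 * max S 0" using d(1) by (simp add: K_def)
      moreover have "norm (vel x) \<le> S" "norm (vel y) \<le> S" using S xy by auto
      then have "norm (vel x - vel y) \<le> S + S" using norm_triangle_ineq4[of "vel x" "vel y"] by linarith
      ultimately show ?thesis using assms by linarith
    qed
  qed
qed

text \<open>Along a subsequence the means cs converge to some cl, hence the momenta of the polygons
  converge in mean square to p = P + cl and their slopes in mean to \<open>vel p\<close>. Since the
  polygons converge to q, it follows that q is a primitive of the continuous function
  \<open>vel p\<close>.\<close>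

lemma euler_lagrange:
  fixes q :: "real \<Rightarrow> 'a"
  assumes q: "continuous_on UNIV q" and ab: "a < b" and L: "L \<ge> 0"
    and lip: "\<And>s t. s \<in> {a..b} \<Longrightarrow> t \<in> {a..b} \<Longrightarrow> norm (q t - q s) \<le> L * \<bar>t - s\<bar>"
    and r: "r > 0"
    and cmp: "\<And>N \<gamma> w B. N > 0 \<Longrightarrow> primitive \<gamma> w \<Longrightarrow> (\<And>t. norm (w t) \<le> B) \<Longrightarrow> \<gamma> a = q a \<Longrightarrow> \<gamma> b = q b \<Longrightarrow>
      (\<And>t. t \<in> {a..b} \<Longrightarrow> dist (\<gamma> t) (q t) < r) \<Longrightarrow>
      disc \<Phi> q a ((b - a) / real N) N + integral {a..b} (\<lambda>t. V (q t) - c) \<le> integral {a..b} (lag \<gamma> w)"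
  shows "\<exists>p. \<forall>t\<in>{a..b}. (p has_vector_derivative grad V (q t)) (at t within {a..b}) \<and>
    (q has_vector_derivative vel (p t)) (at t within {a..b})"
proof -
  obtain P w cs \<gamma> where
    Pd: "\<And>t. t \<in> {a..b} \<Longrightarrow> (P has_vector_derivative grad V (q t)) (at t within {a..b})"
    and Pm: "P \<in> borel_measurable borel" and Pb: "bounded (range P)"
    and wm: "\<And>N. w N \<in> borel_measurable borel" and wb: "\<And>N t. norm (w N t) \<le> L"
    and csb: "bounded (range cs)"
    and pr: "\<And>N::nat. N > 0 \<Longrightarrow> primitive (\<gamma> N) (w N)" and conv: "\<And>t. t \<in> {a..b} \<Longrightarrow> (\<lambda>N. \<gamma> N t) \<longlonglongrightarrow> q t"
    and lim: "(\<lambda>N. integral {a..b} (\<lambda>t. (norm (mom (w N t) - P t - cs N))\<^sup>2)) \<longlonglongrightarrow> 0"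
    by (rule euler_lagrange_step[OF assms]) (assumption | rule that; assumption)+
  obtain cl k where k: "strict_mono k" "(cs \<circ> k) \<longlonglongrightarrow> cl"
    using bounded_imp_convergent_subsequence[OF csb] by blast
  define p where "p t = P t + cl" for t
  have pd: "(p has_vector_derivative grad V (q t)) (at t within {a..b})" if "t \<in> {a..b}" for t
    unfolding p_def[abs_def] using has_vector_derivative_add[OF Pd[OF that] has_vector_derivative_const] by simp
  have cp: "continuous_on {a..b} p" using pd by (rule continuous_on_vector_derivative)
  define W where "W t = vel (p t)" for t
  have cW: "continuous_on {a..b} W"
    unfolding W_def[abs_def] by (rule continuous_on_compose2[OF vel_cont cp]) auto
  obtain B2 where B2: "\<And>t. norm (P t) \<le> B2" using Pb unfolding bounded_iff by blast
  obtain B3 where B3: "\<And>n. norm (cs n) \<le> B3" using csb unfolding bounded_iff by blast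
  define B where "B = max (\<alpha> L) (B2 + norm cl)"
  have pB: "norm (p t) \<le> B" for t
    using norm_triangle_ineq[of "P t" cl] B2[of t] by (simp add: p_def B_def)
  have mB: "norm (mom (w n t)) \<le> B" for n t using \<alpha>_mono[OF norm_ge_zero wb[of n t]] by (simp add: norm_mom B_def)
  define E where "E n = integral {a..b} (\<lambda>t. (norm (mom (w n t) - P t - cs n))\<^sup>2)" for n
  define sq where "sq n t = (norm (mom (w n t) - P t - cs n))\<^sup>2" for n t
  have mwm: "(\<lambda>t. mom (w N t)) \<in> borel_measurable borel" for N
    using measurable_compose[OF wm borel_measurable_continuous_onI[OF mom_cont]] .
  have sqi: "sq n integrable_on {a..b}" for n
  proof (rule set_lebesgue_integral_eq_integral(1)[OF bounded_borel_absolutely_integrable])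
    show "sq n \<in> borel_measurable borel" unfolding sq_def[abs_def] using mwm[of n] Pm by measurable
    show "norm (sq n t) \<le> (B + B2 + B3)\<^sup>2" for t
    proof -
      have "norm (mom (w n t) - P t - cs n) \<le> B + B2 + B3"
        using norm_triangle_ineq4[of "mom (w n t) - P t" "cs n"] norm_triangle_ineq4[of "mom (w n t)" "P t"]
          mB[of n t] B2[of t] B3[of n] by linarith
      then show ?thesis by (simp add: sq_def power_mono)
    qed
  qed
  have qW: "integral {a..t} W = q t - q a" if t: "t \<in> {a..b}" for t
  proof -
    have "(\<lambda>n. integral {a..t} (w (k n))) \<longlonglongrightarrow> integral {a..t} W"
    proof (rule LIMSEQ_I)
      fix \<epsilon> :: real assume "\<epsilon> > 0"
      \<comment> \<open>Half of \<epsilon> pays for the constant in \<open>vel_modulus\<close> over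
        [a,b], the other half for the mean-square terms.\<close>
      define \<eta> where "\<eta> = \<epsilon> / 2 / (b - a)"
      have "b - a \<noteq> 0" using ab by simp
      then have \<eta>: "\<eta> > 0" "\<eta> * (b - a) = \<epsilon> / 2"
        using \<open>\<epsilon> > 0\<close> ab nonzero_eq_divide_eq[of "b - a" \<eta> "\<epsilon> / 2"] by (simp_all only: \<eta>_def) auto
      obtain K where K: "K \<ge> 0" "\<And>x y::'a. norm x \<le> B \<Longrightarrow> norm y \<le> B \<Longrightarrow> norm (vel x - vel y) \<le> \<eta> + K * (norm (x - y))\<^sup>2"
        using vel_modulus[OF \<eta>(1)] by blast
      have "(\<lambda>n. K * (2 * E (k n) + 2 * (norm ((cs \<circ> k) n - cl))\<^sup>2 * (b - a))) \<longlonglongrightarrow> K * (2 * 0 + 2 * (norm (cl - cl))\<^sup>2 * (b - a))"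
        using LIMSEQ_subseq_LIMSEQ[OF lim k(1)] by (intro tendsto_intros k(2)) (simp add: E_def o_def)
      then have "(\<lambda>n. K * (2 * E (k n) + 2 * (norm (cs (k n) - cl))\<^sup>2 * (b - a))) \<longlonglongrightarrow> 0" by (simp add: o_def)
      then have "\<forall>\<^sub>F n in sequentially. K * (2 * E (k n) + 2 * (norm (cs (k n) - cl))\<^sup>2 * (b - a)) < \<epsilon> / 2"
        using \<open>\<epsilon> > 0\<close> by (intro order_tendstoD) auto
      then obtain n0 where n0: "\<And>n. n \<ge> n0 \<Longrightarrow> K * (2 * E (k n) + 2 * (norm (cs (k n) - cl))\<^sup>2 * (b - a)) < \<epsilon> / 2"
        by (auto simp: eventually_sequentially)
      have bd: "norm (integral {a..t} (w (k n)) - integral {a..t} W) < \<epsilon>" if n: "n \<ge> n0" for n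
      proof -
        define g where "g s = \<eta> + K * (2 * sq (k n) s + 2 * (norm (cs (k n) - cl))\<^sup>2)" for s
        have gi: "(g has_integral (b - a) * \<eta> + K * (2 * E (k n) + (b - a) * (2 * (norm (cs (k n) - cl))\<^sup>2))) {a..b}"
          unfolding g_def[abs_def] E_def sq_def[symmetric, abs_def]
          using ab has_integral_const_real[of \<eta> a b] has_integral_const_real[of "2 * (norm (cs (k n) - cl))\<^sup>2" a b]
          by (intro has_integral_add has_integral_mult_right integrable_integral sqi) auto
        have wi: "w (k n) integrable_on {a..t}"
          by (rule set_lebesgue_integral_eq_integral(1)[OF bounded_borel_absolutely_integrable[OF wm wb]])
        have Wi: "W integrable_on {a..t}" using t by (intro integrable_continuous_real continuous_on_subset[OF cW]) auto
        have gib: "g integrable_on {a..b}" using gi by (rule has_integral_integrable)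
        have gi2: "g integrable_on {a..t}" by (rule integrable_subinterval_real[OF gib]) (use t in auto)
        have g0: "g s \<ge> 0" for s using \<eta> K by (simp add: g_def sq_def)
        have "norm (integral {a..t} (w (k n)) - integral {a..t} W) = norm (integral {a..t} (\<lambda>s. w (k n) s - W s))"
          using wi Wi by (simp add: integral_diff)
        also have "\<dots> \<le> integral {a..t} g"
        proof (rule integral_norm_bound_integral[OF integrable_diff[OF wi Wi] gi2])
          fix s
          have "norm (w (k n) s - W s) = norm (vel (mom (w (k n) s)) - vel (p s))" by (simp add: W_def)
          also have "\<dots> \<le> \<eta> + K * (norm (mom (w (k n) s) - p s))\<^sup>2" by (rule K(2)[OF mB pB])
          also have "(norm (mom (w (k n) s) - p s))\<^sup>2 \<le> 2 * sq (k n) s + 2 * (norm (cs (k n) - cl))\<^sup>2"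
          proof -
            have "mom (w (k n) s) - p s = (mom (w (k n) s) - P s - cs (k n)) + (cs (k n) - cl)" by (simp add: p_def)
            then have "norm (mom (w (k n) s) - p s) \<le> norm (mom (w (k n) s) - P s - cs (k n)) + norm (cs (k n) - cl)"
              by (metis norm_triangle_ineq)
            then have "(norm (mom (w (k n) s) - p s))\<^sup>2 \<le> (norm (mom (w (k n) s) - P s - cs (k n)) + norm (cs (k n) - cl))\<^sup>2"
              by (intro power_mono) auto
            also have "\<dots> \<le> 2 * sq (k n) s + 2 * (norm (cs (k n) - cl))\<^sup>2"
              unfolding sq_def using sum_squares_bound[of "norm (mom (w (k n) s) - P s - cs (k n))" "norm (cs (k n) - cl)"]
              by (simp add: power2_sum)
            finally show ?thesis .
          qed
          finally show "norm (w (k n) s - W s) \<le> g s" using K(1) by (simp add: g_def mult_left_mono)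
        qed
        also have "\<dots> \<le> integral {a..b} g"
          by (rule integral_subset_le[OF _ gi2 gib]) (use t g0 in auto)
        also have "\<dots> = \<eta> * (b - a) + K * (2 * E (k n) + 2 * (norm (cs (k n) - cl))\<^sup>2 * (b - a))"
          using gi by (simp add: integral_unique algebra_simps)
        also have "\<dots> < \<epsilon>" using n0[OF n] \<eta>(2) by linarith
        finally show ?thesis .
      qed
      then show "\<exists>n0. \<forall>n\<ge>n0. norm (integral {a..t} (w (k n)) - integral {a..t} W) < \<epsilon>" by blast
    qed
    moreover have "(\<lambda>n. integral {a..t} (w (k n))) \<longlonglongrightarrow> q t - q a"
    proof (rule Lim_transform_eventually)
      have "(\<lambda>n. \<gamma> n t - \<gamma> n a) \<longlonglongrightarrow> q t - q a" using t ab by (intro tendsto_diff conv) auto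
      from LIMSEQ_subseq_LIMSEQ[OF this k(1)] show "(\<lambda>n. \<gamma> (k n) t - \<gamma> (k n) a) \<longlonglongrightarrow> q t - q a" by (simp add: o_def)
      show "\<forall>\<^sub>F n in sequentially. \<gamma> (k n) t - \<gamma> (k n) a = integral {a..t} (w (k n))"
        using eventually_gt_at_top[of 0]
      proof eventually_elim
        case (elim n)
        then have "k n > 0" using seq_suble[OF k(1), of n] by simp
        then show ?case using primitiveD(4)[OF pr, of "k n" a t] t by simp
      qed
    qed
    ultimately show ?thesis by (rule LIMSEQ_unique)
  qed
  have "(q has_vector_derivative W t) (at t within {a..b})" if t: "t \<in> {a..b}" for t
  proof -
    have "((\<lambda>u. integral {a..u} W) has_vector_derivative W t) (at t within {a..b})"
      by (rule integral_has_vector_derivative[OF cW t])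
    from has_vector_derivative_add[OF has_vector_derivative_const this, of "q a"]
    have "((\<lambda>u. q a + integral {a..u} W) has_vector_derivative W t) (at t within {a..b})" by simp
    then show ?thesis by (rule has_vector_derivative_transform[OF t, rotated]) (simp add: qW)
  qed
  then show ?thesis using pd unfolding W_def by (intro exI[of _ p]) blast
qed

end

section \<open>Local regularity and energy of the limit\<close>

context min_seq
begin

text \<open>\<open>comparison\<close> with a single cell and with a segment, run at constant speed
  in an arbitrary time T, as competitor.\<close>

lemma segment_comparison:
  assumes st: "s < t" and T: "T > 0" and seg: "\<And>\<tau>. \<tau> \<in> {0..1} \<Longrightarrow> V (q s + \<tau> *\<^sub>R (q t - q s)) > c"
  shows "(t - s) * \<Phi> (norm (q t - q s) / (t - s)) + integral {s..t} (\<lambda>r. V (q r) - c)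
    \<le> T * \<Phi> (norm (q t - q s) / T) + integral {s..s + T} (\<lambda>r. V (q s + ((r - s) / T) *\<^sub>R (q t - q s)) - c)"
proof -
  define D where "D = q t - q s"
  define \<gamma> where "\<gamma> r = (q s - (s / T) *\<^sub>R D) + r *\<^sub>R (D /\<^sub>R T)" for r
  define w where "w = (\<lambda>_::real. D /\<^sub>R T)"
  have \<gamma>_eq: "\<gamma> r = q s + ((r - s) / T) *\<^sub>R D" for r
    by (simp add: \<gamma>_def scaleR_diff_left divide_inverse left_diff_distrib)
  have p: "primitive \<gamma> w" unfolding \<gamma>_def[abs_def] w_def by (rule primitive_linear)
  have "disc \<Phi> q s ((t - s) / real 1) 1 + integral {s..t} (\<lambda>r. V (q r) - c) \<le> integral {s..s + T} (lag \<gamma> w)"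
  proof (rule comparison[OF st T p])
    show "norm (w r) \<le> norm (D /\<^sub>R T)" for r by (simp add: w_def)
    show "\<gamma> s = q s" "\<gamma> (s + T) = q t" using T by (simp_all add: \<gamma>_eq D_def)
    show "c < V (\<gamma> r)" if "r \<in> {s..s + T}" for r
      unfolding \<gamma>_eq D_def using that T by (intro seg) (auto simp: field_simps)
  qed simp
  also have "integral {s..s + T} (lag \<gamma> w) = integral {s..s + T} (\<lambda>r. \<Phi> (norm D / T) + (V (q s + ((r - s) / T) *\<^sub>R D) - c))"
    using T by (intro integral_cong) (simp add: lag_def \<gamma>_eq w_def divide_inverse mult.commute)
  also have "\<dots> = T * \<Phi> (norm D / T) + integral {s..s + T} (\<lambda>r. V (q s + ((r - s) / T) *\<^sub>R D) - c)"
  proof -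
    have "(\<lambda>r. V (q s + ((r - s) / T) *\<^sub>R D) - c) integrable_on {s..s + T}"
      by (intro V_path_integrable continuous_intros)(use T in auto)
    then show ?thesis using T by (subst integral_add) auto
  qed
  finally show ?thesis by (simp add: disc_def D_def)
qed

text \<open>Run at unit speed, the segment costs at most C per unit length. Hence the mean speed
  \<sigma> of q satisfies Phi(\<sigma>) \<le> C \<sigma>, and superlinearity bounds
  \<sigma>.\<close>

lemma speed_bound:
  "\<exists>L>0. \<forall>s t. s < t \<longrightarrow> (\<forall>\<tau>\<in>{0..1}. V (q s + \<tau> *\<^sub>R (q t - q s)) > c) \<longrightarrow> norm (q t - q s) \<le> L * (t - s)"
proof -
  obtain M where M: "M \<ge> 0" "\<forall>x\<in>cball 0 R. \<bar>V x - c\<bar> \<le> M" using V_bound by blast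
  define C where "C = \<Phi> 1 + M + 1"
  have C: "C > 0" using M(1) Phi_nonneg[of 1] by (simp add: C_def)
  \<comment> \<open>The factor 1 / (2 C) makes the \<Phi> term at most \<sigma> / 2, which is
    absorbed into the left side.\<close>
  obtain K where K: "K > 0" "\<forall>s\<ge>0. s \<le> 1 / (2 * C) * \<Phi> s + K" using le_eps_Phi[of "1 / (2 * C)"] C by auto
  show ?thesis
  proof (intro exI[of _ "2 * K"] conjI allI impI)
    fix s t assume st: "s < t" and seg: "\<forall>\<tau>\<in>{0..1}. V (q s + \<tau> *\<^sub>R (q t - q s)) > c"
    define D where "D = norm (q t - q s)"
    show "norm (q t - q s) \<le> 2 * K * (t - s)"
    proof (cases "D = 0")
      case True
      then show ?thesis using K st by (simp add: D_def)
    next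
      case False
      then have D: "D > 0" by (simp add: D_def)
      define \<sigma> where "\<sigma> = D / (t - s)"
      have \<sigma>: "\<sigma> > 0" using D st by (simp add: \<sigma>_def)
      have "integral {s..t} (\<lambda>r. V (q r) - c) \<ge> 0"
        by (rule Henstock_Kurzweil_Integration.integral_nonneg[OF V_path_integrable[OF q_cont]]) (simp add: V_q_ge)
      moreover have "integral {s..s + D} (\<lambda>r. V (q s + ((r - s) / D) *\<^sub>R (q t - q s)) - c) \<le> integral {s..s + D} (\<lambda>_. M)"
      proof (rule integral_le)
        show "(\<lambda>r. V (q s + ((r - s) / D) *\<^sub>R (q t - q s)) - c) integrable_on {s..s + D}"
          by (intro V_path_integrable continuous_intros) (use D in auto)
        fix r assume r: "r \<in> {s..s + D}"
        have "q s + ((r - s) / D) *\<^sub>R (q t - q s) = (1 - (r - s) / D) *\<^sub>R q s + ((r - s) / D) *\<^sub>R q t"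
          by (simp add: algebra_simps)
        also have "\<dots> \<in> cball 0 R"
          using r D norm_q by (intro convexD[OF convex_cball]) auto
        finally show "V (q s + ((r - s) / D) *\<^sub>R (q t - q s)) - c \<le> M" using M(2) by fastforce
      qed auto
      ultimately have "(t - s) * \<Phi> \<sigma> \<le> D * \<Phi> 1 + D * M"
        using segment_comparison[OF st D] seg D by (simp add: D_def[symmetric] \<sigma>_def)
      also have "\<dots> \<le> D * C" using D by (simp add: C_def algebra_simps)
      also have "D * C = (t - s) * (C * \<sigma>)" using st by (simp add: \<sigma>_def)
      finally have "\<Phi> \<sigma> \<le> C * \<sigma>" using st by simp
      then have "1 / (2 * C) * \<Phi> \<sigma> \<le> 1 / (2 * C) * (C * \<sigma>)" using C by (intro mult_left_mono) auto
      also have "\<dots> = \<sigma> / 2" using C by simp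
      finally have "\<sigma> \<le> 2 * K" using K(2)[rule_format, of \<sigma>] \<sigma> by linarith
      then show ?thesis using st by (simp add: \<sigma>_def D_def[symmetric] pos_divide_le_eq)
    qed
  qed (use K in simp)
qed

lemma local_ball:
  assumes "V (q t0) > c"
  obtains r \<delta> where "r > 0" "\<delta> > 0" "\<And>x. dist x (q t0) < r \<Longrightarrow> V x > c" "\<And>t. \<bar>t - t0\<bar> \<le> \<delta> \<Longrightarrow> dist (q t) (q t0) < r / 2"
proof -
  have "open {x. V x > c}" by (intro open_Collect_less continuous_intros V_cont)
  then obtain r where r: "r > 0" "ball (q t0) r \<subseteq> {x. V x > c}" using assms openE by blast
  obtain \<delta> where \<delta>: "\<delta> > 0" "\<And>s t. dist t s < \<delta> \<Longrightarrow> dist (q t) (q s) < r / 2"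
    using q_unif_cont r(1) unfolding uniformly_continuous_on_def by (metis UNIV_I half_gt_zero)
  show ?thesis
    by (rule that[of r "\<delta> / 2"]) (use r \<delta> in \<open>auto simp: dist_commute dist_real_def subset_iff\<close>)
qed

lemma segment_in_ball:
  fixes x y z :: 'a
  assumes "dist x z < r" "dist y z < r" "\<tau> \<in> {0..1}"
  shows "dist (x + \<tau> *\<^sub>R (y - x)) z < r"
proof -
  have "(1 - \<tau>) *\<^sub>R x + \<tau> *\<^sub>R y \<in> ball z r"
    using assms by (intro convexD[OF convex_ball]) (auto simp: dist_commute)
  moreover have "(1 - \<tau>) *\<^sub>R x + \<tau> *\<^sub>R y = x + \<tau> *\<^sub>R (y - x)" by (simp add: algebra_simps)
  ultimately show ?thesis by (simp add: dist_commute)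
qed

text \<open>Near t0 all values of q lie in half of a ball on which V > c. Segments between them stay
  there, which makes q Lipschitz; competitors deviating by less than the other half of the radius
  remain above level c.\<close>

lemma local_solution:
  assumes t0: "V (q t0) > c"
  obtains p \<delta> where "\<delta> > 0" "\<And>t. \<bar>t - t0\<bar> < \<delta> \<Longrightarrow> (q has_vector_derivative vel (p t)) (at t)"
    "\<And>t. \<bar>t - t0\<bar> < \<delta> \<Longrightarrow> (p has_vector_derivative grad V (q t)) (at t)"
proof -
  obtain r \<delta> where r: "r > 0" "\<delta> > 0" and ball: "\<And>x. dist x (q t0) < r \<Longrightarrow> V x > c"
    and q_near: "\<And>t. \<bar>t - t0\<bar> \<le> \<delta> \<Longrightarrow> dist (q t) (q t0) < r / 2" using local_ball[OF t0] by metis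
  obtain L where L: "L > 0" "\<And>s t. s < t \<Longrightarrow> (\<forall>\<tau>\<in>{0..1}. V (q s + \<tau> *\<^sub>R (q t - q s)) > c) \<Longrightarrow> norm (q t - q s) \<le> L * (t - s)"
    using speed_bound by blast
  define a where "a = t0 - \<delta>"
  define b where "b = t0 + \<delta>"
  have ab: "a < b" using r by (simp add: a_def b_def)
  have near: "dist (q t) (q t0) < r / 2" if "t \<in> {a..b}" for t using that by (intro q_near) (auto simp: a_def b_def)
  have lip1: "norm (q t - q s) \<le> L * (t - s)" if "s \<in> {a..b}" "t \<in> {a..b}" "s < t" for s t
  proof (rule L(2)[OF that(3)], rule ballI)
    fix \<tau> :: real assume "\<tau> \<in> {0..1}"
    then have "dist (q s + \<tau> *\<^sub>R (q t - q s)) (q t0) < r / 2" by (rule segment_in_ball[OF near[OF that(1)] near[OF that(2)]])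
    then show "c < V (q s + \<tau> *\<^sub>R (q t - q s))" using r by (intro ball) auto
  qed
  have lip: "norm (q t - q s) \<le> L * \<bar>t - s\<bar>" if "s \<in> {a..b}" "t \<in> {a..b}" for s t
    using lip1[of s t] lip1[of t s] that by (cases s t rule: linorder_cases) (auto simp: norm_minus_commute)
  have "\<exists>p. \<forall>t\<in>{a..b}. (p has_vector_derivative grad V (q t)) (at t within {a..b}) \<and>
    (q has_vector_derivative vel (p t)) (at t within {a..b})"
  proof (rule euler_lagrange[OF q_cont ab less_imp_le[OF L(1)] lip])
    show "r / 2 > 0" using r by simp
    fix N :: nat and \<gamma> w B
    assume N: "N > 0" and p: "primitive \<gamma> w" "\<And>t. norm (w t) \<le> B" and ends: "\<gamma> a = q a" "\<gamma> b = q b"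
      and cl: "\<And>t. t \<in> {a..b} \<Longrightarrow> dist (\<gamma> t) (q t) < r / 2"
    have "V (\<gamma> t) > c" if "t \<in> {a..b}" for t
      using cl[OF that] near[OF that] dist_triangle[of "\<gamma> t" "q t0" "q t"] by (intro ball) linarith
    then show "disc \<Phi> q a ((b - a) / real N) N + integral {a..b} (\<lambda>t. V (q t) - c) \<le> integral {a..b} (lag \<gamma> w)"
      using comparison[OF ab, of "b - a" \<gamma> w B N] p ends N ab by simp
  qed
  then obtain p where p: "\<And>t. t \<in> {a..b} \<Longrightarrow> (p has_vector_derivative grad V (q t)) (at t within {a..b})"
    "\<And>t. t \<in> {a..b} \<Longrightarrow> (q has_vector_derivative vel (p t)) (at t within {a..b})" by blast
  have at: "at t within {a..b} = at t" "t \<in> {a..b}" if "\<bar>t - t0\<bar> < \<delta>" for t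
    using that at_within_Icc_at[of a t b] by (auto simp: a_def b_def abs_less_iff)
  show ?thesis
  proof (rule that[OF r(2), of p])
    fix t assume t: "\<bar>t - t0\<bar> < \<delta>"
    show "(q has_vector_derivative vel (p t)) (at t)" "(p has_vector_derivative grad V (q t)) (at t)"
      using p[OF at(2)[OF t]] at(1)[OF t] by simp_all
  qed
qed

lemma q_deriv:
  assumes t: "V (q t) > c"
  shows "(q has_vector_derivative vderiv q t) (at t)"
    "((\<lambda>s. mom (vderiv q s)) has_vector_derivative grad V (q t)) (at t)"
proof -
  obtain p \<delta> where d: "\<delta> > 0" and p: "\<And>s. \<bar>s - t\<bar> < \<delta> \<Longrightarrow> (q has_vector_derivative vel (p s)) (at s)"
    "\<And>s. \<bar>s - t\<bar> < \<delta> \<Longrightarrow> (p has_vector_derivative grad V (q s)) (at s)" using local_solution[OF t] by metis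
  have v: "vderiv q s = vel (p s)" if "\<bar>s - t\<bar> < \<delta>" for s by (rule vector_derivative_at[OF p(1)[OF that]])
  show "(q has_vector_derivative vderiv q t) (at t)" using p(1)[of t] v[of t] d by simp
  show "((\<lambda>s. mom (vderiv q s)) has_vector_derivative grad V (q t)) (at t)"
  proof (rule has_vector_derivative_transform_within_open[of p _ _ "ball t \<delta>"])
    show "(p has_vector_derivative grad V (q t)) (at t)" using p(2)[of t] d by simp
    show "p s = mom (vderiv q s)" if "s \<in> ball t \<delta>" for s
      using v[of s] that by (simp add: dist_real_def abs_minus_commute)
  qed (use d in auto)
qed

end

context orlicz
begin

text \<open>Traversing a short piece in \<open>\<nu>\<close> times the time must not lower the action; stationarity at
  \<open>\<nu> = 1\<close> is the energy identity.\<close>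

lemma G_eq_of_scaling_minimum:
  assumes s: "s \<ge> 0" and h: "h > 0"
    and min: "\<And>\<nu>. \<nu> > 0 \<Longrightarrow> \<Phi> s + h \<le> \<nu> * (\<Phi> (s / \<nu>) + h)"
  shows "G s = h"
proof (cases "s = 0")
  case True
  \<comment> \<open>At speed 0 there is no derivative to take, but halving the time would give h
    \<le> h / 2.\<close>
  then show ?thesis using min[of "1/2"] h by simp
next
  case False
  then have s: "s > 0" using s by simp
  define f where "f \<nu> = \<nu> * (\<Phi> (s / \<nu>) + h)" for \<nu>
  have inner: "((\<lambda>\<nu>. s / \<nu>) has_real_derivative - s) (at 1)"
    by (auto intro!: derivative_eq_intros)
  have "((\<lambda>\<nu>. \<Phi> (s / \<nu>)) has_real_derivative \<alpha> s * (- s)) (at 1)"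
    using DERIV_chain2[OF _ inner, of \<Phi> "\<alpha> s"] Phi_deriv[OF s] by simp
  then have "(f has_real_derivative \<Phi> s + h - \<alpha> s * s) (at 1)"
    unfolding f_def[abs_def] by (auto intro!: derivative_eq_intros)
  moreover have "\<forall>y. \<bar>1 - y\<bar> < 1 \<longrightarrow> f 1 \<le> f y"
    using min by (auto simp: f_def)
  ultimately have "\<Phi> s + h - \<alpha> s * s = 0"
    by (intro DERIV_local_min[of f _ 1 1]) auto
  then show ?thesis by (simp add: G_eq)
qed

lemma G_tendsto_0_imp:
  assumes nn: "\<And>x. k x \<ge> 0" and lim: "((\<lambda>x. G (k x)) \<longlongrightarrow> 0) F"
  shows "(k \<longlongrightarrow> 0) F"
proof (rule tendstoI)
  fix e :: real assume "e > 0"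
  then have "0 < G e" using G_strict_mono[of 0 e] by simp
  with lim have "\<forall>\<^sub>F x in F. G (k x) < G e" by (rule order_tendstoD)
  then show "\<forall>\<^sub>F x in F. dist (k x) 0 < e"
  proof eventually_elim
    case (elim x)
    then have "\<not> e \<le> k x" using G_strict_mono[of e "k x"] \<open>e > 0\<close> by (cases "e = k x") auto
    then show ?case using nn[of x] by simp
  qed
qed

end

context min_seq
begin

text \<open>On [t, t + \<tau>] compare q with the segment between the same end points run in time
  \<nu> \<tau>, divide by \<tau> and let \<tau> tend to 0. The mean speeds tend to the speed at t
  and V(q) - c is nearly constant.\<close>

lemma energy_q:
  assumes t: "V (q t) > c"
  shows "G (norm (vderiv q t)) = V (q t) - c"
proof (rule G_eq_of_scaling_minimum)
  define v where "v = vderiv q t"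
  define s where "s = norm v"
  define h where "h = V (q t) - c"
  show "V (q t) - c > 0" using t by simp
  fix \<nu> :: real assume \<nu>: "\<nu> > 0"
  have qd: "(q has_vector_derivative v) (at t)" unfolding v_def by (rule q_deriv(1)[OF t])
  have quot: "((\<lambda>\<tau>. norm (q (t + \<tau>) - q t) / \<tau>) \<longlongrightarrow> s) (at_right 0)"
  proof -
    have "((\<lambda>\<tau>. norm (q (t + \<tau>) - q t - \<tau> *\<^sub>R v) / norm \<tau>) \<longlongrightarrow> 0) (at 0)"
      using qd unfolding has_vector_derivative_def has_derivative_at by simp
    then have 0: "((\<lambda>\<tau>. norm (q (t + \<tau>) - q t - \<tau> *\<^sub>R v) / norm \<tau>) \<longlongrightarrow> 0) (at_right 0)"
      by (rule tendsto_mono[rotated]) (simp add: at_le)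
    have "((\<lambda>\<tau>. norm (q (t + \<tau>) - q t) / \<tau> - s) \<longlongrightarrow> 0) (at_right 0)"
    proof (rule Lim_null_comparison[OF _ 0])
      show "\<forall>\<^sub>F \<tau> in at_right 0. norm (norm (q (t + \<tau>) - q t) / \<tau> - s) \<le> norm (q (t + \<tau>) - q t - \<tau> *\<^sub>R v) / norm \<tau>"
        unfolding eventually_at_right_field
      proof (intro exI[of _ 1] conjI allI impI)
        fix \<tau> :: real assume \<tau>: "0 < \<tau>" "\<tau> < 1"
        have "norm (q (t + \<tau>) - q t) / \<tau> - s = (norm (q (t + \<tau>) - q t) - norm (\<tau> *\<^sub>R v)) / \<tau>"
          using \<tau> by (simp add: s_def diff_divide_distrib)
        then show "norm (norm (q (t + \<tau>) - q t) / \<tau> - s) \<le> norm (q (t + \<tau>) - q t - \<tau> *\<^sub>R v) / norm \<tau>"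
          using \<tau> norm_triangle_ineq3[of "q (t + \<tau>) - q t" "\<tau> *\<^sub>R v"] by (simp add: divide_right_mono)
      qed simp
    qed
    then show ?thesis by (simp add: LIM_zero_iff)
  qed
  have cP: "isCont \<Phi> x" for x using Phi_cont continuous_on_eq_continuous_at by blast
  have "\<Phi> s + h \<le> \<nu> * (\<Phi> (s / \<nu>) + h) + \<epsilon>" if "\<epsilon> > 0" for \<epsilon>
  proof -
    \<comment> \<open>The potential is off by \<eta> on a time \<tau> for q and on a time \<nu>
      \<tau> for the segment, in total (1 + \<nu>) \<eta> per unit of \<tau>.\<close>
    define \<eta> where "\<eta> = \<epsilon> / (1 + \<nu>)"
    have \<eta>: "\<eta> > 0" using that \<nu> by (simp add: \<eta>_def)
    obtain r \<delta> where r: "r > 0" "\<delta> > 0" and ball: "\<And>x. dist x (q t) < r \<Longrightarrow> V x > c"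
      and q_near: "\<And>s. \<bar>s - t\<bar> \<le> \<delta> \<Longrightarrow> dist (q s) (q t) < r / 2" using local_ball[OF t] by metis
    have "isCont V (q t)" using V_cont[of UNIV] continuous_on_eq_continuous_at by blast
    then obtain r2 where r2: "r2 > 0" "\<And>x. dist x (q t) < r2 \<Longrightarrow> dist (V x) (V (q t)) < \<eta>"
      unfolding continuous_at_eps_delta using \<eta> by metis
    define r3 where "r3 = min r r2"
    have r3: "r3 > 0" using r r2 by (simp add: r3_def)
    obtain \<delta>2 where \<delta>2: "\<delta>2 > 0" "\<And>u v. dist v u < \<delta>2 \<Longrightarrow> dist (q v) (q u) < r3"
      using q_unif_cont r3 unfolding uniformly_continuous_on_def by (metis UNIV_I)
    have main: "\<Phi> (norm (q (t + \<tau>) - q t) / \<tau>) + (h - \<eta>) \<le> \<nu> * \<Phi> (norm (q (t + \<tau>) - q t) / \<tau> / \<nu>) + \<nu> * (h + \<eta>)"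
      if \<tau>: "0 < \<tau>" "\<tau> < \<delta>2" for \<tau>
    proof -
      have nearq: "dist (q s) (q t) < r3" if "s \<in> {t..t + \<tau>}" for s
        using \<delta>2(2)[of s t] that \<tau> by (auto simp: dist_real_def)
      have seg: "dist (q t + \<theta> *\<^sub>R (q (t + \<tau>) - q t)) (q t) < r3" if "\<theta> \<in> {0..1}" for \<theta>
        by (rule segment_in_ball[OF _ _ that]) (use nearq \<tau> r3 in auto)
      have cmp: "(t + \<tau> - t) * \<Phi> (norm (q (t + \<tau>) - q t) / (t + \<tau> - t)) + integral {t..t + \<tau>} (\<lambda>r. V (q r) - c)
        \<le> \<nu> * \<tau> * \<Phi> (norm (q (t + \<tau>) - q t) / (\<nu> * \<tau>))
          + integral {t..t + \<nu> * \<tau>} (\<lambda>r. V (q t + ((r - t) / (\<nu> * \<tau>)) *\<^sub>R (q (t + \<tau>) - q t)) - c)"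
      proof (rule segment_comparison)
        show "c < V (q t + \<theta> *\<^sub>R (q (t + \<tau>) - q t))" if "\<theta> \<in> {0..1}" for \<theta>
          using seg[OF that] by (intro ball) (simp add: r3_def)
      qed (use \<tau> \<nu> in auto)
      have I1: "integral {t..t + \<tau>} (\<lambda>_. h - \<eta>) \<le> integral {t..t + \<tau>} (\<lambda>r. V (q r) - c)"
      proof (rule integral_le[OF integrable_const_ivl V_path_integrable[OF q_cont]])
        fix s assume "s \<in> {t..t + \<tau>}"
        then have "dist (V (q s)) (V (q t)) < \<eta>" using nearq[of s] by (intro r2(2)) (auto simp: r3_def)
        then show "h - \<eta> \<le> V (q s) - c" by (auto simp: h_def dist_real_def)
      qed
      have I2: "integral {t..t + \<nu> * \<tau>} (\<lambda>r. V (q t + ((r - t) / (\<nu> * \<tau>)) *\<^sub>R (q (t + \<tau>) - q t)) - c)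
          \<le> integral {t..t + \<nu> * \<tau>} (\<lambda>_. h + \<eta>)"
      proof (rule integral_le[OF V_path_integrable integrable_const_ivl])
        show "continuous_on {t..t + \<nu> * \<tau>} (\<lambda>r. q t + ((r - t) / (\<nu> * \<tau>)) *\<^sub>R (q (t + \<tau>) - q t))"
          using \<tau> \<nu> by (intro continuous_intros) auto
        fix r assume r: "r \<in> {t..t + \<nu> * \<tau>}"
        have "(r - t) / (\<nu> * \<tau>) \<in> {0..1}" using r \<tau> \<nu> by (simp add: pos_divide_le_eq)
        from seg[OF this] have "dist (V (q t + ((r - t) / (\<nu> * \<tau>)) *\<^sub>R (q (t + \<tau>) - q t))) (V (q t)) < \<eta>"
          by (intro r2(2)) (auto simp: r3_def)
        then show "V (q t + ((r - t) / (\<nu> * \<tau>)) *\<^sub>R (q (t + \<tau>) - q t)) - c \<le> h + \<eta>"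
          by (auto simp: h_def dist_real_def)
      qed
      have "\<tau> * (\<Phi> (norm (q (t + \<tau>) - q t) / \<tau>) + (h - \<eta>))
          \<le> \<tau> * (\<nu> * \<Phi> (norm (q (t + \<tau>) - q t) / \<tau> / \<nu>) + \<nu> * (h + \<eta>))"
        using cmp I1 I2 \<tau> \<nu> by (simp add: algebra_simps)
      then show ?thesis using \<tau> by simp
    qed
    have "\<Phi> s + (h - \<eta>) \<le> \<nu> * \<Phi> (s / \<nu>) + \<nu> * (h + \<eta>)"
    proof (rule tendsto_le)
      show "((\<lambda>\<tau>. \<Phi> (norm (q (t + \<tau>) - q t) / \<tau>) + (h - \<eta>)) \<longlongrightarrow> \<Phi> s + (h - \<eta>)) (at_right 0)"
        by (intro tendsto_intros isCont_tendsto_compose[OF cP] quot)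
      show "((\<lambda>\<tau>. \<nu> * \<Phi> (norm (q (t + \<tau>) - q t) / \<tau> / \<nu>) + \<nu> * (h + \<eta>)) \<longlongrightarrow> \<nu> * \<Phi> (s / \<nu>) + \<nu> * (h + \<eta>)) (at_right 0)"
        using \<nu> by (intro tendsto_intros isCont_tendsto_compose[OF cP] quot) auto
      show "\<forall>\<^sub>F \<tau> in at_right 0. \<Phi> (norm (q (t + \<tau>) - q t) / \<tau>) + (h - \<eta>)
          \<le> \<nu> * \<Phi> (norm (q (t + \<tau>) - q t) / \<tau> / \<nu>) + \<nu> * (h + \<eta>)"
        unfolding eventually_at_right_field using main \<delta>2(1) by (intro exI[of _ \<delta>2]) auto
    qed simp
    moreover have "\<eta> * (1 + \<nu>) = \<epsilon>" using \<nu> by (simp add: \<eta>_def)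
    ultimately show ?thesis by (simp add: algebra_simps)
  qed
  then have "\<Phi> s + h \<le> \<nu> * (\<Phi> (s / \<nu>) + h)" by (rule field_le_epsilon)
  then show "\<Phi> (norm (vderiv q t)) + (V (q t) - c) \<le> \<nu> * (\<Phi> (norm (vderiv q t) / \<nu>) + (V (q t) - c))"
    by (simp add: s_def v_def h_def)
qed simp

section \<open>Behaviour of the limit towards its ends\<close>

lemma integral_V_pos: assumes "b > 0" shows "integral {0..b} (\<lambda>r. V (q r) - c) > 0"
proof -
  have cont: "continuous_on {0..b} (\<lambda>r. V (q r) - c)" by (intro continuous_intros Vq_cont)
  have "integral {0..b} (\<lambda>r. V (q r) - c) \<ge> 0"
    by (rule Henstock_Kurzweil_Integration.integral_nonneg[OF V_path_integrable[OF q_cont]]) (simp add: V_q_ge)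
  moreover have "integral {0..b} (\<lambda>r. V (q r) - c) \<noteq> 0"
  proof
    assume "integral {0..b} (\<lambda>r. V (q r) - c) = 0"
    then have "((\<lambda>r. V (q r) - c) has_integral 0) (cbox 0 b)"
      using integrable_integral[OF V_path_integrable[OF q_cont], of 0 b] by simp
    then have "V (q 0) - c = 0"
      using assms cont V_q_ge by (intro has_integral_0_cbox_imp_0[of 0 b "\<lambda>r. V (q r) - c"]) auto
    then show False using q0 by simp
  qed
  ultimately show ?thesis by simp
qed

lemma integral_V_mono: assumes "s \<le> s'" "t' \<le> t"
  shows "integral {s'..t'} (\<lambda>r. V (q r) - c) \<le> integral {s..t} (\<lambda>r. V (q r) - c)"
  using assms by (intro integral_subset_le V_path_integrable q_cont) (auto simp: V_q_ge)

text \<open>If the path came back near \<open>Vm\<close> after time \<open>b0\<close>, cutting off everything before would save a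
  definite amount of action.\<close>

lemma away_from_Vm:
  assumes "b0 > 0"
  obtains \<epsilon>0 where "\<epsilon>0 > 0" "\<And>b. b \<ge> b0 \<Longrightarrow> infdist (q b) Vm \<ge> \<epsilon>0"
proof -
  obtain C where C: "C > 0" "\<And>\<xi> s b \<epsilon>. \<xi> \<in> Vm \<Longrightarrow> s \<le> b \<Longrightarrow> 0 < \<epsilon> \<Longrightarrow> \<epsilon> \<le> min 1 (setdist Vm Vp) \<Longrightarrow> dist (q b) \<xi> < \<epsilon> \<Longrightarrow>
     integral {s..b} (\<lambda>r. V (q r) - c) \<le> C * \<epsilon>"
    using cut by blast
  define d where "d = integral {0..b0} (\<lambda>r. V (q r) - c)"
  have d: "d > 0" unfolding d_def by (rule integral_V_pos[OF assms])
  \<comment> \<open>The last bound makes C \<epsilon>0 at most half of d, the potential integral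
    over [0,b0] that would be saved.\<close>
  define \<epsilon>0 where "\<epsilon>0 = min (min 1 (setdist Vm Vp)) (d / (2 * C))"
  have \<epsilon>0: "\<epsilon>0 > 0" "\<epsilon>0 \<le> min 1 (setdist Vm Vp)" "\<epsilon>0 \<le> d / (2 * C)" using d C(1) sep by (auto simp: \<epsilon>0_def)
  show ?thesis
  proof (rule that[OF \<epsilon>0(1)], rule ccontr)
    fix b assume b: "b \<ge> b0" and "\<not> infdist (q b) Vm \<ge> \<epsilon>0"
    moreover obtain \<xi> where "\<xi> \<in> Vm" "infdist (q b) Vm = dist (q b) \<xi>"
      using infdist_attains_inf[OF closed_Vm Vm_ne] by blast
    ultimately have "\<xi> \<in> Vm" "dist (q b) \<xi> < \<epsilon>0" by simp_all
    then have "integral {0..b} (\<lambda>r. V (q r) - c) \<le> C * \<epsilon>0" using \<epsilon>0 b assms by (intro C(2)) auto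
    also have "\<dots> \<le> C * (d / (2 * C))" using \<epsilon>0(3) C(1) by (intro mult_left_mono) auto
    also have "\<dots> < d" using d C(1) by simp
    also have "d \<le> integral {0..b} (\<lambda>r. V (q r) - c)" unfolding d_def using b by (intro integral_V_mono) auto
    finally show False by simp
  qed
qed

lemma Vq_unif_cont: "uniformly_continuous_on UNIV (\<lambda>t. V (q t))"
proof (unfold uniformly_continuous_on_def, intro allI impI)
  fix \<epsilon> :: real assume \<epsilon>: "\<epsilon> > 0"
  have "uniformly_continuous_on (cball 0 R) V" by (intro compact_uniformly_continuous V_cont) auto
  then obtain d where d: "d > 0" "\<And>x y. x \<in> cball 0 R \<Longrightarrow> y \<in> cball 0 R \<Longrightarrow> dist y x < d \<Longrightarrow> dist (V y) (V x) < \<epsilon>"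
    unfolding uniformly_continuous_on_def using \<epsilon> by metis
  obtain d' where d': "d' > 0" "\<And>s t. dist t s < d' \<Longrightarrow> dist (q t) (q s) < d"
    using q_unif_cont d(1) unfolding uniformly_continuous_on_def by (metis UNIV_I)
  show "\<exists>d>0. \<forall>s\<in>UNIV. \<forall>t\<in>UNIV. dist t s < d \<longrightarrow> dist (V (q t)) (V (q s)) < \<epsilon>"
    using d' d(2) norm_q by (intro exI[of _ d']) simp
qed

text \<open>Barbalat's argument: V(q) - c is nonnegative and uniformly continuous, and its integrals
  are bounded by m0.\<close>

lemma V_q_tendsto_at_top: "((\<lambda>t. V (q t)) \<longlongrightarrow> c) at_top"
proof (rule tendstoI)
  fix \<epsilon> :: real assume \<epsilon>: "\<epsilon> > 0"
  obtain d where d: "d > 0" "\<And>s t. dist t s < d \<Longrightarrow> dist (V (q t)) (V (q s)) < \<epsilon> / 2"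
    using Vq_unif_cont \<epsilon> unfolding uniformly_continuous_on_def by (metis UNIV_I half_gt_zero)
  define I where "I t = integral {0..t} (\<lambda>r. V (q r) - c)" for t
  define S where "S = Sup (I ` {0..})"
  have bdd: "bdd_above (I ` {0..})" unfolding I_def using integral_V_le by (intro bdd_aboveI[of _ m0]) auto
  \<comment> \<open>A value of at least \<epsilon> persists at size \<epsilon> / 2 for a time d / 2,
    so it would add this amount to the integral.\<close>
  have "S - d / 2 * (\<epsilon> / 2) < S" using d \<epsilon> by simp
  then obtain T0 where T0: "T0 \<ge> 0" "S - d / 2 * (\<epsilon> / 2) < I T0"
    unfolding S_def using less_cSup_iff[OF _ bdd] by auto
  have "V (q t) - c < \<epsilon>" if t: "t \<ge> T0" for t
  proof (rule ccontr)
    assume "\<not> V (q t) - c < \<epsilon>"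
    then have big: "V (q s) - c \<ge> \<epsilon> / 2" if "s \<in> {t..t + d / 2}" for s
    proof -
      have "dist (V (q s)) (V (q t)) < \<epsilon> / 2" using that d(1) by (intro d(2)) (auto simp: dist_real_def)
      then show ?thesis using \<open>\<not> V (q t) - c < \<epsilon>\<close> unfolding dist_real_def by linarith
    qed
    have "integral {t..t + d / 2} (\<lambda>_. \<epsilon> / 2) \<le> integral {t..t + d / 2} (\<lambda>r. V (q r) - c)"
      by (rule integral_le[OF integrable_const_ivl V_path_integrable[OF q_cont] big])
    then have "d / 2 * (\<epsilon> / 2) \<le> integral {t..t + d / 2} (\<lambda>r. V (q r) - c)" using d by simp
    also have "\<dots> = I (t + d / 2) - I t"
      using Henstock_Kurzweil_Integration.integral_combine[of 0 t "t + d / 2" "\<lambda>r. V (q r) - c"] V_path_integrable[OF q_cont] t T0 d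
      by (simp add: I_def)
    also have "\<dots> \<le> S - I T0"
    proof -
      have "I (t + d / 2) \<le> S" unfolding S_def using t T0 d by (intro cSup_upper bdd) auto
      moreover have "I T0 \<le> I t" unfolding I_def using t by (intro integral_V_mono) auto
      ultimately show ?thesis by simp
    qed
    finally show False using T0 by simp
  qed
  then show "\<forall>\<^sub>F t in at_top. dist (V (q t)) c < \<epsilon>"
    unfolding eventually_at_top_linorder using V_q_ge by (intro exI[of _ T0]) (auto simp: dist_real_def)
qed

text \<open>On the compact set K of points away from both wells V exceeds c by a margin. As V(q)
  tends to c, the path leaves K, and since it keeps away from Vm it can only be near Vp.\<close>

lemma infdist_Vp_tendsto_at_top: "((\<lambda>t. infdist (q t) Vp) \<longlongrightarrow> 0) at_top"
proof (rule tendstoI)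
  fix \<epsilon> :: real assume \<epsilon>: "\<epsilon> > 0"
  obtain \<epsilon>0 where \<epsilon>0: "\<epsilon>0 > 0" "\<And>b. b \<ge> 1 \<Longrightarrow> infdist (q b) Vm \<ge> \<epsilon>0" using away_from_Vm[of 1] by auto
  define K where "K = cball 0 R \<inter> {x. \<epsilon>0 \<le> infdist x Vm} \<inter> {x. \<epsilon> \<le> infdist x Vp}"
  have "compact K" unfolding K_def by (intro compact_Int_closed compact_cball closed_Collect_le continuous_intros)
  have "\<exists>\<delta>>0. \<forall>x\<in>K. V x \<ge> c + \<delta>"
  proof (cases "K = {}")
    case True
    then show ?thesis by (intro exI[of _ 1]) auto
  next
    case False
    then obtain x0 where x0: "x0 \<in> K" "\<And>x. x \<in> K \<Longrightarrow> V x0 \<le> V x"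
      using continuous_attains_inf[OF \<open>compact K\<close> False V_cont] by blast
    have "V x0 > c" using x0(1) \<epsilon>0(1) \<epsilon> by (intro V_gt) (auto simp: K_def mem_Vm_iff mem_Vp_iff)
    then show ?thesis using x0(2) by (intro exI[of _ "V x0 - c"]) auto
  qed
  then obtain \<delta> where \<delta>: "\<delta> > 0" "\<And>x. x \<in> K \<Longrightarrow> V x \<ge> c + \<delta>" by blast
  have "\<forall>\<^sub>F t in at_top. V (q t) < c + \<delta>" using V_q_tendsto_at_top \<delta>(1) by (intro order_tendstoD) auto
  then show "\<forall>\<^sub>F t in at_top. dist (infdist (q t) Vp) 0 < \<epsilon>"
    using eventually_ge_at_top[of 1]
  proof eventually_elim
    case (elim t)
    then have "q t \<notin> K" using \<delta>(2)[of "q t"] by force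
    then show ?case using norm_q[of t] \<epsilon>0(2)[OF elim(2)] infdist_nonneg[of "q t" Vp] by (auto simp: K_def)
  qed
qed

text \<open>The first positive contact time, if any, is the infimum of a closed set of times. The
  contact point lies in one of the wells, and \<open>away_from_Vm\<close> rules out Vm.\<close>

lemma right_contact:
  obtains (finite) w where "w > 0" "V (q w) = c" "q w \<in> Vp" "\<And>t. 0 \<le> t \<Longrightarrow> t < w \<Longrightarrow> V (q t) > c"
  | (infinite) "\<And>t. 0 \<le> t \<Longrightarrow> V (q t) > c"
proof (cases "\<exists>t\<ge>0. V (q t) = c")
  case False
  have "V (q t) > c" if "t \<ge> 0" for t
    using V_q_ge[of t] False that by (auto simp: less_le)
  then show ?thesis by (rule infinite)
next
  case True
  define S where "S = {0..} \<inter> {t. V (q t) = c}"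
  have "closed S" unfolding S_def by (intro closed_Int closed_atLeast closed_Collect_eq continuous_intros Vq_cont)
  moreover have "S \<noteq> {}" "bdd_below S" using True by (auto simp: S_def intro: bdd_belowI[of _ 0])
  ultimately have inS: "Inf S \<in> S" by (intro closed_contains_Inf)
  define w where "w = Inf S"
  have w: "w \<ge> 0" "V (q w) = c" using inS by (auto simp: S_def w_def)
  have "w \<noteq> 0" using w q0 by auto
  then have "w > 0" using w by simp
  have "V (q t) > c" if "0 \<le> t" "t < w" for t
  proof -
    have "t \<notin> S" using that \<open>bdd_below S\<close> cInf_lower[of t S] by (auto simp: w_def)
    then show ?thesis using V_q_ge[of t] that by (auto simp: S_def)
  qed
  moreover have "q w \<in> Vp"
  proof -
    obtain \<epsilon>0 where "\<epsilon>0 > 0" "infdist (q w) Vm \<ge> \<epsilon>0" using away_from_Vm[OF \<open>w > 0\<close>] by (metis order_refl)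
    then have "q w \<notin> Vm" by (auto simp: mem_Vm_iff)
    then show ?thesis using w(2) V_gt by force
  qed
  ultimately show ?thesis using finite \<open>w > 0\<close> w(2) by blast
qed

end

section \<open>Pointwise solutions, reflection and weak solutions\<close>

text \<open>The fundamental theorem tolerates an exceptional point, so f is an integral of the
  continuous D across t.\<close>

lemma has_vector_derivative_removable:
  fixes f :: "real \<Rightarrow> 'a::euclidean_space"
  assumes \<eta>: "\<eta> > 0" and f: "\<And>s. \<bar>s - t\<bar> < \<eta> \<Longrightarrow> isCont f s"
    and d: "\<And>s. \<bar>s - t\<bar> < \<eta> \<Longrightarrow> s \<noteq> t \<Longrightarrow> (f has_vector_derivative D s) (at s)"
    and D: "\<And>s. \<bar>s - t\<bar> < \<eta> \<Longrightarrow> isCont D s"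
  shows "(f has_vector_derivative D t) (at t)"
proof -
  define a where "a = t - \<eta> / 2"
  define b where "b = t + \<eta> / 2"
  have ab: "a < t" "t < b" using \<eta> by (auto simp: a_def b_def)
  have in_ab: "\<bar>s - t\<bar> < \<eta>" if "s \<in> {a..b}" for s
  proof -
    have "\<bar>s - t\<bar> \<le> \<eta> / 2" using that unfolding a_def b_def atLeastAtMost_iff by linarith
    then show ?thesis using \<eta> by simp
  qed
  have cD: "continuous_on {a..b} D" using D in_ab by (intro continuous_at_imp_continuous_on) auto
  have int: "integral {a..u} D = f u - f a" if u: "u \<in> {a..b}" for u
  proof (rule integral_unique, rule fundamental_theorem_of_calculus_interior_strong[of "{t}"])
    show "continuous_on {a..u} f" using f in_ab u by (intro continuous_at_imp_continuous_on) auto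
    show "(f has_vector_derivative D s) (at s)" if "s \<in> {a<..<u} - {t}" for s
      using that u in_ab[of s] by (intro d) auto
  qed (use u in auto)
  have "((\<lambda>u. integral {a..u} D) has_vector_derivative D t) (at t within {a..b})"
    by (rule integral_has_vector_derivative[OF cD]) (use ab in auto)
  from has_vector_derivative_add[OF has_vector_derivative_const this, of "f a"]
  have "((\<lambda>u. f a + integral {a..u} D) has_vector_derivative D t) (at t within {a..b})" by simp
  then have "(f has_vector_derivative D t) (at t within {a..b})"
    by (rule has_vector_derivative_transform[rotated 2]) (use ab int in auto)
  then show ?thesis using at_within_Icc_at[OF ab] by simp
qed

lemma eventually_nhds_real_iff: "(\<forall>\<^sub>F s in nhds t. P s) \<longleftrightarrow> (\<exists>\<eta>>0. \<forall>s. \<bar>s - t\<bar> < \<eta> \<longrightarrow> P s)" for t :: real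
  by (simp add: eventually_nhds_metric dist_real_def)

lemma vderiv_cong:
  assumes "\<forall>\<^sub>F s in nhds t. f s = g s" shows "vderiv f t = vderiv g t"
proof -
  have "(f has_vector_derivative d) (at t) = (g has_vector_derivative d) (at t)" for d
    by (rule has_vector_derivative_cong_ev)
      (use assms eventually_nhds_x_imp_x[OF assms] in \<open>auto elim: eventually_mono\<close>)
  then show ?thesis by (simp add: vector_derivative_def)
qed

context potential
begin

text \<open>Equation and energy level at a single time, written with the momentum; functions pieced
  together from several formulas can then be checked time by time.\<close>

definition sol_at :: "(real \<Rightarrow> 'a) \<Rightarrow> real \<Rightarrow> bool" where
  "sol_at f t \<longleftrightarrow> (f has_vector_derivative vderiv f t) (at t)
     \<and> ((\<lambda>s. mom (vderiv f s)) has_vector_derivative grad V (f t)) (at t)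
     \<and> G (norm (vderiv f t)) = V (f t) - c"

lemma sol_at_cong:
  assumes ev: "\<forall>\<^sub>F s in nhds t. f s = g s" and g: "sol_at g t"
  shows "sol_at f t"
proof -
  obtain \<eta> where \<eta>: "\<eta> > 0" "\<And>s. \<bar>s - t\<bar> < \<eta> \<Longrightarrow> f s = g s" using ev unfolding eventually_nhds_real_iff by blast
  have v: "vderiv f s = vderiv g s" if "\<bar>s - t\<bar> < \<eta>" for s
  proof (rule vderiv_cong, unfold eventually_nhds_real_iff, intro exI[of _ "\<eta> - \<bar>s - t\<bar>"] conjI allI impI)
    show "0 < \<eta> - \<bar>s - t\<bar>" using that by simp
    show "f u = g u" if "\<bar>u - s\<bar> < \<eta> - \<bar>s - t\<bar>" for u using that by (intro \<eta>(2)) linarith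
  qed
  have eq: "f t = g t" "vderiv f t = vderiv g t" using \<eta> v by auto
  have "(f has_vector_derivative vderiv g t) (at t)"
    by (rule has_vector_derivative_transform_within_open[of g _ _ "ball t \<eta>"])
      (use g \<eta> in \<open>auto simp: sol_at_def dist_real_def abs_minus_commute\<close>)
  moreover have "((\<lambda>s. mom (vderiv f s)) has_vector_derivative grad V (g t)) (at t)"
    by (rule has_vector_derivative_transform_within_open[of "\<lambda>s. mom (vderiv g s)" _ _ "ball t \<eta>"])
      (use g \<eta> v in \<open>auto simp: sol_at_def dist_real_def abs_minus_commute\<close>)
  ultimately show ?thesis using g eq by (simp add: sol_at_def)
qed

lemma has_vector_derivative_affine:
  fixes f :: "real \<Rightarrow> 'b::real_normed_vector"
  assumes "(f has_vector_derivative D) (at (\<sigma> * t + \<kappa>))"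
  shows "((\<lambda>s. f (\<sigma> * s + \<kappa>)) has_vector_derivative \<sigma> *\<^sub>R D) (at t)"
proof -
  have "((\<lambda>s. \<sigma> * s + \<kappa>) has_real_derivative \<sigma>) (at t)" by (auto intro!: derivative_eq_intros)
  from vector_diff_chain_at[OF this[unfolded has_real_derivative_iff_has_vector_derivative] assms]
  show ?thesis by (simp add: o_def)
qed

text \<open>\<open>mom\<close> is odd and the square of \<sigma> is 1, so shifts and time reversal
  preserve the equation. A neighbourhood is required because the momentum is differentiated at
  t.\<close>

lemma sol_at_affine:
  assumes \<sigma>: "\<sigma> = 1 \<or> \<sigma> = -1" and ev: "\<forall>\<^sub>F u in nhds (\<sigma> * t + \<kappa>). sol_at f u"
  shows "sol_at (\<lambda>s. f (\<sigma> * s + \<kappa>)) t"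
proof -
  define t' where "t' = \<sigma> * t + \<kappa>"
  define F where "F s = f (\<sigma> * s + \<kappa>)" for s
  obtain \<eta> where \<eta>: "\<eta> > 0" "\<And>u. \<bar>u - t'\<bar> < \<eta> \<Longrightarrow> sol_at f u"
    using ev unfolding eventually_nhds_real_iff t'_def by blast
  have tr: "\<bar>(\<sigma> * s + \<kappa>) - t'\<bar> = \<bar>s - t\<bar>" for s using \<sigma> by (auto simp: t'_def abs_minus_commute)
  have s: "sol_at f (\<sigma> * s + \<kappa>)" if "\<bar>s - t\<bar> < \<eta>" for s using that tr by (intro \<eta>(2)) simp
  have d: "(F has_vector_derivative \<sigma> *\<^sub>R vderiv f (\<sigma> * s + \<kappa>)) (at s)" if "\<bar>s - t\<bar> < \<eta>" for s
    unfolding F_def[abs_def] by (rule has_vector_derivative_affine) (use s[OF that] in \<open>simp add: sol_at_def\<close>)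
  have v: "vderiv F s = \<sigma> *\<^sub>R vderiv f (\<sigma> * s + \<kappa>)" if "\<bar>s - t\<bar> < \<eta>" for s
    by (rule vector_derivative_at[OF d[OF that]])
  have momv: "mom (\<sigma> *\<^sub>R x) = \<sigma> *\<^sub>R mom x" for x :: 'a using \<sigma> by (auto simp: mom_minus)
  have st: "sol_at f (\<sigma> * t + \<kappa>)" using s[of t] \<eta>(1) by simp
  have "((\<lambda>s. mom (vderiv f (\<sigma> * s + \<kappa>))) has_vector_derivative \<sigma> *\<^sub>R grad V (f (\<sigma> * t + \<kappa>))) (at t)"
    by (rule has_vector_derivative_affine[of "\<lambda>s. mom (vderiv f s)"]) (use st in \<open>simp add: sol_at_def\<close>)
  then have "((\<lambda>s. \<sigma> *\<^sub>R mom (vderiv f (\<sigma> * s + \<kappa>))) has_vector_derivative \<sigma> *\<^sub>R \<sigma> *\<^sub>R grad V (F t)) (at t)"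
    unfolding F_def by (rule bounded_linear.has_vector_derivative[OF bounded_linear_scaleR_right])
  moreover have "\<sigma> *\<^sub>R \<sigma> *\<^sub>R x = x" for x :: 'a using \<sigma> by auto
  ultimately have "((\<lambda>s. \<sigma> *\<^sub>R mom (vderiv f (\<sigma> * s + \<kappa>))) has_vector_derivative grad V (F t)) (at t)" by simp
  then have "((\<lambda>s. mom (vderiv F s)) has_vector_derivative grad V (F t)) (at t)"
    by (rule has_vector_derivative_transform_within_open[of _ _ _ "ball t \<eta>"])
      (use \<eta>(1) v in \<open>auto simp: momv dist_real_def abs_minus_commute\<close>)
  moreover have n: "norm (vderiv F t) = norm (vderiv f (\<sigma> * t + \<kappa>))" using v[of t] \<eta>(1) \<sigma> by auto
  have "G (norm (vderiv F t)) = V (F t) - c"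
    unfolding n using st by (simp add: sol_at_def F_def)
  moreover have "(F has_vector_derivative vderiv F t) (at t)" using d[of t] v[of t] \<eta>(1) by simp
  ultimately have "sol_at F t" by (simp add: sol_at_def)
  then show ?thesis unfolding F_def[abs_def] .
qed

text \<open>The momentum is differentiable, hence continuous, and \<open>vel\<close> recovers the
  velocity from it.\<close>

lemma sol_at_vderiv_cont:
  assumes "sol_at f t" shows "isCont (vderiv f) t"
proof -
  have "isCont (\<lambda>s. mom (vderiv f s)) t"
    using assms has_vector_derivative_continuous unfolding sol_at_def by blast
  moreover have "isCont vel (mom (vderiv f t))" using vel_cont continuous_on_eq_continuous_at by blast
  ultimately have "isCont (\<lambda>s. vel (mom (vderiv f s))) t" by (rule isCont_o2)
  then show ?thesis by simp
qed

text \<open>At a contact point the energy identity forces the speed to vanish, so the even reflection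
  is again of class \<open>C\<^sup>1\<close> and its momentum extends differentiably.\<close>

lemma sol_at_reflection:
  assumes \<eta>: "\<eta> > 0" and sol: "\<And>s. a < s \<Longrightarrow> s < a + \<eta> \<Longrightarrow> sol_at f s"
    and cont: "isCont f a" and Va: "V (f a) = c"
  shows "sol_at (\<lambda>s. f (a + \<bar>s - t\<bar>)) t"
proof -
  define F where "F s = f (a + \<bar>s - t\<bar>)" for s
  have solF: "sol_at F s" if s: "\<bar>s - t\<bar> < \<eta>" "s \<noteq> t" for s
  proof (cases "s > t")
    case True
    show ?thesis
    proof (rule sol_at_cong)
      show "\<forall>\<^sub>F u in nhds s. F u = f (1 * u + (a - t))"
      proof -
        have "\<forall>\<^sub>F u in nhds s. u \<in> {t<..}" by (rule eventually_nhds_in_open) (use True in auto)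
        then show ?thesis by eventually_elim (simp add: F_def algebra_simps)
      qed
      show "sol_at (\<lambda>u. f (1 * u + (a - t))) s"
      proof (rule sol_at_affine)
        show "\<forall>\<^sub>F u in nhds (1 * s + (a - t)). sol_at f u"
        proof -
          have "\<forall>\<^sub>F u in nhds (1 * s + (a - t)). u \<in> {a<..<a + \<eta>}"
            by (rule eventually_nhds_in_open) (use True s in auto)
          then show ?thesis by eventually_elim (use sol in auto)
        qed
      qed simp
    qed
  next
    case False
    then have lt: "s < t" using s by simp
    show ?thesis
    proof (rule sol_at_cong)
      show "\<forall>\<^sub>F u in nhds s. F u = f (-1 * u + (a + t))"
      proof -
        have "\<forall>\<^sub>F u in nhds s. u \<in> {..<t}" by (rule eventually_nhds_in_open) (use lt in auto)
        then show ?thesis by eventually_elim (simp add: F_def algebra_simps)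
      qed
      show "sol_at (\<lambda>u. f (-1 * u + (a + t))) s"
      proof (rule sol_at_affine)
        show "\<forall>\<^sub>F u in nhds (-1 * s + (a + t)). sol_at f u"
        proof -
          have "\<forall>\<^sub>F u in nhds (-1 * s + (a + t)). u \<in> {a<..<a + \<eta>}"
            by (rule eventually_nhds_in_open) (use lt s in auto)
          then show ?thesis by eventually_elim (use sol in auto)
        qed
      qed simp
    qed
  qed
  \<comment> \<open>The derivative is prescribed to be 0 at the contact time; once D is shown to be
    continuous there, the point is removable for F.\<close>
  define D where "D s = (if s = t then 0 else vderiv F s)" for s
  have Ft: "F t = f a" by (simp add: F_def)
  have contF: "isCont F s" if "\<bar>s - t\<bar> < \<eta>" for s
  proof (cases "s = t")
    case True
    have "isCont (\<lambda>s. a + \<bar>s - t\<bar>) t" by (intro continuous_intros)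
    then show ?thesis unfolding True F_def[abs_def] by (rule isCont_o2) (use cont in simp)
  next
    case False
    then show ?thesis using solF[OF that] has_vector_derivative_continuous unfolding sol_at_def by blast
  qed
  have GD: "G (norm (D s)) = V (F s) - c" if "\<bar>s - t\<bar> < \<eta>" for s
    using solF[OF that] Va by (auto simp: D_def sol_at_def Ft)
  have ev_ne: "\<forall>\<^sub>F u in nhds s. D u = vderiv F u" if "s \<noteq> t" for s
  proof -
    have "\<forall>\<^sub>F u in nhds s. u \<in> - {t}" by (rule eventually_nhds_in_open) (use that in auto)
    then show ?thesis by eventually_elim (simp add: D_def)
  qed
  have contD: "isCont D s" if s: "\<bar>s - t\<bar> < \<eta>" for s
  proof (cases "s = t")
    case True
    have "isCont (\<lambda>s. V (F s) - c) t"
      using contF[of t] \<eta> V_cont[of UNIV] continuous_on_eq_continuous_at[of UNIV V]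
      by (intro continuous_intros isCont_o2[where f = F and g = V]) auto
    then have "((\<lambda>s. V (F s) - c) \<longlongrightarrow> 0) (at t)" by (simp add: isCont_def Ft Va)
    then have "((\<lambda>s. G (norm (D s))) \<longlongrightarrow> 0) (at t)"
    proof (rule Lim_transform_eventually)
      show "\<forall>\<^sub>F s in at t. V (F s) - c = G (norm (D s))"
        unfolding eventually_at using \<eta> GD by (intro exI[of _ \<eta>]) (auto simp: dist_real_def)
    qed
    from G_tendsto_0_imp[OF _ this] have "(D \<longlongrightarrow> 0) (at t)" by (simp add: tendsto_norm_zero_cancel)
    then show ?thesis unfolding True by (simp add: isCont_def D_def)
  next
    case False
    then show ?thesis using sol_at_vderiv_cont[OF solF[OF s False]] isCont_cong[OF ev_ne[OF False]] by simp
  qed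
  have dF: "(F has_vector_derivative D t) (at t)"
  proof (rule has_vector_derivative_removable[OF \<eta> contF _ contD])
    show "(F has_vector_derivative D s) (at s)" if "\<bar>s - t\<bar> < \<eta>" "s \<noteq> t" for s
      using solF[OF that] that by (simp add: sol_at_def D_def)
  qed
  then have vt: "vderiv F t = 0" using vector_derivative_at by (metis D_def)
  then have DF: "D = vderiv F" by (auto simp: D_def)
  \<comment> \<open>Removability once more, now for the momentum: both it and \<open>grad V\<close>
    along F are continuous across t.\<close>
  have "((\<lambda>s. mom (vderiv F s)) has_vector_derivative grad V (F t)) (at t)"
  proof (rule has_vector_derivative_removable[OF \<eta>, where D = "\<lambda>s. grad V (F s)"])
    fix s assume s: "\<bar>s - t\<bar> < \<eta>"
    show "isCont (\<lambda>s. mom (vderiv F s)) s"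
      using contD[OF s] mom_cont continuous_on_eq_continuous_at[of UNIV mom] unfolding DF by (intro isCont_o2[where f = "vderiv F" and g = mom]) auto
    show "((\<lambda>s. mom (vderiv F s)) has_vector_derivative grad V (F s)) (at s)" if "s \<noteq> t"
      using solF[OF s that] by (simp add: sol_at_def)
    show "isCont (\<lambda>s. grad V (F s)) s"
      using contF[OF s] grad_cont[of UNIV] continuous_on_eq_continuous_at[of UNIV "grad V"] by (intro isCont_o2[where f = F and g = "grad V"]) auto
  qed
  moreover have "G (norm (vderiv F t)) = V (F t) - c" using GD[of t] \<eta> by (simp add: DF)
  ultimately show ?thesis using dF unfolding sol_at_def F_def[symmetric] DF by simp
qed

text \<open>The integrand is the derivative of the inner product of momentum and test function, so
  its integral vanishes by compact support.\<close>

lemma sol_imp_weak_solution: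
  assumes sol: "\<And>t. sol_at f t"
  shows "weak_solution \<phi> V f"
proof -
  define D where "D = vderiv f"
  have d: "(f has_vector_derivative D t) (at t)" for t using sol[of t] by (simp add: sol_at_def D_def)
  have cD: "continuous_on A D" for A
    using sol_at_vderiv_cont[OF sol] by (intro continuous_at_imp_continuous_on) (auto simp: D_def)
  have cf: "continuous_on A f" for A using d by (meson continuous_at_imp_continuous_on has_vector_derivative_continuous)
  have pr: "primitive f D"
    unfolding primitive_def
  proof (intro conjI allI impI)
    show "D \<in> borel_measurable borel" by (rule borel_measurable_continuous_onI[OF cD])
    fix s t :: real assume "s \<le> t"
    then have "(D has_integral f t - f s) {s..t}"
      by (rule fundamental_theorem_of_calculus[OF _ has_vector_derivative_at_within[OF d]])
    then show "integral {s..t} D = f t - f s" by (rule integral_unique)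
    show "D absolutely_integrable_on {s..t}" by (rule absolutely_integrable_continuous_real[OF cD])
  qed
  have "f \<in> W1_Phi_loc \<phi>"
  proof (rule W1_Phi_loc_I[OF pr])
    fix a b :: real
    have "continuous_on {a..b} (\<lambda>t. \<Phi> (norm (D t)))"
      by (rule continuous_on_compose2[OF Phi_cont]) (auto intro!: continuous_intros cD)
    then have "(\<integral>\<^sup>+t\<in>{a..b}. ennreal (\<Phi> (norm (D t))) \<partial>lborel) = ennreal (integral {a..b} (\<lambda>t. \<Phi> (norm (D t))))"
      by (intro nn_integral_Icc absolutely_integrable_continuous_real) (auto simp: Phi_nonneg)
    then show "(\<integral>\<^sup>+t\<in>{a..b}. ennreal (\<Phi> (norm (D t))) \<partial>lebesgue) < \<infinity>" by (simp add: nn_integral_completion)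
  qed
  moreover have "has_bochner_integral lebesgue
      (\<lambda>t. (\<phi> (norm (weak_deriv f t)) *\<^sub>R weak_deriv f t) \<bullet> vderiv \<psi> t + grad V (f t) \<bullet> \<psi> t) 0"
    if \<psi>: "test_function UNIV \<psi>" for \<psi> :: "real \<Rightarrow> 'a"
  proof -
    define H where "H t = mom (D t) \<bullet> vderiv \<psi> t + grad V (f t) \<bullet> \<psi> t" for t
    obtain n where n: "n > 0" "\<And>x. x \<notin> {-n<..<n} \<Longrightarrow> \<psi> x = 0 \<and> vderiv \<psi> x = 0"
      by (rule test_function_support[OF \<psi>]) blast
    have \<psi>d: "(\<psi> has_vector_derivative vderiv \<psi> t) (at t)" for t by (rule test_functionD(1)[OF \<psi>])
    have c\<psi>: "continuous_on A \<psi>" for A using \<psi>d by (meson continuous_at_imp_continuous_on has_vector_derivative_continuous)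
    have cH: "continuous_on {-n..n} H"
      unfolding H_def[abs_def]
      by (intro continuous_intros test_functionD(2)[OF \<psi>] c\<psi> continuous_on_compose2[OF mom_cont cD] continuous_on_compose2[OF grad_cont[of UNIV] cf]) auto
    have md: "((\<lambda>t. mom (D t) \<bullet> \<psi> t) has_vector_derivative H t) (at t)" for t
    proof -
      have "((\<lambda>s. mom (D s)) has_vector_derivative grad V (f t)) (at t)" using sol[of t] by (simp add: sol_at_def D_def)
      from bounded_bilinear.has_vector_derivative[OF bounded_bilinear_inner this \<psi>d]
      show ?thesis by (simp add: H_def)
    qed
    have "(H has_integral mom (D n) \<bullet> \<psi> n - mom (D (-n)) \<bullet> \<psi> (-n)) {-n..n}"
      by (rule fundamental_theorem_of_calculus[OF _ has_vector_derivative_at_within[OF md]]) (use n(1) in simp)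
    then have HI: "(H has_integral 0) {-n..n}" using n(2)[of n] n(2)[of "-n"] by simp
    have H0: "H t = 0" if "t \<notin> {-n..n}" for t
    proof -
      have "t \<notin> {-n<..<n}" using that by auto
      from n(2)[OF this] show ?thesis by (simp add: H_def)
    qed
    have ai: "H absolutely_integrable_on {-n..n}" by (rule absolutely_integrable_continuous_real[OF cH])
    have eqH: "(\<lambda>t. indicator {-n..n} t *\<^sub>R H t) = H" using H0 by (auto simp: indicator_def fun_eq_iff)
    have "integrable lebesgue H" using ai unfolding set_integrable_def eqH .
    moreover have "(LINT t|lebesgue. H t) = 0"
      using set_lebesgue_integral_eq_integral(2)[OF ai] HI unfolding set_lebesgue_integral_def eqH by (simp add: integral_unique)
    ultimately have HB: "has_bochner_integral lebesgue H 0" by (simp add: has_bochner_integral_iff)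
    \<comment> \<open>\<open>weak_deriv f\<close> agrees with the classical derivative only almost
      everywhere, so the result is transferred across a negligible set.\<close>
    have "AE t in lebesgue. H t = (\<phi> (norm (weak_deriv f t)) *\<^sub>R weak_deriv f t) \<bullet> vderiv \<psi> t + grad V (f t) \<bullet> \<psi> t"
      using primitive_weak_deriv[OF pr] by eventually_elim (simp add: H_def mom_def)
    then obtain N where N: "negligible N"
      "\<And>t. t \<notin> N \<Longrightarrow> H t = (\<phi> (norm (weak_deriv f t)) *\<^sub>R weak_deriv f t) \<bullet> vderiv \<psi> t + grad V (f t) \<bullet> \<psi> t"
      by (rule AE_lebesgue_negligible) blast
    define K where "K t = (\<phi> (norm (weak_deriv f t)) *\<^sub>R weak_deriv f t) \<bullet> vderiv \<psi> t + grad V (f t) \<bullet> \<psi> t" for t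
    have KH: "K t = H t" if "t \<in> UNIV - N" for t using N(2)[of t] that by (simp add: K_def)
    have HU: "H absolutely_integrable_on UNIV"
      using HB by (simp add: set_integrable_def has_bochner_integral_iff)
    have KU: "K absolutely_integrable_on UNIV" by (rule absolutely_integrable_spike[OF HU N(1) KH])
    have "(LINT t|lebesgue. K t) = (LINT t:UNIV|lebesgue. K t)" by (simp add: set_lebesgue_integral_def)
    also have "\<dots> = integral UNIV K" by (rule set_lebesgue_integral_eq_integral(2)[OF KU])
    also have "\<dots> = integral UNIV H" by (rule integral_spike[OF N(1) KH, symmetric])
    also have "\<dots> = (LINT t:UNIV|lebesgue. H t)" by (rule set_lebesgue_integral_eq_integral(2)[OF HU, symmetric])
    also have "\<dots> = 0" using HB by (simp add: set_lebesgue_integral_def has_bochner_integral_iff)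
    finally have "has_bochner_integral lebesgue K 0"
      using KU by (simp add: set_integrable_def has_bochner_integral_iff)
    then show ?thesis unfolding K_def[abs_def] .
  qed
  ultimately show ?thesis by (simp add: weak_solution_def)
qed

end

section \<open>Canonical extensions and connections\<close>

text \<open>If a continuous function exceeded its essential bound, it would do so on a nonempty open
  set, which is not negligible.\<close>

lemma Linf_norm_bound:
  fixes q :: "real \<Rightarrow> 'a::euclidean_space"
  assumes I: "open I" and q: "continuous_on I q" and L: "Linf_norm I q \<le> ereal r" and t: "t \<in> I"
  shows "norm (q t) \<le> r"
proof (rule ccontr)
  assume gt: "\<not> norm (q t) \<le> r"
  have "AE x in restrict_space lebesgue I. ereal (norm (q x)) \<le> Linf_norm I q"
    unfolding Linf_norm_def by (rule esssup_AE)
  then have "AE x in lebesgue. x \<in> I \<longrightarrow> ereal (norm (q x)) \<le> Linf_norm I q"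
    using I by (subst (asm) AE_restrict_space_iff) auto
  then have "AE x in lebesgue. x \<in> I \<longrightarrow> norm (q x) \<le> r"
    using L by (auto elim!: eventually_mono dest: order_trans)
  then obtain N where N: "negligible N" "\<And>x. x \<notin> N \<Longrightarrow> x \<in> I \<longrightarrow> norm (q x) \<le> r"
    by (rule AE_lebesgue_negligible) blast
  have "open {x \<in> I. r < norm (q x)}"
  proof -
    have "continuous_on I (\<lambda>x. norm (q x))" using q by (intro continuous_intros)
    from continuous_open_preimage[OF this I open_greaterThan[of r]]
    show ?thesis by (simp add: vimage_def Int_def)
  qed
  then obtain e where e: "e > 0" "cball t e \<subseteq> {x \<in> I. r < norm (q x)}"
    using t gt open_contains_cball[of "{x \<in> I. r < norm (q x)}"] by force
  then have "cball t e \<subseteq> N" using N(2) by force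
  then have "negligible (cbox (t - e) (t + e))"
    using N(1) by (simp add: cball_eq_atLeastAtMost negligible_subset)
  then have "box (t - e) (t + e) = {}" using negligible_interval(1) by blast
  then show False using e(1) by (simp add: box_eq_empty)
qed

lemma Linf_normI:
  fixes q :: "real \<Rightarrow> 'a::euclidean_space"
  assumes q: "continuous_on UNIV q" and b: "\<And>t. norm (q t) \<le> r"
  shows "Linf_norm I q \<le> ereal r"
  unfolding Linf_norm_def
proof (rule esssup_I)
  have "(\<lambda>t. ereal (norm (q t))) \<in> borel_measurable borel"
    using borel_measurable_continuous_onI[OF q] by measurable
  then show "(\<lambda>t. ereal (norm (q t))) \<in> borel_measurable (restrict_space lebesgue I)"
    by (simp add: measurable_completion measurable_restrict_space1)
qed (use b in auto)

lemma closure_einterval_subset: "closure (einterval \<alpha> \<omega>) \<subseteq> {t. \<alpha> \<le> ereal t \<and> ereal t \<le> \<omega>}"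
proof (rule closure_minimal)
  show "einterval \<alpha> \<omega> \<subseteq> {t. \<alpha> \<le> ereal t \<and> ereal t \<le> \<omega>}" by (auto simp: einterval_def)
  show "closed {t. \<alpha> \<le> ereal t \<and> ereal t \<le> \<omega>}"
    by (intro closed_Collect_conj closed_Collect_le continuous_intros)
qed

lemma canonical_ext_brake:
  fixes a w :: real and k :: int
  assumes "a < w" "a + 2 * (w - a) * of_int k \<le> t" "t < a + 2 * (w - a) * (of_int k + 1)"
  shows "canonical_ext (ereal a) (ereal w) f t =
    (if t - 2 * (w - a) * of_int k \<le> w then f (t - 2 * (w - a) * of_int k) else f (2 * w - (t - 2 * (w - a) * of_int k)))"
proof -
  have "of_int k \<le> (t - a) / (2 * (w - a))" "(t - a) / (2 * (w - a)) < of_int k + 1"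
    using assms by (simp_all add: pos_le_divide_eq pos_divide_less_eq algebra_simps)
  then have "\<lfloor>(t - a) / (2 * (w - a))\<rfloor> = k" by (intro floor_unique) auto
  then show ?thesis by (simp add: canonical_ext_def Let_def)
qed

lemma canonical_ext_inside:
  assumes "\<alpha> < \<omega>" "\<alpha> \<le> ereal t" "ereal t \<le> \<omega>"
  shows "canonical_ext \<alpha> \<omega> f t = f t"
proof (cases \<alpha>; cases \<omega>)
  fix a w assume aw: "\<alpha> = ereal a" "\<omega> = ereal w"
  then have "a < w" "a \<le> t" "t \<le> w" using assms by auto
  then show ?thesis using canonical_ext_brake[of a w 0 t f] aw by simp
qed (use assms in \<open>auto simp: canonical_ext_def Let_def\<close>)

context potential
begin

lemma sol_at_local:
  assumes S: "open S" and sol: "\<And>u. u \<in> S \<Longrightarrow> sol_at f u"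
    and \<sigma>: "\<sigma> = 1 \<or> \<sigma> = -1" and t: "\<sigma> * t + \<kappa> \<in> S" and ev: "\<forall>\<^sub>F s in nhds t. F s = f (\<sigma> * s + \<kappa>)"
  shows "sol_at F t"
proof (rule sol_at_cong[OF ev], rule sol_at_affine[OF \<sigma>])
  have "\<forall>\<^sub>F u in nhds (\<sigma> * t + \<kappa>). u \<in> S" by (rule eventually_nhds_in_open[OF S t])
  then show "\<forall>\<^sub>F u in nhds (\<sigma> * t + \<kappa>). sol_at f u" by eventually_elim (rule sol)
qed

lemma sol_at_left_contact:
  assumes a: "a < b" and sol: "\<And>u. a < u \<Longrightarrow> u < b \<Longrightarrow> sol_at f u" and cont: "isCont f a" and Va: "V (f a) = c"
    and ev: "\<forall>\<^sub>F s in nhds t. F s = f (a + \<bar>s - t\<bar>)"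
  shows "sol_at F t"
  by (rule sol_at_cong[OF ev], rule sol_at_reflection[of "b - a"]) (use assms in auto)

text \<open>Time reversal of \<open>sol_at_left_contact\<close>.\<close>

lemma sol_at_right_contact:
  assumes b: "b < w" and sol: "\<And>u. b < u \<Longrightarrow> u < w \<Longrightarrow> sol_at f u" and cont: "isCont f w" and Vw: "V (f w) = c"
    and ev: "\<forall>\<^sub>F s in nhds t. F s = f (w - \<bar>s - t\<bar>)"
  shows "sol_at F t"
proof (rule sol_at_left_contact[where f = "\<lambda>s. f (- s)" and a = "- w" and b = "- b"])
  show "sol_at (\<lambda>s. f (- s)) u" if "- w < u" "u < - b" for u
    by (rule sol_at_local[of "{b<..<w}" f "-1" u 0]) (use sol that in auto)
  have "isCont (\<lambda>s::real. - s) (- w)" by (intro continuous_intros)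
  then show "isCont (\<lambda>s. f (- s)) (- w)" by (rule isCont_o2) (use cont in simp)
  show "\<forall>\<^sub>F s in nhds t. F s = f (- (- w + \<bar>s - t\<bar>))" using ev by eventually_elim simp
qed (use b Vw in auto)

lemma nhdsI: "r > 0 \<Longrightarrow> (\<And>s. \<bar>s - t\<bar> < r \<Longrightarrow> P s) \<Longrightarrow> \<forall>\<^sub>F s in nhds (t::real). P s"
  unfolding eventually_nhds_real_iff by blast

text \<open>Away from contact times and their images the extension is locally f after a shift or a
  reversal of time; at a contact time it is locally the even reflection, where V = c lets
  \<open>sol_at_reflection\<close> apply.\<close>

lemma canonical_ext_sol:
  assumes lt: "A < \<omega>" and cont: "continuous_on UNIV f"
    and sol: "\<And>t. t \<in> einterval A \<omega> \<Longrightarrow> sol_at f t"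
    and Va: "\<And>a. A = ereal a \<Longrightarrow> V (f a) = c" and Vw: "\<And>w. \<omega> = ereal w \<Longrightarrow> V (f w) = c"
  shows "sol_at (canonical_ext A \<omega> f) t"
proof -
  have ic: "isCont f s" for s using cont continuous_on_eq_continuous_at[of UNIV f] by auto
  consider (het) "A = -\<infinity>" "\<omega> = \<infinity>" | (left) a where "A = ereal a" "\<omega> = \<infinity>"
    | (right) w where "A = -\<infinity>" "\<omega> = ereal w" | (brake) a w where "A = ereal a" "\<omega> = ereal w" "a < w"
    using lt by (cases A; cases \<omega>) auto
  then show ?thesis
  proof cases
    case het
    then have "canonical_ext A \<omega> f = f" by (auto simp: canonical_ext_def Let_def)
    then show ?thesis using sol[of t] het by simp
  next
    case left
    have F: "canonical_ext A \<omega> f = (\<lambda>s. if s < a then f (2 * a - s) else f s)"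
      using left by (auto simp: canonical_ext_def Let_def)
    have sol': "sol_at f u" if "u > a" for u using sol[of u] that left by simp
    show ?thesis
    proof (rule linorder_cases[of t a])
      assume "t = a"
      show ?thesis
      proof (rule sol_at_left_contact[where a = a and b = "a + 1" and f = f and t = t, OF _ sol' ic Va[OF left(1)]])
        show "\<forall>\<^sub>F s in nhds t. canonical_ext A \<omega> f s = f (a + \<bar>s - t\<bar>)"
          by (rule always_eventually) (auto simp: F \<open>t = a\<close> algebra_simps abs_if)
      qed auto
    next
      assume "t > a"
      show ?thesis
      proof (rule sol_at_local[of "{a<..}" f 1 t 0])
        show "\<forall>\<^sub>F s in nhds t. canonical_ext A \<omega> f s = f (1 * s + 0)"
          by (rule nhdsI[of "t - a"]) (use \<open>t > a\<close> in \<open>auto simp: F\<close>)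
      qed (use sol' \<open>t > a\<close> in auto)
    next
      assume "t < a"
      show ?thesis
      proof (rule sol_at_local[of "{a<..}" f "-1" t "2 * a"])
        show "\<forall>\<^sub>F s in nhds t. canonical_ext A \<omega> f s = f (-1 * s + 2 * a)"
          by (rule nhdsI[of "a - t"]) (use \<open>t < a\<close> in \<open>auto simp: F\<close>)
      qed (use sol' \<open>t < a\<close> in auto)
    qed
  next
    case right
    have F: "canonical_ext A \<omega> f = (\<lambda>s. if s > w then f (2 * w - s) else f s)"
      using right by (auto simp: canonical_ext_def Let_def)
    have sol': "sol_at f u" if "u < w" for u using sol[of u] that right by simp
    show ?thesis
    proof (rule linorder_cases[of t w])
      assume "t = w"
      show ?thesis
      proof (rule sol_at_right_contact[where b = "w - 1" and w = w and f = f and t = t, OF _ sol' ic Vw[OF right(2)]])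
        show "\<forall>\<^sub>F s in nhds t. canonical_ext A \<omega> f s = f (w - \<bar>s - t\<bar>)"
          by (rule always_eventually) (auto simp: F \<open>t = w\<close> algebra_simps abs_if)
      qed auto
    next
      assume "t < w"
      show ?thesis
      proof (rule sol_at_local[of "{..<w}" f 1 t 0])
        show "\<forall>\<^sub>F s in nhds t. canonical_ext A \<omega> f s = f (1 * s + 0)"
          by (rule nhdsI[of "w - t"]) (use \<open>t < w\<close> in \<open>auto simp: F\<close>)
      qed (use sol' \<open>t < w\<close> in auto)
    next
      assume "t > w"
      show ?thesis
      proof (rule sol_at_local[of "{..<w}" f "-1" t "2 * w"])
        show "\<forall>\<^sub>F s in nhds t. canonical_ext A \<omega> f s = f (-1 * s + 2 * w)"
          by (rule nhdsI[of "t - w"]) (use \<open>t > w\<close> in \<open>auto simp: F\<close>)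
      qed (use sol' \<open>t > w\<close> in auto)
    qed
  next
    case brake
    define T where "T = 2 * (w - a)"
    have T: "T > 0" "T = 2 * (w - a)" using brake by (auto simp: T_def)
    have aT: "a + T = w + (w - a)" by (simp add: T_def)
    \<comment> \<open>k counts the periods; subtracting \<tau> = k T moves t to its representative u
      in [a, a + T).\<close>
    define k where "k = \<lfloor>(t - a) / T\<rfloor>"
    define \<tau> where "\<tau> = T * of_int k"
    define u where "u = t - \<tau>"
    have "of_int k \<le> (t - a) / T" "(t - a) / T < of_int k + 1" by (auto simp: k_def)
    then have u: "a \<le> u" "u < a + T" using T(1) by (simp_all add: u_def \<tau>_def pos_le_divide_eq pos_divide_less_eq algebra_simps)
    have F0: "canonical_ext A \<omega> f s = (if s - \<tau> \<le> w then f (s - \<tau>) else f (2 * w - (s - \<tau>)))"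
      if "a \<le> s - \<tau>" "s - \<tau> < a + T" for s
      using canonical_ext_brake[of a w k s f] that brake by (simp add: \<tau>_def T_def algebra_simps)
    \<comment> \<open>Just before the start of period k the floor is k - 1 and the reflected branch
      applies; in the coordinate s - \<tau> this is reflection about a.\<close>
    have F1: "canonical_ext A \<omega> f s = f (2 * a - (s - \<tau>))" if "a - (w - a) < s - \<tau>" "s - \<tau> < a" for s
    proof -
      have m: "s - 2 * (w - a) * of_int (k - 1) = s - \<tau> + T" by (simp add: \<tau>_def T_def algebra_simps)
      have l: "a + 2 * (w - a) * of_int (k - 1) \<le> s" "s < a + 2 * (w - a) * (of_int (k - 1) + 1)"
      proof -
        have "w < s - \<tau> + T" using that(1) T(2) by (simp add: algebra_simps)
        then have "a \<le> s - \<tau> + T" using brake(3) by simp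
        then show "a + 2 * (w - a) * of_int (k - 1) \<le> s" using m by linarith
        have "2 * (w - a) * (of_int (k - 1) + 1) = \<tau>" by (simp add: \<tau>_def T_def)
        then show "s < a + 2 * (w - a) * (of_int (k - 1) + 1)" using that by linarith
      qed
      have "canonical_ext A \<omega> f s = (if s - \<tau> + T \<le> w then f (s - \<tau> + T) else f (2 * w - (s - \<tau> + T)))"
        using canonical_ext_brake[OF brake(3) l, of f] unfolding m brake(1,2) .
      moreover have "\<not> s - \<tau> + T \<le> w" using that(1) T(2) by (simp add: algebra_simps)
      moreover have "2 * w - (s - \<tau> + T) = 2 * a - (s - \<tau>)" using T(2) by (simp add: algebra_simps)
      ultimately show ?thesis by simp
    qed
    have sol': "sol_at f v" if "a < v" "v < w" for v using sol[of v] that brake by simp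
    consider "u = a" | "a < u" "u < w" | "u = w" | "w < u" using u by linarith
    then show ?thesis
    proof cases
      case 1
      show ?thesis
      proof (rule sol_at_left_contact[OF brake(3) sol' ic Va[OF brake(1)]])
        show "\<forall>\<^sub>F s in nhds t. canonical_ext A \<omega> f s = f (a + \<bar>s - t\<bar>)"
        proof (rule nhdsI[of "w - a"])
          fix s assume s: "\<bar>s - t\<bar> < w - a"
          have ta: "t - \<tau> = a" using 1 by (simp add: u_def)
          show "canonical_ext A \<omega> f s = f (a + \<bar>s - t\<bar>)"
          proof (cases "s \<ge> t")
            case True
            have "s - \<tau> = a + \<bar>s - t\<bar>" using True ta by simp
            then show ?thesis using F0[of s] s T by simp
          next
            case False
            have e: "2 * a - (s - \<tau>) = a + \<bar>s - t\<bar>" "s - \<tau> = a - \<bar>s - t\<bar>" using False ta by auto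
            then have "a - (w - a) < s - \<tau>" "s - \<tau> < a" using s False by auto
            then show ?thesis using F1[of s] e(1) by simp
          qed
        qed (use brake in simp)
      qed
    next
      case 2
      show ?thesis
      proof (rule sol_at_local[of "{a<..<w}" f 1 t "- \<tau>"])
        show "\<forall>\<^sub>F s in nhds t. canonical_ext A \<omega> f s = f (1 * s + - \<tau>)"
        proof (rule nhdsI[of "min (u - a) (w - u)"])
          fix s assume s: "\<bar>s - t\<bar> < min (u - a) (w - u)"
          then have "a \<le> s - \<tau>" "s - \<tau> \<le> w" by (simp_all add: u_def abs_less_iff)
          then show "canonical_ext A \<omega> f s = f (1 * s + - \<tau>)" using F0[of s] T by simp
        qed (use 2 in auto)
      qed (use 2 sol' in \<open>auto simp: u_def\<close>)
    next
      case 3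
      show ?thesis
      proof (rule sol_at_right_contact[OF brake(3) sol' ic Vw[OF brake(2)]])
        show "\<forall>\<^sub>F s in nhds t. canonical_ext A \<omega> f s = f (w - \<bar>s - t\<bar>)"
        proof (rule nhdsI[of "w - a"])
          fix s assume s: "\<bar>s - t\<bar> < w - a"
          have tw: "t - \<tau> = w" using 3 by (simp add: u_def)
          have b: "a \<le> s - \<tau>" "s - \<tau> < a + T" unfolding aT using s tw by (simp_all add: abs_less_iff)
          show "canonical_ext A \<omega> f s = f (w - \<bar>s - t\<bar>)"
          proof (cases "s \<le> t")
            case True
            have "s - \<tau> = w - \<bar>s - t\<bar>" using True tw by simp
            then show ?thesis using F0[OF b] by simp
          next
            case False
            have "2 * w - (s - \<tau>) = w - \<bar>s - t\<bar>" "\<not> s - \<tau> \<le> w" using False tw by auto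
            then show ?thesis using F0[OF b] by (simp only: if_False)
          qed
        qed (use brake in simp)
      qed
    next
      case 4
      show ?thesis
      proof (rule sol_at_local[of "{a<..<w}" f "-1" t "2 * w + \<tau>"])
        show "\<forall>\<^sub>F s in nhds t. canonical_ext A \<omega> f s = f (-1 * s + (2 * w + \<tau>))"
        proof (rule nhdsI[of "min (u - w) (a + T - u)"])
          fix s assume s: "\<bar>s - t\<bar> < min (u - w) (a + T - u)"
          then have "a \<le> s - \<tau>" "s - \<tau> < a + T" "\<not> s - \<tau> \<le> w" using brake(3) 4 by (simp_all add: u_def abs_less_iff)
          then have "canonical_ext A \<omega> f s = f (2 * w - (s - \<tau>))" using F0[of s] by simp
          then show "canonical_ext A \<omega> f s = f (-1 * s + (2 * w + \<tau>))" by (simp add: algebra_simps)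
        qed (use 4 u in auto)
        show "-1 * t + (2 * w + \<tau>) \<in> {a<..<w}" using 4 u aT by (simp add: u_def)
      qed (use sol' in auto)
    qed
  qed
qed

text \<open>Differentiability up to finite contact times is inherited from the canonical extension,
  which is C1 on the whole line. Inside, V > c and the energy identity make the momentum nonzero, so
  that \<open>vel_C1\<close> gives second derivatives.\<close>

lemma sol_c_connection:
  assumes lt: "A < \<omega>" and cont: "continuous_on UNIV f" and b: "\<And>t. norm (f t) \<le> r"
    and sol: "\<And>t. t \<in> einterval A \<omega> \<Longrightarrow> sol_at f t" and gt: "\<And>t. t \<in> einterval A \<omega> \<Longrightarrow> V (f t) > c"
    and Va: "\<And>a. A = ereal a \<Longrightarrow> V (f a) = c" and Vw: "\<And>w. \<omega> = ereal w \<Longrightarrow> V (f w) = c"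
    and lim: "((\<lambda>t. infdist (f (real_of_ereal t)) Vm) \<longlongrightarrow> 0) (at_right A)"
      "((\<lambda>t. infdist (f (real_of_ereal t)) Vp) \<longlongrightarrow> 0) (at_left \<omega>)"
  shows "c_connection \<phi> V c Vm Vp A \<omega> f"
  unfolding c_connection_def
proof (intro conjI ballI lt lim)
  define I where "I = einterval A \<omega>"
  define E where "E = canonical_ext A \<omega> f"
  have E: "sol_at E t" for t unfolding E_def by (rule canonical_ext_sol[OF lt cont sol Va Vw])
  have Ef: "E t = f t" if "t \<in> closure I" for t
    unfolding E_def using closure_einterval_subset that by (intro canonical_ext_inside[OF lt]) (auto simp: I_def)
  have "Linf_norm I f \<le> ereal r" by (rule Linf_normI[OF cont b])
  then show "Linf_norm (einterval A \<omega>) f < \<infinity>" unfolding I_def by (rule le_less_trans) simp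
  have dE: "(E has_vector_derivative vderiv E t) (at t)" for t using E[of t] by (simp add: sol_at_def)
  have cE: "continuous_on (closure I) (vderiv E)"
    by (rule continuous_at_imp_continuous_on, rule ballI, rule sol_at_vderiv_cont, rule E)
  have "(f has_vector_derivative vderiv E t) (at t within closure I)" if t: "t \<in> closure I" for t
    by (rule has_vector_derivative_transform[OF t _ has_vector_derivative_at_within[OF dE]]) (simp add: Ef)
  then have "C1_on (closure I) f"
    unfolding C1_on_def using cE by (intro exI[of _ "vderiv E"] conjI ballI)
  then show "C1_on (closure (einterval A \<omega>)) f" by (simp add: I_def)
  have solI: "sol_at f t" if "t \<in> I" for t using sol that by (simp add: I_def)
  have "C1_on I (\<lambda>t. vel (mom (vderiv f t)))"
  proof (rule vel_C1)
    show "((\<lambda>t. mom (vderiv f t)) has_vector_derivative grad V (f t)) (at t)" if "t \<in> I" for t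
      using solI[OF that] by (simp add: sol_at_def)
    show "open I" by (simp add: I_def)
    show "continuous_on I (\<lambda>t. grad V (f t))"
      by (rule continuous_on_compose2[OF grad_cont[of UNIV] continuous_on_subset[OF cont]]) auto
    show "mom (vderiv f t) \<noteq> 0" if "t \<in> I" for t
      using solI[OF that] gt[of t] that by (auto simp: sol_at_def I_def)
  qed
  then have "C1_on I (vderiv f)" by simp
  moreover have "(f has_vector_derivative vderiv f t) (at t within I)" if "t \<in> I" for t
    by (rule has_vector_derivative_at_within) (use solI[OF that] in \<open>simp add: sol_at_def\<close>)
  ultimately have "C2_on I f"
    unfolding C2_on_def by (intro exI[of _ "vderiv f"] conjI ballI)
  then show "C2_on (einterval A \<omega>) f" by (simp add: I_def)
  fix t assume t: "t \<in> einterval A \<omega>"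
  show "((\<lambda>s. \<phi> (norm (vderiv f s)) *\<^sub>R vderiv f s) has_vector_derivative grad V (f t)) (at t)"
    using sol[OF t] by (simp add: sol_at_def mom_def)
  show "c < V (f t)" by (rule gt[OF t])
  show "energy \<phi> V f t = - c" using sol[OF t] by (simp add: sol_at_def energy_def)
qed

section \<open>Infinite contact times force a critical level\<close>

text \<open>For a limit point \<xi> of f put e = grad V \<xi>. On [tn, tn + 1] the increment of p
  \<bullet> e tends to 0, and by the mean value theorem it equals grad V (f s) \<bullet> e for some
  s. Testing with this fixed vector makes a scalar mean value theorem sufficient and produces e
  \<bullet> e = 0 in the limit.\<close>

lemma sol_critical_value:
  assumes sol: "\<And>t. t > T0 \<Longrightarrow> sol_at f t" and b: "\<And>t. t > T0 \<Longrightarrow> norm (f t) \<le> r"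
    and lim: "((\<lambda>t. V (f t)) \<longlongrightarrow> c) at_top"
  shows "critical_value V c"
proof -
  define D where "D = vderiv f"
  define p where "p t = mom (D t)" for t
  have d: "(f has_vector_derivative D t) (at t)" "(p has_vector_derivative grad V (f t)) (at t)"
      "G (norm (D t)) = V (f t) - c" if "t > T0" for t
    using sol[OF that] by (simp_all add: sol_at_def D_def p_def[abs_def])
  have "((\<lambda>t. V (f t) - c) \<longlongrightarrow> c - c) at_top" by (intro tendsto_intros lim)
  then have "((\<lambda>t. V (f t) - c) \<longlongrightarrow> 0) at_top" by simp
  then have "((\<lambda>t. G (norm (D t))) \<longlongrightarrow> 0) at_top"
  proof (rule Lim_transform_eventually)
    show "\<forall>\<^sub>F t in at_top. V (f t) - c = G (norm (D t))"
      using eventually_gt_at_top[of T0] by eventually_elim (simp add: d(3))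
  qed
  then have nD: "((\<lambda>t. norm (D t)) \<longlongrightarrow> 0) at_top" by (rule G_tendsto_0_imp[rotated]) simp
  then have D0: "(D \<longlongrightarrow> 0) at_top" by (rule tendsto_norm_zero_cancel)
  have "isCont mom (0::'a)" using mom_cont continuous_on_eq_continuous_at by blast
  from isCont_tendsto_compose[OF this D0] have p0: "(p \<longlongrightarrow> 0) at_top" by (simp add: p_def[abs_def])
  define tn where "tn n = T0 + 1 + real n" for n
  have tn: "tn n > T0" for n by (simp add: tn_def)
  have tn_top: "filterlim tn at_top sequentially"
    unfolding tn_def by (intro filterlim_tendsto_add_at_top[OF tendsto_const] filterlim_real_sequentially)
  have "bounded (range (\<lambda>n. f (tn n)))" unfolding bounded_iff using b[OF tn] by auto
  then obtain \<xi> k where k: "strict_mono k" "((\<lambda>n. f (tn n)) \<circ> k) \<longlonglongrightarrow> \<xi>"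
    using bounded_imp_convergent_subsequence by blast
  then have f\<xi>: "(\<lambda>n. f (tn (k n))) \<longlonglongrightarrow> \<xi>" by (simp add: o_def)
  have tk_top: "filterlim (\<lambda>n. tn (k n)) at_top sequentially"
    by (rule filterlim_compose[OF tn_top filterlim_subseq[OF k(1)]])
  have "isCont V \<xi>" using V_cont[of UNIV] continuous_on_eq_continuous_at by blast
  from isCont_tendsto_compose[OF this f\<xi>] have "(\<lambda>n. V (f (tn (k n)))) \<longlonglongrightarrow> V \<xi>" .
  moreover have "(\<lambda>n. V (f (tn (k n)))) \<longlonglongrightarrow> c" by (rule filterlim_compose[OF lim tk_top])
  ultimately have V\<xi>: "V \<xi> = c" by (rule LIMSEQ_unique)
  define e where "e = grad V \<xi>"
  have "\<exists>s. tn n < s \<and> s < tn n + 1 \<and> p (tn n + 1) \<bullet> e - p (tn n) \<bullet> e = grad V (f s) \<bullet> e" for n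
  proof -
    have "((\<lambda>t. p t \<bullet> e) has_real_derivative grad V (f t) \<bullet> e) (at t)" if "t \<ge> tn n" for t
    proof -
      have "t > T0" using that tn[of n] by simp
      from bounded_linear.has_vector_derivative[OF bounded_linear_inner_left d(2)[OF this]]
      show ?thesis by (simp add: has_real_derivative_iff_has_vector_derivative)
    qed
    then show ?thesis
      using MVT2[of "tn n" "tn n + 1" "\<lambda>t. p t \<bullet> e" "\<lambda>t. grad V (f t) \<bullet> e"] by auto
  qed
  then obtain s where s: "\<And>n. tn n < s n" "\<And>n. s n < tn n + 1"
    "\<And>n. p (tn n + 1) \<bullet> e - p (tn n) \<bullet> e = grad V (f (s n)) \<bullet> e" by metis
  \<comment> \<open>Within unit time f moves at most by its speed at some later time, which tends to
    0; so f at the intermediate times s has the same limit \<xi>.\<close>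
  have "\<exists>x. tn n \<le> x \<and> norm (f (s n) - f (tn n)) \<le> norm (D x)" for n
  proof -
    have "\<exists>x\<in>{tn n<..<s n}. norm (f (s n) - f (tn n)) \<le> norm ((s n - tn n) *\<^sub>R D x)"
    proof (rule mvt_general[OF s(1)])
      show "continuous_on {tn n..s n} f"
        by (intro continuous_at_imp_continuous_on ballI has_vector_derivative_continuous[OF d(1)])
          (use tn[of n] in auto)
      show "(f has_derivative (\<lambda>h. h *\<^sub>R D x)) (at x)" if "tn n < x" "x < s n" for x
        using d(1)[of x] tn[of n] that by (simp add: has_vector_derivative_def)
    qed
    then obtain x where x: "tn n < x" "norm (f (s n) - f (tn n)) \<le> (s n - tn n) * norm (D x)"
      using s(1)[of n] by auto
    have "(s n - tn n) * norm (D x) \<le> 1 * norm (D x)" using s(2)[of n] by (intro mult_right_mono) auto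
    then show ?thesis using x by (intro exI[of _ x]) auto
  qed
  then obtain x where x: "\<And>n. tn n \<le> x n" "\<And>n. norm (f (s n) - f (tn n)) \<le> norm (D (x n))" by metis
  have x_top: "filterlim (\<lambda>n. x (k n)) at_top sequentially"
    by (rule filterlim_at_top_mono[OF tk_top]) (use x(1) in auto)
  have "(\<lambda>n. f (s (k n)) - f (tn (k n))) \<longlonglongrightarrow> 0"
    by (rule Lim_null_comparison[OF _ filterlim_compose[OF nD x_top]]) (use x(2) in auto)
  from tendsto_add[OF this f\<xi>] have fs: "(\<lambda>n. f (s (k n))) \<longlonglongrightarrow> \<xi>" by simp
  have "isCont (grad V) \<xi>" using grad_cont[of UNIV] continuous_on_eq_continuous_at by blast
  from isCont_tendsto_compose[OF this fs] have "(\<lambda>n. grad V (f (s (k n))) \<bullet> e) \<longlonglongrightarrow> e \<bullet> e"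
    unfolding e_def by (intro tendsto_intros)
  moreover have "(\<lambda>n. p (tn (k n) + 1) \<bullet> e - p (tn (k n)) \<bullet> e) \<longlonglongrightarrow> 0 \<bullet> e - 0 \<bullet> e"
  proof (intro tendsto_intros)
    have "filterlim (\<lambda>n. tn (k n) + 1) at_top sequentially"
      by (rule filterlim_at_top_mono[OF tk_top]) auto
    then show "(\<lambda>n. p (tn (k n) + 1)) \<longlonglongrightarrow> 0" by (rule filterlim_compose[OF p0])
    show "(\<lambda>n. p (tn (k n))) \<longlonglongrightarrow> 0" by (rule filterlim_compose[OF p0 tk_top])
  qed
  ultimately have "e \<bullet> e = 0" unfolding s(3) using LIMSEQ_unique by fastforce
  then show ?thesis using V\<xi> unfolding critical_value_def e_def by auto
qed

end

section \<open>The limit path as a connection\<close>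

context min_seq
begin

lemma sol_at_q: "V (q t) > c \<Longrightarrow> sol_at q t"
  unfolding sol_at_def using q_deriv energy_q by blast

lemma isCont_infdist_q: "isCont (\<lambda>t. infdist (q t) A) t"
proof -
  have "continuous_on UNIV (\<lambda>t. infdist (q t) A)" by (intro continuous_intros q_cont)
  then show ?thesis using continuous_on_eq_continuous_at by blast
qed

lemma right_end:
  "\<exists>\<omega>. 0 < \<omega> \<and> (\<forall>t\<ge>0. ereal t < \<omega> \<longrightarrow> V (q t) > c) \<and> (\<forall>w. \<omega> = ereal w \<longrightarrow> V (q w) = c)
    \<and> ((\<lambda>t. infdist (q (real_of_ereal t)) Vp) \<longlongrightarrow> 0) (at_left \<omega>)"
proof (rule right_contact)
  fix w assume w: "w > 0" "V (q w) = c" "q w \<in> Vp" "\<And>t. 0 \<le> t \<Longrightarrow> t < w \<Longrightarrow> V (q t) > c"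
  have "((\<lambda>t. infdist (q t) Vp) \<longlongrightarrow> infdist (q w) Vp) (at_left w)"
    using isCont_infdist_q[where A = Vp and t = w] by (simp add: isCont_def filterlim_at_split)
  then have "((\<lambda>t. infdist (q t) Vp) \<longlongrightarrow> 0) (at_left w)" using w(3) by simp
  then have "((\<lambda>t. infdist (q (real_of_ereal t)) Vp) \<longlongrightarrow> 0) (at_left (ereal w))"
    using ereal_tendsto_simps1(1)[of "\<lambda>t. infdist (q t) Vp"] by (simp add: o_def)
  then show ?thesis using w by (intro exI[of _ "ereal w"]) auto
next
  assume *: "\<And>t. 0 \<le> t \<Longrightarrow> V (q t) > c"
  have "((\<lambda>t. infdist (q (real_of_ereal t)) Vp) \<longlongrightarrow> 0) (at_left \<infinity>)"
    using infdist_Vp_tendsto_at_top ereal_tendsto_simps1(3)[of "\<lambda>t. infdist (q t) Vp"] by (simp add: o_def)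
  then show ?thesis using * by (intro exI[of _ "\<infinity>"]) auto
qed

lemma left_end:
  "\<exists>A. A < 0 \<and> (\<forall>t\<le>0. A < ereal t \<longrightarrow> V (q t) > c) \<and> (\<forall>a. A = ereal a \<longrightarrow> V (q a) = c)
    \<and> ((\<lambda>t. infdist (q (real_of_ereal t)) Vm) \<longlongrightarrow> 0) (at_right A)"
proof (rule min_seq.right_contact[OF rev])
  fix w assume w: "w > 0" "V (q (- w)) = c" "q (- w) \<in> Vm" "\<And>t. 0 \<le> t \<Longrightarrow> t < w \<Longrightarrow> V (q (- t)) > c"
  have "((\<lambda>t. infdist (q t) Vm) \<longlongrightarrow> infdist (q (- w)) Vm) (at_right (- w))"
    using isCont_infdist_q[where A = Vm and t = "- w"] by (simp add: isCont_def filterlim_at_split)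
  then have "((\<lambda>t. infdist (q t) Vm) \<longlongrightarrow> 0) (at_right (- w))" using w(3) by simp
  then have "((\<lambda>t. infdist (q (real_of_ereal t)) Vm) \<longlongrightarrow> 0) (at_right (ereal (- w)))"
    using ereal_tendsto_simps1(2)[of "\<lambda>t. infdist (q t) Vm" 0 "- w"] by (simp add: o_def)
  moreover have "V (q t) > c" if "t \<le> 0" "- w < t" for t using w(4)[of "- t"] that by simp
  ultimately show ?thesis using w by (intro exI[of _ "ereal (- w)"]) auto
next
  assume *: "\<And>t. 0 \<le> t \<Longrightarrow> V (q (- t)) > c"
  have "((\<lambda>t. infdist (q (- t)) Vm) \<longlongrightarrow> 0) at_top" by (rule min_seq.infdist_Vp_tendsto_at_top[OF rev])
  then have "((\<lambda>t. infdist (q t) Vm) \<longlongrightarrow> 0) at_bot" by (simp add: filterlim_at_bot_mirror)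
  then have "((\<lambda>t. infdist (q (real_of_ereal t)) Vm) \<longlongrightarrow> 0) (at_right (- \<infinity>))"
    using ereal_tendsto_simps1(4)[of "\<lambda>t. infdist (q t) Vm"] by (simp add: o_def)
  moreover have "V (q t) > c" if "t \<le> 0" for t using *[of "- t"] that by simp
  ultimately show ?thesis by (intro exI[of _ "- \<infinity>"]) auto
qed

lemma exists_connection:
  "\<exists>A \<omega>. c_connection \<phi> V c Vm Vp A \<omega> q \<and> (\<forall>t. sol_at (canonical_ext A \<omega> q) t)"
proof -
  obtain \<omega> where w: "0 < \<omega>" "\<And>t. t \<ge> 0 \<Longrightarrow> ereal t < \<omega> \<Longrightarrow> V (q t) > c" "\<And>w. \<omega> = ereal w \<Longrightarrow> V (q w) = c"
    "((\<lambda>t. infdist (q (real_of_ereal t)) Vp) \<longlongrightarrow> 0) (at_left \<omega>)" using right_end by blast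
  obtain A where a: "A < 0" "\<And>t. t \<le> 0 \<Longrightarrow> A < ereal t \<Longrightarrow> V (q t) > c" "\<And>a. A = ereal a \<Longrightarrow> V (q a) = c"
    "((\<lambda>t. infdist (q (real_of_ereal t)) Vm) \<longlongrightarrow> 0) (at_right A)" using left_end by blast
  have lt: "A < \<omega>" using a(1) w(1) by (rule less_trans)
  have gt: "V (q t) > c" if "t \<in> einterval A \<omega>" for t
    using a(2)[of t] w(2)[of t] that by (cases "t \<ge> 0") (auto simp: einterval_def)
  have sol: "sol_at q t" if "t \<in> einterval A \<omega>" for t by (rule sol_at_q[OF gt[OF that]])
  have "c_connection \<phi> V c Vm Vp A \<omega> q"
    by (rule sol_c_connection[OF lt q_cont norm_q sol gt a(3) w(3) a(4) w(4)])
  moreover have "sol_at (canonical_ext A \<omega> q) t" for t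
    by (rule canonical_ext_sol[OF lt q_cont sol a(3) w(3)])
  ultimately show ?thesis by blast
qed

end

section \<open>Existence of a minimizing sequence\<close>

context wells
begin

text \<open>Near Vp the distance from Vm exceeds half the distance of the wells, near Vm it is
  smaller. A point at exactly half lies in neither well, and shifting the crossing to time 0 removes
  the translation invariance.\<close>

lemma adm_crossing:
  assumes "adm Vm Vp q g"
  obtains t where "infdist (q t) Vm = setdist Vm Vp / 2"
proof -
  define D where "D = setdist Vm Vp"
  have D: "D > 0" using sep by (simp add: D_def)
  have "from_near Vm q" "to_near Vp q" and p: "path q g" using assms by (auto simp: adm_def)
  then obtain s t where s: "s \<le> 0" "infdist (q s) Vm < D / 2" and t: "t \<ge> 0" "infdist (q t) Vp < D / 2"
    unfolding from_near_def to_near_def using D by (metis half_gt_zero)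
  have "infdist (q t) Vm > D / 2" using infdist_sum[of "q t"] t(2) unfolding D_def[symmetric] by linarith
  moreover have "continuous_on {s..t} (\<lambda>t. infdist (q t) Vm)" by (intro continuous_intros pathD(3)[OF p])
  ultimately have "\<exists>x\<ge>s. x \<le> t \<and> infdist (q x) Vm = D / 2"
    using s t by (intro IVT') auto
  then show ?thesis using that by (auto simp: D_def)
qed

lemma adm_shift:
  assumes "adm Vm Vp q g" shows "adm Vm Vp (\<lambda>t. q (t + d)) (\<lambda>t. g (t + d))"
  using assms primitive_shift from_near_shift to_near_shift unfolding adm_def path_def by blast

text \<open>The Arzela-Ascoli scheme: a diagonal subsequence at rational times, then equicontinuity
  for all the others.\<close>

lemma pointwise_convergent_subsequence:
  fixes qs :: "nat \<Rightarrow> real \<Rightarrow> 'a"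
  assumes b: "\<And>n t. norm (qs n t) \<le> r"
    and equi: "\<And>\<epsilon>. \<epsilon> > 0 \<Longrightarrow> \<exists>\<delta>>0. \<forall>n s t. \<bar>s - t\<bar> < \<delta> \<longrightarrow> dist (qs n s) (qs n t) < \<epsilon>"
  obtains k q where "strict_mono (k :: nat \<Rightarrow> nat)" "\<And>t. (\<lambda>n. qs (k n) t) \<longlonglongrightarrow> q t"
proof -
  obtain k where k: "strict_mono (k :: nat \<Rightarrow> nat)" "\<And>x. x \<in> \<rat> \<Longrightarrow> \<exists>y. (\<lambda>n. qs (k n) x) \<longlonglongrightarrow> y"
    using function_convergent_subsequence[OF countable_rat, of qs r] b by blast
  have "\<exists>y. (\<lambda>n. qs (k n) t) \<longlonglongrightarrow> y" for t
  proof -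
    have "Cauchy (\<lambda>n. qs (k n) t)"
    proof (rule metric_CauchyI)
      fix \<epsilon> :: real assume "\<epsilon> > 0"
      then obtain \<delta> where \<delta>: "\<delta> > 0" "\<And>n s t. \<bar>s - t\<bar> < \<delta> \<Longrightarrow> dist (qs n s) (qs n t) < \<epsilon> / 3"
        using equi[of "\<epsilon> / 3"] by auto
      obtain x where x: "x \<in> \<rat>" "t < x" "x < t + \<delta>" using Rats_dense_in_real[of t "t + \<delta>"] \<delta>(1) by auto
      have near: "dist (qs n t) (qs n x) < \<epsilon> / 3" for n using x by (intro \<delta>(2)) auto
      have "Cauchy (\<lambda>n. qs (k n) x)" using k(2)[OF x(1)] LIMSEQ_imp_Cauchy by blast
      then obtain M where M: "\<And>m n. m \<ge> M \<Longrightarrow> n \<ge> M \<Longrightarrow> dist (qs (k m) x) (qs (k n) x) < \<epsilon> / 3"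
        using \<open>\<epsilon> > 0\<close> metric_CauchyD[of "\<lambda>n. qs (k n) x" "\<epsilon> / 3"] by auto
      have "dist (qs (k m) t) (qs (k n) t) < \<epsilon>" if "m \<ge> M" "n \<ge> M" for m n
      proof -
        have "dist (qs (k m) t) (qs (k n) t) \<le> dist (qs (k m) t) (qs (k m) x) + dist (qs (k m) x) (qs (k n) t)"
          by (rule dist_triangle)
        also have "dist (qs (k m) x) (qs (k n) t) \<le> dist (qs (k m) x) (qs (k n) x) + dist (qs (k n) x) (qs (k n) t)"
          by (rule dist_triangle)
        finally show ?thesis using near[of "k m"] near[of "k n"] M[OF that] by (simp add: dist_commute)
      qed
      then show "\<exists>M. \<forall>m\<ge>M. \<forall>n\<ge>M. dist (qs (k m) t) (qs (k n) t) < \<epsilon>" by blast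
    qed
    then show ?thesis by (simp add: Cauchy_convergent_iff convergent_def)
  qed
  then obtain q where "\<And>t. (\<lambda>n. qs (k n) t) \<longlonglongrightarrow> q t" by metis
  then show ?thesis using that k(1) by blast
qed

lemma exists_min_seq:
  assumes eq: "(INF q\<in>Gamma_set \<phi> V c Vm Vp. J_fun \<phi> V c q)
             = (INF q\<in>{q \<in> Gamma_set \<phi> V c Vm Vp. Linf_norm UNIV q \<le> ereal R}. J_fun \<phi> V c q)"
  obtains qs gs q m0 e where "min_seq \<phi> l V c Vm Vp qs gs q m0 R e"
proof -
  define m where "m = (INF q\<in>Gamma_set \<phi> V c Vm Vp. J_fun \<phi> V c q)"
  obtain p0 w0 where "adm Vm Vp p0 w0" "act UNIV p0 w0 < \<infinity>" using finite_adm by blast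
  from adm_Gamma_set[OF this] this(2) have "m < \<infinity>"
    unfolding m_def by (metis INF_lower le_less_trans)
  then obtain m0 where m0: "m0 \<ge> 0" "m = ennreal m0" by (cases m) auto
  have minimal: "ennreal m0 \<le> act UNIV p w" if a: "adm Vm Vp p w" for p w
  \<comment> \<open>A path of infinite action need not lie in \<open>Gamma_set\<close>, but for it
    the bound is trivial.\<close>
  proof (cases "act UNIV p w < \<infinity>")
    case True
    have "m \<le> J_fun \<phi> V c p" unfolding m_def by (rule INF_lower[OF adm_Gamma_set(1)[OF a True]])
    then show ?thesis using adm_Gamma_set(2)[OF a True] m0 by simp
  next
    case False
    then have "act UNIV p w = top" by (simp add: less_top[symmetric])
    then show ?thesis by simp
  qed
  define e0 where "e0 n = 1 / real (Suc n)" for n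
  have e0: "e0 n > 0" "e0 n \<le> 1" for n by (auto simp: e0_def)
  have "\<exists>q g. adm Vm Vp q g \<and> (\<forall>t. norm (q t) \<le> R) \<and> act UNIV q g \<le> ennreal m0 + ennreal (e0 n)
      \<and> infdist (q 0) Vm = setdist Vm Vp / 2" for n
  proof -
    \<comment> \<open>By the assumed equality of the two infima, near-minimizers can be chosen among
      the paths bounded by R.\<close>
    have "m < ennreal m0 + ennreal (e0 n)"
      unfolding m0(2) using m0(1) e0[of n] by (simp add: ennreal_plus[symmetric] ennreal_lessI del: ennreal_plus)
    then have "(INF q\<in>{q \<in> Gamma_set \<phi> V c Vm Vp. Linf_norm UNIV q \<le> ereal R}. J_fun \<phi> V c q) < ennreal m0 + ennreal (e0 n)"
      unfolding m_def eq .
    then obtain p where p: "p \<in> Gamma_set \<phi> V c Vm Vp" "Linf_norm UNIV p \<le> ereal R" "J_fun \<phi> V c p < ennreal m0 + ennreal (e0 n)"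
      unfolding INF_less_iff by blast
    obtain g where g: "adm Vm Vp p g" "J_fun \<phi> V c p = act UNIV p g" by (rule Gamma_set_adm[OF p(1)])
    obtain d where d: "infdist (p d) Vm = setdist Vm Vp / 2" by (rule adm_crossing[OF g(1)])
    have pp: "path p g" using g(1) by (simp add: adm_def)
    have "norm (p t) \<le> R" for t by (rule Linf_norm_bound[OF open_UNIV pathD(3)[OF pp] p(2)]) simp
    moreover have "act UNIV (\<lambda>t. p (t + d)) (\<lambda>t. g (t + d)) \<le> ennreal m0 + ennreal (e0 n)"
      using act_shift_UNIV[OF pathD(1)[OF pp], of d] p(3) g(2) by simp
    ultimately show ?thesis
      using adm_shift[OF g(1), of d] d by (intro exI[of _ "\<lambda>t. p (t + d)"] exI[of _ "\<lambda>t. g (t + d)"]) simp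
  qed
  then obtain qs gs where qs: "\<And>n. adm Vm Vp (qs n) (gs n)" "\<And>n t. norm (qs n t) \<le> R"
    "\<And>n. act UNIV (qs n) (gs n) \<le> ennreal m0 + ennreal (e0 n)" "\<And>n. infdist (qs n 0) Vm = setdist Vm Vp / 2"
    by metis
  have path: "path (qs n) (gs n)" for n using qs(1) by (simp add: adm_def)
  have actb: "act UNIV (qs n) (gs n) \<le> ennreal (m0 + 1)" for n
  proof -
    have "ennreal m0 + ennreal (e0 n) \<le> ennreal (m0 + 1)"
      using m0(1) e0[of n] by (simp add: ennreal_plus[symmetric] ennreal_leI del: ennreal_plus)
    then show ?thesis using qs(3)[of n] by (rule order_trans[rotated])
  qed
  have equi: "\<exists>\<delta>>0. \<forall>n s t. \<bar>s - t\<bar> < \<delta> \<longrightarrow> dist (qs n s) (qs n t) < \<epsilon>" if "\<epsilon> > 0" for \<epsilon>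
  proof -
    define \<eta> where "\<eta> = \<epsilon> / 4 / (m0 + 1)"
    have "m0 + 1 \<noteq> 0" using m0(1) by linarith
    then have "\<eta> * (m0 + 1) = \<epsilon> / 4" unfolding \<eta>_def by (rule nonzero_eq_divide_eq[THEN iffD1]) (rule refl)
    moreover have "\<eta> > 0" using that m0(1) by (simp add: \<eta>_def)
    ultimately have \<eta>: "\<eta> > 0" "\<eta> * (m0 + 1) = \<epsilon> / 4" by simp_all
    obtain K where K: "K > 0" "\<forall>s\<ge>0. s \<le> \<eta> * \<Phi> s + K" using le_eps_Phi[OF \<eta>(1)] by blast
    have le: "norm (qs n t - qs n s) \<le> \<epsilon> / 4 + K * (t - s)" if "s \<le> t" for n s t
      using path_modulus[OF path actb _ K(2) \<eta>(1) that, of n] m0(1) \<eta>(2) by simp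
    have "dist (qs n s) (qs n t) < \<epsilon>" if "\<bar>s - t\<bar> < \<epsilon> / (4 * K)" for n s t
    proof -
      have "norm (qs n s - qs n t) \<le> \<epsilon> / 4 + K * \<bar>s - t\<bar>"
        using le[of s t n] le[of t s n] by (cases "s \<le> t") (auto simp: norm_minus_commute abs_minus_commute)
      moreover have "K * \<bar>s - t\<bar> < \<epsilon> / 4" using that K(1) by (simp add: field_simps)
      ultimately show ?thesis using \<open>\<epsilon> > 0\<close> by (simp add: dist_norm)
    qed
    then show ?thesis using that K(1) by (intro exI[of _ "\<epsilon> / (4 * K)"]) auto
  qed
  obtain k q where k: "strict_mono (k :: nat \<Rightarrow> nat)" "\<And>t. (\<lambda>n. qs (k n) t) \<longlonglongrightarrow> q t"
    by (rule pointwise_convergent_subsequence[OF qs(2) equi]) (assumption | rule that)+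
  have "(\<lambda>n. infdist (qs (k n) 0) Vm) \<longlonglongrightarrow> infdist (q 0) Vm" by (intro tendsto_infdist k(2))
  then have q0: "infdist (q 0) Vm = setdist Vm Vp / 2" unfolding qs(4) by (simp add: LIMSEQ_const_iff)
  have "V (q 0) > c"
  proof (rule V_gt)
    show "q 0 \<notin> Vm" using q0 sep by (simp add: mem_Vm_iff)
    show "q 0 \<notin> Vp" using q0 infdist_sum[of "q 0"] sep by (auto simp: mem_Vp_iff)
  qed
  moreover have "(\<lambda>n. e0 (k n)) \<longlonglongrightarrow> 0"
  proof -
    have "e0 \<longlonglongrightarrow> 0" unfolding e0_def by (rule LIMSEQ_Suc[OF lim_1_over_n])
    then show ?thesis using LIMSEQ_subseq_LIMSEQ[OF _ k(1)] by (simp add: o_def)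
  qed
  ultimately have "min_seq \<phi> l V c Vm Vp (\<lambda>n. qs (k n)) (\<lambda>n. gs (k n)) q m0 R (\<lambda>n. e0 (k n))"
    using qs(1-3) e0 m0(1) minimal k(2) by unfold_locales (auto intro: less_imp_le)
  then show ?thesis by (rule that)
qed

section \<open>Contact times of arbitrary connections\<close>

lemma c_connection_sol_at:
  assumes cc: "c_connection \<phi> V c Vm Vp A \<omega> q" and t: "t \<in> einterval A \<omega>"
  shows "sol_at q t"
proof -
  have "C2_on (einterval A \<omega>) q" using cc by (simp add: c_connection_def)
  then obtain D where D: "\<forall>t\<in>einterval A \<omega>. (q has_vector_derivative D t) (at t within einterval A \<omega>)"
    unfolding C2_on_def by blast
  have "(q has_vector_derivative D t) (at t)"
    using D t at_within_open[OF t open_einterval] by metis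
  then have "(q has_vector_derivative vderiv q t) (at t)" by (simp add: vector_derivative_at)
  moreover have "((\<lambda>s. mom (vderiv q s)) has_vector_derivative grad V (q t)) (at t)"
    using cc t by (simp add: c_connection_def mom_def)
  moreover have "G (norm (vderiv q t)) = V (q t) - c"
  proof -
    have "energy \<phi> V q t = - c" using cc t by (simp add: c_connection_def)
    then have "G (norm (vderiv q t)) - V (q t) = - c" by (simp add: energy_def)
    then show ?thesis by linarith
  qed
  ultimately show ?thesis by (simp add: sol_at_def)
qed

text \<open>V is compared at f t and at a nearest point of Vp, where V \<le> c. The bound on f puts
  both points into one ball, on which V is uniformly continuous.\<close>

lemma V_tendsto_of_infdist:
  assumes b: "\<forall>\<^sub>F t in F. norm (f t) \<le> r" and ge: "\<forall>\<^sub>F t in F. V (f t) \<ge> c"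
    and lim: "((\<lambda>t. infdist (f t) Vp) \<longlongrightarrow> 0) F"
  shows "((\<lambda>t. V (f t)) \<longlongrightarrow> c) F"
proof (rule tendstoI)
  fix \<epsilon> :: real assume "\<epsilon> > 0"
  have "uniformly_continuous_on (cball 0 (r + 1)) V" by (intro compact_uniformly_continuous V_cont) auto
  then obtain \<delta> where \<delta>: "\<delta> > 0" "\<And>x y. x \<in> cball 0 (r + 1) \<Longrightarrow> y \<in> cball 0 (r + 1) \<Longrightarrow> dist y x < \<delta> \<Longrightarrow> dist (V y) (V x) < \<epsilon>"
    unfolding uniformly_continuous_on_def using \<open>\<epsilon> > 0\<close> by metis
  have "\<forall>\<^sub>F t in F. infdist (f t) Vp < min \<delta> 1" using lim \<delta>(1) by (intro order_tendstoD) auto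
  with b ge show "\<forall>\<^sub>F t in F. dist (V (f t)) c < \<epsilon>"
  proof eventually_elim
    case (elim t)
    obtain y where y: "y \<in> Vp" "infdist (f t) Vp = dist (f t) y"
      using infdist_attains_inf[OF closed_Vp Vp_ne] by blast
    have "norm y \<le> r + 1"
      using norm_triangle_sub[of y "f t"] y(2) elim by (simp add: dist_norm norm_minus_commute)
    then have "dist (V (f t)) (V y) < \<epsilon>" using elim y(2) by (intro \<delta>(2)) auto
    then show ?case using V_le(2)[OF y(1)] elim(2) by (simp add: dist_real_def)
  qed
qed

lemma c_connection_right_infinite:
  assumes cc: "c_connection \<phi> V c Vm Vp A \<infinity> q"
  shows "critical_value V c"
proof -
  have lt: "A < \<infinity>" using cc by (simp add: c_connection_def)
  then obtain T0 where T0: "\<And>t. t > T0 \<Longrightarrow> t \<in> einterval A \<infinity>"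
    by (cases A) (auto simp: einterval_def)
  have sol: "sol_at q t" if "t > T0" for t using c_connection_sol_at[OF cc T0[OF that]] .
  have "Linf_norm (einterval A \<infinity>) q < \<infinity>" using cc by (simp add: c_connection_def)
  then obtain r where r: "Linf_norm (einterval A \<infinity>) q \<le> ereal r"
    by (cases "Linf_norm (einterval A \<infinity>) q") auto
  have "continuous_on (einterval A \<infinity>) q"
    using c_connection_sol_at[OF cc] unfolding sol_at_def
    by (intro continuous_at_imp_continuous_on ballI has_vector_derivative_continuous) blast
  then have b: "norm (q t) \<le> r" if "t > T0" for t
    using Linf_norm_bound[OF open_einterval _ r T0[OF that]] by blast
  show ?thesis
  proof (rule sol_critical_value[OF sol b])
    show "((\<lambda>t. V (q t)) \<longlongrightarrow> c) at_top"
    proof (rule V_tendsto_of_infdist)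
      show "\<forall>\<^sub>F t in at_top. norm (q t) \<le> r" using eventually_gt_at_top[of T0] by eventually_elim (rule b)
      show "\<forall>\<^sub>F t in at_top. c \<le> V (q t)"
        using eventually_gt_at_top[of T0]
      proof eventually_elim
        case (elim t)
        then have "c < V (q t)" using cc T0[OF elim] by (simp add: c_connection_def)
        then show ?case by simp
      qed
      have "((\<lambda>t. infdist (q (real_of_ereal t)) Vp) \<longlongrightarrow> 0) (at_left \<infinity>)" using cc by (simp add: c_connection_def)
      then show "((\<lambda>t. infdist (q t) Vp) \<longlongrightarrow> 0) at_top"
        using ereal_tendsto_simps1(3)[of "\<lambda>t. infdist (q t) Vp"] by (simp add: o_def)
    qed
  qed
qed

lemma c_connection_left_infinite:
  assumes cc: "c_connection \<phi> V c Vm Vp (- \<infinity>) \<omega> q"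
  shows "critical_value V c"
proof -
  interpret r: wells \<phi> l V c Vp Vm by (rule wells_sym)
  have lt: "- \<infinity> < \<omega>" using cc by (simp add: c_connection_def)
  then obtain T0 where T0: "\<And>t. t > T0 \<Longrightarrow> - t \<in> einterval (- \<infinity>) \<omega>"
  proof (cases \<omega>)
    case (real w)
    then show ?thesis by (intro that[of "- w"]) (auto simp: einterval_def)
  qed (auto simp: einterval_def intro: that)
  \<comment> \<open>Reversed in time, the connection approaches Vm at plus infinity, so the previous
    argument applies with the wells exchanged.\<close>
  have sol: "sol_at (\<lambda>t. q (- t)) t" if "t > T0" for t
    by (rule sol_at_local[OF open_einterval c_connection_sol_at[OF cc], where \<sigma> = "-1" and \<kappa> = 0])
      (use T0[OF that] in auto)
  have "Linf_norm (einterval (- \<infinity>) \<omega>) q < \<infinity>" using cc by (simp add: c_connection_def)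
  then obtain r where r: "Linf_norm (einterval (- \<infinity>) \<omega>) q \<le> ereal r"
    by (cases "Linf_norm (einterval (- \<infinity>) \<omega>) q") auto
  have "continuous_on (einterval (- \<infinity>) \<omega>) q"
    using c_connection_sol_at[OF cc] unfolding sol_at_def
    by (intro continuous_at_imp_continuous_on ballI has_vector_derivative_continuous) blast
  then have b: "norm (q (- t)) \<le> r" if "t > T0" for t
    using Linf_norm_bound[OF open_einterval _ r T0[OF that]] by blast
  show ?thesis
  proof (rule sol_critical_value[OF sol b])
    show "((\<lambda>t. V (q (- t))) \<longlongrightarrow> c) at_top"
    proof (rule r.V_tendsto_of_infdist)
      show "\<forall>\<^sub>F t in at_top. norm (q (- t)) \<le> r" using eventually_gt_at_top[of T0] by eventually_elim (rule b)
      show "\<forall>\<^sub>F t in at_top. c \<le> V (q (- t))"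
        using eventually_gt_at_top[of T0]
      proof eventually_elim
        case (elim t)
        then have "c < V (q (- t))" using cc T0[OF elim] by (simp add: c_connection_def)
        then show ?case by simp
      qed
      have "((\<lambda>t. infdist (q (real_of_ereal t)) Vm) \<longlongrightarrow> 0) (at_right (- \<infinity>))" using cc by (simp add: c_connection_def)
      then have "((\<lambda>t. infdist (q t) Vm) \<longlongrightarrow> 0) at_bot"
        using ereal_tendsto_simps1(4)[of "\<lambda>t. infdist (q t) Vm"] by (simp add: o_def)
      then show "((\<lambda>t. infdist (q (- t)) Vm) \<longlongrightarrow> 0) at_top" by (simp add: filterlim_at_bot_mirror)
    qed
  qed
qed

end

theorem mainTheorem5:
  fixes \<phi> :: "real \<Rightarrow> real" and V :: "real ^ 'n \<Rightarrow> real"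
    and l m c :: real and Vm Vp :: "(real ^ 'n) set"
  assumes "\<phi> C1_differentiable_on {0<..}" and "\<And>s. s > 0 \<Longrightarrow> \<phi> s > 0"
    and "1 < l" and "l \<le> m"
    and "\<And>s. s > 0 \<Longrightarrow> deriv (\<lambda>r. \<phi> r * r) s > 0"
    and "\<And>s. s > 0 \<Longrightarrow> l - 1 \<le> deriv (\<lambda>r. \<phi> r * r) s / \<phi> s
                      \<and> deriv (\<lambda>r. \<phi> r * r) s / \<phi> s \<le> m - 1"
    and "C1_potential V"
    and "{x. V x \<le> c} = Vm \<union> Vp" and "Vm \<noteq> {}" and "Vp \<noteq> {}" and "setdist Vm Vp > 0"
    and "\<exists>R>0. (INF q\<in>Gamma_set \<phi> V c Vm Vp. J_fun \<phi> V c q)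
             = (INF q\<in>{q \<in> Gamma_set \<phi> V c Vm Vp. Linf_norm UNIV q \<le> ereal R}. J_fun \<phi> V c q)"
  shows "(\<exists>\<alpha> \<omega> q. c_connection \<phi> V c Vm Vp \<alpha> \<omega> q
            \<and> weak_solution \<phi> V (canonical_ext \<alpha> \<omega> q)
            \<and> (\<forall>t. canonical_ext \<alpha> \<omega> q differentiable (at t)
                 \<and> energy \<phi> V (canonical_ext \<alpha> \<omega> q) t = - c))
       \<and> (\<forall>\<alpha> \<omega> q. c_connection \<phi> V c Vm Vp \<alpha> \<omega> q \<longrightarrow>
            (heteroclinic_type \<alpha> \<omega> \<or> homoclinic_type \<alpha> \<omega> \<longrightarrow> critical_value V c)
            \<and> (\<not> critical_value V c \<longrightarrow> brake_type \<alpha> \<omega>))"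
proof -
  interpret wells \<phi> l V c Vm Vp
    by unfold_locales (use assms in blast)+
  obtain R where "(INF q\<in>Gamma_set \<phi> V c Vm Vp. J_fun \<phi> V c q)
      = (INF q\<in>{q \<in> Gamma_set \<phi> V c Vm Vp. Linf_norm UNIV q \<le> ereal R}. J_fun \<phi> V c q)"
    using assms(12) by blast
  then obtain qs gs q m0 e where "min_seq \<phi> l V c Vm Vp qs gs q m0 R e" by (rule exists_min_seq)
  then interpret min_seq \<phi> l V c Vm Vp qs gs q m0 R e .
  obtain A \<omega> where cc: "c_connection \<phi> V c Vm Vp A \<omega> q" and sol: "\<And>t. sol_at (canonical_ext A \<omega> q) t"
    using exists_connection by blast
  have "canonical_ext A \<omega> q differentiable (at t) \<and> energy \<phi> V (canonical_ext A \<omega> q) t = - c" for t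
    using sol[of t] by (auto simp: sol_at_def energy_def intro: differentiableI_vector)
  then have "\<exists>A \<omega> q. c_connection \<phi> V c Vm Vp A \<omega> q \<and> weak_solution \<phi> V (canonical_ext A \<omega> q)
      \<and> (\<forall>t. canonical_ext A \<omega> q differentiable (at t) \<and> energy \<phi> V (canonical_ext A \<omega> q) t = - c)"
    using cc sol_imp_weak_solution[OF sol] by blast
  \<comment> \<open>The classification concerns every connection, minimizing or not: each infinite
    contact time makes c critical, and brake type is what is left.\<close>
  moreover have "(heteroclinic_type A \<omega> \<or> homoclinic_type A \<omega> \<longrightarrow> critical_value V c)
      \<and> (\<not> critical_value V c \<longrightarrow> brake_type A \<omega>)" if cc: "c_connection \<phi> V c Vm Vp A \<omega> p" for A \<omega> p
  proof -
    have lt: "A < \<omega>" using cc by (simp add: c_connection_def)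
    have inf: "critical_value V c" if "A = - \<infinity> \<or> \<omega> = \<infinity>"
      using that c_connection_right_infinite[of A p] c_connection_left_infinite[of \<omega> p] cc by auto
    have "brake_type A \<omega>" if "\<not> critical_value V c"
      using inf that lt unfolding brake_type_def by (cases A; cases \<omega>) auto
    moreover have "critical_value V c" if "heteroclinic_type A \<omega> \<or> homoclinic_type A \<omega>"
      using inf that unfolding heteroclinic_type_def homoclinic_type_def by auto
    ultimately show ?thesis by blast
  qed
  ultimately show ?thesis by blast
qed

end
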